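(* Let $N\ge1$, let $S$ be a finite set of endomorphisms of $\mathbb{P}^N$ defined over $\overline{\mathbb{Q}}$, all of degree at least two, and let $\nu$ be a discrete probability measure on $S$ with $\nu(\phi)>0$ for all $\phi\in S$. Then there exists a constant $B_S$ such that the following statements hold. (1) The dynamical degree is given by $\delta_{S,\nu}=\prod_{\phi\in S}\deg(\phi)^{\nu(\phi)}$. (2) For $\bar\nu$-almost every $\gamma\in\Phi_S$, the limits $$\lim_{n\to\infty}h(\gamma_n^-(P))^{1/n}=\delta_{S,\nu}=\lim_{n\to\infty}h(\gamma_n^+(P))^{1/n}$$ hold (simultaneously) for all $P\in\mathbb{P}^N(\overline{\mathbb{Q}})$ with $h(P)>B_S$. (3) If the variance $\sigma_{S,\nu}^2$ of the random variable $\phi\mapsto\log(\deg(\phi))$ on $(S,\nu)$ is nonzero, then for $\bar\nu$-almost every $\gamma\in\Phi_S$, for both choices of the sign $\pm$, $$\limsup_{n\to\infty}\frac{\log\left(\dfrac{h(\gamma_n^{\pm}(P))}{\delta_{S,\nu}^n}\right)}{\sigma_{S,\nu}\sqrt{2n\log\log n}}=1=\limsup_{n\to\infty}\frac{\log\left(\dfrac{\delta_{S,\nu}^n}{h(\gamma_n^{\pm}(P))}\right)}{\sigma_{S,\nu}\sqrt{2n\log\log n}}$$ hold (simultaneously) for all $P\in\mathbb{P}^N(\overline{\mathbb{Q}})$ with $h(P)>B_S$.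
   Context: $h:\mathbb{P}^N(\overline{\mathbb{Q}})\to\mathbb{R}_{\ge0}$ is the absolute logarithmic Weil height. $\deg(\phi)$ is the degree of the homogeneous polynomials (without common factor) defining $\phi$. $\Phi_S=\prod_{i=1}^\infty S$ is the set of infinite sequences in $S$, with product measure $\bar\nu=\prod_{i=1}^\infty\nu$. For $\gamma=(\theta_1,\theta_2,\dots)\in\Phi_S$ and $n\ge1$: $\gamma_n^-=\theta_n\circ\cdots\circ\theta_1$ and $\gamma_n^+=\theta_1\circ\cdots\circ\theta_n$. The dynamical degree $\delta_{S,\nu}$ of $(S,\nu)$ is the constant such that $\lim_{n\to\infty}\deg(\gamma_n^-)^{1/n}=\delta_{S,\nu}=\lim_{n\to\infty}\deg(\gamma_n^+)^{1/n}$ for $\bar\nu$-almost every $\gamma\in\Phi_S$ (such a constant exists). $\sigma_{S,\nu}\geq 0$ is the square root of the variance. *)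

theory Defs
  imports
    "HOL-Probability.Probability"
    "HOL-Library.Poly_Mapping"
    "HOL-Computational_Algebra.Primes"
    "HOL-Algebra.Embedded_Algebras"
    "HOL-Algebra.QuotRing"
    "HOL-Algebra.Algebraic_Closure_Type"
begin

unbundle no fps_syntax

type_synonym qbar = "rat alg_closure"

text \<open>
  The type \<open>'n pspace\<close> is the set of points, over \<open>qbar\<close>, of the projective space of
  dimension \<open>CARD('n) - 1\<close>; the homogeneous coordinates are indexed by \<open>'n\<close>, and
  \<open>abs_pspace x\<close> is the point with homogeneous coordinates \<open>x\<close>, for \<open>x \<noteq> 0\<close>.
\<close>

definition proj_rel :: "qbar ^ 'n::finite \<Rightarrow> qbar ^ 'n \<Rightarrow> bool" where
  "proj_rel x y \<longleftrightarrow> x \<noteq> 0 \<and> y \<noteq> 0 \<and> (\<exists>c. c \<noteq> 0 \<and> y = c *s x)"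

lemma part_equivp_proj_rel: "part_equivp proj_rel"
proof (rule part_equivpI)
  have "(1 :: qbar ^ 'n) \<noteq> 0"
    by (simp add: vec_eq_iff)
  then have "proj_rel (1 :: qbar ^ 'n) 1"
    by (auto simp: proj_rel_def intro!: exI[of _ 1])
  then show "\<exists>x :: qbar ^ 'n. proj_rel x x" ..
  show "symp (proj_rel :: qbar ^ 'n \<Rightarrow> _)"
  proof (rule sympI)
    fix x y :: "qbar ^ 'n"
    assume "proj_rel x y"
    then obtain c where c: "x \<noteq> 0" "y \<noteq> 0" "c \<noteq> 0" "y = c *s x"
      unfolding proj_rel_def by blast
    then have "x = inverse c *s y" "inverse c \<noteq> 0"
      by (simp_all add: vector_smult_assoc)
    then show "proj_rel y x"
      unfolding proj_rel_def using c by blast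
  qed
  show "transp (proj_rel :: qbar ^ 'n \<Rightarrow> _)"
    by (rule transpI) (auto simp: proj_rel_def vector_smult_assoc)
qed

quotient_type 'n pspace = "qbar ^ 'n::finite" / partial: proj_rel
  by (rule part_equivp_proj_rel)

definition number_field :: "qbar set \<Rightarrow> bool" where
  "number_field K \<longleftrightarrow>
     subfield K (ring_of_type_algebra :: qbar ring) \<and>
     ring.finite_dimension (ring_of_type_algebra :: qbar ring) \<rat> K"

definition field_degree :: "qbar set \<Rightarrow> nat" where
  "field_degree K = ring.dim (ring_of_type_algebra :: qbar ring) \<rat> K"

definition padic_abs :: "nat \<Rightarrow> rat \<Rightarrow> real" where
  "padic_abs p q = (if q = 0 then 0
     else real p powi (int (multiplicity (int p) (snd (quotient_of q)))
                       - int (multiplicity (int p) (fst (quotient_of q)))))"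

definition is_abs_value :: "qbar set \<Rightarrow> (qbar \<Rightarrow> real) \<Rightarrow> bool" where
  "is_abs_value K v \<longleftrightarrow>
     (\<forall>x\<in>K. 0 \<le> v x \<and> (v x = 0 \<longleftrightarrow> x = 0)) \<and>
     (\<forall>x\<in>K. \<forall>y\<in>K. v (x * y) = v x * v y \<and> v (x + y) \<le> v x + v y)"

text \<open>
  The standard absolute values on \<open>K\<close>, i.e. those extending the usual absolute value or
  a \<open>p\<close>-adic absolute value (normalised by \<open>\<bar>p\<bar> = 1/p\<close>) of the rationals. They represent
  each place of \<open>K\<close> exactly once, because \<open>extensional\<close> makes \<open>v\<close> canonical outside \<open>K\<close>.
\<close>

definition places :: "qbar set \<Rightarrow> (qbar \<Rightarrow> real) set" where
  "places K = {v \<in> extensional K. is_abs_value K v \<and>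
     ((\<forall>q::rat. v (of_rat q) = \<bar>of_rat q\<bar>) \<or>
      (\<exists>p. Factorial_Ring.prime p \<and> (\<forall>q. v (of_rat q) = padic_abs p q)))}"

definition cauchy_seqs :: "qbar set \<Rightarrow> (qbar \<Rightarrow> real) \<Rightarrow> (nat \<Rightarrow> qbar) set" where
  "cauchy_seqs K v = {s. (\<forall>n. s n \<in> K) \<and>
     (\<forall>e>0. \<exists>M. \<forall>m\<ge>M. \<forall>n\<ge>M. v (s m - s n) < e)}"

definition null_seqs :: "qbar set \<Rightarrow> (qbar \<Rightarrow> real) \<Rightarrow> (nat \<Rightarrow> qbar) set" where
  "null_seqs K v = {s. (\<forall>n. s n \<in> K) \<and> (\<lambda>n. v (s n)) \<longlonglongrightarrow> 0}"

definition cauchy_ring :: "qbar set \<Rightarrow> (qbar \<Rightarrow> real) \<Rightarrow> (nat \<Rightarrow> qbar) ring" where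
  "cauchy_ring K v = \<lparr> carrier = cauchy_seqs K v,
     monoid.mult = (\<lambda>s t n. s n * t n), one = (\<lambda>n. 1),
     ring.zero = (\<lambda>n. 0), add = (\<lambda>s t n. s n + t n) \<rparr>"

definition completion :: "qbar set \<Rightarrow> (qbar \<Rightarrow> real) \<Rightarrow> (nat \<Rightarrow> qbar) set ring" where
  "completion K v = cauchy_ring K v Quot null_seqs K v"

text \<open>
  The completion of the rationals, embedded in the completion of \<open>K\<close>. The local degree below
  is the vector space dimension of the latter over the former.
\<close>

definition rat_completion_in :: "qbar set \<Rightarrow> (qbar \<Rightarrow> real) \<Rightarrow> (nat \<Rightarrow> qbar) set set" where
  "rat_completion_in K v =
     (\<lambda>s. null_seqs K v +>\<^bsub>cauchy_ring K v\<^esub> s) ` cauchy_seqs \<rat> v"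

definition local_degree :: "qbar set \<Rightarrow> (qbar \<Rightarrow> real) \<Rightarrow> nat" where
  "local_degree K v =
     ring.dim (completion K v) (rat_completion_in K v) (carrier (completion K v))"

text \<open>Only finitely many terms of the following sum over all places are nonzero.\<close>

definition height_in :: "qbar set \<Rightarrow> qbar ^ 'n::finite \<Rightarrow> real" where
  "height_in K x = (\<Sum>\<^sub>\<infinity>v\<in>places K.
     real (local_degree K v) * ln (Max (range (\<lambda>i. v (x $ i))))) / real (field_degree K)"

text \<open>The value does not depend on the coordinates nor on the number field containing them.\<close>

definition weil_height :: "'n::finite pspace \<Rightarrow> real" where
  "weil_height P = (THE r. \<exists>K x. number_field K \<and> x \<noteq> 0 \<and> (\<forall>i. x $ i \<in> K) \<and>
     P = abs_pspace x \<and> r = height_in K x)"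

type_synonym 'n qpoly = "('n \<Rightarrow>\<^sub>0 nat) \<Rightarrow>\<^sub>0 qbar"

definition peval :: "'n::finite qpoly \<Rightarrow> qbar ^ 'n \<Rightarrow> qbar" where
  "peval p x = (\<Sum>m\<in>Poly_Mapping.keys p. Poly_Mapping.lookup p m * (\<Prod>i\<in>UNIV. (x $ i) ^ Poly_Mapping.lookup m i))"

definition homogeneous :: "nat \<Rightarrow> 'n::finite qpoly \<Rightarrow> bool" where
  "homogeneous d p \<longleftrightarrow> (\<forall>m\<in>Poly_Mapping.keys p. (\<Sum>i\<in>UNIV. Poly_Mapping.lookup m i) = d)"

text \<open>
  The tuple \<open>F\<close> has no common factor (so it is the reduced representative of a rational map)
  and no common zero (so this rational map is a morphism). If \<open>CARD('n) \<ge> 2\<close>, the second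
  condition implies the first; for a single coordinate the first one makes \<open>d\<close> unique.
\<close>

definition defines_endo ::
  "nat \<Rightarrow> ('n::finite \<Rightarrow> 'n qpoly) \<Rightarrow> ('n pspace \<Rightarrow> 'n pspace) \<Rightarrow> bool" where
  "defines_endo d F \<phi> \<longleftrightarrow>
     (\<forall>i. homogeneous d (F i)) \<and>
     (\<forall>G. (\<forall>i. G dvd F i) \<longrightarrow> G dvd 1) \<and>
     (\<forall>x. x \<noteq> 0 \<longrightarrow> (\<chi> i. peval (F i) x) \<noteq> 0 \<and>
        \<phi> (abs_pspace x) = abs_pspace (\<chi> i. peval (F i) x))"

definition endomorphism :: "('n::finite pspace \<Rightarrow> 'n pspace) \<Rightarrow> bool" where
  "endomorphism \<phi> \<longleftrightarrow> (\<exists>d F. defines_endo d F \<phi>)"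

definition endo_degree :: "('n::finite pspace \<Rightarrow> 'n pspace) \<Rightarrow> nat" where
  "endo_degree \<phi> = (THE d. \<exists>F. defines_endo d F \<phi>)"

text \<open>
  A sequence \<open>\<gamma> = (\<theta>\<^sub>1, \<theta>\<^sub>2, \<dots>)\<close> is indexed from 0, so that \<open>\<theta>\<^sub>n\<close> is \<open>\<gamma> (n - 1)\<close>.
\<close>

fun left_comp :: "(nat \<Rightarrow> 'a \<Rightarrow> 'a) \<Rightarrow> nat \<Rightarrow> 'a \<Rightarrow> 'a" where
  "left_comp \<gamma> 0 = id"
| "left_comp \<gamma> (Suc n) = \<gamma> n \<circ> left_comp \<gamma> n"

fun right_comp :: "(nat \<Rightarrow> 'a \<Rightarrow> 'a) \<Rightarrow> nat \<Rightarrow> 'a \<Rightarrow> 'a" where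
  "right_comp \<gamma> 0 = id"
| "right_comp \<gamma> (Suc n) = right_comp \<gamma> n \<circ> \<gamma> n"

definition seq_measure :: "'a measure \<Rightarrow> (nat \<Rightarrow> 'a) measure" where
  "seq_measure \<nu> = Pi\<^sub>M UNIV (\<lambda>_. \<nu>)"

definition dynamical_degree :: "('n::finite pspace \<Rightarrow> 'n pspace) measure \<Rightarrow> real" where
  "dynamical_degree \<nu> = (THE \<delta>. AE \<gamma> in seq_measure \<nu>.
     (\<lambda>n. root n (real (endo_degree (left_comp \<gamma> n)))) \<longlonglongrightarrow> \<delta> \<and>
     (\<lambda>n. root n (real (endo_degree (right_comp \<gamma> n)))) \<longlonglongrightarrow> \<delta>)"

definition log_degree_variance :: "('n::finite pspace \<Rightarrow> 'n pspace) measure \<Rightarrow> real" where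
  "log_degree_variance \<nu> = prob_space.variance \<nu> (\<lambda>\<phi>. ln (real (endo_degree \<phi>)))"

end

theory Submission
  imports Defs "HOL-Real_Asymp.Real_Asymp"
begin

text \<open>
  An endomorphism \<open>\<phi>\<close> of degree \<open>d\<close> satisfies \<open>\<bar>h (\<phi> P) - d h P\<bar> \<le> C\<close>. The upper bound is the triangle
  inequality at every place, the lower bound applies it to the identities
  \<open>x\<^sub>i ^ (d + e) = (\<Sum>j. G\<^sub>i\<^sub>j F\<^sub>j)\<close> of the projective Nullstellensatz. If \<open>C\<close> works for all elements of
  \<open>S\<close>, whose degrees are at least 2, a geometric series gives
  \<open>\<bar>h (\<gamma>\<^sub>n P) - deg \<gamma>\<^sub>n h P\<bar> \<le> C deg \<gamma>\<^sub>n\<close> for both orders of composition, so that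
  \<open>ln (h (\<gamma>\<^sub>n P)) = ln (deg \<gamma>\<^sub>n) + O(1)\<close> as soon as \<open>h P > C\<close>. Degrees multiply under composition, hence
  \<open>ln (deg \<gamma>\<^sub>n)\<close> is a sum of independent identically distributed bounded variables, and everything
  follows from the law of large numbers and the law of the iterated logarithm.

  That the height does not depend on coordinates and field rests on the identity
  \<open>\<Sum>\<^sub>v\<^sub>|\<^sub>p n\<^sub>v g(v) = \<Sum>\<^sub>\<sigma> g(w \<circ> \<sigma>)\<close>, where \<open>n\<^sub>v\<close> is the local degree, \<open>\<sigma>\<close> runs through the embeddings of
  \<open>K\<close> and \<open>w\<close> is one fixed place of a normal extension: it turns the product formula and the
  compatibility with field extensions into statements on conjugates.
\<close>

section \<open>Extension of absolute values\<close>

text \<open>The place \<open>w\<close> of the overview comes from Zorn's lemma: a minimal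
  submultiplicative seminorm whose values on the rationals stay below a given absolute value is
  multiplicative. This treats the usual and the p-adic absolute values alike and needs neither
  completions nor Hensel's lemma. The identity for local degrees is forced by counting. A basis of
  the completion is chosen inside \<open>K\<close>, so that independence and spanning become
  estimates in \<open>K\<close>. Weak approximation shows that the local degrees add up to at most
  [K:Q]; independence of embeddings shows that each is at least the number of embeddings inducing
  \<open>v\<close>; there are [K:Q] embeddings, so equality holds at every place. That the degree of
  an endomorphism is well defined is itself a consequence of heights: h(\<phi> P) / h(P) tends to
  the degree as h(P) grows, and heights are unbounded once there are two coordinates. Two
  coordinates also ensure that a tuple without common zero has no common factor, hence that degrees
  multiply under composition.\<close>

definition rscale :: "rat \<Rightarrow> 'a::field_char_0 \<Rightarrow> 'a" where
  "rscale q x = of_rat q * x"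

interpretation QV: vector_space "rscale :: rat \<Rightarrow> 'a::field_char_0 \<Rightarrow> 'a"
  by unfold_locales (auto simp: rscale_def algebra_simps of_rat_add of_rat_mult)

text \<open>A predicate on plain sets, so that arguments use the type class operations;
  \<open>subfield_QR\<close> identifies it with \<open>subfield\<close> for the ring structure on
  the type.\<close>

definition is_subfield :: "'a::field_char_0 set \<Rightarrow> bool" where
  "is_subfield K \<longleftrightarrow> 0 \<in> K \<and> 1 \<in> K \<and> (\<forall>x\<in>K. \<forall>y\<in>K. x + y \<in> K \<and> x * y \<in> K) \<and>
     (\<forall>x\<in>K. - x \<in> K \<and> inverse x \<in> K)"

lemma is_subfieldD:
  assumes "is_subfield K"
  shows "0 \<in> K" "1 \<in> K" "\<And>x y. x \<in> K \<Longrightarrow> y \<in> K \<Longrightarrow> x + y \<in> K"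
    "\<And>x y. x \<in> K \<Longrightarrow> y \<in> K \<Longrightarrow> x * y \<in> K" "\<And>x. x \<in> K \<Longrightarrow> - x \<in> K"
    "\<And>x. x \<in> K \<Longrightarrow> inverse x \<in> K"
  using assms by (auto simp: is_subfield_def)

lemma is_subfield_diff: "is_subfield K \<Longrightarrow> x \<in> K \<Longrightarrow> y \<in> K \<Longrightarrow> x - y \<in> K"
  using is_subfieldD(3,5)[of K] by (metis add_uminus_conv_diff)

lemma is_subfield_divide: "is_subfield K \<Longrightarrow> x \<in> K \<Longrightarrow> y \<in> K \<Longrightarrow> x / y \<in> K"
  using is_subfieldD(4,6)[of K] by (metis divide_inverse)

lemma is_subfield_power: "is_subfield K \<Longrightarrow> x \<in> K \<Longrightarrow> x ^ n \<in> K"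
  by (induction n) (auto intro: is_subfieldD)

lemma is_subfield_sum: "is_subfield K \<Longrightarrow> (\<And>i. i \<in> I \<Longrightarrow> f i \<in> K) \<Longrightarrow> sum f I \<in> K"
  by (induction I rule: infinite_finite_induct) (auto intro: is_subfieldD)

lemma is_subfield_prod: "is_subfield K \<Longrightarrow> (\<And>i. i \<in> I \<Longrightarrow> f i \<in> K) \<Longrightarrow> prod f I \<in> K"
  by (induction I rule: infinite_finite_induct) (auto intro: is_subfieldD)

lemma is_subfield_of_nat: "is_subfield K \<Longrightarrow> of_nat n \<in> K"
  by (induction n) (auto intro: is_subfieldD)

lemma is_subfield_of_int: "is_subfield K \<Longrightarrow> of_int n \<in> K"
  by (cases n) (auto intro: is_subfieldD is_subfield_of_nat simp del: of_nat_Suc)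

lemma is_subfield_of_rat: "is_subfield K \<Longrightarrow> of_rat q \<in> K"
  by (metis of_rat_rat[of "snd (quotient_of q)" "fst (quotient_of q)"] is_subfield_of_int is_subfield_divide quotient_of_denom_pos' less_irrefl Fract_of_int_quotient quotient_of_div of_rat_divide of_rat_of_int_eq prod.collapse)

lemma is_subfield_subspace: "is_subfield K \<Longrightarrow> QV.subspace K"
  by (auto simp: QV.subspace_def rscale_def intro: is_subfieldD is_subfield_of_rat)

definition poly_over :: "'a::field_char_0 set \<Rightarrow> 'a poly \<Rightarrow> bool" where
  "poly_over K p \<longleftrightarrow> (\<forall>i. Polynomial.coeff p i \<in> K)"

lemma poly_over_pCons: "0 \<in> K \<Longrightarrow> poly_over K (pCons c p) \<longleftrightarrow> c \<in> K \<and> poly_over K p"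
  unfolding poly_over_def
  by (metis coeff_pCons_0 coeff_pCons_Suc not0_implies_Suc)

lemma poly_over_0: "0 \<in> K \<Longrightarrow> poly_over K 0"
  by (simp add: poly_over_def)

lemma poly_over_add: "is_subfield K \<Longrightarrow> poly_over K p \<Longrightarrow> poly_over K q \<Longrightarrow> poly_over K (p + q)"
  by (auto simp: poly_over_def intro: is_subfieldD)

lemma poly_over_diff: "is_subfield K \<Longrightarrow> poly_over K p \<Longrightarrow> poly_over K q \<Longrightarrow> poly_over K (p - q)"
  by (auto simp: poly_over_def intro: is_subfield_diff)

lemma poly_over_smult: "is_subfield K \<Longrightarrow> c \<in> K \<Longrightarrow> poly_over K p \<Longrightarrow> poly_over K (Polynomial.smult c p)"
  by (auto simp: poly_over_def intro: is_subfieldD)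

lemma poly_over_mult: "is_subfield K \<Longrightarrow> poly_over K p \<Longrightarrow> poly_over K q \<Longrightarrow> poly_over K (p * q)"
  by (auto simp: poly_over_def coeff_mult intro!: is_subfield_sum is_subfieldD(4))

lemma poly_over_monom: "is_subfield K \<Longrightarrow> c \<in> K \<Longrightarrow> poly_over K (Polynomial.monom c n)"
  by (auto simp: poly_over_def coeff_monom is_subfieldD)

text \<open>The weighted l1 norm in which the variable has size \<open>r\<close>. Dividing by the
  relation that sends the variable to \<open>x\<close> gives \<open>adjoined\<close>.\<close>

definition poly_len :: "('a::field_char_0 \<Rightarrow> real) \<Rightarrow> real \<Rightarrow> 'a poly \<Rightarrow> real" where
  "poly_len N r p = (\<Sum>i\<le>Polynomial.degree p. N (Polynomial.coeff p i) * r ^ i)"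

lemma poly_len_bound:
  assumes "N 0 = 0" "Polynomial.degree p \<le> n"
  shows "poly_len N r p = (\<Sum>i\<le>n. N (Polynomial.coeff p i) * r ^ i)"
  unfolding poly_len_def using assms
  by (intro sum.mono_neutral_left) (auto simp: coeff_eq_0)

text \<open>On the rationals only an upper bound is imposed: infima of chains preserve it, and
  equality follows once \<open>N\<close> is known to be multiplicative. The value 0 outside
  \<open>K\<close> turns pointwise comparison of functions into comparison on \<open>K\<close>, so
  that minimality is about functions themselves.\<close>

locale seminorm_on =
  fixes K :: "'a::field_char_0 set" and a :: "rat \<Rightarrow> real" and N :: "'a \<Rightarrow> real"
  assumes K: "is_subfield K"
    and nonneg: "x \<in> K \<Longrightarrow> 0 \<le> N x"
    and triangle: "x \<in> K \<Longrightarrow> y \<in> K \<Longrightarrow> N (x + y) \<le> N x + N y"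
    and submult: "x \<in> K \<Longrightarrow> y \<in> K \<Longrightarrow> N (x * y) \<le> N x * N y"
    and one: "N 1 = 1"
    and rat_le: "N (of_rat q) \<le> a q"
    and out: "x \<notin> K \<Longrightarrow> N x = 0"
    and a0: "a 0 = 0"
begin

lemma zero: "N 0 = 0"
  using rat_le[of 0] a0 nonneg[OF is_subfieldD(1)[OF K]] by simp

lemma pow: "x \<in> K \<Longrightarrow> N (x ^ n) \<le> N x ^ n"
proof (induction n)
  case (Suc n)
  then show ?case
    using submult[of x "x ^ n"] is_subfield_power[OF K, of x n] nonneg[of x]
    by (auto intro: order_trans[OF _ mult_left_mono])
qed (simp add: one)

lemma pos: assumes "x \<in> K" "x \<noteq> 0" shows "0 < N x"
proof -
  have "1 \<le> N x * N (inverse x)"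
    using submult[of x "inverse x"] assms is_subfieldD[OF K] one by simp
  then show ?thesis
    using nonneg[of x] nonneg[of "inverse x"] assms is_subfieldD[OF K]
    by (metis less_le mult_zero_left not_one_le_zero)
qed

lemma sum_le: "finite I \<Longrightarrow> (\<And>i. i \<in> I \<Longrightarrow> f i \<in> K) \<Longrightarrow> N (sum f I) \<le> (\<Sum>i\<in>I. N (f i))"
proof (induction I rule: finite_induct)
  case (insert i I)
  have "N (f i + sum f I) \<le> N (f i) + N (sum f I)"
    by (rule triangle) (use insert is_subfield_sum[OF K, of I f] in auto)
  with insert show ?case by fastforce
qed (simp add: zero)

lemma poly_len_nonneg: "r \<ge> 0 \<Longrightarrow> poly_over K p \<Longrightarrow> 0 \<le> poly_len N r p"
  by (auto simp: poly_len_def poly_over_def intro!: sum_nonneg mult_nonneg_nonneg nonneg)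

lemma poly_len_add:
  assumes "r \<ge> 0" "poly_over K p" "poly_over K q"
  shows "poly_len N r (p + q) \<le> poly_len N r p + poly_len N r q"
proof -
  define n where "n = max (Polynomial.degree p) (Polynomial.degree q)"
  have "Polynomial.degree (p + q) \<le> n"
    by (simp add: n_def degree_add_le_max)
  then show ?thesis
    using assms triangle
    by (simp add: poly_len_bound[of N _ n, OF zero] n_def sum.distrib[symmetric] poly_over_def
        distrib_right[symmetric] mult_right_mono sum_mono)
qed

lemma poly_len_smult:
  assumes "r \<ge> 0" "c \<in> K" "poly_over K p"
  shows "poly_len N r (Polynomial.smult c p) \<le> N c * poly_len N r p"
proof -
  have "poly_len N r (Polynomial.smult c p) =
      (\<Sum>i\<le>Polynomial.degree p. N (c * Polynomial.coeff p i) * r ^ i)"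
    by (subst poly_len_bound[of N _ "Polynomial.degree p", OF zero]) (auto simp: degree_smult_le)
  also have "\<dots> \<le> (\<Sum>i\<le>Polynomial.degree p. (N c * N (Polynomial.coeff p i)) * r ^ i)"
    using assms by (intro sum_mono mult_right_mono submult) (auto simp: poly_over_def)
  finally show ?thesis
    by (simp add: poly_len_def sum_distrib_left mult.assoc)
qed

lemma poly_len_pCons: "poly_len N r (pCons c p) = N c + r * poly_len N r p"
proof -
  have "poly_len N r (pCons c p) =
      (\<Sum>i\<le>Suc (Polynomial.degree p). N (Polynomial.coeff (pCons c p) i) * r ^ i)"
    by (rule poly_len_bound[of N, OF zero]) (rule degree_pCons_le)
  also have "\<dots> = N c + (\<Sum>i\<le>Polynomial.degree p. N (Polynomial.coeff p i) * r ^ Suc i)"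
    by (subst sum.atMost_Suc_shift) simp
  finally show ?thesis
    by (simp add: poly_len_def sum_distrib_left mult_ac)
qed

lemma poly_len_mult:
  assumes "r \<ge> 0" "poly_over K p" "poly_over K q"
  shows "poly_len N r (p * q) \<le> poly_len N r p * poly_len N r q"
  using assms(2)
proof (induction p rule: pCons_induct)
  case 0
  then show ?case by (simp add: poly_len_def zero)
next
  case (pCons c p)
  have cp: "c \<in> K" "poly_over K p"
    using pCons.prems poly_over_pCons[OF is_subfieldD(1)[OF K]] by auto
  have "poly_len N r (pCons c p * q) = poly_len N r (Polynomial.smult c q + pCons 0 (p * q))"
    by simp
  also have "\<dots> \<le> poly_len N r (Polynomial.smult c q) + poly_len N r (pCons 0 (p * q))"
    using cp assms K
    by (intro poly_len_add) (auto simp: poly_over_pCons is_subfieldD poly_over_smult poly_over_mult)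
  also have "\<dots> \<le> N c * poly_len N r q + r * (poly_len N r p * poly_len N r q)"
    using cp assms pCons.IH poly_len_smult[of r c q]
    by (intro add_mono) (auto simp: poly_len_pCons zero intro!: mult_left_mono)
  also have "\<dots> = poly_len N r (pCons c p) * poly_len N r q"
    by (simp add: poly_len_pCons algebra_simps)
  finally show ?case .
qed

text \<open>Multiplying p(x) = 1 by x^-n gives a recursion for N(x^-n) r^n whose coefficients add up
  to \<open>poly_len N r p\<close>. If that sum were below 1, the sequence would be bounded; but it
  is at least (s r)^n with s r > 1. So forcing \<open>x\<close> to have size at most
  \<open>r\<close> does not collapse the size of 1.\<close>

lemma poly_len_one_ge:
  assumes x: "x \<in> K" "x \<noteq> 0" and s: "s > 0" "\<And>n. s ^ n \<le> N (inverse x ^ n)" and r: "1 / s < r"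
    and p: "poly_over K p" "poly p x = 1"
  shows "1 \<le> poly_len N r p"
proof (rule ccontr)
  assume "\<not> 1 \<le> poly_len N r p"
  define k where "k = poly_len N r p"
  define z where "z = inverse x"
  define m where "m = Polynomial.degree p"
  define u where "u n = N (z ^ n) * r ^ n" for n
  have rpos: "r > 0" using r s by (meson divide_pos_pos less_trans zero_less_one)
  have k: "k < 1" using \<open>\<not> 1 \<le> poly_len N r p\<close> by (simp add: k_def)
  have zK: "z \<in> K" using is_subfieldD(6)[OF K x(1)] by (simp add: z_def)
  have unn: "0 \<le> u n" for n
    using rpos nonneg[OF is_subfield_power[OF K zK]] by (simp add: u_def)
  have rec: "u n \<le> (\<Sum>i\<le>m. N (Polynomial.coeff p i) * r ^ i * u (n - i))" if n: "n \<ge> m" for n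
  proof -
    have "z ^ n = poly p x * z ^ n" using p by simp
    also have "\<dots> = (\<Sum>i\<le>m. Polynomial.coeff p i * z ^ (n - i))"
    proof -
      have "x ^ i * z ^ n = z ^ (n - i)" if "i \<le> m" for i
      proof -
        have "z ^ n = z ^ i * z ^ (n - i)" using that n by (simp add: power_add[symmetric])
        then show ?thesis using x by (simp add: z_def power_mult_distrib[symmetric] mult.assoc[symmetric])
      qed
      then show ?thesis
        by (simp add: poly_altdef sum_distrib_right m_def mult.assoc)
    qed
    finally have "N (z ^ n) \<le> (\<Sum>i\<le>m. N (Polynomial.coeff p i * z ^ (n - i)))"
      using sum_le[of "{..m}" "\<lambda>i. Polynomial.coeff p i * z ^ (n - i)"] p zK
      by (auto simp: poly_over_def intro: is_subfieldD[OF K] is_subfield_power[OF K])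
    also have "\<dots> \<le> (\<Sum>i\<le>m. N (Polynomial.coeff p i) * N (z ^ (n - i)))"
      using p zK by (intro sum_mono submult) (auto simp: poly_over_def intro: is_subfield_power[OF K])
    finally have "u n \<le> (\<Sum>i\<le>m. N (Polynomial.coeff p i) * N (z ^ (n - i))) * r ^ n"
      using rpos by (simp add: u_def mult_right_mono)
    also have "\<dots> = (\<Sum>i\<le>m. N (Polynomial.coeff p i) * r ^ i * u (n - i))"
      unfolding sum_distrib_right
    proof (rule sum.cong)
      fix i assume "i \<in> {..m}"
      then have "r ^ n = r ^ i * r ^ (n - i)" using n by (simp add: power_add[symmetric])
      then show "N (Polynomial.coeff p i) * N (z ^ (n - i)) * r ^ n =
          N (Polynomial.coeff p i) * r ^ i * u (n - i)"
        by (simp add: u_def)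
    qed simp
    finally show ?thesis .
  qed
  define V where "V = Max (u ` {..m})"
  have V: "u i \<le> V" if "i \<le> m" for i using that by (auto simp: V_def)
  have bound: "u n \<le> V" for n
  proof (induction n rule: less_induct)
    case (less n)
    show ?case
    proof (cases "n \<le> m")
      case False
      have "u n \<le> (\<Sum>i\<le>m. N (Polynomial.coeff p i) * r ^ i * max V (u n))"
      proof (rule order_trans[OF rec], use False in simp, rule sum_mono)
        fix i assume "i \<in> {..m}"
        \<comment> \<open>For \<open>i = 0\<close> the recursion refers to \<open>u n\<close>
          itself, hence the maximum; \<open>k < 1\<close> removes that term afterwards.\<close>
        have "u (n - i) \<le> max V (u n)"
        proof (cases "i = 0")
          case False
          then show ?thesis using less[of "n - i"] \<open>\<not> n \<le> m\<close> by (simp add: max.coboundedI1)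
        qed simp
        then show "N (Polynomial.coeff p i) * r ^ i * u (n - i) \<le>
            N (Polynomial.coeff p i) * r ^ i * max V (u n)"
          using p rpos by (intro mult_left_mono) (auto simp: poly_over_def intro!: mult_nonneg_nonneg nonneg)
      qed
      also have "\<dots> = k * max V (u n)"
        by (simp add: k_def poly_len_def m_def sum_distrib_right)
      finally have *: "u n \<le> k * max V (u n)" .
      show ?thesis
      proof (rule ccontr)
        assume "\<not> u n \<le> V"
        moreover have "0 \<le> V" using V[of 0] unn[of 0] by simp
        ultimately have "0 < u n" "u n \<le> k * u n" using * by (auto simp: max_def split: if_splits)
        then show False using k by simp
      qed
    qed (rule V)
  qed
  have "1 < s * r" using r s by (simp add: field_simps)
  then obtain n where "V < (s * r) ^ n" using real_arch_pow by blast
  also have "\<dots> \<le> u n"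
    using s(2)[of n] rpos by (simp add: u_def power_mult_distrib z_def mult_right_mono)
  finally show False using bound[of n] by simp
qed

text \<open>The quotient of the polynomial norm under evaluation at \<open>x\<close>: it lies below
  \<open>N\<close> and makes \<open>x\<close> no larger than \<open>r\<close>.\<close>

definition adjoined :: "'a \<Rightarrow> real \<Rightarrow> 'a \<Rightarrow> real" where
  "adjoined x r y = (if y \<in> K then Inf (poly_len N r ` {p. poly_over K p \<and> poly p x = y}) else 0)"

context
  fixes x :: 'a and s r :: real
  assumes x: "x \<in> K" "x \<noteq> 0" and s: "s > 0" "\<And>n. s ^ n \<le> N (inverse x ^ n)" and r: "1 / s < r"
begin

lemma rpos: "r > 0"
  using r s by (meson divide_pos_pos less_trans zero_less_one)

lemma adjoined_lower: "poly_over K p \<Longrightarrow> y \<in> K \<Longrightarrow> poly p x = y \<Longrightarrow> adjoined x r y \<le> poly_len N r p"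
  unfolding adjoined_def using poly_len_nonneg rpos
  by (auto intro!: cInf_lower bdd_belowI[of _ 0] simp: less_imp_le)

lemma const_mem: "y \<in> K \<Longrightarrow> [:y:] \<in> {p. poly_over K p \<and> poly p x = y}"
  by (auto simp: poly_over_pCons is_subfieldD[OF K] poly_over_0)

lemma adjoined_greatest:
  assumes "y \<in> K" "\<And>p. poly_over K p \<Longrightarrow> poly p x = y \<Longrightarrow> c \<le> poly_len N r p"
  shows "c \<le> adjoined x r y"
  unfolding adjoined_def using assms const_mem[of y] by (auto intro!: cInf_greatest)

lemma adjoined_nonneg: "y \<in> K \<Longrightarrow> 0 \<le> adjoined x r y"
  using poly_len_nonneg rpos by (intro adjoined_greatest) auto

lemma adjoined_le: "y \<in> K \<Longrightarrow> adjoined x r y \<le> N y"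
  using adjoined_lower[of "[:y:]" y] const_mem[of y] by (simp add: poly_len_def)

lemma adjoined_mult_bound:
  assumes "y \<in> K" "0 \<le> d" "\<And>p. poly_over K p \<Longrightarrow> poly p x = y \<Longrightarrow> c \<le> d * poly_len N r p"
  shows "c \<le> d * adjoined x r y"
proof (cases "d = 0")
  case True
  with assms const_mem[of y] show ?thesis by fastforce
next
  case False
  then have "c / d \<le> adjoined x r y"
    using assms by (intro adjoined_greatest) (auto simp: field_simps)
  with False assms show ?thesis by (simp add: field_simps)
qed

lemma adjoined_seminorm: "seminorm_on K a (adjoined x r)"
proof
  show "is_subfield K" by (rule K)
  show "0 \<le> adjoined x r y" if "y \<in> K" for y
    using that by (rule adjoined_nonneg)
  show "adjoined x r (y + z) \<le> adjoined x r y + adjoined x r z" if yz: "y \<in> K" "z \<in> K" for y z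
  proof -
    have "adjoined x r (y + z) - poly_len N r p \<le> adjoined x r z"
      if "poly_over K p" "poly p x = y" for p
    proof (rule adjoined_greatest)
      fix q assume q: "poly_over K q" "poly q x = z"
      have "adjoined x r (y + z) \<le> poly_len N r (p + q)"
        using that q yz K by (intro adjoined_lower) (auto simp: poly_over_add is_subfieldD)
      then show "adjoined x r (y + z) - poly_len N r p \<le> poly_len N r q"
        using poly_len_add[of r p q] rpos that q by simp
    qed fact
    then have "adjoined x r (y + z) - adjoined x r z \<le> adjoined x r y"
      using yz by (intro adjoined_greatest) (auto simp: algebra_simps)
    then show ?thesis by simp
  qed
  show "adjoined x r (y * z) \<le> adjoined x r y * adjoined x r z" if yz: "y \<in> K" "z \<in> K" for y z
  proof -
    have *: "adjoined x r (y * z) \<le> poly_len N r p * adjoined x r z"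
      if p: "poly_over K p" "poly p x = y" for p
    proof (rule adjoined_mult_bound)
      fix q assume q: "poly_over K q" "poly q x = z"
      have "adjoined x r (y * z) \<le> poly_len N r (p * q)"
        using p q yz K by (intro adjoined_lower) (auto simp: poly_over_mult is_subfieldD)
      then show "adjoined x r (y * z) \<le> poly_len N r p * poly_len N r q"
        using poly_len_mult[of r p q] rpos p q by simp
    qed (use yz p poly_len_nonneg rpos in auto)
    have "adjoined x r (y * z) \<le> adjoined x r z * adjoined x r y"
      using yz * adjoined_nonneg by (intro adjoined_mult_bound) (auto simp: mult.commute)
    then show ?thesis by (simp add: mult.commute)
  qed
  show "adjoined x r 1 = 1"
  proof (rule antisym)
    show "adjoined x r 1 \<le> 1" using adjoined_le[of 1] is_subfieldD[OF K] one by simp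
    show "1 \<le> adjoined x r 1"
      using poly_len_one_ge[OF x s r] is_subfieldD[OF K] by (intro adjoined_greatest) auto
  qed
  show "adjoined x r (of_rat q) \<le> a q" for q
    using adjoined_le[of "of_rat q"] rat_le[of q] is_subfield_of_rat[OF K] by (metis order_trans)
  show "adjoined x r y = 0" if "y \<notin> K" for y
    using that by (simp add: adjoined_def)
  show "a 0 = 0" by (rule a0)
qed

lemma adjoined_x_le: "adjoined x r x \<le> r"
proof -
  have "poly_over K [:0, 1:]"
    using is_subfieldD[OF K] by (auto simp: poly_over_pCons poly_over_0)
  from adjoined_lower[OF this, of x] x show ?thesis
    by (simp add: poly_len_pCons zero one) (simp add: poly_len_def zero)
qed

end

context
  assumes minimal: "\<And>N'. seminorm_on K a N' \<Longrightarrow> (\<And>x. N' x \<le> N x) \<Longrightarrow> N' = N"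
begin

text \<open>For every r > 1/s the seminorm \<open>adjoined x r\<close> is admissible and lies below
  \<open>N\<close>, so it equals \<open>N\<close> by minimality; and it gives \<open>x\<close> size
  at most \<open>r\<close>.\<close>

lemma minimal_le:
  assumes "x \<in> K" "x \<noteq> 0" "s > 0" "\<And>n. s ^ n \<le> N (inverse x ^ n)"
  shows "N x \<le> 1 / s"
proof (rule dense_ge)
  fix r assume r: "1 / s < r"
  have "adjoined x r y \<le> N y" for y
    using adjoined_le[OF assms r, of y] by (cases "y \<in> K") (auto simp: adjoined_def out)
  then have "adjoined x r = N"
    by (rule minimal[OF adjoined_seminorm[OF assms r]])
  then show "N x \<le> r" using adjoined_x_le[OF assms r] by simp
qed

text \<open>This is \<open>minimal_le\<close> for \<open>z\<close>, with \<open>s\<close> the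
  inverse of the n-th root of \<open>N (z ^ n)\<close>. The hypothesis on the powers of 1/z follows
  from submultiplicativity alone after raising it to the n-th power.\<close>

lemma minimal_power:
  assumes z: "z \<in> K" "z \<noteq> 0" shows "N z ^ n \<le> N (z ^ n)"
proof (cases "n = 0")
  case False
  define x where "x = inverse z"
  have x: "x \<in> K" "x \<noteq> 0" "inverse x = z" using z is_subfieldD[OF K] by (auto simp: x_def)
  have zn: "N (z ^ n) > 0" using pos[of "z ^ n"] z is_subfield_power[OF K] by simp
  define t where "t = 1 / root n (N (z ^ n))"
  have t: "t > 0" using zn False by (simp add: t_def)
  have tn: "t ^ n = 1 / N (z ^ n)" using zn False by (simp add: t_def power_divide)
  have "t ^ m \<le> N (inverse z ^ m)" for m
  proof -
    have "(t ^ m) ^ n = (1 / N (z ^ n)) ^ m"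
      by (simp add: tn[symmetric] power_mult[symmetric] mult.commute)
    also have "\<dots> \<le> 1 / N (z ^ (n * m))"
    proof -
      have "N (z ^ (n * m)) \<le> N (z ^ n) ^ m"
        using pow[of "z ^ n" m] z is_subfield_power[OF K] by (simp add: power_mult)
      moreover have "N (z ^ (n * m)) > 0" using pos[of "z ^ (n * m)"] z is_subfield_power[OF K] by simp
      ultimately show ?thesis by (simp add: power_divide frac_le)
    qed
    also have "\<dots> \<le> N (x ^ (n * m))"
    proof -
      have "1 \<le> N (x ^ (n * m)) * N (z ^ (n * m))"
        using submult[of "x ^ (n * m)" "z ^ (n * m)"] x z is_subfield_power[OF K] one
        by (simp add: power_mult_distrib[symmetric] x_def)
      moreover have "N (z ^ (n * m)) > 0" using pos[of "z ^ (n * m)"] z is_subfield_power[OF K] by simp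
      ultimately show ?thesis by (simp add: field_simps)
    qed
    also have "\<dots> \<le> N (x ^ m) ^ n"
      using pow[of "x ^ m" n] x is_subfield_power[OF K] by (simp add: power_mult[symmetric] mult.commute)
    finally show ?thesis
      using False t nonneg[of "x ^ m"] x is_subfield_power[OF K] by (simp add: x_def)
  qed
  from minimal_le[OF z t this] have "N z \<le> root n (N (z ^ n))" by (simp add: t_def)
  then have "N z ^ n \<le> root n (N (z ^ n)) ^ n"
    using nonneg[OF z(1)] by (intro power_mono)
  then show ?thesis using False zn by simp
qed (use one in simp)

text \<open>Since \<open>N\<close> respects powers of 1/x, \<open>minimal_le\<close> applies with
  \<open>s = N (inverse x)\<close> and yields N(x) N(1/x) \<le> 1. Together with y = (1/x)(x y) this
  gives the inequality opposite to submultiplicativity.\<close>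

lemma minimal_mult:
  assumes "x \<in> K" "y \<in> K" shows "N (x * y) = N x * N y"
proof (cases "x = 0")
  case False
  have ix: "inverse x \<in> K" "inverse x \<noteq> 0" using assms False is_subfieldD[OF K] by auto
  have 1: "N x \<le> 1 / N (inverse x)"
    using assms ix False by (intro minimal_le pos minimal_power) auto
  have "N y \<le> N (inverse x) * N (x * y)"
    using submult[of "inverse x" "x * y"] ix assms False is_subfieldD[OF K] by (simp add: mult.assoc[symmetric])
  then have "N x * N y \<le> (1 / N (inverse x)) * (N (inverse x) * N (x * y))"
    using 1 assms nonneg pos[OF ix] by (intro mult_mono) auto
  also have "\<dots> = N (x * y)" using pos[OF ix] by simp
  finally show ?thesis using submult[OF assms] by simp
qed (simp add: zero)

end

end

section \<open>Existence of an extension by Zorn's lemma\<close>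

definition rat_abs :: "(rat \<Rightarrow> real) \<Rightarrow> bool" where
  "rat_abs a \<longleftrightarrow> (\<forall>q. 0 \<le> a q \<and> (a q = 0 \<longleftrightarrow> q = 0)) \<and>
     (\<forall>q r. a (q * r) = a q * a r \<and> a (q + r) \<le> a q + a r)"

lemma rat_absD:
  assumes "rat_abs a"
  shows "0 \<le> a q" "a q = 0 \<longleftrightarrow> q = 0" "a (q * r) = a q * a r" "a (q + r) \<le> a q + a r" "a 1 = 1"
proof -
  show 1: "0 \<le> a q" "a q = 0 \<longleftrightarrow> q = 0" "a (q * r) = a q * a r" "a (q + r) \<le> a q + a r"
    using assms by (auto simp: rat_abs_def)
  have "a 1 * a 1 = a 1" "a 1 \<noteq> 0" using assms unfolding rat_abs_def by (metis mult_1, metis zero_neq_one)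
  then show "a 1 = 1" by simp
qed

text \<open>The sum \<open>n\<close> of the absolute values of the coordinates is submultiplicative
  only up to the constant \<open>C\<close>. The operator norm of multiplication with respect to
  \<open>n\<close> is submultiplicative without a constant and takes the value 1 at 1.\<close>

lemma ex_seminorm:
  fixes K :: "'a::field_char_0 set"
  assumes a: "rat_abs a" and K: "is_subfield K" and B: "finite B" "QV.independent B" "QV.span B = K"
  shows "\<exists>N. seminorm_on K a N"
proof -
  define c where "c x b = QV.representation B x b" for x b
  define n where "n x = (\<Sum>b\<in>B. a (c x b))" for x
  have exp: "(\<Sum>b\<in>B. of_rat (c x b) * b) = x" if "x \<in> K" for x
    using QV.sum_representation_eq[OF B(2), of x B] that B
    by (simp add: c_def rscale_def)
  have n0: "0 \<le> n x" for x using a by (auto simp: n_def rat_absD intro: sum_nonneg)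
  have npos: "0 < n x" if "x \<in> K" "x \<noteq> 0" for x
  proof (rule ccontr)
    assume "\<not> 0 < n x"
    then have "n x = 0" using n0[of x] by simp
    then have "\<forall>b\<in>B. c x b = 0"
      using a B by (simp add: n_def sum_nonneg_eq_0_iff rat_absD)
    with exp[OF that(1)] that(2) show False by simp
  qed
  have nadd: "n (x + y) \<le> n x + n y" if "x \<in> K" "y \<in> K" for x y
    using that B by (auto simp: n_def c_def QV.representation_add sum.distrib[symmetric]
        intro!: sum_mono rat_absD[OF a])
  have nscale: "n (of_rat q * x) = a q * n x" if "x \<in> K" for q x
    using that B QV.representation_scale[OF B(2), of x q]
    by (simp add: n_def c_def rscale_def rat_absD[OF a] sum_distrib_left)
  have nzero: "n 0 = 0" using nscale[of 0 0] is_subfieldD[OF K] rat_absD(2)[OF a, of 0] by simp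
  have nsum: "n (sum f I) \<le> (\<Sum>i\<in>I. n (f i))" if "finite I" "\<And>i. i \<in> I \<Longrightarrow> f i \<in> K" for f :: "_ \<Rightarrow> 'a" and I :: "'a set"
    using that
  proof (induction I rule: finite_induct)
    case (insert i I)
    have "n (f i + sum f I) \<le> n (f i) + n (sum f I)"
      by (rule nadd) (use insert is_subfield_sum[OF K, of I f] in auto)
    with insert show ?case by fastforce
  qed (simp add: nzero)
  have BK: "B \<subseteq> K" using B QV.span_base by blast
  define C where "C = (\<Sum>b\<in>B. \<Sum>b'\<in>B. n (b * b'))"
  have C: "n (b * b') \<le> C" if "b \<in> B" "b' \<in> B" for b b'
  proof -
    have "n (b * b') \<le> (\<Sum>b'\<in>B. n (b * b'))"
      by (rule member_le_sum) (use that B n0 in auto)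
    also have "\<dots> \<le> C" unfolding C_def
      by (rule member_le_sum[where f="\<lambda>b. \<Sum>b'\<in>B. n (b * b')"]) (use that B n0 in \<open>auto intro: sum_nonneg\<close>)
    finally show ?thesis .
  qed
  have nmult: "n (x * y) \<le> C * n x * n y" if xy: "x \<in> K" "y \<in> K" for x y
  proof -
    have trm: "n (of_rat (c x b) * (b * y)) \<le> a (c x b) * (C * n y)" if b: "b \<in> B" for b
    proof -
      have "b * y = (\<Sum>b'\<in>B. of_rat (c y b') * (b * b'))"
        by (subst exp[OF xy(2), symmetric]) (simp add: sum_distrib_left mult_ac)
      then have "n (b * y) = n (\<Sum>b'\<in>B. of_rat (c y b') * (b * b'))" by simp
      also have "\<dots> \<le> (\<Sum>b'\<in>B. n (of_rat (c y b') * (b * b')))"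
        using b BK B(1) by (intro nsum is_subfieldD(4)[OF K] is_subfield_of_rat[OF K]) auto
      also have "\<dots> = (\<Sum>b'\<in>B. a (c y b') * n (b * b'))"
        using b BK K by (intro sum.cong nscale) (auto intro!: is_subfieldD(4)[OF K])
      also have "\<dots> \<le> (\<Sum>b'\<in>B. a (c y b') * C)"
        using C b rat_absD[OF a] by (intro sum_mono mult_left_mono) auto
      finally have "n (b * y) \<le> C * n y" by (simp add: n_def sum_distrib_left mult.commute)
      moreover have "n (of_rat (c x b) * (b * y)) = a (c x b) * n (b * y)"
        using b BK xy by (intro nscale is_subfieldD(4)[OF K]) auto
      ultimately show ?thesis using rat_absD[OF a] by (simp add: mult_left_mono)
    qed
    have "x * y = (\<Sum>b\<in>B. of_rat (c x b) * (b * y))"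
      by (subst exp[OF xy(1), symmetric]) (simp add: sum_distrib_right mult.assoc)
    then have "n (x * y) = n (\<Sum>b\<in>B. of_rat (c x b) * (b * y))" by simp
    also have "\<dots> \<le> (\<Sum>b\<in>B. n (of_rat (c x b) * (b * y)))"
      using BK B(1) xy by (intro nsum is_subfieldD(4)[OF K] is_subfield_of_rat[OF K]) auto
    also have "\<dots> \<le> (\<Sum>b\<in>B. a (c x b) * (C * n y))"
      by (rule sum_mono) (rule trm)
    finally show ?thesis by (simp add: n_def[of x] sum_distrib_left sum_distrib_right mult_ac)
  qed
  define Q where "Q x = (\<lambda>y. n (x * y) / n y) ` (K - {0})" for x
  define N where "N x = (if x \<in> K then Sup (Q x) else 0)" for x
  have ne: "Q x \<noteq> {}" for x using is_subfieldD[OF K] by (auto simp: Q_def)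
  have div: "n (x * y) / n y \<le> d" if "y \<in> K - {0}" "n (x * y) \<le> d * n y" for x y d
    using that npos[of y] by (simp add: pos_divide_le_eq)
  have bdd: "bdd_above (Q x)" if "x \<in> K" for x
    using nmult[OF that] by (intro bdd_aboveI[of _ "C * n x"]) (auto simp: Q_def intro!: div)
  have le: "n (x * y) \<le> N x * n y" if "x \<in> K" "y \<in> K" for x y
  proof (cases "y = 0")
    case False
    have "n (x * y) / n y \<le> Sup (Q x)"
      using bdd[OF that(1)] that False by (intro cSup_upper) (auto simp: Q_def)
    then show ?thesis using npos[OF that(2) False] that by (simp add: N_def field_simps)
  qed (simp add: nzero)
  have least: "N x \<le> d" if "x \<in> K" "\<And>y. y \<in> K \<Longrightarrow> n (x * y) \<le> d * n y" for x d
    using that ne[of x] unfolding N_def by (auto intro!: cSup_least div simp: Q_def)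
  have Nn: "0 \<le> N x" if "x \<in> K" for x
  proof -
    have "0 \<le> N x * n 1" using le[OF that, of 1] n0[of "x * 1"] is_subfieldD[OF K] by (metis order_trans)
    then show ?thesis using npos[of 1] is_subfieldD[OF K] by (simp add: zero_le_mult_iff)
  qed
  have "seminorm_on K a N"
  proof
    show "N (x + y) \<le> N x + N y" if xy: "x \<in> K" "y \<in> K" for x y
    proof (rule least)
      show "n ((x + y) * z) \<le> (N x + N y) * n z" if "z \<in> K" for z
        using nadd[of "x * z" "y * z"] le[of x z] le[of y z] xy that is_subfieldD(4)[OF K]
        by (auto simp: algebra_simps)
    qed (use xy is_subfieldD[OF K] in auto)
    show "N (x * y) \<le> N x * N y" if xy: "x \<in> K" "y \<in> K" for x y
    proof (rule least)
      show "n ((x * y) * z) \<le> (N x * N y) * n z" if "z \<in> K" for z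
        using le[of x "y * z"] mult_left_mono[OF le[of y z], of "N x"] xy that is_subfieldD(4)[OF K] Nn
        by (auto simp: mult.assoc)
    qed (use xy is_subfieldD[OF K] in auto)
    show "N 1 = 1"
    proof (rule antisym)
      show "N 1 \<le> 1" using is_subfieldD[OF K] by (intro least) auto
      show "1 \<le> N 1" using le[of 1 1] npos[of 1] is_subfieldD[OF K] by simp
    qed
    show "N (of_rat q) \<le> a q" for q
      using is_subfield_of_rat[OF K] by (intro least) (auto simp: nscale)
    show "a 0 = 0" using rat_absD(2)[OF a, of 0] by simp
  qed (use K Nn in \<open>auto simp: N_def\<close>)
  then show ?thesis by blast
qed

text \<open>Zorn's lemma for the reversed pointwise order \<open>P\<close>, whose maximal elements
  are minimal seminorms. A chain is bounded by its pointwise infimum.\<close>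

theorem ex_abs_value_extension:
  fixes K :: "'a::field_char_0 set"
  assumes a: "rat_abs a" and K: "is_subfield K" and B: "finite B" "QV.independent B" "QV.span B = K"
  shows "\<exists>w. (\<forall>x\<in>K. 0 \<le> w x \<and> (w x = 0 \<longleftrightarrow> x = 0)) \<and>
     (\<forall>x\<in>K. \<forall>y\<in>K. w (x * y) = w x * w y \<and> w (x + y) \<le> w x + w y) \<and> (\<forall>q. w (of_rat q) = a q)"
proof -
  obtain N0 where N0: "seminorm_on K a N0" using ex_seminorm[OF assms] by blast
  define A where "A = {N. seminorm_on K a N}"
  define P where "P N N' \<longleftrightarrow> (\<forall>x. N' x \<le> N x)" for N N' :: "'a \<Rightarrow> real"
  have "\<exists>N\<in>A. \<forall>N'\<in>A. P N N' \<longrightarrow> N' = N"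
  proof (rule predicate_Zorn)
    show "partial_order_on A (relation_of P A)"
    proof (rule partial_order_on_relation_ofI)
      show "P N N''" if "P N N'" "P N' N''" for N N' N''
        using that unfolding P_def by (meson order_trans)
      show "N = N'" if "P N N'" "P N' N" for N N'
        using that unfolding P_def by (intro ext antisym) auto
    qed (simp add: P_def)
    fix C assume C: "C \<in> Chains (relation_of P A)"
    show "\<exists>u\<in>A. \<forall>N\<in>C. P N u"
    proof (cases "C = {}")
      case True
      with N0 show ?thesis by (auto simp: A_def)
    next
      case False
      have CA: "C \<subseteq> A" using C by (auto simp: Chains_def relation_of_def)
      have sn: "seminorm_on K a N" if "N \<in> C" for N using that CA by (auto simp: A_def)
      have chain: "P N N' \<or> P N' N" if "N \<in> C" "N' \<in> C" for N N'
        using C that by (auto simp: Chains_def relation_of_def)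
      define I where "I x = (INF N\<in>C. N x)" for x
      have nn: "0 \<le> N x" if "N \<in> C" for N x
        using seminorm_on.nonneg[OF sn[OF that], of x] seminorm_on.out[OF sn[OF that], of x] by fastforce
      have bdd: "bdd_below ((\<lambda>N. N x) ` C)" for x using nn by (auto intro!: bdd_belowI[of _ 0])
      have lower: "I x \<le> N x" if "N \<in> C" for N x
        unfolding I_def by (rule cINF_lower[OF bdd that])
      have great: "c \<le> I x" if "\<And>N. N \<in> C \<Longrightarrow> c \<le> N x" for c x
        unfolding I_def using False that by (rule cINF_greatest)
      have In: "0 \<le> I x" for x by (rule great) (rule nn)
      have gmult: "c \<le> d * I x" if "0 \<le> d" "\<And>N. N \<in> C \<Longrightarrow> c \<le> d * N x" for c d x
      proof (cases "d = 0")
        case False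
        then have "c / d \<le> I x" using that by (intro great) (auto simp: field_simps)
        with False that show ?thesis by (simp add: field_simps)
      qed (use that \<open>C \<noteq> {}\<close> in auto)
      have "seminorm_on K a I"
      proof
        show "I (x + y) \<le> I x + I y" if xy: "x \<in> K" "y \<in> K" for x y
        proof -
          have "I (x + y) - N x \<le> N' y" if NN: "N \<in> C" "N' \<in> C" for N N'
          proof -
            \<comment> \<open>In a chain the smaller of two members serves for both summands, so the
              infimum stays subadditive although the infima at \<open>x\<close> and \<open>y\<close>
              are taken separately.\<close>
            obtain M where M: "M \<in> C" "\<And>x. M x \<le> N x" "\<And>x. M x \<le> N' x"
              using chain[OF NN] NN unfolding P_def by (metis order_refl)
            have "I (x + y) \<le> M x + M y"
              using lower[OF M(1), of "x + y"] seminorm_on.triangle[OF sn[OF M(1)] xy] by simp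
            with M(2)[of x] M(3)[of y] show ?thesis by linarith
          qed
          then have "I (x + y) - N x \<le> I y" if "N \<in> C" for N using that by (intro great)
          then have "I (x + y) - I y \<le> I x" by (intro great) (auto simp: algebra_simps)
          then show ?thesis by simp
        qed
        show "I (x * y) \<le> I x * I y" if xy: "x \<in> K" "y \<in> K" for x y
        proof -
          have "I (x * y) \<le> N x * N' y" if NN: "N \<in> C" "N' \<in> C" for N N'
          proof -
            obtain M where M: "M \<in> C" "\<And>x. M x \<le> N x" "\<And>x. M x \<le> N' x"
              using chain[OF NN] NN unfolding P_def by (metis order_refl)
            have "I (x * y) \<le> M x * M y"
              using lower[OF M(1), of "x * y"] seminorm_on.submult[OF sn[OF M(1)] xy] by simp
            also have "\<dots> \<le> N x * N' y"
              by (rule mult_mono) (use M nn NN in auto)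
            finally show ?thesis .
          qed
          then have "I (x * y) \<le> N x * I y" if "N \<in> C" for N using that nn by (intro gmult)
          then have "I (x * y) \<le> I y * I x" using In by (intro gmult) (auto simp: mult.commute)
          then show ?thesis by (simp add: mult.commute)
        qed
        show "I 1 = 1"
        proof -
          have "I 1 = (INF N\<in>C. (1::real))"
            unfolding I_def by (rule INF_cong) (auto simp: seminorm_on.one[OF sn])
          then show ?thesis using False by simp
        qed
        show "I (of_rat q) \<le> a q" for q
          using False lower seminorm_on.rat_le[OF sn] by (metis ex_in_conv order_trans)
        show "I x = 0" if "x \<notin> K" for x
        proof -
          have "I x = (INF N\<in>C. (0::real))"
            unfolding I_def by (rule INF_cong) (auto simp: seminorm_on.out[OF sn] that)
          then show ?thesis using False by simp
        qed
        show "a 0 = 0" using rat_absD(2)[OF a, of 0] by simp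
      qed (use K In in auto)
      then show ?thesis using lower by (auto simp: A_def P_def)
    qed
  qed
  then obtain w where w: "seminorm_on K a w" "\<And>N'. seminorm_on K a N' \<Longrightarrow> (\<And>x. N' x \<le> w x) \<Longrightarrow> N' = w"
    unfolding A_def P_def by auto
  interpret seminorm_on K a w by (rule w(1))
  have mult: "w (x * y) = w x * w y" if "x \<in> K" "y \<in> K" for x y
    using that by (intro minimal_mult w(2)) auto
  \<comment> \<open>Only \<open>w (of_rat q) \<le> a q\<close> is built in. Applied to 1/q and
    combined with multiplicativity, it gives the opposite bound.\<close>
  have "w (of_rat q) = a q" for q
  proof (cases "q = 0")
    case False
    have "1 = w (of_rat q) * w (of_rat (inverse q))"
      using False one by (subst mult[symmetric]) (auto simp: is_subfield_of_rat[OF K] of_rat_mult[symmetric])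
    also have "\<dots> \<le> w (of_rat q) * a (inverse q)"
      using rat_le is_subfield_of_rat[OF K] nonneg by (intro mult_left_mono) auto
    finally have "a q * 1 \<le> a q * (w (of_rat q) * a (inverse q))"
      using rat_absD[OF a] by (intro mult_left_mono) auto
    also have "\<dots> = w (of_rat q) * a (q * inverse q)" by (simp add: rat_absD[OF a])
    also have "\<dots> = w (of_rat q)" using False rat_absD[OF a] by simp
    finally show ?thesis using rat_le[of q] by simp
  qed (simp add: zero a0)
  moreover have "w x = 0 \<longleftrightarrow> x = 0" if "x \<in> K" for x
    using pos[OF that] zero by (metis less_irrefl)
  ultimately show ?thesis
    using mult triangle nonneg by (intro exI[of _ w]) auto
qed

section \<open>Number fields and minimal polynomials\<close>

lemma to_ac_of_rat: "to_ac q = (of_rat q :: qbar)"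
  proof -
  have "q = of_int (fst (quotient_of q)) / of_int (snd (quotient_of q))"
    by (metis prod.collapse quotient_of_div)
  moreover have "to_ac (of_int a / of_int b :: rat) = (of_rat (of_int a / of_int b) :: qbar)" for a b
    by (simp add: of_rat_divide)
  ultimately show ?thesis by metis
qed

definition rpoly :: "rat poly \<Rightarrow> 'a::field_char_0 \<Rightarrow> 'a" where
  "rpoly p x = poly (map_poly of_rat p) x"

lemma rpoly_0 [simp]: "rpoly 0 x = 0"
  and rpoly_1 [simp]: "rpoly 1 x = 1"
  by (simp_all add: rpoly_def)

lemma map_poly_of_rat_pCons: "map_poly of_rat (pCons c p) = pCons (of_rat c :: 'a::field_char_0) (map_poly of_rat p)"
  by (rule poly_eqI) (simp add: coeff_map_poly coeff_pCons split: nat.split)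

lemma rpoly_pCons [simp]: "rpoly (pCons c p) x = of_rat c + x * rpoly p x"
  by (simp add: rpoly_def map_poly_of_rat_pCons)

lemma rpoly_add: "rpoly (p + q) x = rpoly p x + rpoly q x"
  by (induction p q rule: poly_induct2) (simp_all add: of_rat_add algebra_simps)

lemma rpoly_smult: "rpoly (Polynomial.smult c p) x = of_rat c * rpoly p x"
  by (induction p) (simp_all add: of_rat_mult algebra_simps)

lemma rpoly_mult: "rpoly (p * q) x = rpoly p x * rpoly q x"
  by (induction p) (simp_all add: rpoly_add rpoly_smult algebra_simps)

lemma rpoly_minus: "rpoly (- p) x = - rpoly p x"
  using rpoly_smult[of "-1" p x] by simp

lemma rpoly_diff: "rpoly (p - q) x = rpoly p x - rpoly q x"
  using rpoly_add[of p "- q" x] by (simp add: rpoly_minus)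

lemma rpoly_pcompose: "rpoly (pcompose p q) x = rpoly p (rpoly q x)"
  by (induction p) (simp_all add: pcompose_pCons rpoly_add rpoly_mult)

lemma rpoly_altdef: "rpoly p x = (\<Sum>i\<le>Polynomial.degree p. of_rat (Polynomial.coeff p i) * x ^ i)"
proof -
  have "Polynomial.degree (map_poly of_rat p :: 'a poly) = Polynomial.degree p"
    by (rule degree_map_poly) simp
  then show ?thesis by (simp add: rpoly_def poly_altdef coeff_map_poly)
qed

lemma rpoly_in: "is_subfield K \<Longrightarrow> x \<in> K \<Longrightarrow> rpoly p x \<in> K"
  by (induction p) (auto intro!: is_subfieldD is_subfield_of_rat)

lemma rpoly_Poly: "rpoly (Poly (map c [0..<n])) x = (\<Sum>i<n. of_rat (c i) * x ^ i)"
proof (induction n)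
  case (Suc n)
  have "rpoly (Poly (xs @ [y])) x = rpoly (Poly xs) x + of_rat y * x ^ length xs" for xs and y :: rat
    by (induction xs) (simp_all add: algebra_simps)
  then show ?case using Suc by simp
qed simp

lemma algebraic_qbar: "\<exists>p. p \<noteq> 0 \<and> rpoly p (x :: qbar) = 0"
proof -
  obtain p :: "rat poly" where "p \<noteq> 0" "poly (map_poly to_ac p) x = 0"
    using alg_closure_algebraic by metis
  moreover have "(to_ac :: rat \<Rightarrow> qbar) = of_rat" by (rule ext) (rule to_ac_of_rat)
  ultimately show ?thesis by (auto simp: rpoly_def)
qed

definition minp :: "qbar \<Rightarrow> rat poly" where
  "minp x = (ARG_MIN Polynomial.degree p. Polynomial.lead_coeff p = 1 \<and> rpoly p x = 0)"

lemma minp: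
  shows minp_monic: "Polynomial.lead_coeff (minp x) = 1" and minp_root: "rpoly (minp x) x = 0"
    and minp_least: "p \<noteq> 0 \<Longrightarrow> rpoly p x = 0 \<Longrightarrow> Polynomial.degree (minp x) \<le> Polynomial.degree p"
proof -
  have *: "\<exists>q. Polynomial.lead_coeff q = 1 \<and> rpoly q x = 0 \<and> Polynomial.degree q = Polynomial.degree p"
    if "p \<noteq> 0" "rpoly p x = 0" for p
    using that by (intro exI[of _ "Polynomial.smult (inverse (Polynomial.lead_coeff p)) p"])
      (simp add: rpoly_smult)
  obtain p where "p \<noteq> 0" "rpoly p x = 0" using algebraic_qbar by blast
  from *[OF this] obtain q where q: "Polynomial.lead_coeff q = 1 \<and> rpoly q x = 0" by blast
  show "Polynomial.lead_coeff (minp x) = 1" "rpoly (minp x) x = 0"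
    using arg_min_natI[of "\<lambda>p. Polynomial.lead_coeff p = 1 \<and> rpoly p x = 0", OF q, of Polynomial.degree]
    unfolding minp_def by blast+
  show "Polynomial.degree (minp x) \<le> Polynomial.degree p" if p: "p \<noteq> 0" "rpoly p x = 0" for p
  proof -
    obtain q where q: "Polynomial.lead_coeff q = 1 \<and> rpoly q x = 0" "Polynomial.degree q = Polynomial.degree p"
      using *[OF p] by blast
    show ?thesis
      using arg_min_nat_le[of "\<lambda>p. Polynomial.lead_coeff p = 1 \<and> rpoly p x = 0", OF q(1), of Polynomial.degree]
      unfolding minp_def q(2) .
  qed
qed

lemma minp_nz: "minp x \<noteq> 0"
  using minp_monic[of x] by auto

lemma minp_dvd: "rpoly p x = 0 \<longleftrightarrow> minp x dvd p"
proof
  assume p: "rpoly p x = 0"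
  have "rpoly (p mod minp x) x = 0"
  proof -
    have "p mod minp x = p - minp x * (p div minp x)" by (simp add: minus_mult_div_eq_mod)
    then show ?thesis using p minp_root by (simp add: rpoly_diff rpoly_mult)
  qed
  then have "p mod minp x = 0"
    using minp_least[of "p mod minp x" x] degree_mod_less[OF minp_nz[of x], of p] by fastforce
  then show "minp x dvd p" by (simp add: dvd_eq_mod_eq_0)
qed (auto simp: dvd_def rpoly_mult minp_root)

lemma degree_minp_pos: "0 < Polynomial.degree (minp x)"
proof (rule ccontr)
  assume "\<not> ?thesis"
  then obtain c where c: "minp x = [:c:]" by (metis degree_eq_zeroE gr0I)
  with minp_monic[of x] have "c = 1" by simp
  with minp_root[of x] c show False by simp
qed

text \<open>This is irreducibility: in the factorisation \<open>minp x = minp y * h\<close>, one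
  factor vanishes at \<open>x\<close>. By minimality it cannot be \<open>h\<close>, and then
  \<open>h\<close> must be constant.\<close>

lemma minp_conj:
  assumes "rpoly (minp x) y = 0" shows "minp y = minp x"
proof -
  obtain h where h: "minp x = minp y * h" using assms minp_dvd by (auto simp: dvd_def)
  have "h \<noteq> 0" using h minp_nz[of x] by auto
  have lc: "Polynomial.lead_coeff h = 1"
    using arg_cong[OF h, of Polynomial.lead_coeff] minp_monic[of x] minp_monic[of y]
    by (simp add: lead_coeff_mult)
  have deg: "Polynomial.degree (minp x) = Polynomial.degree (minp y) + Polynomial.degree h"
    using h \<open>h \<noteq> 0\<close> minp_nz by (simp add: degree_mult_eq)
  have "rpoly (minp y) x = 0 \<or> rpoly h x = 0"
    using minp_root[of x] h by (simp add: rpoly_mult)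
  moreover have "rpoly h x \<noteq> 0"
    using minp_least[OF \<open>h \<noteq> 0\<close>, of x] deg degree_minp_pos[of y] by auto
  ultimately have "Polynomial.degree h = 0"
    using minp_least[OF minp_nz[of y], of x] deg by auto
  then obtain c where "h = [:c:]" by (rule degree_eq_zeroE)
  then have "h = 1" using lc by (simp add: one_pCons)
  with h show ?thesis by simp
qed

lemma separable_factorization:
  fixes p :: "'a::alg_closed_field poly"
  assumes "p \<noteq> 0" "\<And>y. poly p y = 0 \<Longrightarrow> poly (pderiv p) y \<noteq> 0"
  shows "p = Polynomial.smult (Polynomial.lead_coeff p) (\<Prod>y | poly p y = 0. [:- y, 1:])"
  using assms
proof (induction "Polynomial.degree p" arbitrary: p)
  case 0
  then obtain c where "p = [:c:]" "c \<noteq> 0" by (metis degree_eq_zeroE pCons_0_0)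
  then show ?case by simp
next
  case (Suc n)
  obtain y where y: "poly p y = 0" using alg_closed_imp_poly_has_root[of p] Suc.hyps by auto
  then obtain q where q: "p = [:- y, 1:] * q" using poly_eq_0_iff_dvd by (metis dvd_def)
  have q0: "q \<noteq> 0" using q Suc.prems by auto
  have deg: "Polynomial.degree q = n" using Suc.hyps q q0 by (simp add: degree_mult_eq del: mult_pCons_left)
  have pd: "poly (pderiv p) z = poly q z + (z - y) * poly (pderiv q) z" for z
  proof -
    have "pderiv p = [:- y, 1:] * pderiv q + q * pderiv [:- y, 1:]" by (simp only: q pderiv_mult)
    then have "poly (pderiv p) z = poly ([:- y, 1:] * pderiv q + q * pderiv [:- y, 1:]) z" by simp
    then show ?thesis by (simp only: poly_add poly_mult) (simp add: pderiv_pCons algebra_simps)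
  qed
  have qy: "poly q y \<noteq> 0" using Suc.prems(2)[OF y] pd[of y] by simp
  have IH: "q = Polynomial.smult (Polynomial.lead_coeff q) (\<Prod>y | poly q y = 0. [:- y, 1:])"
  proof (rule Suc.hyps(1))
    show "poly (pderiv q) z \<noteq> 0" if "poly q z = 0" for z
      using Suc.prems(2)[of z] pd[of z] that by (auto simp: q)
  qed (use deg q0 in auto)
  have roots: "{z. poly p z = 0} = insert y {z. poly q z = 0}" by (auto simp: q)
  have fin: "finite {z. poly q z = 0}" using q0 poly_roots_finite by blast
  have "p = [:- y, 1:] * Polynomial.smult (Polynomial.lead_coeff q) (\<Prod>y | poly q y = 0. [:- y, 1:])"
    using q IH by simp
  also have "\<dots> = Polynomial.smult (Polynomial.lead_coeff q) ([:- y, 1:] * (\<Prod>y | poly q y = 0. [:- y, 1:]))"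
    by (rule mult_smult_right)
  also have "[:- y, 1:] * (\<Prod>y | poly q y = 0. [:- y, 1:]) = (\<Prod>y | poly p y = 0. [:- y, 1:])"
    unfolding roots by (rule prod.insert[symmetric]) (use fin qy in auto)
  also have "Polynomial.lead_coeff q = Polynomial.lead_coeff p"
    unfolding q lead_coeff_mult by simp
  finally show ?case .
qed

definition conjs :: "qbar \<Rightarrow> qbar set" where
  "conjs x = {y. rpoly (minp x) y = 0}"

text \<open>Separability: a multiple root \<open>y\<close> would satisfy
  \<open>minp y = minp x\<close>, but also be a root of the derivative, which is nonzero and of
  smaller degree.\<close>

lemma minp_factorization: "map_poly of_rat (minp x) = (\<Prod>y\<in>conjs x. [:- y, 1:])"
proof -
  let ?p = "map_poly of_rat (minp x) :: qbar poly"
  have lc: "Polynomial.lead_coeff ?p = 1"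
    using minp_monic[of x] by (simp add: degree_map_poly coeff_map_poly)
  then have "?p \<noteq> 0" by auto
  have "poly (pderiv ?p) y \<noteq> 0" if "poly ?p y = 0" for y
  proof
    assume "poly (pderiv ?p) y = 0"
    moreover have "pderiv ?p = map_poly of_rat (pderiv (minp x))"
      by (rule poly_eqI) (simp add: coeff_pderiv coeff_map_poly of_rat_mult of_rat_add)
    ultimately have "rpoly (pderiv (minp x)) y = 0" by (simp add: rpoly_def)
    moreover have "minp y = minp x" using that by (intro minp_conj) (simp add: rpoly_def)
    moreover have "pderiv (minp x) \<noteq> 0" using degree_minp_pos[of x] by (simp add: pderiv_eq_0_iff)
    moreover have "Polynomial.degree (pderiv (minp x)) < Polynomial.degree (minp x)"
      using degree_minp_pos[of x] by (simp add: degree_pderiv)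
    ultimately show False using minp_least[of "pderiv (minp x)" y] by auto
  qed
  from separable_factorization[OF \<open>?p \<noteq> 0\<close> this] lc show ?thesis
    by (simp add: conjs_def rpoly_def)
qed

lemma finite_conjs: "finite (conjs x)"
proof -
  have "map_poly of_rat (minp x) \<noteq> (0 :: qbar poly)"
    using minp_nz[of x] by (simp add: map_poly_eq_0_iff)
  then show ?thesis unfolding conjs_def rpoly_def by (rule poly_roots_finite)
qed

lemma card_conjs: "card (conjs x) = Polynomial.degree (minp x)"
proof -
  have "Polynomial.degree (map_poly of_rat (minp x) :: qbar poly) = Polynomial.degree (minp x)"
    by (rule degree_map_poly) simp
  moreover have "Polynomial.degree (\<Prod>y\<in>conjs x. [:- y, 1:]) = (\<Sum>y\<in>conjs x. 1)"
    by (subst degree_prod_eq_sum_degree) auto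
  ultimately show ?thesis by (simp add: minp_factorization)
qed

text \<open>Up to sign the product is the constant coefficient of \<open>minp x\<close>.\<close>

lemma prod_conjs: "(\<Prod>y\<in>conjs x. y) \<in> range of_rat"
proof -
  have "poly (map_poly of_rat (minp x)) 0 = (\<Prod>y\<in>conjs x. - y)"
    by (simp add: minp_factorization poly_prod)
  also have "\<dots> = (-1) ^ card (conjs x) * (\<Prod>y\<in>conjs x. y)"
    by (simp add: prod.distrib[symmetric] prod_constant[symmetric] del: prod_constant)
  finally have "(\<Prod>y\<in>conjs x. y) = (-1) ^ card (conjs x) * of_rat (Polynomial.coeff (minp x) 0)"
    by (simp add: poly_0_coeff_0 coeff_map_poly power_mult_distrib[symmetric] mult.assoc[symmetric])
  then have "(\<Prod>y\<in>conjs x. y) = of_rat ((-1) ^ card (conjs x) * Polynomial.coeff (minp x) 0)"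
    by (simp add: of_rat_mult of_rat_power of_rat_minus)
  then show ?thesis by blast
qed

section \<open>Simple extensions of the rationals\<close>

definition qadj :: "qbar \<Rightarrow> qbar set" where
  "qadj x = range (\<lambda>p. rpoly p x)"

lemma qadj_self: "x \<in> qadj x"
  unfolding qadj_def by (rule range_eqI[of _ _ "[:0, 1:]"]) simp

lemma qadj_trans: "y \<in> qadj x \<Longrightarrow> qadj y \<subseteq> qadj x"
  unfolding qadj_def by (auto simp: rpoly_pcompose[symmetric])

lemma is_subfield_qadj: "is_subfield (qadj x)"
proof -
  have "inverse y \<in> qadj x" if y: "y \<in> qadj x" for y
  proof (cases "y = 0")
    case False
    \<comment> \<open>Write the minimal equation as c + y g(y) = 0. Minimality gives c \<noteq> 0,
      so - g(y) / c is the inverse of \<open>y\<close>.\<close>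
    obtain c g where g: "minp y = pCons c g" by (metis pCons_cases)
    have "c \<noteq> 0"
    proof
      assume "c = 0"
      then have "rpoly g y = 0" "g \<noteq> 0" using minp_root[of y] minp_nz[of y] g False by auto
      then show False using minp_least[of g y] g by simp
    qed
    moreover have "of_rat c + y * rpoly g y = 0" using minp_root[of y] g by simp
    ultimately have "inverse y = of_rat (- inverse c) * rpoly g y"
    proof -
      have "y * rpoly g y = - of_rat c"
        using \<open>of_rat c + y * rpoly g y = 0\<close> by (simp add: add_eq_0_iff)
      moreover have "of_rat c \<noteq> (0::qbar)" using \<open>c \<noteq> 0\<close> by simp
      moreover have "inverse y = - inverse r * G"
        if "y * G = - r" "r \<noteq> 0" "y \<noteq> 0" for r G y :: qbar
        using that by (simp add: field_simps)
      ultimately show ?thesis using False by (simp add: of_rat_minus of_rat_inverse)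
    qed
    then have "inverse y = rpoly (Polynomial.smult (- inverse c) g) y" by (simp only: rpoly_smult)
    then have "inverse y \<in> qadj y" by (auto simp: qadj_def)
    with qadj_trans[OF y] show ?thesis by blast
  next
    case True
    have "rpoly 0 x = 0" by simp
    then show ?thesis using True unfolding qadj_def by (metis inverse_zero rangeI)
  qed
  moreover have "0 \<in> qadj x" "1 \<in> qadj x"
    unfolding qadj_def by (rule range_eqI[of _ _ 0], simp, rule range_eqI[of _ _ 1], simp)
  ultimately show ?thesis
    unfolding is_subfield_def
    by (auto simp: qadj_def rpoly_add[symmetric] rpoly_mult[symmetric] rpoly_minus[symmetric])
qed

lemma qadj_subset: "is_subfield K \<Longrightarrow> x \<in> K \<Longrightarrow> qadj x \<subseteq> K"
  by (auto simp: qadj_def rpoly_in)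

lemma qadj_basis:
  assumes "y \<in> qadj x"
  shows "\<exists>c. y = (\<Sum>i<Polynomial.degree (minp x). of_rat (c i) * x ^ i)"
proof -
  obtain p where "y = rpoly p x" using assms by (auto simp: qadj_def)
  also have "rpoly p x = rpoly (p mod minp x + minp x * (p div minp x)) x" by simp
  also have "\<dots> = rpoly (p mod minp x) x"
    by (simp only: rpoly_add rpoly_mult minp_root mult_zero_left add_0_right)
  also have "\<dots> = (\<Sum>i<Polynomial.degree (minp x). of_rat (Polynomial.coeff (p mod minp x) i) * x ^ i)"
  proof -
    have "p mod minp x = 0 \<or> Polynomial.degree (p mod minp x) < Polynomial.degree (minp x)"
      by (rule degree_mod_less[OF minp_nz])
    then show ?thesis
    proof
      assume "Polynomial.degree (p mod minp x) < Polynomial.degree (minp x)"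
      then show ?thesis unfolding rpoly_altdef
        by (intro sum.mono_neutral_left) (auto simp: coeff_eq_0)
    qed simp
  qed
  finally show ?thesis by blast
qed

lemma qadj_basis_unique:
  assumes "(\<Sum>i<Polynomial.degree (minp x). of_rat (c i) * x ^ i) = 0" "i < Polynomial.degree (minp x)"
  shows "c i = 0"
proof -
  let ?d = "Polynomial.degree (minp x)"
  let ?p = "Poly (map c [0..<?d])"
  have root: "rpoly ?p x = 0" using assms by (simp add: rpoly_Poly)
  have "Polynomial.degree ?p < ?d"
  proof -
    have "Polynomial.degree ?p \<le> ?d - 1"
      by (rule degree_le) (auto simp: nth_default_beyond)
    then show ?thesis using degree_minp_pos[of x] by linarith
  qed
  then have "?p = 0" using minp_least[OF _ root] by fastforce
  then have "Polynomial.coeff ?p i = 0" by simp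
  then show ?thesis using assms(2) by (simp add: nth_default_nth)
qed

lemma qadj_independent_card:
  shows "\<exists>B. finite B \<and> QV.independent B \<and> QV.span B = qadj x \<and> card B = Polynomial.degree (minp x)"
proof -
  let ?d = "Polynomial.degree (minp x)"
  let ?B = "(\<lambda>i. x ^ i) ` {..<?d}"
  have inj: "inj_on (\<lambda>i. x ^ i) {..<?d}"
  proof (rule inj_onI)
    fix i j assume ij: "i \<in> {..<?d}" "j \<in> {..<?d}" "x ^ i = x ^ j"
    show "i = j"
    proof (rule ccontr)
      assume "i \<noteq> j"
      let ?c = "\<lambda>k. if k = i then 1 else if k = j then -1 else 0 :: rat"
      have "(\<Sum>k<?d. of_rat (?c k) * x ^ k) = (\<Sum>k\<in>{i, j}. of_rat (?c k) * x ^ k)"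
        using ij by (intro sum.mono_neutral_right) auto
      also have "\<dots> = 0" using ij \<open>i \<noteq> j\<close> by simp
      finally have "(\<Sum>k<?d. of_rat (?c k) * x ^ k) = 0" .
      from qadj_basis_unique[OF this, of i] ij \<open>i \<noteq> j\<close> show False by auto
    qed
  qed
  have ind: "QV.independent ?B"
  proof (rule QV.independent_if_scalars_zero)
    fix f y assume f: "(\<Sum>y\<in>?B. rscale (f y) y) = 0" and y: "y \<in> ?B"
    then have "(\<Sum>i<?d. of_rat (f (x ^ i)) * x ^ i) = 0"
      by (subst (asm) sum.reindex[OF inj]) (simp add: rscale_def)
    from qadj_basis_unique[OF this] y show "f y = 0" by auto
  qed simp
  have "QV.span ?B = qadj x"
  proof
    show "QV.span ?B \<subseteq> qadj x"
      by (intro QV.span_minimal is_subfield_subspace is_subfield_qadj)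
        (auto intro: is_subfield_power[OF is_subfield_qadj qadj_self])
    show "qadj x \<subseteq> QV.span ?B"
    proof
      fix y assume "y \<in> qadj x"
      then obtain c where "y = (\<Sum>i<?d. rscale (c i) (x ^ i))"
        using qadj_basis by (fastforce simp: rscale_def)
      moreover have "\<dots> \<in> QV.span ?B"
        by (rule QV.span_sum, rule QV.span_scale, rule QV.span_base) auto
      ultimately show "y \<in> QV.span ?B" by simp
    qed
  qed
  then show ?thesis using ind card_image[OF inj] by (intro exI[of _ ?B]) auto
qed

lemma dim_qadj: "QV.dim (qadj x) = Polynomial.degree (minp x)"
  using qadj_independent_card[of x] QV.dim_eq_card_independent QV.dim_span by metis

section \<open>Comparison with subfields and dimensions in HOL-Algebra\<close>

abbreviation "QR \<equiv> (ring_of_type_algebra :: qbar ring)"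

lemma ring_QR: "Ring.ring QR"
  using ring_from_type_algebra .

lemma QR_simps: "carrier QR = UNIV" "add QR x y = x + y" "mult QR x y = x * y"
  "ring.zero QR = 0" "one QR = 1"
  by (simp_all add: ring_of_type_algebra_def)

lemma line_extension_QR: "ring.line_extension QR \<rat> v E = {rscale q v + e |q e. e \<in> E}"
  using ring.line_extension_mem_iff[OF ring_QR, of _ \<rat> v E]
  by (auto simp: QR_simps rscale_def Rats_def set_eq_iff)

lemma span_insert_QV: "QV.span (insert v B) = {rscale q v + e |q e. e \<in> QV.span B}"
proof (rule equalityI; rule subsetI)
  fix x assume "x \<in> QV.span (insert v B)"
  then obtain k where "x - rscale k v \<in> QV.span B" unfolding QV.span_insert by blast
  moreover have "x = rscale k v + (x - rscale k v)" by simp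
  ultimately show "x \<in> {rscale q v + e |q e. e \<in> QV.span B}" by blast
next
  fix x assume "x \<in> {rscale q v + e |q e. e \<in> QV.span B}"
  then obtain q e where "x = rscale q v + e" "e \<in> QV.span B" by blast
  then show "x \<in> QV.span (insert v B)" unfolding QV.span_insert by (auto intro!: exI[of _ q])
qed

lemma dimension_imp_basis:
  assumes "ring.dimension QR n \<rat> E"
  shows "\<exists>B. finite B \<and> card B = n \<and> QV.independent B \<and> QV.span B = E"
  using ring_QR assms
proof (induction n "\<rat> :: qbar set" E rule: ring.dimension.induct[consumes 2, case_names zero_dim Suc_dim])
  case zero_dim
  then show ?case using QV.independent_empty by (intro exI[of _ "{}"]) (auto simp: QR_simps)
next
  case (Suc_dim v E n)
  then obtain B where B: "finite B" "card B = n" "QV.independent B" "QV.span B = E" by auto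
  have "v \<notin> B" using B Suc_dim QV.span_base by auto
  moreover have "QV.span (insert v B) = {rscale q v + e |q e. e \<in> E}"
    unfolding span_insert_QV B ..
  ultimately show ?case
    using B Suc_dim line_extension_QR
    by (intro exI[of _ "insert v B"]) (auto simp: QV.independent_insert)
qed

lemma basis_imp_dimension:
  assumes "finite B" "QV.independent B"
  shows "ring.dimension QR (card B) \<rat> (QV.span B)"
  using assms
proof (induction B rule: finite_induct)
  case empty
  then show ?case using ring.dimension.zero_dim[OF ring_QR, of \<rat>] by (simp add: QR_simps)
next
  case (insert v B)
  have ind: "QV.independent B" "v \<notin> QV.span B"
    using insert by (auto simp: QV.independent_insert)
  have "ring.dimension QR (Suc (card B)) \<rat> (ring.line_extension QR \<rat> v (QV.span B))"
    using insert ind by (intro ring.dimension.Suc_dim[OF ring_QR]) (auto simp: QR_simps)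
  moreover have "QV.span (insert v B) = {rscale q v + e |q e. e \<in> QV.span B}"
    by (rule span_insert_QV)
  ultimately show ?case using insert by (simp add: line_extension_QR)
qed

lemma subfield_QR: "subfield K QR \<longleftrightarrow> is_subfield K"
proof
  assume K: "subfield K QR"
  interpret R: Ring.ring QR by (rule ring_QR)
  have neg: "a_inv QR x = - x" for x
    using R.minus_equality[of "- x" x] by (simp add: QR_simps)
  have inv: "m_inv QR x = inverse x" if "x \<noteq> 0" for x
  proof -
    interpret F: Ring.field QR using field_from_type_algebra .
    show ?thesis using that by (intro F.comm_inv_char) (auto simp: QR_simps)
  qed
  have "inverse x \<in> K" if "x \<in> K" for x
    using R.subfield_m_inv(1)[OF K, of x] inv[of x] subringE(2)[OF subfieldE(1)[OF K]] that
    by (cases "x = 0") (auto simp: QR_simps)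
  then show "is_subfield K"
    using subringE[OF subfieldE(1)[OF K]] neg by (auto simp: is_subfield_def QR_simps)
next
  assume K: "is_subfield K"
  interpret F: Ring.field QR using field_from_type_algebra .
  have neg: "a_inv QR x = - x" for x
    using F.minus_equality[of "- x" x] by (simp add: QR_simps)
  have inv: "m_inv QR x = inverse x" if "x \<noteq> 0" for x
    using that by (intro F.comm_inv_char) (auto simp: QR_simps)
  show "subfield K QR"
  proof (rule F.subfieldI')
    show "subring K QR"
      by (rule F.subringI) (use K neg in \<open>auto simp: QR_simps is_subfieldD\<close>)
    show "m_inv QR k \<in> K" if "k \<in> K - {ring.zero QR}" for k
      using that inv[of k] K by (auto simp: QR_simps is_subfieldD)
  qed
qed

lemma number_field_iff:
  "number_field K \<longleftrightarrow> is_subfield K \<and> (\<exists>B. finite B \<and> QV.independent B \<and> QV.span B = K)"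
  unfolding number_field_def subfield_QR ring.finite_dimension_def[OF ring_QR]
  using dimension_imp_basis basis_imp_dimension by metis

lemma field_degree_eq: "number_field K \<Longrightarrow> field_degree K = QV.dim K"
proof -
  assume "number_field K"
  then obtain B where B: "finite B" "QV.independent B" "QV.span B = K" by (auto simp: number_field_iff)
  have *: "n = QV.dim K" if "ring.dimension QR n \<rat> K" for n
    using dimension_imp_basis[OF that] QV.dim_eq_card_independent QV.dim_span by metis
  have dim: "ring.dimension QR (QV.dim K) \<rat> K"
    using basis_imp_dimension[OF B(1,2)] *[of "card B"] B by simp
  show ?thesis
    unfolding field_degree_def ring.dim_def[OF ring_QR] over_def by (rule the_equality[where P = "\<lambda>n. ring.dimension QR n \<rat> K", OF dim]) (rule *)
qed

lemma number_field_qadj: "number_field (qadj x)"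
  using qadj_independent_card[of x] is_subfield_qadj by (auto simp: number_field_iff)

text \<open>Polynomial division is carried out on leading terms, so that every quotient and
  remainder visibly keeps its coefficients in \<open>K\<close>.\<close>

lemma poly_over_dvd:
  assumes K: "is_subfield K" and m: "poly_over K m" "m \<noteq> 0" "poly m y = 0"
    and least: "\<And>p. poly_over K p \<Longrightarrow> p \<noteq> 0 \<Longrightarrow> poly p y = 0 \<Longrightarrow> Polynomial.degree m \<le> Polynomial.degree p"
    and p: "poly_over K p" "poly p y = 0"
  shows "m dvd p"
  using p
proof (induction "Polynomial.degree p" arbitrary: p rule: less_induct)
  case less
  show ?case
  proof (cases "p = 0")
    case False
    then have le: "Polynomial.degree m \<le> Polynomial.degree p" using least less.prems by auto
    define t where "t = Polynomial.monom (Polynomial.lead_coeff p / Polynomial.lead_coeff m) (Polynomial.degree p - Polynomial.degree m)"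
    have t: "poly_over K t"
      using K m less.prems by (auto simp: t_def poly_over_def[of K p] poly_over_def[of K m] intro!: poly_over_monom is_subfield_divide)
    let ?q = "p - t * m"
    have lc: "Polynomial.lead_coeff p / Polynomial.lead_coeff m \<noteq> 0" using False m by simp
    have deg: "Polynomial.degree (t * m) = Polynomial.degree p"
      using le m lc by (simp add: t_def degree_mult_eq degree_monom_eq monom_eq_0_iff)
    have "Polynomial.coeff (t * m) (Polynomial.degree p) = Polynomial.lead_coeff p"
      using deg m lead_coeff_mult[of t m] lc by (simp add: t_def degree_monom_eq coeff_monom)
    then have "?q = 0 \<or> Polynomial.degree ?q < Polynomial.degree p"
      using deg by (metis (no_types, lifting) coeff_diff degree_diff_le eq_iff_diff_eq_0 le_neq_implies_less leading_coeff_0_iff order_refl)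
    then have "m dvd ?q"
    proof
      assume "Polynomial.degree ?q < Polynomial.degree p"
      then show ?thesis
        using less.hyps[of ?q] K t m less.prems by (auto simp: poly_over_diff poly_over_mult)
    qed simp
    then have "m dvd ?q + t * m" by (rule dvd_add) simp
    then show ?thesis by simp
  qed simp
qed

lemma ex_relative_minp:
  assumes K: "is_subfield K"
  shows "\<exists>m. poly_over K m \<and> Polynomial.lead_coeff m = 1 \<and> poly m (y :: qbar) = 0 \<and>
     (\<forall>p. poly_over K p \<longrightarrow> p \<noteq> 0 \<longrightarrow> poly p y = 0 \<longrightarrow> Polynomial.degree m \<le> Polynomial.degree p)"
proof -
  let ?P = "\<lambda>p. poly_over K p \<and> p \<noteq> 0 \<and> poly p y = 0"
  have "?P (map_poly of_rat (minp y))"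
    using minp_root[of y] minp_nz[of y] K
    by (auto simp: rpoly_def poly_over_def coeff_map_poly is_subfield_of_rat map_poly_eq_0_iff)
  then obtain m where m: "?P m" "\<And>p. ?P p \<Longrightarrow> Polynomial.degree m \<le> Polynomial.degree p"
    using ex_has_least_nat[of ?P _ Polynomial.degree] by metis
  let ?m = "Polynomial.smult (inverse (Polynomial.lead_coeff m)) m"
  have "inverse (Polynomial.lead_coeff m) \<in> K"
    using m K by (auto simp: poly_over_def is_subfieldD)
  then have "poly_over K ?m \<and> Polynomial.lead_coeff ?m = 1 \<and> poly ?m y = 0 \<and> Polynomial.degree ?m = Polynomial.degree m"
    using m K by (auto simp: poly_over_smult)
  then show ?thesis using m(2) by metis
qed

text \<open>The primitive element is c = a + n b. Over Q(c) the relative minimal polynomial of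
  \<open>b\<close> divides both \<open>minp b\<close> and the polynomial minp a (c - n T). For a
  good \<open>n\<close> their only common root is \<open>b\<close>, and separability makes that
  polynomial linear, so \<open>b\<close> lies in Q(c). The last clause of the statement lets
  \<open>c\<close> be found inside a given field.\<close>

lemma ex_primitive_pair:
  "\<exists>c. a \<in> qadj c \<and> b \<in> qadj c \<and> (\<forall>K. is_subfield K \<longrightarrow> a \<in> K \<longrightarrow> b \<in> K \<longrightarrow> c \<in> K)"
proof -
  \<comment> \<open>If n = (a' - a) / (b - b') with b' \<noteq> b, then a + n b = a' + n b' for
    conjugates a', b'. Pairs with b' = b contribute only the value 0, by division by 0.\<close>
  define bad where "bad = (\<lambda>(a', b'). (a' - a) / (b - b')) ` (conjs a \<times> conjs b)"
  have "finite bad" by (simp add: bad_def finite_conjs)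
  then have "\<exists>n::nat. of_nat n \<notin> bad"
  proof (rule contrapos_pp)
    assume "\<not> (\<exists>n::nat. of_nat n \<notin> bad)"
    then have "range (of_nat :: nat \<Rightarrow> qbar) \<subseteq> bad" by auto
    moreover have "infinite (range (of_nat :: nat \<Rightarrow> qbar))"
      by (rule range_inj_infinite) (auto simp: inj_def)
    ultimately show "infinite bad" using finite_subset by blast
  qed
  then obtain n :: nat where n: "of_nat n \<notin> bad" by blast
  define c where "c = a + of_nat n * b"
  have F: "is_subfield (qadj c)" by (rule is_subfield_qadj)
  obtain m where m: "poly_over (qadj c) m" "Polynomial.lead_coeff m = 1" "poly m b = 0"
     "\<And>p. poly_over (qadj c) p \<Longrightarrow> p \<noteq> 0 \<Longrightarrow> poly p b = 0 \<Longrightarrow> Polynomial.degree m \<le> Polynomial.degree p"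
    using ex_relative_minp[OF F, of b] by blast
  have m0: "m \<noteq> 0" using m by auto
  let ?g = "map_poly of_rat (minp b) :: qbar poly"
  let ?f = "pcompose (map_poly of_rat (minp a)) [:c, - of_nat n:] :: qbar poly"
  have rat_over: "poly_over (qadj c) (map_poly of_rat p)" for p
    by (auto simp: poly_over_def coeff_map_poly is_subfield_of_rat[OF F])
  have comp_over: "poly_over (qadj c) (pcompose p q)" if "poly_over (qadj c) p" "poly_over (qadj c) q" for p q
    using that(1)
  proof (induction p)
    case (pCons x p)
    then show ?case using that(2) F
      by (auto simp: pcompose_pCons poly_over_pCons is_subfieldD intro!: poly_over_add poly_over_mult)
        (auto simp: poly_over_pCons is_subfieldD poly_over_0)
  qed (simp add: poly_over_0 is_subfieldD[OF F])
  have "poly_over (qadj c) [:c, - of_nat n:]"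
    using qadj_self[of c] by (auto simp: poly_over_pCons is_subfieldD[OF F] poly_over_0 is_subfield_of_nat[OF F])
  then have "m dvd ?f"
    using minp_root[of a] by (intro poly_over_dvd[OF F m(1) m0 m(3) m(4)] comp_over rat_over)
      (auto simp: poly_pcompose c_def rpoly_def)
  moreover have "m dvd ?g"
    using minp_root[of b] by (intro poly_over_dvd[OF F m(1) m0 m(3) m(4)] rat_over) (auto simp: rpoly_def)
  ultimately have common: "y = b" if y: "poly m y = 0" for y
  proof -
    have "poly ?g y = 0" "poly ?f y = 0" using \<open>m dvd ?f\<close> \<open>m dvd ?g\<close> y by (auto simp: dvd_def)
    then have "y \<in> conjs b" "c - of_nat n * y \<in> conjs a"
      by (auto simp: conjs_def rpoly_def poly_pcompose algebra_simps)
    then have "(c - of_nat n * y - a) / (b - y) \<in> bad"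
      unfolding bad_def by (intro image_eqI[of _ _ "(c - of_nat n * y, y)"]) auto
    moreover have "(c - of_nat n * y - a) / (b - y) = of_nat n" if "y \<noteq> b"
      using that by (simp add: c_def field_simps)
    ultimately show ?thesis using n by metis
  qed
  have "Polynomial.degree m = 1"
  proof (rule antisym)
    show "1 \<le> Polynomial.degree m"
    proof (rule ccontr)
      assume "\<not> 1 \<le> Polynomial.degree m"
      then obtain v where "m = [:v:]" by (metis degree_eq_zeroE less_one not_le)
      then show False using m(3) m0 by simp
    qed
    obtain q where q: "m = [:- b, 1:] * q" using m(3) poly_eq_0_iff_dvd by (metis dvd_def)
    have q0: "q \<noteq> 0" using q m0 by auto
    \<comment> \<open>Every root of \<open>m\<close> is \<open>b\<close>; a root of the cofactor
      would make \<open>b\<close> a double root of the separable polynomial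
      \<open>minp b\<close>.\<close>
    have "poly q y \<noteq> 0" for y
    proof
      assume y: "poly q y = 0"
      then have "y = b" using common[of y] q by simp
      with y have "[:- b, 1:] dvd q" using poly_eq_0_iff_dvd by blast
      then have "[:- b, 1:] * [:- b, 1:] dvd m" unfolding q by (rule mult_dvd_mono[OF dvd_refl])
      then have "[:- b, 1:] ^ 2 dvd (\<Prod>y\<in>conjs b. [:- y, 1:])"
        using \<open>m dvd ?g\<close> by (simp add: minp_factorization power2_eq_square del: mult_pCons_left) (rule dvd_trans)
      then obtain u where "(\<Prod>y\<in>conjs b. [:- y, 1:]) = [:- b, 1:] ^ 2 * u" by (rule dvdE)
      then have u: "(\<Prod>y\<in>conjs b. [:- y, 1:]) = [:- b, 1:] * ([:- b, 1:] * u)"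
        by (simp only: power2_eq_square mult.assoc)
      have "b \<in> conjs b" using minp_root by (simp add: conjs_def)
      then have "(\<Prod>y\<in>conjs b. [:- y, 1:]) = [:- b, 1:] * (\<Prod>y\<in>conjs b - {b}. [:- y, 1:])"
        using prod.remove[OF finite_conjs] by blast
      with u have "(\<Prod>y\<in>conjs b - {b}. [:- y, 1:]) = [:- b, 1:] * u"
      proof -
        have "[:- b, 1:] \<noteq> 0" by simp
        from mult_left_cancel[OF this] u \<open>_ = [:- b, 1:] * (\<Prod>y\<in>conjs b - {b}. [:- y, 1:])\<close>
        show ?thesis by metis
      qed
      then have "poly (\<Prod>y\<in>conjs b - {b}. [:- y, 1:]) b = 0" by simp
      then show False using finite_conjs[of b] by (auto simp: poly_prod)
    qed
    then have "Polynomial.degree q = 0" using alg_closed_imp_poly_has_root[of q] by blast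
    then show "Polynomial.degree m \<le> 1" using q q0 by (simp add: degree_mult_eq del: mult_pCons_left)
  qed
  obtain u q where uq: "m = pCons u q" by (cases m)
  with \<open>Polynomial.degree m = 1\<close> have "q \<noteq> 0" "Polynomial.degree q = 0" by (auto split: if_splits)
  then obtain v where "q = [:v:]" by (metis degree_eq_zeroE)
  then have u: "m = [:u, 1:]" using m(2) uq \<open>q \<noteq> 0\<close> by simp
  then have "b = - u" using m(3) by (simp add: add_eq_0_iff)
  moreover have "u \<in> qadj c" using m(1) u by (metis poly_over_pCons is_subfieldD(1) F)
  ultimately have b: "b \<in> qadj c" using F by (simp add: is_subfieldD)
  have "a = c - of_nat n * b" by (simp add: c_def)
  then have "a \<in> qadj c"
    using F b qadj_self[of c] by (auto intro!: is_subfield_diff is_subfieldD(4) is_subfield_of_nat)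
  then show ?thesis using b
    by (intro exI[of _ c]) (auto simp: c_def intro!: is_subfieldD(3,4) is_subfield_of_nat)
qed

lemma ex_primitive:
  assumes "finite B"
  shows "\<exists>c. B \<subseteq> qadj c \<and> (\<forall>K. is_subfield K \<longrightarrow> B \<subseteq> K \<longrightarrow> c \<in> K)"
  using assms
proof (induction B rule: finite_induct)
  case empty
  then show ?case by (intro exI[of _ 0]) (auto simp: is_subfieldD)
next
  case (insert b B)
  then obtain c where c: "B \<subseteq> qadj c" "\<And>K. is_subfield K \<Longrightarrow> B \<subseteq> K \<Longrightarrow> c \<in> K" by blast
  obtain d where d: "b \<in> qadj d" "c \<in> qadj d" "\<And>K. is_subfield K \<Longrightarrow> b \<in> K \<Longrightarrow> c \<in> K \<Longrightarrow> d \<in> K"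
    using ex_primitive_pair[of b c] by metis
  then show ?case using c qadj_trans[of c d] by (intro exI[of _ d]) auto
qed

lemma number_field_primitive:
  assumes "number_field K" shows "\<exists>c. K = qadj c"
proof -
  obtain B where B: "finite B" "QV.span B = K" and K: "is_subfield K"
    using assms by (auto simp: number_field_iff)
  obtain c where c: "B \<subseteq> qadj c" "c \<in> K"
    using ex_primitive[OF B(1)] B(2) K QV.span_superset by metis
  have "K \<subseteq> qadj c"
    using QV.span_minimal[OF c(1) is_subfield_subspace[OF is_subfield_qadj]] B by simp
  then show ?thesis using qadj_subset[OF K c(2)] by blast
qed

lemma ex_number_field:
  assumes "finite B" "number_field K" shows "\<exists>L. number_field L \<and> B \<subseteq> L \<and> K \<subseteq> L"
proof -
  obtain x where x: "K = qadj x" using number_field_primitive[OF assms(2)] by blast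
  obtain c where c: "insert x B \<subseteq> qadj c" using ex_primitive[of "insert x B"] assms by blast
  then show ?thesis using qadj_trans[of x c] x number_field_qadj[of c] by (intro exI[of _ "qadj c"]) auto
qed

text \<open>Gaussian elimination: the pivot unknown \<open>k\<close> is removed from the remaining
  equations and its value \<open>s\<close> restored after the induction step. The solution stays in
  \<open>K\<close>, because \<open>card_Emb_le\<close> has to measure it by an absolute value
  there.\<close>

lemma linear_system:
  fixes M :: "'i \<Rightarrow> 'j \<Rightarrow> 'a::field_char_0"
  assumes K: "is_subfield K" and "finite J" "finite I" "card J < card I"
    and "\<And>i j. i \<in> I \<Longrightarrow> j \<in> J \<Longrightarrow> M i j \<in> K"
  shows "\<exists>c. (\<forall>i. c i \<in> K) \<and> (\<exists>i\<in>I. c i \<noteq> 0) \<and> (\<forall>j\<in>J. (\<Sum>i\<in>I. c i * M i j) = 0)"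
  using assms(2-)
proof (induction J arbitrary: I M rule: finite_induct)
  case empty
  then have "I \<noteq> {}" by auto
  then show ?case using is_subfieldD[OF K] by (intro exI[of _ "\<lambda>_. 1"]) auto
next
  case (insert j J)
  show ?case
  proof (cases "\<forall>i\<in>I. M i j = 0")
    case True
    have "\<exists>c. (\<forall>i. c i \<in> K) \<and> (\<exists>i\<in>I. c i \<noteq> 0) \<and> (\<forall>j\<in>J. (\<Sum>i\<in>I. c i * M i j) = 0)"
      using insert.prems insert.hyps by (intro insert.IH) auto
    then obtain c where c: "\<And>i. c i \<in> K" "\<exists>i\<in>I. c i \<noteq> 0" "\<And>j. j \<in> J \<Longrightarrow> (\<Sum>i\<in>I. c i * M i j) = 0"
      by blast
    then show ?thesis using True by (intro exI[of _ c]) auto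
  next
    case False
    then obtain k where k: "k \<in> I" "M k j \<noteq> 0" by blast
    let ?I = "I - {k}"
    define M' where "M' i l = M i l - M i j / M k j * M k l" for i l
    have "\<exists>c. (\<forall>i. c i \<in> K) \<and> (\<exists>i\<in>?I. c i \<noteq> 0) \<and> (\<forall>l\<in>J. (\<Sum>i\<in>?I. c i * M' i l) = 0)"
      using insert.prems insert.hyps k
      by (intro insert.IH) (auto simp: M'_def intro!: is_subfield_diff[OF K] is_subfieldD(4)[OF K] is_subfield_divide[OF K])
    then obtain c where c: "\<And>i. c i \<in> K" "\<exists>i\<in>?I. c i \<noteq> 0" "\<And>l. l \<in> J \<Longrightarrow> (\<Sum>i\<in>?I. c i * M' i l) = 0"
      by blast
    define s where "s = - (\<Sum>i\<in>?I. c i * (M i j / M k j))"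
    have sK: "s \<in> K" unfolding s_def using c(1) insert.prems k
      by (intro is_subfieldD(5)[OF K] is_subfield_sum[OF K] is_subfieldD(4)[OF K] is_subfield_divide[OF K]) auto
    have split: "(\<Sum>i\<in>I. (c(k := s)) i * M i l) = s * M k l + (\<Sum>i\<in>?I. c i * M i l)" for l
    proof -
      have "(\<Sum>i\<in>I. (c(k := s)) i * M i l) = s * M k l + (\<Sum>i\<in>?I. (c(k := s)) i * M i l)"
        using k insert.prems by (subst sum.remove[of _ k]) auto
      also have "(\<Sum>i\<in>?I. (c(k := s)) i * M i l) = (\<Sum>i\<in>?I. c i * M i l)"
        by (rule sum.cong) auto
      finally show ?thesis .
    qed
    have zero: "s * M k l + (\<Sum>i\<in>?I. c i * M i l) = (\<Sum>i\<in>?I. c i * M' i l)" for l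
      by (simp add: s_def M'_def right_diff_distrib sum_subtractf sum_distrib_left sum_distrib_right mult_ac)
    have "(\<Sum>i\<in>?I. c i * M' i j) = 0"
      using k by (simp add: M'_def)
    then show ?thesis
      using c sK k split zero by (intro exI[of _ "c(k := s)"]) (auto split: if_splits)
  qed
qed

section \<open>Homogeneous polynomial functions\<close>

definition monom_fun :: "('n \<Rightarrow> nat) \<Rightarrow> 'k::field ^ 'n::finite \<Rightarrow> 'k" where
  "monom_fun m x = (\<Prod>i\<in>UNIV. (x $ i) ^ m i)"

definition mdeg :: "('n::finite \<Rightarrow> nat) \<Rightarrow> nat" where
  "mdeg m = (\<Sum>i\<in>UNIV. m i)"

text \<open>Forms of degree \<open>d\<close> are represented by the functions they define, so that
  ring operations are pointwise. The zero function belongs to every degree.\<close>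

definition hom_fun :: "nat \<Rightarrow> ('k::field ^ 'n::finite \<Rightarrow> 'k) set" where
  "hom_fun d = range (\<lambda>c x. \<Sum>m | mdeg m = d. c m * monom_fun m x)"

lemma finite_mdeg: "finite {m :: 'n::finite \<Rightarrow> nat. mdeg m = d}"
proof (rule finite_subset)
  show "{m :: 'n \<Rightarrow> nat. mdeg m = d} \<subseteq> PiE UNIV (\<lambda>_. {..d})"
    unfolding mdeg_def by (auto intro: member_le_sum)
qed (auto intro: finite_PiE)

lemma monom_fun_add: "monom_fun (\<lambda>i. m i + m' i) x = monom_fun m x * monom_fun m' x"
  by (simp add: monom_fun_def power_add prod.distrib)

lemma mdeg_add: "mdeg (\<lambda>i. m i + m' i) = mdeg m + mdeg m'"
  by (simp add: mdeg_def sum.distrib)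

lemma hom_fun_zero: "(\<lambda>x. 0) \<in> hom_fun d"
  unfolding hom_fun_def by (rule range_eqI[of _ _ "\<lambda>_. 0"]) simp

lemma hom_fun_add: "f \<in> hom_fun d \<Longrightarrow> g \<in> hom_fun d \<Longrightarrow> (\<lambda>x. f x + g x) \<in> hom_fun d"
proof -
  assume "f \<in> hom_fun d" "g \<in> hom_fun d"
  then obtain c c' where "f = (\<lambda>x. \<Sum>m | mdeg m = d. c m * monom_fun m x)"
    "g = (\<lambda>x. \<Sum>m | mdeg m = d. c' m * monom_fun m x)" by (auto simp: hom_fun_def)
  then show ?thesis unfolding hom_fun_def
    by (intro range_eqI[of _ _ "\<lambda>m. c m + c' m"]) (simp add: algebra_simps sum.distrib)
qed

lemma hom_fun_scale: "f \<in> hom_fun d \<Longrightarrow> (\<lambda>x. a * f x) \<in> hom_fun d"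
proof -
  assume "f \<in> hom_fun d"
  then obtain c where "f = (\<lambda>x. \<Sum>m | mdeg m = d. c m * monom_fun m x)" by (auto simp: hom_fun_def)
  then show ?thesis unfolding hom_fun_def
    by (intro range_eqI[of _ _ "\<lambda>m. a * c m"]) (simp add: sum_distrib_left mult.assoc)
qed

lemma hom_fun_sum: "(\<And>i. i \<in> I \<Longrightarrow> f i \<in> hom_fun d) \<Longrightarrow> (\<lambda>x. \<Sum>i\<in>I. f i x) \<in> hom_fun d"
  by (induction I rule: infinite_finite_induct) (auto intro: hom_fun_zero hom_fun_add)

lemma hom_fun_diff: "f \<in> hom_fun d \<Longrightarrow> g \<in> hom_fun d \<Longrightarrow> (\<lambda>x. f x - g x) \<in> hom_fun d"
  using hom_fun_add[OF _ hom_fun_scale[of g d "-1"], of f] by simp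

lemma hom_fun_monom: "monom_fun m \<in> hom_fun (mdeg m)"
proof -
  have "monom_fun m = (\<lambda>x. \<Sum>m' | mdeg m' = mdeg m. (if m' = m then 1 else 0) * monom_fun m' x)"
    by (rule ext, subst sum.remove[OF finite_mdeg, of m]) (auto intro!: sum.neutral)
  then show ?thesis unfolding hom_fun_def by (intro range_eqI)
qed

text \<open>Serves as the induction principle for forms: a property closed under linear combinations
  is checked on monomials.\<close>

lemma hom_fun_subsetI:
  fixes S :: "('k::field ^ 'n::finite \<Rightarrow> 'k) set"
  assumes "\<And>m. mdeg m = d \<Longrightarrow> monom_fun m \<in> S" "(\<lambda>x. 0) \<in> S"
    "\<And>f g. f \<in> S \<Longrightarrow> g \<in> S \<Longrightarrow> (\<lambda>x. f x + g x) \<in> S" "\<And>a f. f \<in> S \<Longrightarrow> (\<lambda>x. a * f x) \<in> S"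
  shows "hom_fun d \<subseteq> S"
proof
  fix f :: "'k ^ 'n \<Rightarrow> 'k" assume "f \<in> hom_fun d"
  then obtain c where f: "f = (\<lambda>x. \<Sum>m | mdeg m = d. c m * monom_fun m x)" by (auto simp: hom_fun_def)
  have "(\<lambda>x. \<Sum>m\<in>A. c m * monom_fun m x) \<in> S" if "finite A" "A \<subseteq> {m. mdeg m = d}" for A
    using that by (induction A rule: finite_induct) (auto intro!: assms)
  from this[OF finite_mdeg] show "f \<in> S" unfolding f by simp
qed

lemma hom_fun_mult:
  assumes "f \<in> hom_fun d" "g \<in> hom_fun e"
  shows "(\<lambda>x. f x * g x) \<in> hom_fun (d + e)"
proof -
  have *: "(\<lambda>x. monom_fun m x * g x) \<in> hom_fun (d + e)" if m: "mdeg m = d" for m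
  proof -
    have "hom_fun e \<subseteq> {g. (\<lambda>x. monom_fun m x * g x) \<in> hom_fun (d + e)}"
    proof (rule hom_fun_subsetI)
      show "monom_fun m' \<in> {g. (\<lambda>x. monom_fun m x * g x) \<in> hom_fun (d + e)}" if "mdeg m' = e" for m'
        using hom_fun_monom[of "\<lambda>i. m i + m' i"] that m
        by (simp add: monom_fun_add[symmetric] mdeg_add)
    qed (auto simp: hom_fun_zero distrib_left intro: hom_fun_add
        dest: hom_fun_scale simp: mult.left_commute)
    with assms(2) show ?thesis by blast
  qed
  have "hom_fun d \<subseteq> {f. (\<lambda>x. f x * g x) \<in> hom_fun (d + e)}"
  proof (rule hom_fun_subsetI)
    show "monom_fun m \<in> {f. (\<lambda>x. f x * g x) \<in> hom_fun (d + e)}" if "mdeg m = d" for m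
      using *[OF that] by simp
  qed (auto simp: hom_fun_zero distrib_right mult.assoc intro: hom_fun_add hom_fun_scale)
  with assms(1) show ?thesis by blast
qed

lemma hom_fun_const: "(\<lambda>x. a) \<in> hom_fun 0"
  using hom_fun_scale[OF hom_fun_monom[of "\<lambda>_. 0"], of a] by (simp add: monom_fun_def mdeg_def)

lemma hom_fun_power: "f \<in> hom_fun d \<Longrightarrow> (\<lambda>x. f x ^ n) \<in> hom_fun (n * d)"
  by (induction n) (auto intro: hom_fun_const hom_fun_mult)

lemma hom_fun_coord: "(\<lambda>x. x $ i) \<in> hom_fun 1"
proof -
  let ?m = "\<lambda>j. if j = i then 1 else 0 :: nat"
  have "monom_fun ?m = (\<lambda>x :: 'a ^ 'b. x $ i)"
    by (auto simp: monom_fun_def if_distrib[of "\<lambda>n. _ ^ n"] prod.delta cong: if_cong)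
  moreover have "mdeg ?m = 1" by (simp add: mdeg_def)
  ultimately show ?thesis using hom_fun_monom[of ?m] by metis
qed

lemma mdeg_split:
  assumes "mdeg m = a + b"
  shows "\<exists>m1 m2. m = (\<lambda>i. m1 i + m2 i) \<and> mdeg m1 = a \<and> mdeg m2 = b"
  using assms
proof (induction a arbitrary: b)
  case 0
  then show ?case by (intro exI[of _ "\<lambda>_. 0"] exI[of _ m]) (auto simp: mdeg_def)
next
  case (Suc a)
  then obtain m1 m2 where m: "m = (\<lambda>i. m1 i + m2 i)" "mdeg m1 = a" "mdeg m2 = Suc b"
    using Suc.IH[of "Suc b"] by auto
  then obtain i where i: "m2 i > 0" by (metis gr0I mdeg_def sum.neutral nat.distinct(1))
  have split: "mdeg (u(i := k)) = k + sum u (UNIV - {i})" for u :: "'a \<Rightarrow> nat" and k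
  proof -
    have "mdeg (u(i := k)) = (u(i := k)) i + sum (u(i := k)) (UNIV - {i})"
      unfolding mdeg_def by (rule sum.remove) auto
    also have "sum (u(i := k)) (UNIV - {i}) = sum u (UNIV - {i})" by (rule sum.cong) auto
    finally show ?thesis by (simp only: fun_upd_same)
  qed
  have "mdeg (m1(i := Suc (m1 i))) = Suc a"
    using m(2) split[of m1 "m1 i"] split[of m1 "Suc (m1 i)"] by simp
  moreover have "mdeg (m2(i := m2 i - 1)) = b"
    using m(3) i split[of m2 "m2 i"] split[of m2 "m2 i - 1"] by simp
  moreover have "m = (\<lambda>j. (m1(i := Suc (m1 i))) j + (m2(i := m2 i - 1)) j)"
    using m(1) i by (auto simp: fun_eq_iff)
  ultimately show ?case by blast
qed

section \<open>Graded ideals and the projective Nullstellensatz\<close>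

text \<open>\<open>J d\<close> is the degree \<open>d\<close> part of a homogeneous ideal.\<close>

definition gideal :: "(nat \<Rightarrow> ('k::field ^ 'n::finite \<Rightarrow> 'k) set) \<Rightarrow> bool" where
  "gideal J \<longleftrightarrow> (\<forall>d. J d \<subseteq> hom_fun d \<and> (\<lambda>x. 0) \<in> J d \<and>
     (\<forall>f\<in>J d. \<forall>g\<in>J d. (\<lambda>x. f x + g x) \<in> J d) \<and>
     (\<forall>e. \<forall>h\<in>hom_fun e. \<forall>f\<in>J d. (\<lambda>x. h x * f x) \<in> J (e + d)))"

lemma gidealD:
  assumes "gideal J"
  shows "f \<in> J d \<Longrightarrow> f \<in> hom_fun d" "(\<lambda>x. 0) \<in> J d"
    "f \<in> J d \<Longrightarrow> g \<in> J d \<Longrightarrow> (\<lambda>x. f x + g x) \<in> J d"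
    "h \<in> hom_fun e \<Longrightarrow> f \<in> J d \<Longrightarrow> (\<lambda>x. h x * f x) \<in> J (e + d)"
    "f \<in> J d \<Longrightarrow> (\<lambda>x. a * f x) \<in> J d"
proof -
  show "f \<in> J d \<Longrightarrow> f \<in> hom_fun d" "(\<lambda>x. 0) \<in> J d"
    "f \<in> J d \<Longrightarrow> g \<in> J d \<Longrightarrow> (\<lambda>x. f x + g x) \<in> J d"
    "h \<in> hom_fun e \<Longrightarrow> f \<in> J d \<Longrightarrow> (\<lambda>x. h x * f x) \<in> J (e + d)"
    using assms by (auto simp: gideal_def)
  have "\<And>h e. h \<in> hom_fun e \<Longrightarrow> f \<in> J d \<Longrightarrow> (\<lambda>x. h x * f x) \<in> J (e + d)"
    using assms by (auto simp: gideal_def)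
  from this[OF hom_fun_const] show "f \<in> J d \<Longrightarrow> (\<lambda>x. a * f x) \<in> J d" by simp
qed

text \<open>Excludes not only the unit ideal but every ideal that contains a power of the irrelevant
  ideal. The maximal ideals with this property are the ideals of points of projective space.\<close>

definition gproper :: "(nat \<Rightarrow> ('k::field ^ 'n::finite \<Rightarrow> 'k) set) \<Rightarrow> bool" where
  "gproper J \<longleftrightarrow> (\<forall>e. \<not> hom_fun e \<subseteq> J e)"

text \<open>The ideal generated by \<open>J\<close> and a form \<open>a\<close> of degree
  \<open>c\<close>. Below degree \<open>c\<close> nothing is added; the case distinction keeps the
  truncated difference \<open>d - c\<close> meaningful.\<close>

definition gadjoin where
  "gadjoin J c a d = (if c \<le> d then {\<lambda>x. p x + a x * h x |p h. p \<in> J d \<and> h \<in> hom_fun (d - c)} else J d)"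

lemma gadjoinI:
  "c \<le> d \<Longrightarrow> p \<in> J d \<Longrightarrow> h \<in> hom_fun (d - c) \<Longrightarrow> f = (\<lambda>x. p x + a x * h x) \<Longrightarrow> f \<in> gadjoin J c a d"
  unfolding gadjoin_def by auto

lemma gideal_gadjoin:
  assumes J: "gideal J" and a: "a \<in> hom_fun c"
  shows "gideal (gadjoin J c a)"
  unfolding gideal_def
proof (intro allI conjI ballI)
  note D = gidealD[OF J]
  show "gadjoin J c a d \<subseteq> hom_fun d" for d
    using hom_fun_mult[OF a, of _ "d - c"] D(1) by (auto simp: gadjoin_def intro!: hom_fun_add)
  show "(\<lambda>x. 0) \<in> gadjoin J c a d" for d
  proof (cases "c \<le> d")
    case True
    then show ?thesis
      by (rule gadjoinI[where p = "\<lambda>x. 0" and h = "\<lambda>x. 0"]) (auto intro: D hom_fun_zero)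
  qed (simp add: gadjoin_def D)
  show "(\<lambda>x. f x + g x) \<in> gadjoin J c a d" if fg: "f \<in> gadjoin J c a d" "g \<in> gadjoin J c a d" for d f g
  proof (cases "c \<le> d")
    case True
    with fg obtain p h p' h' where "f = (\<lambda>x. p x + a x * h x)" "g = (\<lambda>x. p' x + a x * h' x)"
      "p \<in> J d" "p' \<in> J d" "h \<in> hom_fun (d - c)" "h' \<in> hom_fun (d - c)" by (auto simp: gadjoin_def)
    with True show ?thesis
      by (intro gadjoinI[where p = "\<lambda>x. p x + p' x" and h = "\<lambda>x. h x + h' x"])
        (auto intro: D hom_fun_add simp: algebra_simps)
  qed (use fg D in \<open>auto simp: gadjoin_def\<close>)
  show "(\<lambda>x. h x * f x) \<in> gadjoin J c a (e + d)" if hf: "h \<in> hom_fun e" "f \<in> gadjoin J c a d" for d e h f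
  proof (cases "c \<le> d")
    case True
    with hf obtain p h' where "f = (\<lambda>x. p x + a x * h' x)" "p \<in> J d" "h' \<in> hom_fun (d - c)"
      by (auto simp: gadjoin_def)
    moreover have "(\<lambda>x. h x * h' x) \<in> hom_fun (e + d - c)"
      using hom_fun_mult[OF hf(1), of h' "d - c"] calculation True by simp
    ultimately show ?thesis using True hf
      by (intro gadjoinI[where p = "\<lambda>x. h x * p x" and h = "\<lambda>x. h x * h' x"])
        (auto intro: D simp: distrib_left mult.left_commute)
  next
    case False
    then have "(\<lambda>x. h x * f x) \<in> J (e + d)" using hf D by (auto simp: gadjoin_def)
    then show ?thesis
      using gadjoinI[of c "e + d" "\<lambda>x. h x * f x" J "\<lambda>x. 0" _ a]
      by (cases "c \<le> e + d") (auto simp: hom_fun_zero, simp add: gadjoin_def)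
  qed
qed

text \<open>The union of a chain stays \<open>gproper\<close>: a full degree is spanned by finitely
  many monomials, and these already lie in a single member of the chain.\<close>

lemma ex_maximal_gideal:
  fixes J0 :: "nat \<Rightarrow> ('k::field ^ 'n::finite \<Rightarrow> 'k) set"
  assumes "gideal J0" "gproper J0"
  shows "\<exists>P. gideal P \<and> gproper P \<and> J0 \<le> P \<and> (\<forall>J. gideal J \<longrightarrow> gproper J \<longrightarrow> P \<le> J \<longrightarrow> J = P)"
proof -
  define A where "A = {J. gideal J \<and> gproper J \<and> J0 \<le> J}"
  have "\<exists>P\<in>A. \<forall>J\<in>A. P \<le> J \<longrightarrow> J = P"
  proof (rule predicate_Zorn)
    show "partial_order_on A (relation_of (\<le>) A)"
      by (rule partial_order_on_relation_ofI) auto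
    fix C assume C: "C \<in> Chains (relation_of (\<le>) A)"
    show "\<exists>U\<in>A. \<forall>J\<in>C. J \<le> U"
    proof (cases "C = {}")
      case True
      with assms show ?thesis by (auto simp: A_def)
    next
      case False
      have CA: "J \<in> A" if "J \<in> C" for J using C that by (auto simp: Chains_def relation_of_def)
      have chain: "J \<le> J' \<or> J' \<le> J" if "J \<in> C" "J' \<in> C" for J J'
        using C that by (auto simp: Chains_def relation_of_def)
      define U where "U d = (\<Union>J\<in>C. J d)" for d
      have common: "\<exists>J\<in>C. B \<subseteq> J d" if "finite B" "B \<subseteq> U d" for B d
        using that
      proof (induction B rule: finite_induct)
        case (insert b B)
        then obtain J J' where J: "J \<in> C" "B \<subseteq> J d" "J' \<in> C" "b \<in> J' d" by (auto simp: U_def)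
        from chain[OF J(1,3)] show ?case
        proof
          assume "J \<le> J'"
          then have "J d \<subseteq> J' d" by (auto simp: le_fun_def)
          with J show ?thesis by (intro bexI[of _ J']) auto
        next
          assume "J' \<le> J"
          then have "J' d \<subseteq> J d" by (auto simp: le_fun_def)
          with J show ?thesis by (intro bexI[of _ J]) auto
        qed
      qed (use False in auto)
      have gi: "gideal J" if "J \<in> C" for J using CA[OF that] by (simp add: A_def)
      have "gideal U"
        unfolding gideal_def
      proof (intro allI conjI ballI)
        show "U d \<subseteq> hom_fun d" for d using gi gidealD(1) by (fastforce simp: U_def)
        show "(\<lambda>x. 0) \<in> U d" for d using False gi gidealD(2) by (fastforce simp: U_def)
        show "(\<lambda>x. f x + g x) \<in> U d" if "f \<in> U d" "g \<in> U d" for d f g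
        proof -
          have "\<exists>J\<in>C. {f, g} \<subseteq> J d" by (rule common) (use that in auto)
          then obtain J where J: "J \<in> C" "{f, g} \<subseteq> J d" by blast
          then have "(\<lambda>x. f x + g x) \<in> J d" using gidealD(3)[OF gi[OF J(1)]] by blast
          with J show ?thesis by (auto simp: U_def)
        qed
        show "(\<lambda>x. h x * f x) \<in> U (e + d)" if "h \<in> hom_fun e" "f \<in> U d" for d e h f
          using that gidealD(4)[OF gi] unfolding U_def by blast
      qed
      moreover have "gproper U"
        unfolding gproper_def
      proof (intro allI notI)
        fix e :: nat assume "hom_fun e \<subseteq> U e"
        then have "monom_fun ` {m. mdeg m = e} \<subseteq> U e" using hom_fun_monom by blast
        then obtain J where J: "J \<in> C" "monom_fun ` {m. mdeg m = e} \<subseteq> J e"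
          using common[of "monom_fun ` {m. mdeg m = e}" e] finite_mdeg by blast
        have "hom_fun e \<subseteq> J e"
          using J gidealD[OF gi[OF J(1)]] by (intro hom_fun_subsetI) auto
        then show False using CA[OF J(1)] by (auto simp: A_def gproper_def)
      qed
      moreover have "J0 \<le> U" using False CA by (fastforce simp: A_def le_fun_def U_def)
      ultimately have "U \<in> A" by (simp add: A_def)
      moreover have "J \<le> U" if "J \<in> C" for J using that by (auto simp: le_fun_def U_def)
      ultimately show ?thesis by blast
    qed
  qed
  then obtain P where P: "P \<in> A" "\<And>J. J \<in> A \<Longrightarrow> P \<le> J \<Longrightarrow> J = P" by blast
  then show ?thesis by (intro exI[of _ P]) (auto simp: A_def intro: order_trans)
qed

section \<open>Maximal graded ideals come from points\<close>

locale maximal_gideal =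
  fixes P :: "nat \<Rightarrow> ('k::{alg_closed_field,field_char_0} ^ 'n::finite \<Rightarrow> 'k) set"
  assumes P: "gideal P" "gproper P"
    and maximal: "\<And>J. gideal J \<Longrightarrow> gproper J \<Longrightarrow> P \<le> J \<Longrightarrow> J = P"
begin

lemmas D = gidealD[OF P(1)]

lemma diff: "f \<in> P d \<Longrightarrow> g \<in> P d \<Longrightarrow> (\<lambda>x. f x - g x) \<in> P d"
  using D(3)[OF _ D(5)[of g d "-1"], of f] by simp

lemma mult_right: "h \<in> hom_fun e \<Longrightarrow> f \<in> P d \<Longrightarrow> (\<lambda>x. f x * h x) \<in> P (d + e)"
  using D(4)[of h e f d] by (simp add: mult.commute add.commute)

text \<open>By maximality the ideal generated by \<open>P\<close> and \<open>a\<close> contains all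
  forms of some degree. For a linear form \<open>a\<close> this makes the quotient ring a finite
  module over the polynomials in \<open>a\<close>.\<close>

lemma quotient_finite:
  assumes a: "a \<in> hom_fun c" "a \<notin> P c"
  shows "\<exists>e. \<forall>f\<in>hom_fun (c + e). \<exists>p\<in>P (c + e). \<exists>h\<in>hom_fun e. f = (\<lambda>x. p x + a x * h x)"
proof -
  have le: "P \<le> gadjoin P c a"
  proof (intro le_funI subsetI)
    fix d f assume "f \<in> P d"
    then show "f \<in> gadjoin P c a d"
      using gadjoinI[of c d f P "\<lambda>x. 0" f a] by (cases "c \<le> d") (auto simp: hom_fun_zero, simp add: gadjoin_def)
  qed
  have "a \<in> gadjoin P c a c"
    using D(2)[of c] hom_fun_const[of 1]
    by (intro gadjoinI[where p = "\<lambda>x. 0" and h = "\<lambda>x. 1"]) auto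
  then have "gadjoin P c a \<noteq> P" using a by auto
  then have "\<not> gproper (gadjoin P c a)"
    using maximal[OF gideal_gadjoin[OF P(1) a(1)] _ le] by blast
  then obtain e where e: "hom_fun e \<subseteq> gadjoin P c a e" by (auto simp: gproper_def)
  have "c \<le> e"
  proof (rule ccontr)
    assume "\<not> c \<le> e"
    then have "gadjoin P c a e = P e" by (simp add: gadjoin_def)
    with e P(2) show False by (auto simp: gproper_def)
  qed
  then have "gadjoin P c a e = {\<lambda>x. p x + a x * h x |p h. p \<in> P e \<and> h \<in> hom_fun (e - c)}"
    by (simp add: gadjoin_def)
  with e have "\<exists>p\<in>P e. \<exists>h\<in>hom_fun (e - c). f = (\<lambda>x. p x + a x * h x)" if "f \<in> hom_fun e" for f
    using that by blast
  with \<open>c \<le> e\<close> show ?thesis by (intro exI[of _ "e - c"]) simp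
qed

lemma full_span:
  assumes "\<And>m. mdeg m = d \<Longrightarrow> monom_fun m \<in> P d" shows False
proof -
  have "hom_fun d \<subseteq> P d" by (rule hom_fun_subsetI) (use assms D in auto)
  then show False using P(2) by (auto simp: gproper_def)
qed

text \<open>If both \<open>a\<close> and \<open>b\<close> are outside \<open>P\<close>, then all
  forms of one degree lie in P + (a) and all forms of another in P + (b). Multiplying, all forms of
  the sum of these degrees lie in P + (ab) = P, which is excluded.\<close>

lemma prime:
  assumes a: "a \<in> hom_fun c" and b: "b \<in> hom_fun c'" and ab: "(\<lambda>x. a x * b x) \<in> P (c + c')"
  shows "a \<in> P c \<or> b \<in> P c'"
proof (rule ccontr)
  assume "\<not> ?thesis"
  then obtain e e' where
    e: "\<And>f. f \<in> hom_fun (c + e) \<Longrightarrow> \<exists>p\<in>P (c + e). \<exists>h\<in>hom_fun e. f = (\<lambda>x. p x + a x * h x)" and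
    e': "\<And>f. f \<in> hom_fun (c' + e') \<Longrightarrow> \<exists>p\<in>P (c' + e'). \<exists>h\<in>hom_fun e'. f = (\<lambda>x. p x + b x * h x)"
    using quotient_finite[OF a] quotient_finite[OF b] by blast
  show False
  proof (rule full_span)
    fix m :: "'n \<Rightarrow> nat" assume "mdeg m = (c + e) + (c' + e')"
    then obtain m1 m2 where m: "m = (\<lambda>i. m1 i + m2 i)" "mdeg m1 = c + e" "mdeg m2 = c' + e'"
      using mdeg_split by blast
    obtain p h where p: "p \<in> P (c + e)" "h \<in> hom_fun e" "monom_fun m1 = (\<lambda>x. p x + a x * h x)"
      using e[of "monom_fun m1"] hom_fun_monom[of m1] m by metis
    obtain p' h' where p': "p' \<in> P (c' + e')" "h' \<in> hom_fun e'" "monom_fun m2 = (\<lambda>x. p' x + b x * h' x)"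
      using e'[of "monom_fun m2"] hom_fun_monom[of m2] m by metis
    have 1: "(\<lambda>x. p x * monom_fun m2 x) \<in> P ((c + e) + (c' + e'))"
      using mult_right[OF _ p(1)] hom_fun_monom[of m2] m by metis
    have 2: "(\<lambda>x. (a x * h x) * p' x) \<in> P ((c + e) + (c' + e'))"
      by (rule D(4)[OF hom_fun_mult[OF a p(2)] p'(1)])
    have "(\<lambda>x. (h x * h' x) * (a x * b x)) \<in> P ((e + e') + (c + c'))"
      by (rule D(4)[OF hom_fun_mult[OF p(2) p'(2)] ab])
    then have 3: "(\<lambda>x. (h x * h' x) * (a x * b x)) \<in> P ((c + e) + (c' + e'))"
      by (simp add: ac_simps)
    have "monom_fun m = (\<lambda>x. p x * monom_fun m2 x + ((a x * h x) * p' x + (h x * h' x) * (a x * b x)))"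
      by (rule ext) (simp add: m monom_fun_add p p' algebra_simps)
    then show "monom_fun m \<in> P ((c + e) + (c' + e'))"
      using D(3)[OF 1 D(3)[OF 2 3]] by simp
  qed
qed

lemma power_notin: "f \<in> hom_fun 1 \<Longrightarrow> f \<notin> P 1 \<Longrightarrow> (\<lambda>x. f x ^ n) \<notin> P n"
proof (induction n)
  case 0
  show ?case
  proof
    assume "(\<lambda>x. f x ^ 0) \<in> P 0"
    then have 1: "(\<lambda>x. 1) \<in> P 0" by simp
    have "monom_fun m \<in> P 0" if "mdeg m = 0" for m
      using D(4)[OF hom_fun_monom[of m] 1] that by simp
    then show False by (rule full_span)
  qed
next
  case (Suc n)
  then show ?case using prime[of f 1 "\<lambda>x. f x ^ n" n] hom_fun_power[of f 1 n] by auto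
qed

text \<open>The homogenisation of \<open>p\<close> in degree \<open>m\<close>, evaluated at
  \<open>f\<close> and \<open>g\<close>. The degree \<open>m\<close> may exceed that of
  \<open>p\<close>; the surplus consists of powers of \<open>f\<close>.\<close>

definition bin where
  "bin f g m p x = (\<Sum>k\<le>m. Polynomial.coeff p k * f x ^ (m - k) * g x ^ k)"

text \<open>A root \<open>r\<close> of \<open>p\<close> splits the factor g - r f off the binary
  form. Primality puts this factor or the remaining form into \<open>P\<close>; the process cannot
  end in a constant, since no power of \<open>f\<close> lies in \<open>P\<close>.\<close>

lemma bin_root:
  assumes fg: "f \<in> hom_fun 1" "g \<in> hom_fun 1" "f \<notin> P 1"
  shows "p \<noteq> 0 \<Longrightarrow> Polynomial.degree p \<le> m \<Longrightarrow> bin f g m p \<in> P m \<Longrightarrow> \<exists>r. (\<lambda>x. g x - r * f x) \<in> P 1"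
proof (induction "Polynomial.degree p" arbitrary: p m)
  case 0
  then obtain c where c: "p = [:c:]" "c \<noteq> 0" by (metis degree_eq_zeroE pCons_0_0)
  have "bin f g m p = (\<lambda>x. c * f x ^ m)"
    by (rule ext) (simp add: bin_def c coeff_pCons sum.atMost_shift split: nat.split)
  with 0 have "(\<lambda>x. inverse c * (c * f x ^ m)) \<in> P m"
    using D(5)[of "\<lambda>x. c * f x ^ m" m "inverse c"] by simp
  moreover have "(\<lambda>x. inverse c * (c * f x ^ m)) = (\<lambda>x. f x ^ m)"
    using c by (auto simp: mult.assoc[symmetric])
  ultimately show ?case using power_notin[OF fg(1,3), of m] by simp
next
  case (Suc n)
  obtain r where "poly p r = 0" using alg_closed_imp_poly_has_root[of p] Suc.hyps by auto
  then obtain q where q: "p = [:- r, 1:] * q" using poly_eq_0_iff_dvd by (metis dvd_def)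
  have q0: "q \<noteq> 0" using q Suc.prems by auto
  have deg: "Polynomial.degree q = n" using Suc.hyps q q0 by (simp add: degree_mult_eq del: mult_pCons_left)
  obtain m' where m': "m = Suc m'" using Suc.hyps Suc.prems by (cases m) auto
  have n: "n \<le> m'" using Suc.prems Suc.hyps m' by simp
  have "bin f g m p x = (g x - r * f x) * bin f g m' q x" for x
  proof -
    have co: "Polynomial.coeff p k = (case k of 0 \<Rightarrow> 0 | Suc j \<Rightarrow> Polynomial.coeff q j) - r * Polynomial.coeff q k" for k
      unfolding q by (simp add: coeff_pCons split: nat.split)
    have "bin f g m p x = (\<Sum>k\<le>Suc m'. (case k of 0 \<Rightarrow> 0 | Suc j \<Rightarrow> Polynomial.coeff q j) * f x ^ (Suc m' - k) * g x ^ k) -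
       (\<Sum>k\<le>Suc m'. r * Polynomial.coeff q k * f x ^ (Suc m' - k) * g x ^ k)"
      by (simp add: bin_def m' co left_diff_distrib sum_subtractf del: sum.atMost_Suc)
    also have "(\<Sum>k\<le>Suc m'. (case k of 0 \<Rightarrow> 0 | Suc j \<Rightarrow> Polynomial.coeff q j) * f x ^ (Suc m' - k) * g x ^ k) = g x * bin f g m' q x"
      by (subst sum.atMost_Suc_shift) (simp add: bin_def sum_distrib_left mult_ac)
    also have "(\<Sum>k\<le>Suc m'. r * Polynomial.coeff q k * f x ^ (Suc m' - k) * g x ^ k) = r * f x * bin f g m' q x"
      using deg n by (simp add: bin_def sum_distrib_left coeff_eq_0 Suc_diff_le mult_ac cong: sum.cong_simp)
    finally show ?thesis by (simp add: algebra_simps)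
  qed
  then have "(\<lambda>x. (g x - r * f x) * bin f g m' q x) \<in> P (1 + m')"
    using Suc.prems m' by (simp add: bin_def[abs_def])
  moreover have "(\<lambda>x. g x - r * f x) \<in> hom_fun 1"
    using fg by (intro hom_fun_diff hom_fun_scale)
  moreover have "bin f g m' q \<in> hom_fun m'"
  proof -
    have "(\<lambda>x. f x ^ (m' - k) * g x ^ k) \<in> hom_fun m'" if "k \<le> m'" for k
      using hom_fun_mult[OF hom_fun_power[OF fg(1), of "m' - k"] hom_fun_power[OF fg(2), of k]] that by simp
    then show ?thesis unfolding bin_def mult.assoc by (intro hom_fun_sum hom_fun_scale) auto
  qed
  ultimately have "(\<lambda>x. g x - r * f x) \<in> P 1 \<or> bin f g m' q \<in> P m'" by (intro prime)
  then show ?case using Suc.hyps(1)[of q m'] deg q0 n by blast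
qed

text \<open>Modulo \<open>P\<close>, every form of degree e + k is a combination of f^k times the
  monomials of degree \<open>e\<close>, whose number does not depend on \<open>k\<close>. Hence in a
  large degree the products f^(n-k) g^k become linearly dependent modulo \<open>P\<close>, and the
  resulting binary form splits into linear factors.\<close>

lemma linear_relation:
  assumes fg: "f \<in> hom_fun 1" "g \<in> hom_fun 1" "f \<notin> P 1"
  shows "\<exists>r. (\<lambda>x. g x - r * f x) \<in> P 1"
proof -
  obtain e where e: "\<And>h. h \<in> hom_fun (1 + e) \<Longrightarrow> \<exists>p\<in>P (1 + e). \<exists>h'\<in>hom_fun e. h = (\<lambda>x. p x + f x * h' x)"
    using quotient_finite[OF fg(1,3)] by blast
  have red: "\<exists>c. (\<lambda>x. h x - (\<Sum>m | mdeg m = e. c m * (f x ^ k * monom_fun m x))) \<in> P (e + k)"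
    if "h \<in> hom_fun (e + k)" for h k
    using that
  proof (induction k arbitrary: h)
    case 0
    then obtain c where "h = (\<lambda>x. \<Sum>m | mdeg m = e. c m * monom_fun m x)" by (auto simp: hom_fun_def)
    then show ?case using D(2) by (intro exI[of _ c]) simp
  next
    case (Suc k)
    have "hom_fun (e + Suc k) \<subseteq> {h. \<exists>p\<in>P (e + Suc k). \<exists>h'\<in>hom_fun (e + k). h = (\<lambda>x. p x + f x * h' x)}" (is "_ \<subseteq> ?S")
    proof (rule hom_fun_subsetI)
      have SI: "u \<in> ?S" if "p \<in> P (e + Suc k)" "h \<in> hom_fun (e + k)" "\<And>x. u x = p x + f x * h x" for u p h
        using that by (intro CollectI bexI[of _ p] bexI[of _ h] ext) auto
      fix m :: "'n \<Rightarrow> nat" assume "mdeg m = e + Suc k"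
      then obtain m1 m2 where m: "m = (\<lambda>i. m1 i + m2 i)" "mdeg m1 = 1 + e" "mdeg m2 = k"
        using mdeg_split[of m "1 + e" k] by auto
      obtain p h' where p: "p \<in> P (1 + e)" "h' \<in> hom_fun e" "monom_fun m1 = (\<lambda>x. p x + f x * h' x)"
        using e[of "monom_fun m1"] hom_fun_monom[of m1] m by metis
      have "(\<lambda>x. p x * monom_fun m2 x) \<in> P (e + Suc k)"
        using mult_right[OF hom_fun_monom[of m2] p(1)] m by simp
      moreover have "(\<lambda>x. h' x * monom_fun m2 x) \<in> hom_fun (e + k)"
        using hom_fun_mult[OF p(2) hom_fun_monom[of m2]] m by simp
      ultimately show "monom_fun m \<in> ?S"
        by (rule SI) (simp add: m monom_fun_add p algebra_simps)
    next
      have SI: "u \<in> ?S" if "p \<in> P (e + Suc k)" "h \<in> hom_fun (e + k)" "\<And>x. u x = p x + f x * h x" for u p h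
        using that by (intro CollectI bexI[of _ p] bexI[of _ h] ext) auto
      show "(\<lambda>x. 0) \<in> ?S" using D(2) hom_fun_zero by force
      show "(\<lambda>x. u x + v x) \<in> ?S" if uv: "u \<in> ?S" "v \<in> ?S" for u v
      proof -
        obtain p h p' h' where "p \<in> P (e + Suc k)" "h \<in> hom_fun (e + k)" "u = (\<lambda>x. p x + f x * h x)"
          "p' \<in> P (e + Suc k)" "h' \<in> hom_fun (e + k)" "v = (\<lambda>x. p' x + f x * h' x)" using uv by auto
        then show ?thesis
          by (intro SI[of "\<lambda>x. p x + p' x" "\<lambda>x. h x + h' x"] D(3) hom_fun_add) (auto simp: algebra_simps)
      qed
      show "(\<lambda>x. a * u x) \<in> ?S" if uv: "u \<in> ?S" for a u
      proof -
        obtain p h where "p \<in> P (e + Suc k)" "h \<in> hom_fun (e + k)" "u = (\<lambda>x. p x + f x * h x)" using uv by auto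
        then show ?thesis
          by (intro SI[of "\<lambda>x. a * p x" "\<lambda>x. a * h x"] D(5) hom_fun_scale) (auto simp: algebra_simps)
      qed
    qed
    with Suc.prems obtain p h' where p: "p \<in> P (e + Suc k)" "h' \<in> hom_fun (e + k)" "h = (\<lambda>x. p x + f x * h' x)"
      by blast
    obtain c where c: "(\<lambda>x. h' x - (\<Sum>m | mdeg m = e. c m * (f x ^ k * monom_fun m x))) \<in> P (e + k)"
      using Suc.IH[OF p(2)] by blast
    have "(\<lambda>x. f x * (h' x - (\<Sum>m | mdeg m = e. c m * (f x ^ k * monom_fun m x)))) \<in> P (e + Suc k)"
      using D(4)[OF fg(1) c] by simp
    then have "(\<lambda>x. p x + f x * (h' x - (\<Sum>m | mdeg m = e. c m * (f x ^ k * monom_fun m x)))) \<in> P (e + Suc k)"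
      by (rule D(3)[OF p(1)])
    moreover have "(\<lambda>x. p x + f x * (h' x - (\<Sum>m | mdeg m = e. c m * (f x ^ k * monom_fun m x)))) =
      (\<lambda>x. h x - (\<Sum>m | mdeg m = e. c m * (f x ^ Suc k * monom_fun m x)))"
      by (rule ext) (simp add: p algebra_simps sum_distrib_left)
    ultimately show ?case by auto
  qed
  define J where "J = {m :: 'n \<Rightarrow> nat. mdeg m = e}"
  \<comment> \<open>The degree \<open>n\<close> has the shape \<open>e + k\<close> with
    \<open>k = card J\<close> that \<open>red\<close> requires, and the \<open>n + 1\<close>
    products outnumber the \<open>card J\<close> coordinates.\<close>
  define n where "n = e + card J"
  have hk: "(\<lambda>x. f x ^ (n - k) * g x ^ k) \<in> hom_fun (e + card J)" if "k \<le> n" for k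
    using hom_fun_mult[OF hom_fun_power[OF fg(1), of "n - k"] hom_fun_power[OF fg(2), of k]] that by (simp add: n_def)
  then have "\<forall>k. \<exists>c. k \<le> n \<longrightarrow> (\<lambda>x. f x ^ (n - k) * g x ^ k - (\<Sum>m\<in>J. c m * (f x ^ card J * monom_fun m x))) \<in> P n"
    using red[OF hk] unfolding n_def[symmetric] J_def[symmetric] by blast
  from choice[OF this] obtain c where c: "\<And>k. k \<le> n \<Longrightarrow> (\<lambda>x. f x ^ (n - k) * g x ^ k - (\<Sum>m\<in>J. c k m * (f x ^ card J * monom_fun m x))) \<in> P n"
    by blast
  have finJ: "finite J" by (simp add: J_def finite_mdeg)
  have "\<exists>l. (\<forall>i. l i \<in> UNIV) \<and> (\<exists>i\<in>{..n}. l i \<noteq> 0) \<and> (\<forall>j\<in>J. (\<Sum>i\<in>{..n}. l i * c i j) = 0)"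
    by (rule linear_system) (auto simp: finJ n_def is_subfield_def)
  then obtain l i where l: "i \<le> n" "l i \<noteq> 0" "\<And>j. j \<in> J \<Longrightarrow> (\<Sum>i\<le>n. l i * c i j) = 0" by auto
  define p where "p = (\<Sum>k\<le>n. Polynomial.monom (l k) k)"
  have coeff: "Polynomial.coeff p k = (if k \<le> n then l k else 0)" for k
    by (simp add: p_def coeff_sum)
  have "p \<noteq> 0" using coeff[of i] l by auto
  moreover have "Polynomial.degree p \<le> n" by (rule degree_le) (simp add: coeff)
  moreover have "bin f g n p \<in> P n"
  proof -
    have sum_in: "(\<lambda>x. \<Sum>k\<in>A. u k x) \<in> P n" if "\<And>k. k \<in> A \<Longrightarrow> u k \<in> P n" for A :: "nat set" and u
      using that by (induction A rule: infinite_finite_induct) (auto intro: D)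
    have "(\<lambda>x. \<Sum>k\<le>n. l k * (f x ^ (n - k) * g x ^ k - (\<Sum>m\<in>J. c k m * (f x ^ card J * monom_fun m x)))) \<in> P n"
      by (intro sum_in D(5) c) auto
    moreover have "(\<Sum>k\<le>n. l k * (f x ^ (n - k) * g x ^ k - (\<Sum>m\<in>J. c k m * (f x ^ card J * monom_fun m x)))) = bin f g n p x" for x
    proof -
      have "(\<Sum>k\<le>n. l k * (\<Sum>m\<in>J. c k m * (f x ^ card J * monom_fun m x))) =
          (\<Sum>m\<in>J. (\<Sum>k\<le>n. l k * c k m) * (f x ^ card J * monom_fun m x))"
        unfolding sum_distrib_left sum_distrib_right by (subst sum.swap) (simp add: mult.assoc)
      also have "\<dots> = 0" using l(3) by simp
      finally show ?thesis
        by (simp add: right_diff_distrib sum_subtractf bin_def coeff mult.assoc)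
    qed
    ultimately show ?thesis by (simp add: bin_def[abs_def])
  qed
  ultimately show ?thesis using bin_root[OF fg] by blast
qed

text \<open>Some coordinate x_i is outside \<open>P\<close>, and every other coordinate is a
  multiple l_j x_i modulo \<open>P\<close>. Hence F = F(l) x_i^d modulo \<open>P\<close> for every
  form of degree \<open>d\<close>; if F is in \<open>P\<close>, then F(l) = 0 because no power of
  x_i lies in \<open>P\<close>.\<close>

lemma ex_zero: "\<exists>l. l \<noteq> 0 \<and> (\<forall>d. \<forall>F\<in>P d. F l = 0)"
proof -
  have "\<exists>i. (\<lambda>x. x $ i) \<notin> P 1"
  proof (rule ccontr)
    assume *: "\<not> ?thesis"
    show False
    proof (rule full_span)
      fix m :: "'n \<Rightarrow> nat" assume m: "mdeg m = 1"
      then obtain i where i: "m i \<noteq> 0" by (metis mdeg_def sum.neutral zero_neq_one)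
      have le: "m i \<le> mdeg m" unfolding mdeg_def by (rule member_le_sum) auto
      have "mdeg m = m i + sum m (UNIV - {i})" unfolding mdeg_def by (rule sum.remove) auto
      then have "m i = 1" "sum m (UNIV - {i}) = 0" using i m by linarith+
      then have "\<forall>j\<in>UNIV - {i}. m j = 0" by simp
      then have "monom_fun m = (\<lambda>x :: 'k ^ 'n. x $ i)"
        using \<open>m i = 1\<close> by (intro ext) (simp add: monom_fun_def prod.remove[of UNIV i])
      moreover have "(\<lambda>x. x $ i) \<in> P 1" using * by blast
      ultimately show "monom_fun m \<in> P 1" by (simp only:)
    qed
  qed
  then obtain i where i: "(\<lambda>x. x $ i) \<notin> P 1" by blast
  define l' where "l' j = (SOME r. (\<lambda>x. x $ j - r * x $ i) \<in> P 1)" for j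
  have l': "(\<lambda>x. x $ j - l' j * x $ i) \<in> P 1" for j
    unfolding l'_def by (rule someI_ex, rule linear_relation[OF hom_fun_coord hom_fun_coord i])
  define l where "l = (\<chi> j. l' j)"
  have l: "(\<lambda>x. x $ j - l $ j * x $ i) \<in> P 1" for j using l' by (simp add: l_def)
  have "l $ i \<noteq> 0"
  proof
    assume "l $ i = 0"
    with l[of i] i show False by simp
  qed
  have pw: "(\<lambda>x. (x $ j) ^ n - (l $ j) ^ n * (x $ i) ^ n) \<in> P n" for j n
  proof (induction n)
    case (Suc n)
    have "(\<lambda>x. x $ j * ((x $ j) ^ n - (l $ j) ^ n * (x $ i) ^ n)) \<in> P (Suc n)"
      using D(4)[OF hom_fun_coord Suc] by simp
    moreover have "(\<lambda>x. ((l $ j) ^ n * (x $ i) ^ n) * (x $ j - l $ j * x $ i)) \<in> P (Suc n)"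
      using D(4)[OF hom_fun_scale[OF hom_fun_power[OF hom_fun_coord[of i], of n]] l[of j]] by simp
    ultimately have "(\<lambda>x. x $ j * ((x $ j) ^ n - (l $ j) ^ n * (x $ i) ^ n) +
        ((l $ j) ^ n * (x $ i) ^ n) * (x $ j - l $ j * x $ i)) \<in> P (Suc n)" by (rule D(3))
    then show ?case by (simp add: algebra_simps)
  qed (simp add: D)
  have mon: "(\<lambda>x. (\<Prod>j\<in>A. (x $ j) ^ m j) - (\<Prod>j\<in>A. (l $ j) ^ m j) * (x $ i) ^ sum m A) \<in> P (sum m A) \<and>
      (\<lambda>x :: 'k ^ 'n. \<Prod>j\<in>A. (x $ j) ^ m j) \<in> hom_fun (sum m A)" for m and A :: "'n set"
    using finite[of A]
  proof (induction A rule: finite_induct)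
    case (insert j A)
    let ?u = "\<lambda>x :: 'k ^ 'n. \<Prod>j\<in>A. (x $ j) ^ m j" and ?c = "\<Prod>j\<in>A. (l $ j) ^ m j"
    have 1: "(\<lambda>x. (x $ j) ^ m j * (?u x - ?c * (x $ i) ^ sum m A)) \<in> P (m j + sum m A)"
      using D(4)[OF hom_fun_power[OF hom_fun_coord[of j], of "m j"], of _ "sum m A"] insert.IH by simp
    have 2: "(\<lambda>x. (?c * (x $ i) ^ sum m A) * ((x $ j) ^ m j - (l $ j) ^ m j * (x $ i) ^ m j)) \<in> P (sum m A + m j)"
      using D(4)[OF hom_fun_scale[OF hom_fun_power[OF hom_fun_coord[of i], of "sum m A"]] pw[of j "m j"]] by simp
    have "(\<lambda>x. (x $ j) ^ m j * (?u x - ?c * (x $ i) ^ sum m A) +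
       (?c * (x $ i) ^ sum m A) * ((x $ j) ^ m j - (l $ j) ^ m j * (x $ i) ^ m j)) \<in> P (m j + sum m A)"
      by (rule D(3)[OF 1 2[unfolded add.commute[of "sum m A" "m j"]]])
    moreover have "(\<lambda>x :: 'k ^ 'n. (x $ j) ^ m j * ?u x) \<in> hom_fun (m j + sum m A)"
      using hom_fun_mult[OF hom_fun_power[OF hom_fun_coord[of j], of "m j"] conjunct2[OF insert.IH]] by simp
    ultimately show ?case using insert.hyps by (simp add: algebra_simps power_add)
  qed (auto simp: D hom_fun_const)
  have "F l = 0" if F: "F \<in> P d" for F d
  proof -
    obtain c where c: "F = (\<lambda>x. \<Sum>m | mdeg m = d. c m * monom_fun m x)"
      using D(1)[OF F] by (auto simp: hom_fun_def)
    have sum_in: "(\<lambda>x. \<Sum>k\<in>A. u k x) \<in> P d" if "\<And>k. k \<in> A \<Longrightarrow> u k \<in> P d" for A :: "('n \<Rightarrow> nat) set" and u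
      using that by (induction A rule: infinite_finite_induct) (auto intro: D)
    have "(\<lambda>x. \<Sum>m | mdeg m = d. c m * (monom_fun m x - monom_fun m l * (x $ i) ^ d)) \<in> P d"
    proof (intro sum_in D(5))
      fix m :: "'n \<Rightarrow> nat" assume "m \<in> {m. mdeg m = d}"
      then show "(\<lambda>x. monom_fun m x - monom_fun m l * (x $ i) ^ d) \<in> P d"
        using mon[where m = m and A = UNIV] by (simp add: monom_fun_def mdeg_def)
    qed
    then have "(\<lambda>x. F x - F l * (x $ i) ^ d) \<in> P d"
      by (simp add: c right_diff_distrib sum_subtractf sum_distrib_right mult.assoc)
    from diff[OF F this] have in_P: "(\<lambda>x. F l * (x $ i) ^ d) \<in> P d" by simp
    show ?thesis
    proof (rule ccontr)
      assume nz: "F l \<noteq> 0"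
      have "(\<lambda>x. inverse (F l) * (F l * (x $ i) ^ d)) \<in> P d" by (rule D(5)[OF in_P])
      moreover have "(\<lambda>x. inverse (F l) * (F l * (x $ i) ^ d)) = (\<lambda>x. (x $ i) ^ d)"
        using nz by (auto simp: mult.assoc[symmetric])
      ultimately show False using power_notin[OF hom_fun_coord i, of d] by simp
    qed
  qed
  moreover have "l \<noteq> 0" using \<open>l $ i \<noteq> 0\<close> by auto
  ultimately show ?thesis by blast
qed

end

text \<open>If the ideal generated by the forms were \<open>gproper\<close>, a maximal one above it
  would provide a common zero. So it contains all forms of some degree, which is why a single
  \<open>e\<close> serves all coordinates.\<close>

theorem projective_nullstellensatz:
  fixes F :: "'n::finite \<Rightarrow> 'k::{alg_closed_field,field_char_0} ^ 'n \<Rightarrow> 'k"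
  assumes F: "\<And>j. F j \<in> hom_fun d" and no_zero: "\<And>x. x \<noteq> 0 \<Longrightarrow> \<exists>j. F j x \<noteq> 0"
  shows "\<exists>e. \<forall>i. \<exists>G. (\<forall>j. G j \<in> hom_fun e) \<and> (\<forall>x. (x $ i) ^ (d + e) = (\<Sum>j\<in>UNIV. G j x * F j x))"
proof -
  define J where "J n = (if d \<le> n then {\<lambda>x. \<Sum>j\<in>UNIV. G j x * F j x |G. \<forall>j. G j \<in> hom_fun (n - d)} else {\<lambda>x. 0})" for n
  have J: "gideal J"
    unfolding gideal_def
  proof (intro allI conjI ballI)
    show "J n \<subseteq> hom_fun n" for n
      using hom_fun_mult[OF _ F, of _ "n - d"] by (auto simp: J_def hom_fun_zero intro!: hom_fun_sum)
    show "(\<lambda>x. 0) \<in> J n" for n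
      by (auto simp: J_def hom_fun_zero intro!: exI[of _ "\<lambda>_ _. 0"])
    show "(\<lambda>x. f x + g x) \<in> J n" if fg: "f \<in> J n" "g \<in> J n" for n f g
    proof (cases "d \<le> n")
      case True
      with fg obtain G G' where "\<forall>j. G j \<in> hom_fun (n - d)" "\<forall>j. G' j \<in> hom_fun (n - d)"
        "f = (\<lambda>x. \<Sum>j\<in>UNIV. G j x * F j x)" "g = (\<lambda>x. \<Sum>j\<in>UNIV. G' j x * F j x)" by (auto simp: J_def)
      with True show ?thesis
        by (auto simp: J_def distrib_right sum.distrib intro!: exI[of _ "\<lambda>j x. G j x + G' j x"] hom_fun_add)
    qed (use fg in \<open>auto simp: J_def\<close>)
    show "(\<lambda>x. h x * f x) \<in> J (e + n)" if hf: "h \<in> hom_fun e" "f \<in> J n" for n e h f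
    proof (cases "d \<le> n")
      case True
      with hf obtain G where G: "\<forall>j. G j \<in> hom_fun (n - d)" "f = (\<lambda>x. \<Sum>j\<in>UNIV. G j x * F j x)"
        by (auto simp: J_def)
      have "(\<lambda>x. h x * G j x) \<in> hom_fun (e + n - d)" for j
        using hom_fun_mult[OF hf(1), of "G j" "n - d"] G True by simp
      with G True show ?thesis
        by (auto simp: J_def sum_distrib_left mult.assoc intro!: exI[of _ "\<lambda>j x. h x * G j x"])
    next
      case False
      with hf have "f = (\<lambda>x. 0)" by (auto simp: J_def)
      then show ?thesis by (auto simp: J_def hom_fun_zero intro!: exI[of _ "\<lambda>_ _. 0"])
    qed
  qed
  have "\<not> gproper J"
  proof
    assume "gproper J"
    then obtain P where P': "gideal P" "gproper P" "J \<le> P" "\<And>J. gideal J \<Longrightarrow> gproper J \<Longrightarrow> P \<le> J \<Longrightarrow> J = P"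
      using ex_maximal_gideal[OF J] by blast
    interpret maximal_gideal P using P' by unfold_locales
    obtain l where l: "l \<noteq> 0" "\<And>d F. F \<in> P d \<Longrightarrow> F l = 0" using ex_zero by blast
    have "F j \<in> J d" for j
    proof -
      have "F j = (\<lambda>x. \<Sum>k\<in>UNIV. (if k = j then 1 else 0) * F k x)"
        by (rule ext) (simp add: if_distrib[of "\<lambda>u. u * _"] cong: if_cong)
      moreover have "(\<lambda>x. if k = j then 1 else 0) \<in> hom_fun 0" for k by (rule hom_fun_const)
      ultimately show ?thesis by (auto simp: J_def intro!: exI[of _ "\<lambda>k x. if k = j then 1 else 0"])
    qed
    then have "F j l = 0" for j using l(2) le_funD[OF P'(3), of d] by blast
    then show False using no_zero[OF l(1)] by blast
  qed
  then obtain n where n: "hom_fun n \<subseteq> J n" by (auto simp: gproper_def)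
  have "d \<le> n"
  proof (rule ccontr)
    assume "\<not> d \<le> n"
    then have "hom_fun n \<subseteq> {\<lambda>x :: 'k ^ 'n. 0}" using n by (simp add: J_def)
    moreover have "(\<lambda>x :: 'k ^ 'n. (x $ undefined) ^ n) \<in> hom_fun n"
      using hom_fun_power[OF hom_fun_coord, of _ n] by simp
    ultimately have "(\<lambda>x :: 'k ^ 'n. (x $ undefined) ^ n) = (\<lambda>x. 0)" by blast
    then have "((1 :: 'k ^ 'n) $ undefined) ^ n = 0" by (rule fun_cong)
    then show False by simp
  qed
  have "\<exists>G. (\<forall>j. G j \<in> hom_fun (n - d)) \<and> (\<forall>x. (x $ i) ^ (d + (n - d)) = (\<Sum>j\<in>UNIV. G j x * F j x))" for i
  proof -
    have "(\<lambda>x :: 'k ^ 'n. (x $ i) ^ n) \<in> hom_fun n" using hom_fun_power[OF hom_fun_coord, of i n] by simp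
    with n have "(\<lambda>x. (x $ i) ^ n) \<in> J n" by blast
    with \<open>d \<le> n\<close> obtain G where "\<forall>j. G j \<in> hom_fun (n - d)" "(\<lambda>x. (x $ i) ^ n) = (\<lambda>x. \<Sum>j\<in>UNIV. G j x * F j x)"
      by (auto simp: J_def)
    with \<open>d \<le> n\<close> show ?thesis by (auto dest: fun_cong intro!: exI[of _ G])
  qed
  then show ?thesis by blast
qed

lemma QV_card_le_dim:
  assumes L: "number_field L" and I: "finite I" "\<And>i. i \<in> I \<Longrightarrow> u i \<in> L"
    and ind: "\<And>c i. (\<Sum>i\<in>I. of_rat (c i) * u i) = 0 \<Longrightarrow> i \<in> I \<Longrightarrow> c i = 0"
  shows "card I \<le> QV.dim L"
proof -
  obtain B where B: "finite B" "QV.independent B" "QV.span B = L" using L by (auto simp: number_field_iff)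
  have inj: "inj_on u I"
  proof (rule inj_onI, rule ccontr)
    fix i j assume ij: "i \<in> I" "j \<in> I" "u i = u j" "i \<noteq> j"
    let ?c = "\<lambda>k. if k = i then 1 else if k = j then -1 else 0 :: rat"
    have "(\<Sum>k\<in>I. of_rat (?c k) * u k) = (\<Sum>k\<in>{i, j}. of_rat (?c k) * u k)"
      using ij I(1) by (intro sum.mono_neutral_right) auto
    also have "\<dots> = 0" using ij by simp
    finally have "?c i = 0" by (rule ind) (rule ij)
    then show False by simp
  qed
  have "QV.independent (u ` I)"
  proof (rule QV.independent_if_scalars_zero)
    fix f y assume f: "(\<Sum>y\<in>u ` I. rscale (f y) y) = 0" and y: "y \<in> u ` I"
    then have "(\<Sum>i\<in>I. of_rat (f (u i)) * u i) = 0"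
      by (subst (asm) sum.reindex[OF inj]) (simp add: rscale_def)
    from ind[OF this] y show "f y = 0" by auto
  qed (use I in simp)
  then have "card (u ` I) \<le> card B"
    using QV.independent_span_bound[OF B(1), of "u ` I"] B I(2) by auto
  also have "card B = QV.dim L"
    using B QV.dim_eq_card_independent QV.dim_span by metis
  finally show ?thesis by (simp add: card_image[OF inj])
qed

section \<open>Embeddings of number fields\<close>

text \<open>Being \<open>extensional\<close> gives each embedding exactly one representing function,
  so that embeddings can be counted.\<close>

definition Emb :: "qbar set \<Rightarrow> (qbar \<Rightarrow> qbar) set" where
  "Emb K = {\<sigma> \<in> extensional K. \<sigma> 1 = 1 \<and> (\<forall>x\<in>K. \<forall>y\<in>K. \<sigma> (x + y) = \<sigma> x + \<sigma> y \<and> \<sigma> (x * y) = \<sigma> x * \<sigma> y)}"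

locale embedding =
  fixes K :: "qbar set" and \<sigma> :: "qbar \<Rightarrow> qbar"
  assumes K: "is_subfield K" and \<sigma>: "\<sigma> \<in> Emb K"
begin

lemma one: "\<sigma> 1 = 1"
  and add: "x \<in> K \<Longrightarrow> y \<in> K \<Longrightarrow> \<sigma> (x + y) = \<sigma> x + \<sigma> y"
  and mult: "x \<in> K \<Longrightarrow> y \<in> K \<Longrightarrow> \<sigma> (x * y) = \<sigma> x * \<sigma> y"
  using \<sigma> by (auto simp: Emb_def)

lemma zero: "\<sigma> 0 = 0"
  using add[of 0 0] is_subfieldD[OF K] by simp

lemma minus: "x \<in> K \<Longrightarrow> \<sigma> (- x) = - \<sigma> x"
  using add[of x "- x"] is_subfieldD[OF K] zero by (simp add: add_eq_0_iff)

lemma diff: "x \<in> K \<Longrightarrow> y \<in> K \<Longrightarrow> \<sigma> (x - y) = \<sigma> x - \<sigma> y"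
  using add[of x "- y"] is_subfieldD[OF K] minus[of y] by simp

lemma sum: "(\<And>i. i \<in> I \<Longrightarrow> f i \<in> K) \<Longrightarrow> \<sigma> (sum f I) = (\<Sum>i\<in>I. \<sigma> (f i))"
  by (induction I rule: infinite_finite_induct) (auto simp: zero add is_subfield_sum[OF K])

lemma power: "x \<in> K \<Longrightarrow> \<sigma> (x ^ n) = \<sigma> x ^ n"
  by (induction n) (auto simp: one mult is_subfield_power[OF K])

lemma of_nat: "\<sigma> (of_nat n) = of_nat n"
  by (induction n) (auto simp: zero one add is_subfield_of_nat[OF K] is_subfieldD[OF K])

lemma of_int: "\<sigma> (of_int n) = of_int n"
  by (cases n) (auto simp: of_nat minus is_subfield_of_nat[OF K] simp del: of_nat_Suc)

lemma of_rat: "\<sigma> (of_rat q) = of_rat q"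
proof -
  obtain n d where nd: "quotient_of q = (n, d)" by (cases "quotient_of q")
  have d: "d \<noteq> 0" using quotient_of_denom_pos[OF nd] by simp
  have "q = of_int n / of_int d" using quotient_of_div[OF nd] .
  then have q: "(of_rat q :: qbar) = of_int n / of_int d" by (simp add: of_rat_divide)
  have "\<sigma> (of_rat q) * of_int d = \<sigma> (of_rat q * of_int d)"
    by (simp add: mult of_int is_subfield_of_rat[OF K] is_subfield_of_int[OF K])
  also have "\<dots> = of_int n" using d by (simp add: q of_int)
  finally show ?thesis using d by (simp add: q field_simps)
qed

lemma rpoly: "x \<in> K \<Longrightarrow> \<sigma> (rpoly p x) = rpoly p (\<sigma> x)"
  by (induction p) (simp_all add: zero add mult of_rat rpoly_in[OF K] is_subfield_of_rat[OF K] is_subfieldD[OF K])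

lemma nonzero: "x \<in> K \<Longrightarrow> x \<noteq> 0 \<Longrightarrow> \<sigma> x \<noteq> 0"
  using mult[of x "inverse x"] is_subfieldD(6)[OF K, of x] one by auto

end

lemma bij_Emb_qadj: "bij_betw (\<lambda>\<sigma>. \<sigma> x) (Emb (qadj x)) (conjs x)"
proof (rule bij_betwI')
  fix \<sigma> \<tau> assume s: "\<sigma> \<in> Emb (qadj x)" "\<tau> \<in> Emb (qadj x)"
  interpret s: embedding "qadj x" \<sigma> using s is_subfield_qadj by unfold_locales
  interpret t: embedding "qadj x" \<tau> using s is_subfield_qadj by unfold_locales
  show "\<sigma> x = \<tau> x \<longleftrightarrow> \<sigma> = \<tau>"
  proof
    assume eq: "\<sigma> x = \<tau> x"
    show "\<sigma> = \<tau>"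
    proof (rule extensionalityI)
      show "\<sigma> \<in> extensional (qadj x)" "\<tau> \<in> extensional (qadj x)" using s by (auto simp: Emb_def)
      fix y assume "y \<in> qadj x"
      then obtain p where "y = rpoly p x" by (auto simp: qadj_def)
      then show "\<sigma> y = \<tau> y" using s.rpoly[OF qadj_self] t.rpoly[OF qadj_self] eq by simp
    qed
  qed simp
next
  fix \<sigma> assume s: "\<sigma> \<in> Emb (qadj x)"
  interpret s: embedding "qadj x" \<sigma> using s is_subfield_qadj by unfold_locales
  show "\<sigma> x \<in> conjs x"
    using s.rpoly[OF qadj_self, of "minp x"] minp_root[of x] s.zero by (simp add: conjs_def)
next
  fix y assume "y \<in> conjs x"
  then have y: "minp y = minp x" by (simp add: conjs_def minp_conj)
  have eq: "rpoly p y = rpoly q y" if "rpoly p x = rpoly q x" for p q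
    using that minp_dvd[of "p - q" x] minp_dvd[of "p - q" y] y by (simp add: rpoly_diff)
  define \<sigma> where "\<sigma> = restrict (\<lambda>z. rpoly (SOME p. rpoly p x = z) y) (qadj x)"
  have \<sigma>: "\<sigma> (rpoly p x) = rpoly p y" for p
  proof -
    have "rpoly (SOME q. rpoly q x = rpoly p x) x = rpoly p x" by (rule someI) simp
    then show ?thesis by (auto simp: \<sigma>_def qadj_def intro: eq)
  qed
  have "\<sigma> \<in> Emb (qadj x)"
  proof -
    have "\<sigma> 1 = 1" using \<sigma>[of 1] by simp
    moreover have "\<sigma> (rpoly p x + rpoly q x) = \<sigma> (rpoly p x) + \<sigma> (rpoly q x)" for p q
      by (simp add: \<sigma> rpoly_add[symmetric])
    moreover have "\<sigma> (rpoly p x * rpoly q x) = \<sigma> (rpoly p x) * \<sigma> (rpoly q x)" for p q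
      by (simp add: \<sigma> rpoly_mult[symmetric])
    ultimately show ?thesis unfolding Emb_def by (auto simp: qadj_def \<sigma>_def)
  qed
  moreover have "\<sigma> x = y" using \<sigma>[of "[:0, 1:]"] by simp
  ultimately show "\<exists>\<sigma>\<in>Emb (qadj x). y = \<sigma> x" by blast
qed

lemma finite_Emb: "number_field K \<Longrightarrow> finite (Emb K)"
  using number_field_primitive[of K] bij_betw_finite[OF bij_Emb_qadj] finite_conjs by metis

lemma card_Emb: "number_field K \<Longrightarrow> card (Emb K) = QV.dim K"
  using number_field_primitive[of K] bij_betw_same_card[OF bij_Emb_qadj] card_conjs dim_qadj by metis

lemma number_fieldD: "number_field K \<Longrightarrow> is_subfield K"
  by (simp add: number_field_iff)

lemma restrict_Emb:
  assumes "is_subfield K" "K \<subseteq> L" "\<tau> \<in> Emb L" shows "restrict \<tau> K \<in> Emb K"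
  using assms is_subfieldD[OF assms(1)] by (auto simp: Emb_def subset_iff)

text \<open>Let \<open>k\<close> be the degree over \<open>K\<close> of a generator \<open>x\<close>
  of \<open>L\<close>. A fibre has at most \<open>k\<close> elements, because \<open>x\<close> must
  go to a root of the transported relative minimal polynomial. The products g^i x^j are independent,
  so [L:Q] is at least [K:Q] k. Since [L:Q] embeddings are spread over [K:Q] fibres, every fibre has
  exactly \<open>k\<close>.\<close>

lemma Emb_fibre:
  assumes K: "number_field K" and L: "number_field L" and KL: "K \<subseteq> L"
  shows "\<exists>k. QV.dim L = QV.dim K * k \<and> (\<forall>\<sigma>\<in>Emb K. card {\<tau> \<in> Emb L. restrict \<tau> K = \<sigma>} = k)"
proof -
  obtain x where x: "L = qadj x" using number_field_primitive[OF L] by blast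
  obtain g where g: "K = qadj g" using number_field_primitive[OF K] by blast
  have K': "is_subfield K" and L': "is_subfield L" using K L by (auto simp: number_fieldD)
  have xL: "x \<in> L" using qadj_self x by simp
  obtain m where m: "poly_over K m" "Polynomial.lead_coeff m = 1" "poly m x = 0"
    "\<And>p. poly_over K p \<Longrightarrow> p \<noteq> 0 \<Longrightarrow> poly p x = 0 \<Longrightarrow> Polynomial.degree m \<le> Polynomial.degree p"
    using ex_relative_minp[OF K', of x] by blast
  define k where "k = Polynomial.degree m"
  define e where "e = QV.dim K"
  have e: "e = Polynomial.degree (minp g)" by (simp add: e_def g dim_qadj)
  have le1: "e * k \<le> QV.dim L"
  proof -
    have "card ({..<e} \<times> {..<k}) \<le> QV.dim L"
    proof (rule QV_card_le_dim[OF L])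
      show "(case ij of (i, j) \<Rightarrow> g ^ i * x ^ j) \<in> L" if "ij \<in> {..<e} \<times> {..<k}" for ij
        using KL xL qadj_self[of g] g
        by (auto split: prod.split intro!: is_subfieldD(4)[OF L'] is_subfield_power[OF L'])
      fix c ij assume 0: "(\<Sum>ij\<in>{..<e} \<times> {..<k}. of_rat (c ij) * (case ij of (i, j) \<Rightarrow> g ^ i * x ^ j)) = 0"
        and ij: "ij \<in> {..<e} \<times> {..<k}"
      define s where "s j = (\<Sum>i<e. of_rat (c (i, j)) * g ^ i)" for j
      define P where "P = (\<Sum>j<k. Polynomial.monom (s j) j)"
      have coeffP: "Polynomial.coeff P j = (if j < k then s j else 0)" for j
        by (simp add: P_def coeff_sum)
      have sK: "s j \<in> K" for j unfolding s_def using qadj_self[of g] g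
        by (intro is_subfield_sum[OF K'] is_subfieldD(4)[OF K'] is_subfield_of_rat[OF K'] is_subfield_power[OF K']) auto
      have "poly P x = (\<Sum>j<k. s j * x ^ j)" by (simp add: P_def poly_sum poly_monom)
      also have "\<dots> = (\<Sum>j<k. \<Sum>i<e. of_rat (c (i, j)) * (g ^ i * x ^ j))"
        by (simp add: s_def sum_distrib_right mult.assoc)
      also have "\<dots> = (\<Sum>i<e. \<Sum>j<k. of_rat (c (i, j)) * (g ^ i * x ^ j))" by (rule sum.swap)
      also have "\<dots> = 0" using 0 by (simp add: sum.cartesian_product split_beta)
      finally have "poly P x = 0" .
      moreover have "poly_over K P" using sK is_subfieldD(1)[OF K'] by (simp add: poly_over_def coeffP)
      moreover have "Polynomial.degree P < k" if "P \<noteq> 0"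
        using leading_coeff_neq_0[OF that] coeffP by (metis (full_types))
      ultimately have "P = 0" using m(4)[of P] unfolding k_def by (metis not_le)
      obtain i j where [simp]: "ij = (i, j)" by (cases ij)
      have "s j = 0" using coeffP[of j] \<open>P = 0\<close> ij by simp
      then show "c ij = 0"
        using qadj_basis_unique[where x = g and c = "\<lambda>i. c (i, j)" and i = i] ij by (simp add: s_def e)
    qed simp
    then show ?thesis by (simp add: card_cartesian_product)
  qed
  let ?F = "\<lambda>\<sigma>. {\<tau> \<in> Emb L. restrict \<tau> K = \<sigma>}"
  have le2: "card (?F \<sigma>) \<le> k" if \<sigma>: "\<sigma> \<in> Emb K" for \<sigma>
  proof -
    define ms where "ms = (\<Sum>j\<le>k. Polynomial.monom (\<sigma> (Polynomial.coeff m j)) j)"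
    have coeff: "Polynomial.coeff ms j = (if j \<le> k then \<sigma> (Polynomial.coeff m j) else 0)" for j
      by (simp add: ms_def coeff_sum)
    have "\<sigma> 1 = 1" using \<sigma> by (simp add: Emb_def)
    then have "Polynomial.coeff ms k = 1" using m(2) by (simp add: coeff k_def)
    then have nz: "ms \<noteq> 0" by auto
    have deg: "Polynomial.degree ms \<le> k" by (rule degree_le) (simp add: coeff)
    have "inj_on (\<lambda>\<tau>. \<tau> x) (?F \<sigma>)"
      using bij_Emb_qadj[of x] unfolding x bij_betw_def by (auto intro: inj_on_subset)
    moreover have "(\<lambda>\<tau>. \<tau> x) ` ?F \<sigma> \<subseteq> {y. poly ms y = 0}"
    proof safe
      fix \<tau> assume t: "\<tau> \<in> Emb L" "\<sigma> = restrict \<tau> K"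
      interpret t: embedding L \<tau> using t L' by unfold_locales
      have coK: "Polynomial.coeff m j \<in> K" for j using m(1) by (simp add: poly_over_def)
      have "poly ms (\<tau> x) = (\<Sum>j\<le>k. \<tau> (Polynomial.coeff m j) * \<tau> x ^ j)"
        using t(2) coK by (simp add: ms_def poly_sum poly_monom)
      also have "\<dots> = \<tau> (\<Sum>j\<le>k. Polynomial.coeff m j * x ^ j)"
        using coK KL xL
        by (subst t.sum) (auto simp: t.mult t.power is_subfield_power[OF L'] subset_iff intro!: is_subfieldD(4)[OF L'])
      also have "\<dots> = 0" using m(3) t.zero by (simp add: poly_altdef k_def)
      finally show "poly ms (\<tau> x) = 0" .
    qed
    ultimately have "card (?F \<sigma>) \<le> card {y. poly ms y = 0}"
      by (rule card_inj_on_le) (rule poly_roots_finite[OF nz])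
    also have "\<dots> \<le> k" using card_poly_roots_bound[OF nz] deg by simp
    finally show ?thesis .
  qed
  have fin: "finite (Emb K)" "finite (Emb L)" using K L by (auto simp: finite_Emb)
  have total: "(\<Sum>\<sigma>\<in>Emb K. card (?F \<sigma>)) = QV.dim L"
  proof -
    have "(\<Sum>\<sigma>\<in>Emb K. card (?F \<sigma>)) = card (\<Union>\<sigma>\<in>Emb K. ?F \<sigma>)"
      using fin by (subst card_UN_disjoint) auto
    also have "(\<Union>\<sigma>\<in>Emb K. ?F \<sigma>) = Emb L" using restrict_Emb[OF K' KL] by auto
    finally show ?thesis by (simp only: card_Emb[OF L])
  qed
  have "(\<Sum>\<sigma>\<in>Emb K. k) = e * k" using card_Emb[OF K] by (simp add: e_def)
  have eq: "(\<Sum>\<sigma>\<in>Emb K. card (?F \<sigma>)) = (\<Sum>\<sigma>\<in>Emb K. k)"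
  proof (rule antisym)
    show "(\<Sum>\<sigma>\<in>Emb K. card (?F \<sigma>)) \<le> (\<Sum>\<sigma>\<in>Emb K. k)" by (rule sum_mono) (rule le2)
    show "(\<Sum>\<sigma>\<in>Emb K. k) \<le> (\<Sum>\<sigma>\<in>Emb K. card (?F \<sigma>))"
      using total le1 \<open>(\<Sum>\<sigma>\<in>Emb K. k) = e * k\<close> by linarith
  qed
  have "card (?F \<sigma>) = k" if s: "\<sigma> \<in> Emb K" for \<sigma>
  proof (rule ccontr)
    assume "card (?F \<sigma>) \<noteq> k"
    then have "card (?F \<sigma>) < k" using le2[OF s] by simp
    then have "(\<Sum>\<sigma>\<in>Emb K. card (?F \<sigma>)) < (\<Sum>\<sigma>\<in>Emb K. k)"
      using le2 s fin by (intro sum_strict_mono_ex1) auto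
    then show False using eq by simp
  qed
  then show ?thesis using eq total \<open>(\<Sum>\<sigma>\<in>Emb K. k) = e * k\<close> by (intro exI[of _ k]) (simp add: e_def)
qed

text \<open>Grouped by restriction to Q(c), where all fibres have the same size, the product is a
  power of the product of the conjugates of \<open>c\<close>.\<close>

lemma prod_Emb_rat:
  assumes K: "number_field K" and c: "c \<in> K"
  shows "(\<Prod>\<sigma>\<in>Emb K. \<sigma> c) \<in> range of_rat"
proof -
  have sub: "qadj c \<subseteq> K" using qadj_subset[OF number_fieldD[OF K] c] .
  obtain k where k: "\<And>\<rho>. \<rho> \<in> Emb (qadj c) \<Longrightarrow> card {\<sigma> \<in> Emb K. restrict \<sigma> (qadj c) = \<rho>} = k"
    using Emb_fibre[OF number_field_qadj K sub] by blast
  have "(\<Prod>\<sigma>\<in>Emb K. \<sigma> c) = (\<Prod>\<rho>\<in>Emb (qadj c). \<Prod>\<sigma> | \<sigma> \<in> Emb K \<and> restrict \<sigma> (qadj c) = \<rho>. \<sigma> c)"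
    using restrict_Emb[OF is_subfield_qadj sub] finite_Emb[OF K] finite_Emb[OF number_field_qadj]
    by (subst prod.group) auto
  also have "\<dots> = (\<Prod>\<rho>\<in>Emb (qadj c). \<rho> c ^ k)"
  proof (rule prod.cong)
    fix \<rho> assume r: "\<rho> \<in> Emb (qadj c)"
    have "(\<Prod>\<sigma> | \<sigma> \<in> Emb K \<and> restrict \<sigma> (qadj c) = \<rho>. \<sigma> c) = (\<Prod>\<sigma> | \<sigma> \<in> Emb K \<and> restrict \<sigma> (qadj c) = \<rho>. \<rho> c)"
      using qadj_self[of c] by (intro prod.cong) auto
    then show "(\<Prod>\<sigma> | \<sigma> \<in> Emb K \<and> restrict \<sigma> (qadj c) = \<rho>. \<sigma> c) = \<rho> c ^ k"
      using k[OF r] by simp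
  qed simp
  also have "\<dots> = (\<Prod>y\<in>conjs c. y) ^ k"
    using prod.reindex_bij_betw[OF bij_Emb_qadj, of "\<lambda>y. y ^ k" c] by (simp add: prod_power_distrib)
  also have "\<dots> \<in> range of_rat"
    using prod_conjs[of c] by (auto simp: of_rat_power[symmetric] simp del: of_rat_power)
  finally show ?thesis .
qed

lemma ex_normal:
  assumes K: "number_field K"
  shows "\<exists>M. number_field M \<and> K \<subseteq> M \<and> (\<forall>\<sigma>\<in>Emb K. \<sigma> ` K \<subseteq> M)"
proof -
  obtain x where x: "K = qadj x" using number_field_primitive[OF K] by blast
  obtain M where M: "number_field M" "conjs x \<subseteq> M" "K \<subseteq> M"
    using ex_number_field[OF finite_conjs K] by blast
  have "\<sigma> y \<in> M" if "\<sigma> \<in> Emb K" "y \<in> K" for \<sigma> y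
  proof -
    interpret embedding K \<sigma> using that number_fieldD[OF K] by unfold_locales
    have "y \<in> qadj x" using that x by simp
    then obtain p where p: "y = rpoly p x" by (auto simp: qadj_def)
    have "\<sigma> x \<in> M" using bij_betwE[OF bij_Emb_qadj, of x] that M x by auto
    then show ?thesis using rpoly[of x p] qadj_self[of x] x p rpoly_in[OF number_fieldD[OF M(1)]] by simp
  qed
  then show ?thesis using M by (intro exI[of _ M]) auto
qed

text \<open>Evaluated on powers of a primitive element \<open>x\<close>, the relation extends to all
  polynomials in the values of \<open>x\<close>. The polynomial that vanishes at all conjugates
  except \<sigma>0(x) isolates one coefficient.\<close>

lemma Emb_independent:
  assumes K: "number_field K" and "\<And>x. x \<in> K \<Longrightarrow> (\<Sum>\<sigma>\<in>Emb K. c \<sigma> * \<sigma> x) = 0" and s: "\<sigma>0 \<in> Emb K"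
  shows "c \<sigma>0 = 0"
proof -
  obtain x where x: "K = qadj x" using number_field_primitive[OF K] by blast
  have xK: "x \<in> K" using qadj_self x by simp
  have pw: "(\<Sum>\<sigma>\<in>Emb K. c \<sigma> * \<sigma> x ^ n) = 0" for n
  proof -
    have "(\<Sum>\<sigma>\<in>Emb K. c \<sigma> * \<sigma> x ^ n) = (\<Sum>\<sigma>\<in>Emb K. c \<sigma> * \<sigma> (x ^ n))"
    proof (rule sum.cong)
      fix \<sigma> assume "\<sigma> \<in> Emb K"
      then interpret embedding K \<sigma> using number_fieldD[OF K] by unfold_locales
      show "c \<sigma> * \<sigma> x ^ n = c \<sigma> * \<sigma> (x ^ n)" using power[OF xK] by simp
    qed simp
    also have "\<dots> = 0" by (rule assms(2)) (rule is_subfield_power[OF number_fieldD[OF K] xK])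
    finally show ?thesis .
  qed
  have poly: "(\<Sum>\<sigma>\<in>Emb K. c \<sigma> * poly p (\<sigma> x)) = 0" for p
  proof -
    have "(\<Sum>\<sigma>\<in>Emb K. c \<sigma> * poly p (\<sigma> x)) = (\<Sum>i\<le>Polynomial.degree p. Polynomial.coeff p i * (\<Sum>\<sigma>\<in>Emb K. c \<sigma> * \<sigma> x ^ i))"
      unfolding poly_altdef sum_distrib_left by (subst sum.swap) (simp add: mult_ac)
    then show ?thesis by (simp add: pw)
  qed
  define p where "p = (\<Prod>y\<in>conjs x - {\<sigma>0 x}. [:- y, 1:])"
  have inj: "\<sigma> x = \<sigma>0 x \<longleftrightarrow> \<sigma> = \<sigma>0" if "\<sigma> \<in> Emb K" for \<sigma>
    using bij_betw_imp_inj_on[OF bij_Emb_qadj, of x] that s x by (auto dest: inj_onD)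
  have "poly p (\<sigma> x) = 0" if "\<sigma> \<in> Emb K - {\<sigma>0}" for \<sigma>
    using that inj bij_betwE[OF bij_Emb_qadj, of x] x finite_conjs[of x] by (auto simp: p_def poly_prod)
  then have "(\<Sum>\<sigma>\<in>Emb K. c \<sigma> * poly p (\<sigma> x)) = c \<sigma>0 * poly p (\<sigma>0 x)"
    using finite_Emb[OF K] s by (subst sum.remove[of _ \<sigma>0]) auto
  moreover have "poly p (\<sigma>0 x) \<noteq> 0" using finite_conjs[of x] by (auto simp: p_def poly_prod)
  ultimately show ?thesis using poly[of p] by simp
qed

section \<open>Places above a fixed absolute value of the rationals\<close>

locale abs_value_on =
  fixes K :: "qbar set" and v :: "qbar \<Rightarrow> real"
  assumes K: "is_subfield K" and v: "is_abs_value K v"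
begin

lemma nonneg: "x \<in> K \<Longrightarrow> 0 \<le> v x"
  and zero_iff: "x \<in> K \<Longrightarrow> v x = 0 \<longleftrightarrow> x = 0"
  and mult: "x \<in> K \<Longrightarrow> y \<in> K \<Longrightarrow> v (x * y) = v x * v y"
  and triangle: "x \<in> K \<Longrightarrow> y \<in> K \<Longrightarrow> v (x + y) \<le> v x + v y"
  using v by (auto simp: is_abs_value_def)

lemma zero: "v 0 = 0"
  using zero_iff is_subfieldD[OF K] by blast

lemma pos: "x \<in> K \<Longrightarrow> x \<noteq> 0 \<Longrightarrow> 0 < v x"
  using nonneg zero_iff by (metis less_le)

lemma one: "v 1 = 1"
  using mult[of 1 1] pos[of 1] is_subfieldD[OF K] by simp

lemma minus: assumes "x \<in> K" shows "v (- x) = v x"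
proof -
  have "v (-1) * v (-1) = 1" using mult[of "-1" "-1"] is_subfieldD[OF K] one by simp
  then have "v (-1) = 1" using nonneg[of "-1"] is_subfieldD[OF K] by (simp add: square_eq_1_iff)
  then show ?thesis using mult[of "-1" x] is_subfieldD[OF K] assms by simp
qed

lemma diff: "x \<in> K \<Longrightarrow> y \<in> K \<Longrightarrow> v (x - y) \<le> v x + v y"
  using triangle[of x "- y"] minus[of y] is_subfieldD(5)[OF K] by simp

lemma diff_ge: "x \<in> K \<Longrightarrow> y \<in> K \<Longrightarrow> v x - v y \<le> v (x - y)"
  using triangle[of "x - y" y] is_subfield_diff[OF K] by simp

lemma commute: "x \<in> K \<Longrightarrow> y \<in> K \<Longrightarrow> v (x - y) = v (y - x)"
  using minus[of "x - y"] is_subfield_diff[OF K] by simp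

lemma inverse: "x \<in> K \<Longrightarrow> v (inverse x) = inverse (v x)"
proof (cases "x = 0")
  case False
  assume x: "x \<in> K"
  then have "v x * v (inverse x) = 1" using mult[of x "inverse x"] is_subfieldD[OF K] one False by simp
  then show ?thesis by (metis inverse_unique)
qed (simp add: zero)

lemma divide: "x \<in> K \<Longrightarrow> y \<in> K \<Longrightarrow> v (x / y) = v x / v y"
  using mult[of x "inverse y"] inverse[of y] is_subfieldD(6)[OF K] by (simp add: divide_inverse)

lemma power: "x \<in> K \<Longrightarrow> v (x ^ n) = v x ^ n"
  by (induction n) (auto simp: one mult is_subfield_power[OF K])

lemma sum_le: "(\<And>i. i \<in> I \<Longrightarrow> f i \<in> K) \<Longrightarrow> v (sum f I) \<le> (\<Sum>i\<in>I. v (f i))"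
proof (induction I rule: infinite_finite_induct)
  case (insert i I)
  have "v (f i + sum f I) \<le> v (f i) + v (sum f I)"
    by (rule triangle) (use insert is_subfield_sum[OF K, of I f] in auto)
  with insert show ?case by fastforce
qed (simp_all add: zero)

lemma prod: "(\<And>i. i \<in> I \<Longrightarrow> f i \<in> K) \<Longrightarrow> v (prod f I) = (\<Prod>i\<in>I. v (f i))"
  by (induction I rule: infinite_finite_induct) (auto simp: one mult is_subfield_prod[OF K])

end

text \<open>The rational absolute value stays a parameter, so that archimedean and p-adic places
  share all arguments about local degrees.\<close>

definition places_over :: "(rat \<Rightarrow> real) \<Rightarrow> qbar set \<Rightarrow> (qbar \<Rightarrow> real) set" where
  "places_over a K = {v \<in> extensional K. is_abs_value K v \<and> (\<forall>q. v (of_rat q) = a q)}"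

lemma places_overD:
  assumes "v \<in> places_over a K"
  shows "v \<in> extensional K" "is_abs_value K v" "v (of_rat q) = a q"
  using assms by (auto simp: places_over_def)

lemma ex_place:
  assumes "number_field M" "rat_abs a" shows "\<exists>w. w \<in> places_over a M"
proof -
  obtain B where "is_subfield M" "finite B" "QV.independent B" "QV.span B = M"
    using assms by (auto simp: number_field_iff)
  from ex_abs_value_extension[OF assms(2) this] obtain w where w: "(\<forall>x\<in>M. 0 \<le> w x \<and> (w x = 0 \<longleftrightarrow> x = 0)) \<and>
     (\<forall>x\<in>M. \<forall>y\<in>M. w (x * y) = w x * w y \<and> w (x + y) \<le> w x + w y) \<and> (\<forall>q. w (of_rat q) = a q)"
    by (elim exE)
  then have "restrict w M \<in> places_over a M"
    using \<open>is_subfield M\<close> by (auto simp: places_over_def is_abs_value_def is_subfieldD is_subfield_of_rat)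
  then show ?thesis by blast
qed

lemma place_comp_Emb:
  assumes K: "is_subfield K" and M: "is_subfield M" and w: "w \<in> places_over a M"
    and s: "\<sigma> \<in> Emb K" "\<sigma> ` K \<subseteq> M"
  shows "restrict (w \<circ> \<sigma>) K \<in> places_over a K"
proof -
  interpret embedding K \<sigma> using K s by unfold_locales
  interpret w: abs_value_on M w using M places_overD[OF w] by unfold_locales
  have sM: "\<sigma> x \<in> M" if "x \<in> K" for x using s that by blast
  have "\<sigma> x = 0 \<longleftrightarrow> x = 0" if "x \<in> K" for x using nonzero[OF that] zero by blast
  then show ?thesis
    using sM by (auto simp: places_over_def is_abs_value_def is_subfieldD[OF K] is_subfield_of_rat[OF K]
        add mult of_rat w.nonneg w.zero_iff w.mult w.triangle places_overD(3)[OF w])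
qed

text \<open>Linear independence over the completion of the rationals, expressed inside \<open>K\<close>.\<close>

definition strongly_independent :: "(rat \<Rightarrow> real) \<Rightarrow> (qbar \<Rightarrow> real) \<Rightarrow> qbar set \<Rightarrow> bool" where
  "strongly_independent a v B \<longleftrightarrow> finite B \<and>
     (\<exists>e>0. \<forall>c. \<forall>b\<in>B. e * a (c b) \<le> v (\<Sum>b\<in>B. of_rat (c b) * b))"

text \<open>For a strongly independent \<open>B\<close> this amounts to spanning the completion of
  \<open>K\<close> over the completion of the rationals.\<close>

definition dense_span :: "qbar set \<Rightarrow> (qbar \<Rightarrow> real) \<Rightarrow> qbar set \<Rightarrow> bool" where
  "dense_span K v B \<longleftrightarrow> (\<forall>x\<in>K. \<forall>d>0. \<exists>c. v (x - (\<Sum>b\<in>B. of_rat (c b) * b)) < d)"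

locale places_above =
  fixes K :: "qbar set" and a :: "rat \<Rightarrow> real"
  assumes nf: "number_field K" and a: "rat_abs a" and nontrivial: "\<exists>q. 0 < a q \<and> a q < 1"
begin

lemma K: "is_subfield K"
  by (rule number_fieldD[OF nf])

lemma abs_value: "v \<in> places_over a K \<Longrightarrow> abs_value_on K v"
  using K places_overD(2) by unfold_locales

lemma comb_in: "B \<subseteq> K \<Longrightarrow> (\<Sum>b\<in>B. of_rat (c b) * b) \<in> K"
  by (intro is_subfield_sum[OF K] is_subfieldD(4)[OF K] is_subfield_of_rat[OF K]) auto

lemma strongly_independent_card:
  assumes v: "v \<in> places_over a K" and B: "strongly_independent a v B" "B \<subseteq> K"
  shows "card B \<le> QV.dim K"
proof (rule QV_card_le_dim[OF nf, where u = "\<lambda>b. b"])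
  interpret abs_value_on K v by (rule abs_value[OF v])
  fix c b assume 0: "(\<Sum>b\<in>B. of_rat (c b) * b) = 0" and b: "b \<in> B"
  obtain e where "e > 0" "e * a (c b) \<le> v (\<Sum>b\<in>B. of_rat (c b) * b)"
    using B b unfolding strongly_independent_def by blast
  then have "a (c b) \<le> 0" using 0 zero by (simp add: mult_le_0_iff)
  then show "c b = 0" using rat_absD(1,2)[OF a, of "c b"] by simp
qed (use B in \<open>auto simp: strongly_independent_def\<close>)

text \<open>A strongly independent set of largest size works. Adding a new \<open>x\<close> destroys
  strong independence, so for each threshold \<open>t\<close> there is a relatively small
  combination; divided by its coefficient at \<open>x\<close>, it becomes an approximation of
  \<open>x\<close>.\<close>

lemma ex_strongly_independent_dense:
  assumes vP: "v \<in> places_over a K"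
  shows "\<exists>B. B \<subseteq> K \<and> strongly_independent a v B \<and> dense_span K v B"
proof -
  interpret abs_value_on K v by (rule abs_value[OF vP])
  let ?P = "\<lambda>B. B \<subseteq> K \<and> strongly_independent a v B"
  have "?P {}" by (auto simp: strongly_independent_def intro: exI[of _ 1])
  moreover have "\<forall>B. ?P B \<longrightarrow> card B < Suc (QV.dim K)" using strongly_independent_card[OF vP] by (metis le_imp_less_Suc)
  ultimately obtain B where B: "?P B" "\<And>B'. ?P B' \<Longrightarrow> card B' \<le> card B"
    using ex_has_greatest_nat[of ?P "{}" card "Suc (QV.dim K)"] by blast
  obtain e where e: "e > 0" "\<And>c b. b \<in> B \<Longrightarrow> e * a (c b) \<le> v (\<Sum>b\<in>B. of_rat (c b) * b)"
    and fin: "finite B" using B(1) unfolding strongly_independent_def by blast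
  have "\<exists>c. v (x - (\<Sum>b\<in>B. of_rat (c b) * b)) < d" if x: "x \<in> K" and d: "d > 0" for x d
  proof (cases "x \<in> B")
    case True
    have "(\<Sum>b\<in>B. of_rat (if b = x then 1 else 0) * b) = (\<Sum>b\<in>{x}. of_rat (if b = x then 1 else 0) * b)"
      using True fin by (intro sum.mono_neutral_right) auto
    then have "v (x - (\<Sum>b\<in>B. of_rat (if b = x then 1 else 0) * b)) < d" using d zero by simp
    then show ?thesis by (rule exI[where x = "\<lambda>b. if b = x then 1 else 0"])
  next
    case False
    have "\<not> ?P (insert x B)" using B(2)[of "insert x B"] False fin by fastforce
    then have nsi: "\<not> strongly_independent a v (insert x B)" using B(1) x by simp
    \<comment> \<open>The bound \<open>d\<close> settles the case \<open>b0 = x\<close>. For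
      \<open>b0\<close> in \<open>B\<close>, the bound \<open>e / 2\<close> lets strong independence
      of \<open>B\<close> estimate \<open>a (c b0)\<close> by the coefficient of \<open>x\<close>,
      and the third bound turns this estimate into the error \<open>d\<close>.\<close>
    define t where "t = min (e / 2) (min d (d * e / (2 * (v x + 1))))"
    have vx: "0 \<le> v x" by (rule nonneg[OF x])
    have t: "t > 0" using e(1) d vx by (simp add: t_def)
    obtain c b0 where b0: "b0 \<in> insert x B" "v (\<Sum>b\<in>insert x B. of_rat (c b) * b) < t * a (c b0)"
      using nsi fin t unfolding strongly_independent_def by (meson finite_insert not_le)
    define y where "y = (\<Sum>b\<in>B. of_rat (c b) * b)"
    have yK: "y \<in> K" using B(1) by (simp add: y_def comb_in)
    have cx: "of_rat (c x) * x \<in> K" using x by (simp add: is_subfieldD[OF K] is_subfield_of_rat[OF K])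
    have s: "v (of_rat (c x) * x + y) < t * a (c b0)"
      using b0(2) False fin by (simp add: y_def)
    have vcx: "v (of_rat (c x) * x) = a (c x) * v x"
      using x by (simp add: mult is_subfield_of_rat[OF K] places_overD(3)[OF vP])
    have t1: "t \<le> e / 2" and t2: "t \<le> d" and "t \<le> d * e / (2 * (v x + 1))"
      unfolding t_def by (rule min.cobounded1, rule min.coboundedI2[OF min.cobounded1], rule min.coboundedI2[OF min.cobounded2])
    then have t3: "t * (2 * (v x + 1)) \<le> d * e" using vx by (simp add: pos_le_divide_eq)
    have ax: "0 \<le> a (c x)" "0 \<le> a (c b0)" using rat_absD(1)[OF a] by auto
    have bound: "t * a (c b0) \<le> a (c x) * d"
    proof (cases "b0 = x")
      case True
      then show ?thesis using mult_right_mono[OF t2 ax(1)] by (simp add: mult.commute)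
    next
      case False
      then have "e * a (c b0) \<le> v y" using e(2) b0(1) by (simp add: y_def)
      also have "v y \<le> v (of_rat (c x) * x + y) + v (of_rat (c x) * x)"
        using diff[of "of_rat (c x) * x + y" "of_rat (c x) * x"] cx yK is_subfieldD(3)[OF K] by simp
      also have "\<dots> \<le> e / 2 * a (c b0) + a (c x) * v x"
        using s vcx mult_right_mono[OF t1 ax(2)] by linarith
      finally have "e * a (c b0) \<le> 2 * a (c x) * v x" by (simp add: field_simps)
      then have "t * (e * a (c b0)) \<le> t * (2 * a (c x) * v x)" using t by (intro mult_left_mono) auto
      also have "\<dots> \<le> a (c x) * (t * (2 * (v x + 1)))"
        using ax t by (simp add: algebra_simps)
      also have "\<dots> \<le> a (c x) * (d * e)" using t3 ax by (intro mult_left_mono) auto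
      finally have "e * (t * a (c b0)) \<le> e * (a (c x) * d)" by (simp add: mult_ac)
      then show ?thesis using e(1) by simp
    qed
    have "0 \<le> v (of_rat (c x) * x + y)" using cx yK by (intro nonneg is_subfieldD(3)[OF K])
    then have "0 < a (c x) * d" using s bound by linarith
    then have A: "0 < a (c x)" using d ax by (simp add: zero_less_mult_iff)
    then have "c x \<noteq> 0" using rat_absD(2)[OF a, of "c x"] by auto
    then have cx0: "(of_rat (c x) :: qbar) \<noteq> 0" by simp
    have sum_eq: "(\<Sum>b\<in>B. of_rat (- c b / c x) * b) = - (y / of_rat (c x))"
      by (simp add: y_def of_rat_divide of_rat_minus sum_divide_distrib sum_negf)
    have "x - (\<Sum>b\<in>B. of_rat (- c b / c x) * b) = (of_rat (c x) * x + y) / of_rat (c x)"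
      unfolding sum_eq using cx0 by (simp add: add_divide_distrib)
    then have "v (x - (\<Sum>b\<in>B. of_rat (- c b / c x) * b)) = v (of_rat (c x) * x + y) / a (c x)"
      using cx yK by (simp add: divide is_subfieldD(3)[OF K] is_subfield_of_rat[OF K] places_overD(3)[OF vP])
    also have "\<dots> < d" using s bound A by (simp add: pos_divide_less_eq mult.commute)
    finally show ?thesis by (rule exI[where x = "\<lambda>b. - c b / c x"])
  qed
  then show ?thesis using B(1) unfolding dense_span_def by blast
qed

lemma dense_span_nonempty: "v \<in> places_over a K \<Longrightarrow> dense_span K v B \<Longrightarrow> B \<noteq> {}"
proof
  assume v: "v \<in> places_over a K" and d: "dense_span K v B" and "B = {}"
  interpret abs_value_on K v by (rule abs_value[OF v])
  have "v (1 - 0) < 1" using d is_subfieldD(2)[OF K] \<open>B = {}\<close> unfolding dense_span_def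
    by (metis sum.empty zero_less_one)
  then show False using one by simp
qed

text \<open>Start from some \<open>y\<close> with w(y) < v(y). For large \<open>n\<close> the
  quotient of v(y^n) and w(y^n) exceeds t = 1/a(q), so an integer power of \<open>t\<close> fits
  between them. A power of \<open>q\<close>, whose size is the same at both places, moves that value
  to 1.\<close>

lemma ex_greater:
  assumes v: "v \<in> places_over a K" and w: "w \<in> places_over a K" and "v \<noteq> w"
  shows "\<exists>x\<in>K. 1 < v x \<and> w x < 1"
proof -
  interpret v: abs_value_on K v by (rule abs_value[OF v])
  interpret w: abs_value_on K w by (rule abs_value[OF w])
  obtain y0 where y0: "y0 \<in> K" "v y0 \<noteq> w y0"
    using extensionalityI[OF places_overD(1)[OF v] places_overD(1)[OF w]] \<open>v \<noteq> w\<close> by blast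
  have y00: "y0 \<noteq> 0" using y0 v.zero w.zero by auto
  have "\<exists>y\<in>K. y \<noteq> 0 \<and> w y < v y"
  proof (cases "w y0 < v y0")
    case False
    then have "v y0 < w y0" using y0 by simp
    then have "w (inverse y0) < v (inverse y0)"
      using y0 y00 v.inverse w.inverse v.pos by (simp add: less_imp_inverse_less)
    then show ?thesis using y0 y00 is_subfieldD(6)[OF K] by (intro bexI[of _ "inverse y0"]) auto
  qed (use y0 y00 in auto)
  then obtain y where y: "y \<in> K" "y \<noteq> 0" "w y < v y" by blast
  obtain q where q: "0 < a q" "a q < 1" using nontrivial by blast
  define t where "t = 1 / a q"
  have t: "1 < t" using q by (simp add: t_def)
  have wy: "0 < w y" using w.pos y by simp
  then have "1 < v y / w y" using y by simp
  then obtain n where n: "t < (v y / w y) ^ n" using real_arch_pow by blast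
  define m where "m = \<lfloor>log t (w y ^ n)\<rfloor> + 1"
  have 1: "w y ^ n < t powr m"
  proof -
    have "w y ^ n = t powr (log t (w y ^ n))" using t wy by simp
    also have "\<dots> < t powr m"
    proof (rule powr_less_mono[OF _ t])
      show "log t (w y ^ n) < m" unfolding m_def by linarith
    qed
    finally show ?thesis .
  qed
  have 2: "t powr m < v y ^ n"
  proof -
    have "t powr m \<le> t powr (log t (w y ^ n) + 1)" using t by (intro powr_mono) (auto simp: m_def)
    also have "\<dots> = t * w y ^ n" using t wy by (simp add: powr_add)
    also have "\<dots> < v y ^ n" using n wy by (simp add: power_divide pos_less_divide_eq)
    finally show ?thesis .
  qed
  have apow: "a (q ^ k) = a q ^ k" for k by (induction k) (simp_all add: rat_absD[OF a])
  have "\<exists>p. a p = t powr (- m)"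
  proof (cases "m \<ge> 0")
    case True
    have "a (q ^ nat m) = t powr (- m)"
      using True q by (simp add: apow t_def powr_minus powr_realpow[symmetric] powr_divide inverse_eq_divide)
    then show ?thesis by blast
  next
    case False
    have "a (inverse q ^ k) * a (q ^ k) = 1" for k
      using q rat_absD(2)[OF a, of q] by (auto simp: rat_absD(3)[OF a, symmetric] power_mult_distrib[symmetric] rat_absD(5)[OF a])
    then have "a (inverse q ^ nat (- m)) = 1 / a q ^ nat (- m)"
      using q by (simp add: apow eq_divide_eq)
    also have "\<dots> = t powr (- m)"
      using False q by (simp add: t_def powr_realpow[symmetric] powr_divide)
    finally show ?thesis by blast
  qed
  then obtain p where p: "a p = t powr (- m)" by blast
  let ?x = "y ^ n * of_rat p"
  have xK: "y ^ n \<in> K" "of_rat p \<in> K" using y K by (auto intro: is_subfield_power is_subfield_of_rat)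
  have "v ?x = v y ^ n / t powr m"
    using xK y by (simp add: v.mult v.power places_overD(3)[OF v] p powr_minus divide_inverse)
  moreover have "w ?x = w y ^ n / t powr m"
    using xK y by (simp add: w.mult w.power places_overD(3)[OF w] p powr_minus divide_inverse)
  ultimately have "1 < v ?x" "w ?x < 1" using 1 2 t by (auto simp: pos_less_divide_eq pos_divide_less_eq)
  then show ?thesis using xK is_subfieldD(4)[OF K] by blast
qed

text \<open>The sequence x^n / (1 + x^n) acts as a switch: near 1 at places where \<open>x\<close>
  is larger than 1, near 0 (by \<open>tendsto_zero\<close>) where it is smaller.\<close>

lemma tendsto_one:
  assumes v: "v \<in> places_over a K" and x: "x \<in> K" "1 < v x"
  shows "(\<lambda>n. v (1 - x ^ n / (1 + x ^ n))) \<longlonglongrightarrow> 0" "(\<lambda>n. v (x ^ n / (1 + x ^ n))) \<longlonglongrightarrow> 1"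
    "\<And>n. n > 0 \<Longrightarrow> 1 + x ^ n \<noteq> 0"
proof -
  interpret abs_value_on K v by (rule abs_value[OF v])
  have xn: "x ^ n \<in> K" for n using x K by (simp add: is_subfield_power)
  have big: "1 < v (x ^ n)" if "n > 0" for n using x that by (simp add: power one_less_power)
  show nz: "1 + x ^ n \<noteq> 0" if "n > 0" for n
  proof
    assume "1 + x ^ n = 0"
    then have "x ^ n = - 1" by (simp add: add_eq_0_iff)
    then have "v (x ^ n) = 1" using minus[of 1] one is_subfieldD[OF K] by simp
    with big[OF that] show False by simp
  qed
  have yK: "x ^ n / (1 + x ^ n) \<in> K" for n
    using xn by (intro is_subfield_divide[OF K] is_subfieldD(3)[OF K] is_subfieldD(2)[OF K]) auto
  have up: "v (1 - x ^ n / (1 + x ^ n)) \<le> 1 / (v x ^ n - 1)" if "n > 0" for n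
  proof -
    have "1 - x ^ n / (1 + x ^ n) = 1 / (1 + x ^ n)" using nz[OF that] by (simp add: field_simps)
    then have "v (1 - x ^ n / (1 + x ^ n)) = 1 / v (1 + x ^ n)"
      using xn is_subfieldD[OF K] by (simp add: divide one)
    also have "\<dots> \<le> 1 / (v x ^ n - 1)"
    proof (rule divide_left_mono)
      have "v (x ^ n) - v (-1) \<le> v (x ^ n - (- 1))" using xn is_subfieldD[OF K] by (intro diff_ge) auto
      then show ge: "v x ^ n - 1 \<le> v (1 + x ^ n)"
        using minus[of 1] one is_subfieldD[OF K] x by (simp add: power add.commute)
      show "0 < v (1 + x ^ n) * (v x ^ n - 1)"
        using ge big[OF that] x by (simp add: power zero_less_mult_iff)
    qed simp
    finally show ?thesis .
  qed
  have lim: "(\<lambda>n. 1 / (v x ^ n - 1)) \<longlonglongrightarrow> 0"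
  proof -
    have l: "(\<lambda>n. inverse (v x ^ n)) \<longlonglongrightarrow> 0" by (rule LIMSEQ_inverse_realpow_zero[OF x(2)])
    have "(\<lambda>n. inverse (v x ^ n) / (1 - inverse (v x ^ n))) \<longlonglongrightarrow> 0 / (1 - 0)"
      by (rule tendsto_divide[OF l tendsto_diff[OF tendsto_const l]]) simp
    moreover have "inverse y / (1 - inverse y) = 1 / (y - 1)" if "y \<noteq> 0" for y :: real
      using that by (cases "y = 1") (auto simp: field_simps)
    ultimately show ?thesis using x(2) by simp
  qed
  show 1: "(\<lambda>n. v (1 - x ^ n / (1 + x ^ n))) \<longlonglongrightarrow> 0"
    by (rule tendsto_sandwich[OF _ _ tendsto_const lim])
      (use up yK nonneg is_subfield_diff[OF K] is_subfieldD[OF K] in \<open>auto simp: eventually_sequentially intro!: exI[of _ 1]\<close>)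
  have "\<bar>v (x ^ n / (1 + x ^ n)) - 1\<bar> \<le> v (1 - x ^ n / (1 + x ^ n))" for n
    using diff_ge[OF yK is_subfieldD(2)[OF K], of n] diff_ge[OF is_subfieldD(2)[OF K] yK, of n]
      commute[OF yK is_subfieldD(2)[OF K], of n] one by linarith
  then have "(\<lambda>n. v (x ^ n / (1 + x ^ n)) - 1) \<longlonglongrightarrow> 0"
    by (intro Lim_null_comparison[OF _ 1]) auto
  then show "(\<lambda>n. v (x ^ n / (1 + x ^ n))) \<longlonglongrightarrow> 1" by (simp add: LIM_zero_iff)
qed

lemma tendsto_zero:
  assumes v: "v \<in> places_over a K" and x: "x \<in> K" "v x < 1"
  shows "(\<lambda>n. v (x ^ n / (1 + x ^ n))) \<longlonglongrightarrow> 0"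
proof -
  interpret abs_value_on K v by (rule abs_value[OF v])
  have xn: "x ^ n \<in> K" for n using x K by (simp add: is_subfield_power)
  have vx: "0 \<le> v x" using x nonneg by simp
  have up: "v (x ^ n / (1 + x ^ n)) \<le> v x ^ n / (1 - v x ^ n)" if n: "n > 0" for n
  proof -
    have small: "v x ^ n < 1" using x vx n by (simp add: power_Suc_less_one power_less_one_iff)
    have "v 1 - v (- (x ^ n)) \<le> v (1 - - (x ^ n))"
      using xn is_subfieldD[OF K] by (intro diff_ge) auto
    then have ge: "1 - v x ^ n \<le> v (1 + x ^ n)" using xn x by (simp add: minus one power)
    have "v (x ^ n / (1 + x ^ n)) = v x ^ n / v (1 + x ^ n)"
      using xn x is_subfieldD[OF K] by (simp add: divide power)
    also have "\<dots> \<le> v x ^ n / (1 - v x ^ n)"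
      using ge small vx by (intro divide_left_mono) auto
    finally show ?thesis .
  qed
  have lim0: "(\<lambda>n. v x ^ n) \<longlonglongrightarrow> 0" using x vx by (intro LIMSEQ_realpow_zero) auto
  have "(\<lambda>n. v x ^ n / (1 - v x ^ n)) \<longlonglongrightarrow> 0 / (1 - 0)"
    by (rule tendsto_divide[OF lim0 tendsto_diff[OF tendsto_const lim0]]) simp
  then have lim: "(\<lambda>n. v x ^ n / (1 - v x ^ n)) \<longlonglongrightarrow> 0" by simp
  have yK: "x ^ n / (1 + x ^ n) \<in> K" for n
    using xn by (intro is_subfield_divide[OF K] is_subfieldD(3)[OF K] is_subfieldD(2)[OF K]) auto
  show ?thesis
    by (rule tendsto_sandwich[OF _ _ tendsto_const lim])
      (use up yK nonneg in \<open>auto simp: eventually_sequentially intro!: exI[of _ 1]\<close>)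
qed

text \<open>Induction on the set of places. If the old element satisfies w(x) \<le> 1 at the new
  place, then x^n y works for large \<open>n\<close>. Otherwise the switch x^n / (1 + x^n) replaces
  x^n: it tends to 1 at \<open>v\<close> and \<open>w\<close> and to 0 on \<open>T\<close>.\<close>

lemma ex_separating:
  assumes v: "v \<in> places_over a K" and "finite T" "T \<subseteq> places_over a K" "v \<notin> T"
  shows "\<exists>x\<in>K. 1 < v x \<and> (\<forall>w\<in>T. w x < 1)"
  using assms(2-)
proof (induction T rule: finite_induct)
  case empty
  interpret v: abs_value_on K v by (rule abs_value[OF v])
  obtain q where q: "0 < a q" "a q < 1" using nontrivial by blast
  have "1 < v (inverse (of_rat q))"
    using q v.inverse[OF is_subfield_of_rat[OF K]] by (simp add: places_overD(3)[OF v] one_less_inverse)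
  then show ?case using is_subfieldD(6)[OF K] is_subfield_of_rat[OF K] by blast
next
  case (insert w T)
  interpret v: abs_value_on K v by (rule abs_value[OF v])
  have w: "w \<in> places_over a K" using insert.prems by auto
  interpret w: abs_value_on K w by (rule abs_value[OF w])
  have T: "u \<in> places_over a K" if "u \<in> T" for u using that insert.prems by auto
  obtain x where x: "x \<in> K" "1 < v x" "\<And>u. u \<in> T \<Longrightarrow> u x < 1" using insert by auto
  obtain y where y: "y \<in> K" "1 < v y" "w y < 1" using ex_greater[OF v w] insert.prems by auto
  have xn: "x ^ n \<in> K" for n using x K by (simp add: is_subfield_power)
  have yn: "x ^ n / (1 + x ^ n) \<in> K" for n
    using xn by (intro is_subfield_divide[OF K] is_subfieldD(3)[OF K] is_subfieldD(2)[OF K]) auto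
  show ?case
  proof (cases "w x \<le> 1")
    case True
    have "\<forall>\<^sub>F n in sequentially. \<forall>u\<in>T. u (x ^ n * y) < 1"
    proof (rule eventually_ball_finite[OF insert.hyps(1)], rule ballI)
      fix u assume u: "u \<in> T"
      interpret u: abs_value_on K u by (rule abs_value[OF T[OF u]])
      have "(\<lambda>n. u x ^ n * u y) \<longlonglongrightarrow> 0 * u y"
        using x(3)[OF u] u.nonneg[OF x(1)] by (intro tendsto_intros LIMSEQ_realpow_zero) auto
      then have "\<forall>\<^sub>F n in sequentially. u x ^ n * u y < 1" by (intro order_tendstoD) auto
      then show "\<forall>\<^sub>F n in sequentially. u (x ^ n * y) < 1"
        using u.mult[OF xn y(1)] u.power[OF x(1)] by simp
    qed
    then obtain n where n: "\<And>u. u \<in> T \<Longrightarrow> u (x ^ n * y) < 1" by (auto simp: eventually_sequentially)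
    have "1 < v (x ^ n * y)"
    proof -
      have "1 * v y \<le> v x ^ n * v y" using x y by (intro mult_right_mono one_le_power) auto
      then have "1 < v x ^ n * v y" using y(2) by linarith
      then show ?thesis using x y by (simp only: v.mult[OF xn] v.power)
    qed
    moreover have "w (x ^ n * y) < 1"
    proof -
      have "w x ^ n * w y \<le> 1 * w y"
        using True w.nonneg x y by (intro mult_right_mono power_le_one) auto
      then show ?thesis using y by (simp add: w.mult[OF xn] w.power x)
    qed
    ultimately show ?thesis using n is_subfieldD(4)[OF K xn y(1)] by (intro bexI[of _ "x ^ n * y"]) auto
  next
    case False
    have "(\<lambda>n. v (x ^ n / (1 + x ^ n)) * v y) \<longlonglongrightarrow> 1 * v y"
      by (intro tendsto_intros tendsto_one v x)
    then have 1: "\<forall>\<^sub>F n in sequentially. 1 < v (x ^ n / (1 + x ^ n) * y)"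
      using y(2) order_tendstoD(1)[of _ "v y" sequentially 1] v.mult[OF yn y(1)] by simp
    have "(\<lambda>n. w (x ^ n / (1 + x ^ n)) * w y) \<longlonglongrightarrow> 1 * w y"
      using False by (intro tendsto_intros tendsto_one w x) auto
    then have 2: "\<forall>\<^sub>F n in sequentially. w (x ^ n / (1 + x ^ n) * y) < 1"
      using y(3) order_tendstoD(2)[of _ "w y" sequentially 1] w.mult[OF yn y(1)] by simp
    have 3: "\<forall>\<^sub>F n in sequentially. \<forall>u\<in>T. u (x ^ n / (1 + x ^ n) * y) < 1"
    proof (rule eventually_ball_finite[OF insert.hyps(1)], rule ballI)
      fix u assume u: "u \<in> T"
      interpret u: abs_value_on K u by (rule abs_value[OF T[OF u]])
      have "(\<lambda>n. u (x ^ n / (1 + x ^ n)) * u y) \<longlonglongrightarrow> 0 * u y"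
        by (intro tendsto_intros tendsto_zero T u x)
      then have "\<forall>\<^sub>F n in sequentially. u (x ^ n / (1 + x ^ n)) * u y < 1" by (intro order_tendstoD) auto
      then show "\<forall>\<^sub>F n in sequentially. u (x ^ n / (1 + x ^ n) * y) < 1"
        using u.mult[OF yn y(1)] by simp
    qed
    obtain n where "1 < v (x ^ n / (1 + x ^ n) * y)" "w (x ^ n / (1 + x ^ n) * y) < 1"
      "\<forall>u\<in>T. u (x ^ n / (1 + x ^ n) * y) < 1"
      using eventually_happens'[OF _ eventually_conj[OF 1 eventually_conj[OF 2 3]]] by auto
    then show ?thesis using is_subfieldD(4)[OF K yn y(1)] by (intro bexI[of _ "x ^ n / (1 + x ^ n) * y"]) auto
  qed
qed

lemma weak_approximation:
  assumes T: "finite T" "T \<subseteq> places_over a K" and v: "v \<in> T" and d: "d > 0"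
  shows "\<exists>x\<in>K. v (1 - x) < d \<and> (\<forall>w\<in>T - {v}. w x < d)"
proof -
  have vP: "v \<in> places_over a K" using v T by auto
  obtain x where x: "x \<in> K" "1 < v x" "\<And>w. w \<in> T - {v} \<Longrightarrow> w x < 1"
    using ex_separating[OF vP, of "T - {v}"] T by auto
  have 1: "\<forall>\<^sub>F n in sequentially. v (1 - x ^ n / (1 + x ^ n)) < d"
    using tendsto_one(1)[OF vP x(1,2)] d by (intro order_tendstoD)
  have 2: "\<forall>\<^sub>F n in sequentially. \<forall>w\<in>T - {v}. w (x ^ n / (1 + x ^ n)) < d"
    using T x d by (intro eventually_ball_finite ballI order_tendstoD(2)[OF tendsto_zero]) auto
  obtain n where "v (1 - x ^ n / (1 + x ^ n)) < d" "\<forall>w\<in>T - {v}. w (x ^ n / (1 + x ^ n)) < d"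
    using eventually_happens'[OF _ eventually_conj[OF 1 2]] by auto
  moreover have "x ^ n / (1 + x ^ n) \<in> K"
    using x(1) by (intro is_subfield_divide[OF K] is_subfieldD(3)[OF K] is_subfieldD(2)[OF K] is_subfield_power[OF K])
  ultimately show ?thesis by blast
qed

text \<open>Choose z_v close to 1 at \<open>v\<close> and close to 0 at the other places. Then the
  elements z_v b with b in \<open>B v\<close> are independent over the rationals: in a vanishing
  relation, a coefficient of largest size, belonging to \<open>v\<close>, would contradict strong
  independence at \<open>v\<close>, because everything else is small there.\<close>

lemma sum_card_le_dim:
  assumes T: "finite T" "T \<subseteq> places_over a K"
    and B: "\<And>v. v \<in> T \<Longrightarrow> B v \<subseteq> K" "\<And>v. v \<in> T \<Longrightarrow> strongly_independent a v (B v)"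
  shows "(\<Sum>v\<in>T. card (B v)) \<le> QV.dim K"
proof -
  have "\<forall>v\<in>T. \<exists>e>0. \<forall>c. \<forall>b\<in>B v. e * a (c b) \<le> v (\<Sum>b\<in>B v. of_rat (c b) * b)"
    using B(2) unfolding strongly_independent_def by blast
  then obtain e where e: "\<And>v. v \<in> T \<Longrightarrow> 0 < e v"
    "\<And>v c b. v \<in> T \<Longrightarrow> b \<in> B v \<Longrightarrow> e v * a (c b) \<le> v (\<Sum>b\<in>B v. of_rat (c b) * b)" by metis
  have finB: "finite (B v)" if "v \<in> T" for v using B(2)[OF that] by (simp add: strongly_independent_def)
  define I where "I = (SIGMA v:T. B v)"
  have finI: "finite I" using T finB by (simp add: I_def)
  define S where "S v = (\<Sum>i\<in>I. v (snd i))" for v :: "qbar \<Rightarrow> real"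
  have inK: "snd i \<in> K" if "i \<in> I" for i using that B(1) unfolding I_def by fastforce
  have S0: "0 \<le> S v" if "v \<in> T" for v
    using abs_value_on.nonneg[OF abs_value, of v] that T inK by (auto simp: S_def intro!: sum_nonneg)
  \<comment> \<open>One tolerance for all places of \<open>T\<close>: below, the error at
    \<open>v\<close> is at most \<open>A * (d * S v)\<close>, which is smaller than
    \<open>e v * A\<close> if \<open>A\<close> is positive.\<close>
  have "\<exists>d>0. \<forall>v\<in>T. d * (S v + 1) \<le> e v"
    using T(1) S0 e(1)
  proof (induction T rule: finite_induct)
    case (insert v T)
    then obtain d where d: "d > 0" "\<forall>v\<in>T. d * (S v + 1) \<le> e v" by auto
    let ?d = "min d (e v / (S v + 1))"
    have pos: "0 < S v + 1" "0 < e v" using insert.prems by (auto simp: add_nonneg_pos)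
    have "?d * (S u + 1) \<le> e u" if "u \<in> T" for u
    proof -
      have "?d * (S u + 1) \<le> d * (S u + 1)" using insert.prems(1)[of u] that by (intro mult_right_mono) auto
      then show ?thesis using d(2) that by fastforce
    qed
    moreover have "?d * (S v + 1) \<le> e v / (S v + 1) * (S v + 1)" using pos by (intro mult_right_mono) auto
    ultimately show ?case using d(1) pos by (intro exI[of _ ?d]) auto
  qed (auto intro: exI[of _ 1])
  then obtain d where d: "d > 0" "\<And>v. v \<in> T \<Longrightarrow> d * (S v + 1) \<le> e v" by blast
  have "\<forall>v\<in>T. \<exists>x\<in>K. v (1 - x) < d \<and> (\<forall>w\<in>T - {v}. w x < d)"
    using weak_approximation[OF T _ d(1)] by blast
  then obtain z where z: "\<And>v. v \<in> T \<Longrightarrow> z v \<in> K" "\<And>v. v \<in> T \<Longrightarrow> v (1 - z v) < d"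
    "\<And>v w. v \<in> T \<Longrightarrow> w \<in> T - {v} \<Longrightarrow> w (z v) < d" by metis
  have "card I \<le> QV.dim K"
  proof (rule QV_card_le_dim[OF nf finI, where u = "\<lambda>i. z (fst i) * snd i"])
    show "z (fst i) * snd i \<in> K" if "i \<in> I" for i
      using that z(1) inK is_subfieldD(4)[OF K] by (auto simp: I_def)
    fix c j assume 0: "(\<Sum>i\<in>I. of_rat (c i) * (z (fst i) * snd i)) = 0" and j: "j \<in> I"
    define A where "A = Max ((\<lambda>i. a (c i)) ` I)"
    have "A \<in> (\<lambda>i. a (c i)) ` I" unfolding A_def using finI j by (intro Max_in) auto
    then obtain i0 where i0: "i0 \<in> I" "A = a (c i0)" by auto
    have A: "a (c i) \<le> A" if "i \<in> I" for i using finI that by (simp add: A_def)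
    obtain v b where vb: "i0 = (v, b)" "v \<in> T" "b \<in> B v" using i0 by (auto simp: I_def)
    have vP: "v \<in> places_over a K" using vb T by auto
    interpret v: abs_value_on K v by (rule abs_value[OF vP])
    \<comment> \<open>The difference between the local combination at \<open>v\<close>, in which z_v
      is replaced by 1 and the other places are dropped, and the vanishing global relation.\<close>
    define r where "r i = (if fst i = v then of_rat (c i) * ((1 - z v) * snd i) else - (of_rat (c i) * (z (fst i) * snd i)))" for i
    have rK: "r i \<in> K" if "i \<in> I" for i
    proof -
      have "z (fst i) \<in> K" "snd i \<in> K" using that z(1) inK by (auto simp: I_def)
      then show ?thesis using z(1)[OF vb(2)] unfolding r_def
        by (auto intro!: is_subfieldD(4,5)[OF K] is_subfield_of_rat[OF K] is_subfield_diff[OF K] is_subfieldD(2)[OF K])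
    qed
    have vr: "v (r i) \<le> A * (d * v (snd i))" if i: "i \<in> I" for i
    proof -
      have zi: "z (fst i) \<in> K" "snd i \<in> K" "fst i \<in> T" using i z(1) inK by (auto simp: I_def)
      have z1: "1 - z v \<in> K" using z(1)[OF vb(2)] by (intro is_subfield_diff[OF K] is_subfieldD(2)[OF K])
      have q: "of_rat (c i) \<in> K" by (rule is_subfield_of_rat[OF K])
      have sn: "0 \<le> v (snd i)" "0 \<le> a (c i)" using zi v.nonneg rat_absD(1)[OF a] by auto
      show ?thesis
      proof (cases "fst i = v")
        case True
        then have "v (r i) = a (c i) * (v (1 - z v) * v (snd i))"
          using zi z1 q by (simp add: r_def v.mult is_subfieldD(4)[OF K] places_overD(3)[OF vP])
        also have "\<dots> \<le> A * (d * v (snd i))"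
          using A[OF i] z(2)[OF vb(2)] sn v.nonneg[OF z1]
          by (intro mult_mono mult_nonneg_nonneg) auto
        finally show ?thesis .
      next
        case False
        then have "v (r i) = a (c i) * (v (z (fst i)) * v (snd i))"
          using zi q by (simp add: r_def v.mult v.minus is_subfieldD(4)[OF K] places_overD(3)[OF vP])
        also have "\<dots> \<le> A * (d * v (snd i))"
          using A[OF i] z(3)[OF zi(3), of v] vb(2) False sn v.nonneg[OF zi(1)]
          by (intro mult_mono mult_nonneg_nonneg) auto
        finally show ?thesis .
      qed
    qed
    have "(\<Sum>b\<in>B v. of_rat (c (v, b)) * b) = (\<Sum>i\<in>I. if fst i = v then of_rat (c i) * snd i else 0)"
    proof -
      have "(\<Sum>i\<in>I. if fst i = v then of_rat (c i) * snd i else 0) = (\<Sum>i\<in>Pair v ` B v. of_rat (c i) * snd i)"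
        using finI vb(2) by (intro sum.mono_neutral_cong_right) (auto simp: I_def)
      then show ?thesis by (simp add: sum.reindex inj_on_def)
    qed
    also have "\<dots> = (\<Sum>i\<in>I. r i + of_rat (c i) * (z (fst i) * snd i))"
      by (rule sum.cong) (auto simp: r_def algebra_simps)
    also have "\<dots> = (\<Sum>i\<in>I. r i)" using 0 by (simp add: sum.distrib)
    finally have eq: "(\<Sum>b\<in>B v. of_rat (c (v, b)) * b) = (\<Sum>i\<in>I. r i)" .
    have "e v * A \<le> v (\<Sum>i\<in>I. r i)"
      using e(2)[OF vb(2,3), of "\<lambda>b. c (v, b)"] eq i0 vb by simp
    also have "\<dots> \<le> (\<Sum>i\<in>I. v (r i))" by (rule v.sum_le) (rule rK)
    also have "\<dots> \<le> (\<Sum>i\<in>I. A * (d * v (snd i)))" by (rule sum_mono) (rule vr)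
    also have "\<dots> = A * (d * S v)" by (simp add: S_def sum_distrib_left)
    finally have le: "e v * A \<le> A * (d * S v)" .
    have "A \<le> 0"
    proof (rule ccontr)
      assume "\<not> A \<le> 0"
      then have "e v \<le> d * S v" using le by (simp add: mult.commute)
      also have "\<dots> < d * (S v + 1)" using d(1) by simp
      finally show False using d(2)[OF vb(2)] by simp
    qed
    then have "a (c j) \<le> 0" using A[OF j] by simp
    then show "c j = 0" using rat_absD(1,2)[OF a, of "c j"] by simp
  qed
  then show ?thesis using T finB by (simp add: I_def card_SigmaI)
qed

text \<open>With more embeddings than elements of \<open>B\<close>, a nontrivial combination of them
  vanishes on \<open>B\<close>. All of them carry \<open>v\<close> to \<open>w\<close>, so the
  combination is continuous and vanishes on \<open>K\<close> by density, against
  \<open>Emb_independent\<close>.\<close>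

lemma card_Emb_le:
  assumes M: "number_field M" "\<And>\<sigma>. \<sigma> \<in> Emb K \<Longrightarrow> \<sigma> ` K \<subseteq> M" and w: "w \<in> places_over a M"
    and v: "v \<in> places_over a K" and B: "B \<subseteq> K" "finite B" "dense_span K v B"
  shows "card {\<sigma> \<in> Emb K. restrict (w \<circ> \<sigma>) K = v} \<le> card B"
proof (rule ccontr)
  let ?E = "{\<sigma> \<in> Emb K. restrict (w \<circ> \<sigma>) K = v}"
  assume "\<not> card ?E \<le> card B"
  then have lt: "card B < card ?E" by simp
  have M': "is_subfield M" by (rule number_fieldD[OF M(1)])
  interpret w: abs_value_on M w using M' places_overD(2)[OF w] by unfold_locales
  interpret v: abs_value_on K v by (rule abs_value[OF v])
  have finE: "finite ?E" using finite_Emb[OF nf] by simp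
  have "\<exists>l. (\<forall>\<sigma>. l \<sigma> \<in> M) \<and> (\<exists>\<sigma>\<in>?E. l \<sigma> \<noteq> 0) \<and> (\<forall>b\<in>B. (\<Sum>\<sigma>\<in>?E. l \<sigma> * \<sigma> b) = 0)"
    by (rule linear_system[OF M' B(2) finE lt]) (use M(2) B(1) in blast)
  then obtain l where l: "\<And>\<sigma>. l \<sigma> \<in> M" "\<exists>\<sigma>\<in>?E. l \<sigma> \<noteq> 0" "\<And>b. b \<in> B \<Longrightarrow> (\<Sum>\<sigma>\<in>?E. l \<sigma> * \<sigma> b) = 0"
    by blast
  define L where "L = (\<Sum>\<sigma>\<in>?E. w (l \<sigma>))"
  have L0: "0 \<le> L" using w.nonneg l(1) by (simp add: L_def sum_nonneg)
  have zero: "(\<Sum>\<sigma>\<in>?E. l \<sigma> * \<sigma> x) = 0" if x: "x \<in> K" for x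
  proof -
    have sM: "\<sigma> y \<in> M" if "\<sigma> \<in> ?E" "y \<in> K" for \<sigma> y using M(2) that by blast
    have XM: "(\<Sum>\<sigma>\<in>?E. l \<sigma> * \<sigma> x) \<in> M" using l(1) sM x by (intro is_subfield_sum[OF M'] is_subfieldD(4)[OF M']) auto
    have "w (\<Sum>\<sigma>\<in>?E. l \<sigma> * \<sigma> x) \<le> 0 + d" if d: "d > 0" for d
    proof -
      have "d / (L + 1) > 0" using d L0 by simp
      then obtain c where c: "v (x - (\<Sum>b\<in>B. of_rat (c b) * b)) < d / (L + 1)"
        using B(3) x unfolding dense_span_def by blast
      let ?y = "x - (\<Sum>b\<in>B. of_rat (c b) * b)"
      have yK: "?y \<in> K" using x B(1) comb_in by (intro is_subfield_diff[OF K])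
      have "(\<Sum>\<sigma>\<in>?E. l \<sigma> * \<sigma> ?y) = (\<Sum>\<sigma>\<in>?E. l \<sigma> * \<sigma> x - (\<Sum>b\<in>B. of_rat (c b) * (l \<sigma> * \<sigma> b)))"
      proof (rule sum.cong)
        fix \<sigma> assume "\<sigma> \<in> ?E"
        then interpret s: embedding K \<sigma> using K by unfold_locales auto
        have "\<sigma> ?y = \<sigma> x - (\<Sum>b\<in>B. of_rat (c b) * \<sigma> b)"
          using x B(1) comb_in
          by (subst s.diff, simp, simp, subst s.sum) (auto simp: s.mult s.of_rat is_subfield_of_rat[OF K] subset_iff intro!: is_subfieldD(4)[OF K])
        then show "l \<sigma> * \<sigma> ?y = l \<sigma> * \<sigma> x - (\<Sum>b\<in>B. of_rat (c b) * (l \<sigma> * \<sigma> b))"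
          by (simp add: right_diff_distrib sum_distrib_left mult_ac)
      qed simp
      also have "\<dots> = (\<Sum>\<sigma>\<in>?E. l \<sigma> * \<sigma> x) - (\<Sum>b\<in>B. of_rat (c b) * (\<Sum>\<sigma>\<in>?E. l \<sigma> * \<sigma> b))"
        unfolding sum_subtractf sum_distrib_left by (subst sum.swap) simp
      also have "\<dots> = (\<Sum>\<sigma>\<in>?E. l \<sigma> * \<sigma> x)" using l(3) by simp
      finally have "w (\<Sum>\<sigma>\<in>?E. l \<sigma> * \<sigma> x) = w (\<Sum>\<sigma>\<in>?E. l \<sigma> * \<sigma> ?y)" by simp
      also have "\<dots> \<le> (\<Sum>\<sigma>\<in>?E. w (l \<sigma> * \<sigma> ?y))"
        using l(1) sM yK by (intro w.sum_le is_subfieldD(4)[OF M']) auto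
      also have "\<dots> = (\<Sum>\<sigma>\<in>?E. w (l \<sigma>) * v ?y)"
      proof (rule sum.cong)
        fix \<sigma> assume s: "\<sigma> \<in> ?E"
        then have "v ?y = w (\<sigma> ?y)" using yK by (auto dest!: fun_cong[of _ _ ?y])
        then show "w (l \<sigma> * \<sigma> ?y) = w (l \<sigma>) * v ?y" using l(1) sM[OF s yK] by (simp add: w.mult)
      qed simp
      also have "\<dots> = L * v ?y" by (simp add: L_def sum_distrib_right)
      also have "\<dots> \<le> L * (d / (L + 1))" using L0 c by (intro mult_left_mono) auto
      also have "\<dots> \<le> d" using L0 d by (simp add: divide_simps)
      finally show ?thesis by simp
    qed
    then have "w (\<Sum>\<sigma>\<in>?E. l \<sigma> * \<sigma> x) \<le> 0" by (rule field_le_epsilon)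
    then show ?thesis using w.nonneg[OF XM] w.zero_iff[OF XM] by simp
  qed
  define l' where "l' \<sigma> = (if \<sigma> \<in> ?E then l \<sigma> else 0)" for \<sigma>
  have "(\<Sum>\<sigma>\<in>Emb K. l' \<sigma> * \<sigma> x) = 0" if "x \<in> K" for x
  proof -
    have "(\<Sum>\<sigma>\<in>Emb K. l' \<sigma> * \<sigma> x) = (\<Sum>\<sigma>\<in>?E. l \<sigma> * \<sigma> x)"
      using finite_Emb[OF nf] by (intro sum.mono_neutral_cong_right) (auto simp: l'_def)
    then show ?thesis using zero[OF that] by simp
  qed
  then have "l' \<sigma> = 0" if "\<sigma> \<in> Emb K" for \<sigma> using Emb_independent[OF nf] that by blast
  then show False using l(2) by (fastforce simp: l'_def)
qed

text \<open>The bounds of \<open>card_Emb_le\<close>, added over all places, meet the bound of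
  \<open>sum_card_le_dim\<close> because there are \<open>QV.dim K\<close> embeddings, so none of
  them can be strict. Finiteness comes first: each place contributes at least 1 to the sum of the
  sizes.\<close>

theorem local_degree_count:
  assumes M: "number_field M" "\<And>\<sigma>. \<sigma> \<in> Emb K \<Longrightarrow> \<sigma> ` K \<subseteq> M" and w: "w \<in> places_over a M"
  shows "finite (places_over a K)"
    and "\<And>v B. v \<in> places_over a K \<Longrightarrow> B \<subseteq> K \<Longrightarrow> strongly_independent a v B \<Longrightarrow> dense_span K v B \<Longrightarrow>
       card B = card {\<sigma> \<in> Emb K. restrict (w \<circ> \<sigma>) K = v}"
proof -
  let ?P = "places_over a K" and ?e = "\<lambda>v. card {\<sigma> \<in> Emb K. restrict (w \<circ> \<sigma>) K = v}"
  obtain B0 where B0: "\<And>v. v \<in> ?P \<Longrightarrow> B0 v \<subseteq> K" "\<And>v. v \<in> ?P \<Longrightarrow> strongly_independent a v (B0 v)"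
    "\<And>v. v \<in> ?P \<Longrightarrow> dense_span K v (B0 v)"
    using ex_strongly_independent_dense by metis
  have fin: "finite B" if "strongly_independent a v B" for v B using that by (simp add: strongly_independent_def)
  have "card T \<le> QV.dim K" if T: "T \<subseteq> ?P" "finite T" for T
  proof -
    have "card T = (\<Sum>v\<in>T. 1)" by simp
    also have "\<dots> \<le> (\<Sum>v\<in>T. card (B0 v))"
    proof (rule sum_mono)
      fix v assume "v \<in> T"
      then have v: "v \<in> ?P" using T by blast
      then show "1 \<le> card (B0 v)"
        using dense_span_nonempty[OF v B0(3)[OF v]] fin[OF B0(2)[OF v]] by (simp add: Suc_le_eq card_gt_0_iff)
    qed
    also have "\<dots> \<le> QV.dim K" using T B0 by (intro sum_card_le_dim) auto
    finally show ?thesis .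
  qed
  then show finP: "finite ?P" using finite_if_finite_subsets_card_bdd[of ?P] by blast
  fix v B assume v: "v \<in> ?P" and B: "B \<subseteq> K" "strongly_independent a v B" "dense_span K v B"
  \<comment> \<open>The given \<open>B\<close> replaces the chosen set at \<open>v\<close>, so that
    the count applies to this particular set.\<close>
  define B1 where "B1 = B0(v := B)"
  have B1: "B1 u \<subseteq> K" "strongly_independent a u (B1 u)" "dense_span K u (B1 u)" if "u \<in> ?P" for u
    using that B0 B by (auto simp: B1_def)
  have le: "?e u \<le> card (B1 u)" if "u \<in> ?P" for u
    using that B1[OF that] fin[OF B1(2)[OF that]] by (intro card_Emb_le[OF M w])
  have "(\<Sum>u\<in>?P. card (B1 u)) \<le> QV.dim K" using finP B1 by (intro sum_card_le_dim) auto
  also have "\<dots> = card (Emb K)" by (simp add: card_Emb[OF nf])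
  also have "Emb K = (\<Union>u\<in>?P. {\<sigma> \<in> Emb K. restrict (w \<circ> \<sigma>) K = u})"
    using place_comp_Emb[OF K number_fieldD[OF M(1)] w _ M(2)] by blast
  also have "card \<dots> = (\<Sum>u\<in>?P. ?e u)"
    using finP finite_Emb[OF nf] by (subst card_UN_disjoint) auto
  finally have sum: "(\<Sum>u\<in>?P. card (B1 u)) \<le> (\<Sum>u\<in>?P. ?e u)" .
  have "\<not> ?e v < card (B1 v)"
  proof
    assume "?e v < card (B1 v)"
    then have "(\<Sum>u\<in>?P. ?e u) < (\<Sum>u\<in>?P. card (B1 u))"
      using le v finP by (intro sum_strict_mono_ex1) auto
    with sum show False by simp
  qed
  then show "card B = ?e v" using le[OF v] by (simp add: B1_def)
qed

end

section \<open>Local degrees\<close>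

locale place_completion = places_above K a for K a +
  fixes v :: "qbar \<Rightarrow> real"
  assumes vP: "v \<in> places_over a K"
begin

sublocale V: abs_value_on K v
  by (rule abs_value[OF vP])

section \<open>The completion as a field\<close>

abbreviation "CR \<equiv> cauchy_ring K v"
abbreviation "CI \<equiv> null_seqs K v"
abbreviation "QC \<equiv> completion K v"

lemma CR_simps: "carrier CR = cauchy_seqs K v" "s \<otimes>\<^bsub>CR\<^esub> t = (\<lambda>n. s n * t n)" "s \<oplus>\<^bsub>CR\<^esub> t = (\<lambda>n. s n + t n)"
  "\<zero>\<^bsub>CR\<^esub> = (\<lambda>n. 0)" "\<one>\<^bsub>CR\<^esub> = (\<lambda>n. 1)"
  by (simp_all add: cauchy_ring_def)

lemma rats_subset: "\<rat> \<subseteq> K"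
  using is_subfield_of_rat[OF K] by (auto simp: Rats_def)

lemma cauchy_in: "s \<in> cauchy_seqs F v \<Longrightarrow> s n \<in> F"
  by (simp add: cauchy_seqs_def)

lemma cauchyD: "s \<in> cauchy_seqs F v \<Longrightarrow> e > 0 \<Longrightarrow> \<exists>M. \<forall>m\<ge>M. \<forall>n\<ge>M. v (s m - s n) < e"
  by (simp add: cauchy_seqs_def)

lemma cauchy_mono: "F \<subseteq> K \<Longrightarrow> s \<in> cauchy_seqs F v \<Longrightarrow> s \<in> cauchy_seqs K v"
  by (auto simp: cauchy_seqs_def)

lemma cauchy_const: "x \<in> F \<Longrightarrow> (\<lambda>n. x) \<in> cauchy_seqs F v"
  by (simp add: cauchy_seqs_def V.zero)

lemma cauchy_bounded:
  assumes s: "s \<in> cauchy_seqs K v" shows "\<exists>M>0. \<forall>n. v (s n) \<le> M"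
proof -
  obtain N where N: "\<And>m n. m \<ge> N \<Longrightarrow> n \<ge> N \<Longrightarrow> v (s m - s n) < 1" using cauchyD[OF s, of 1] by auto
  let ?M = "1 + (\<Sum>i\<le>N. v (s i))"
  have nn: "0 \<le> v (s n)" for n using cauchy_in[OF s] V.nonneg by blast
  have le: "v (s i) \<le> (\<Sum>i\<le>N. v (s i))" if "i \<le> N" for i
    using that nn by (intro member_le_sum) auto
  have "v (s n) \<le> ?M" for n
  proof (cases "n \<le> N")
    case False
    have "v (s n) - v (s N) \<le> v (s n - s N)" using cauchy_in[OF s] by (intro V.diff_ge)
    then show ?thesis using N[of n N] False le[of N] by simp
  qed (use le in force)
  moreover have "?M > 0" using nn by (simp add: add_pos_nonneg sum_nonneg)
  ultimately show ?thesis by blast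
qed

lemma cauchy_add:
  assumes F: "is_subfield F" "F \<subseteq> K" and s: "s \<in> cauchy_seqs F v" and t: "t \<in> cauchy_seqs F v"
  shows "(\<lambda>n. s n + t n) \<in> cauchy_seqs F v"
proof -
  have "\<exists>M. \<forall>m\<ge>M. \<forall>n\<ge>M. v ((s m + t m) - (s n + t n)) < e" if e0: "e > 0" for e
  proof -
    obtain M where M: "\<And>m n. m \<ge> M \<Longrightarrow> n \<ge> M \<Longrightarrow> v (s m - s n) < e / 2" using cauchyD[OF s, of "e / 2"] e0 by auto
    obtain M' where M': "\<And>m n. m \<ge> M' \<Longrightarrow> n \<ge> M' \<Longrightarrow> v (t m - t n) < e / 2" using cauchyD[OF t, of "e / 2"] e0 by auto
    have "v ((s m + t m) - (s n + t n)) < e" if "m \<ge> max M M'" "n \<ge> max M M'" for m n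
    proof -
      have "s m - s n \<in> K" "t m - t n \<in> K"
        using cauchy_in[OF s] cauchy_in[OF t] F(2) by (auto intro!: is_subfield_diff[OF K])
      then have "v ((s m - s n) + (t m - t n)) \<le> v (s m - s n) + v (t m - t n)" by (rule V.triangle)
      moreover have "v (s m - s n) < e / 2" using M that by simp
      moreover have "v (t m - t n) < e / 2" using M' that by simp
      ultimately have "v ((s m - s n) + (t m - t n)) < e" by linarith
      then show ?thesis by (simp add: algebra_simps)
    qed
    then show ?thesis by blast
  qed
  then show ?thesis using is_subfieldD(3)[OF F(1)] cauchy_in[OF s] cauchy_in[OF t] by (auto simp: cauchy_seqs_def)
qed

lemma cauchy_mult:
  assumes F: "is_subfield F" "F \<subseteq> K" and s: "s \<in> cauchy_seqs F v" and t: "t \<in> cauchy_seqs F v"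
  shows "(\<lambda>n. s n * t n) \<in> cauchy_seqs F v"
proof -
  obtain A where A: "A > 0" "\<And>n. v (s n) \<le> A" using cauchy_bounded[OF cauchy_mono[OF F(2) s]] by blast
  obtain A' where A': "A' > 0" "\<And>n. v (t n) \<le> A'" using cauchy_bounded[OF cauchy_mono[OF F(2) t]] by blast
  have sK: "s n \<in> K" "t n \<in> K" for n using cauchy_in[OF s] cauchy_in[OF t] F(2) by auto
  have "\<exists>M. \<forall>m\<ge>M. \<forall>n\<ge>M. v (s m * t m - s n * t n) < e" if e0: "e > 0" for e
  proof -
    obtain M where M: "\<And>m n. m \<ge> M \<Longrightarrow> n \<ge> M \<Longrightarrow> v (s m - s n) < e / (2 * A')"
      using cauchyD[OF s, of "e / (2 * A')"] e0 A'(1) by auto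
    obtain M' where M': "\<And>m n. m \<ge> M' \<Longrightarrow> n \<ge> M' \<Longrightarrow> v (t m - t n) < e / (2 * A)"
      using cauchyD[OF t, of "e / (2 * A)"] e0 A(1) by auto
    have "v (s m * t m - s n * t n) < e" if mn: "m \<ge> max M M'" "n \<ge> max M M'" for m n
    proof -
      have dK: "s m - s n \<in> K" "t m - t n \<in> K" using sK by (auto intro!: is_subfield_diff[OF K])
      have "v (s m * (t m - t n) + (s m - s n) * t n) \<le> v (s m) * v (t m - t n) + v (s m - s n) * v (t n)"
        using V.triangle[of "s m * (t m - t n)" "(s m - s n) * t n"] dK sK is_subfieldD(4)[OF K] by (simp add: V.mult)
      also have "\<dots> \<le> A * v (t m - t n) + v (s m - s n) * A'"
        using A A' dK sK V.nonneg by (intro add_mono mult_mono) (auto intro: less_imp_le)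
      also have "\<dots> < A * (e / (2 * A)) + e / (2 * A') * A'"
        using A A' M[of m n] M'[of m n] mn by (intro add_strict_mono mult_strict_left_mono mult_strict_right_mono) auto
      also have "\<dots> = e" using A A' by simp
      finally show ?thesis by (simp add: algebra_simps)
    qed
    then show ?thesis by blast
  qed
  then show ?thesis using is_subfieldD(4)[OF F(1)] cauchy_in[OF s] cauchy_in[OF t] by (auto simp: cauchy_seqs_def)
qed

lemma null_cauchy: assumes s: "s \<in> CI" shows "s \<in> cauchy_seqs K v"
proof -
  have sK: "s n \<in> K" for n using s by (simp add: null_seqs_def)
  have "\<exists>M. \<forall>m\<ge>M. \<forall>n\<ge>M. v (s m - s n) < e" if e0: "e > 0" for e
  proof -
    have "(\<lambda>n. v (s n)) \<longlonglongrightarrow> 0" using s by (simp add: null_seqs_def)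
    then have "\<forall>\<^sub>F n in sequentially. v (s n) < e / 2" using e0 by (intro order_tendstoD) auto
    then obtain M where M: "\<And>n. n \<ge> M \<Longrightarrow> v (s n) < e / 2" by (auto simp: eventually_sequentially)
    have "v (s m - s n) < e" if "m \<ge> M" "n \<ge> M" for m n
      using V.diff[OF sK sK, of m n] M[OF that(1)] M[OF that(2)] by linarith
    then show ?thesis by blast
  qed
  then show ?thesis using sK by (simp add: cauchy_seqs_def)
qed

lemma null_le:
  assumes "\<And>n. s n \<in> K" "\<And>n. v (s n) \<le> u n" "u \<longlonglongrightarrow> 0" shows "s \<in> CI"
proof -
  have "(\<lambda>n. v (s n)) \<longlonglongrightarrow> 0"
    by (rule tendsto_sandwich[OF _ _ tendsto_const assms(3)]) (use assms V.nonneg in auto)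
  then show ?thesis using assms(1) by (simp add: null_seqs_def)
qed

lemma null_add: assumes "s \<in> CI" "t \<in> CI" shows "(\<lambda>n. s n + t n) \<in> CI"
proof (rule null_le)
  have st: "s n \<in> K" "t n \<in> K" for n using assms by (auto simp: null_seqs_def)
  then show "s n + t n \<in> K" "v (s n + t n) \<le> v (s n) + v (t n)" for n
    by (auto intro: is_subfieldD(3)[OF K] V.triangle)
  show "(\<lambda>n. v (s n) + v (t n)) \<longlonglongrightarrow> 0"
    using tendsto_add[of "\<lambda>n. v (s n)" 0 _ "\<lambda>n. v (t n)" 0] assms by (simp add: null_seqs_def)
qed

lemma null_mult: assumes "s \<in> cauchy_seqs K v" "t \<in> CI" shows "(\<lambda>n. s n * t n) \<in> CI"
proof -
  obtain A where A: "A > 0" "\<And>n. v (s n) \<le> A" using cauchy_bounded[OF assms(1)] by blast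
  have st: "s n \<in> K" "t n \<in> K" for n using assms cauchy_in by (auto simp: null_seqs_def)
  show ?thesis
  proof (rule null_le)
    show "s n * t n \<in> K" for n using st by (intro is_subfieldD(4)[OF K])
    show "v (s n * t n) \<le> A * v (t n)" for n
      using st A V.nonneg by (auto simp: V.mult intro!: mult_right_mono)
    show "(\<lambda>n. A * v (t n)) \<longlonglongrightarrow> 0"
      using tendsto_mult[OF tendsto_const, of "\<lambda>n. v (t n)" 0 _ A] assms by (simp add: null_seqs_def)
  qed
qed

lemma cauchy_uminus: "F \<subseteq> K \<Longrightarrow> is_subfield F \<Longrightarrow> s \<in> cauchy_seqs F v \<Longrightarrow> (\<lambda>n. - s n) \<in> cauchy_seqs F v"
  using cauchy_mult[of F "\<lambda>n. - 1" s] cauchy_const[of "- 1" F] is_subfieldD(2,5)[of F] by simp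

lemma cring_CR: "cring CR"
proof (rule cringI)
  note cl = cauchy_add[OF K order_refl] cauchy_mult[OF K order_refl] cauchy_uminus[OF order_refl K]
    cauchy_const is_subfieldD(1,2)[OF K]
  show "abelian_group CR"
    by (rule abelian_groupI) (auto simp: CR_simps cl algebra_simps intro!: bexI[of _ "\<lambda>n. - _ n"])
  show "comm_monoid CR"
    by (rule comm_monoidI) (auto simp: CR_simps cl algebra_simps)
qed (auto simp: CR_simps algebra_simps)

sublocale CR: cring CR
  by (rule cring_CR)

lemma CR_uminus: "s \<in> cauchy_seqs K v \<Longrightarrow> \<ominus>\<^bsub>CR\<^esub> s = (\<lambda>n. - s n)"
  using CR.minus_equality[of "\<lambda>n. - s n" s] cauchy_uminus[OF order_refl K, of s] by (simp add: CR_simps)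

lemma CR_minus: "s \<in> cauchy_seqs K v \<Longrightarrow> t \<in> cauchy_seqs K v \<Longrightarrow> s \<ominus>\<^bsub>CR\<^esub> t = (\<lambda>n. s n - t n)"
  by (simp add: a_minus_def CR_uminus) (simp add: CR_simps)

lemma ideal_CI: "ideal CI CR"
proof (rule idealI)
  show "Ring.ring CR" by (rule CR.ring_axioms)
  have zero: "(\<lambda>n. 0) \<in> CI" using is_subfieldD(1)[OF K] by (simp add: null_seqs_def V.zero)
  have um: "(\<lambda>n. - s n) \<in> CI" if "s \<in> CI" for s
    using null_mult[of "\<lambda>n. - 1" s] cauchy_const[of "- 1" K] is_subfieldD(2,5)[OF K] that by simp
  show "subgroup CI (add_monoid CR)"
  proof (rule CR.add.subgroupI)
    show "CI \<subseteq> carrier CR" using null_cauchy by (auto simp: CR_simps)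
    show "\<ominus>\<^bsub>CR\<^esub> s \<in> CI" if "s \<in> CI" for s using um[OF that] null_cauchy[OF that] by (simp add: CR_uminus)
    show "s \<oplus>\<^bsub>CR\<^esub> t \<in> CI" if "s \<in> CI" "t \<in> CI" for s t using null_add[OF that] by (simp add: CR_simps)
  qed (use zero in auto)
  show "x \<otimes>\<^bsub>CR\<^esub> s \<in> CI" if "s \<in> CI" "x \<in> carrier CR" for s x
    using null_mult[of x s] that by (simp add: CR_simps)
  show "s \<otimes>\<^bsub>CR\<^esub> x \<in> CI" if "s \<in> CI" "x \<in> carrier CR" for s x
    using null_mult[of x s] that by (simp add: CR_simps mult.commute)
qed

sublocale CI: ideal CI CR
  by (rule ideal_CI)

definition "cls s = CI +>\<^bsub>CR\<^esub> s"

lemma cls_eq: "s \<in> cauchy_seqs K v \<Longrightarrow> t \<in> cauchy_seqs K v \<Longrightarrow> cls s = cls t \<longleftrightarrow> (\<lambda>n. s n - t n) \<in> CI"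
  using CR.quotient_eq_iff_same_a_r_cos[OF ideal_CI, of s t] by (simp add: cls_def CR_simps(1) CR_minus)

lemma carrier_QC: "carrier QC = cls ` cauchy_seqs K v"
  by (auto simp: completion_def FactRing_def A_RCOSETS_def' cls_def CR_simps)

lemma cls_add: "s \<in> cauchy_seqs K v \<Longrightarrow> t \<in> cauchy_seqs K v \<Longrightarrow> cls s \<oplus>\<^bsub>QC\<^esub> cls t = cls (\<lambda>n. s n + t n)"
  using ring_hom_add[OF CI.rcos_ring_hom, of s t] by (simp add: cls_def completion_def CR_simps)

lemma cls_mult: "s \<in> cauchy_seqs K v \<Longrightarrow> t \<in> cauchy_seqs K v \<Longrightarrow> cls s \<otimes>\<^bsub>QC\<^esub> cls t = cls (\<lambda>n. s n * t n)"
  using ring_hom_mult[OF CI.rcos_ring_hom, of s t] by (simp add: cls_def completion_def CR_simps)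

lemma cls_one: "\<one>\<^bsub>QC\<^esub> = cls (\<lambda>n. 1)"
  using ring_hom_one[OF CI.rcos_ring_hom] by (simp add: cls_def completion_def CR_simps)

lemma cls_zero: "\<zero>\<^bsub>QC\<^esub> = cls (\<lambda>n. 0)"
  using ring_hom_zero[OF CI.rcos_ring_hom CR.ring_axioms CI.quotient_is_ring]
  by (simp add: cls_def completion_def CR_simps)

lemma cls_eq_zero: "s \<in> cauchy_seqs K v \<Longrightarrow> cls s = \<zero>\<^bsub>QC\<^esub> \<longleftrightarrow> s \<in> CI"
  using cls_eq[of s "\<lambda>n. 0"] cauchy_const[of 0 K] is_subfieldD(1)[OF K] by (simp add: cls_zero)

text \<open>A Cauchy sequence that is not null is eventually bounded away from 0. Its initial terms
  may vanish; with \<open>inverse 0 = 0\<close> they cause no trouble, but the product with the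
  inverse is 1 only up to a null sequence.\<close>

lemma cauchy_inverse:
  assumes F: "is_subfield F" "F \<subseteq> K" and s: "s \<in> cauchy_seqs F v" "s \<notin> CI"
  shows "(\<lambda>n. inverse (s n)) \<in> cauchy_seqs F v" "(\<lambda>n. s n * inverse (s n) - 1) \<in> CI"
proof -
  have sK: "s n \<in> K" for n using cauchy_in[OF s(1)] F by auto
  have "\<not> (\<lambda>n. v (s n)) \<longlonglongrightarrow> 0" using s(2) sK by (simp add: null_seqs_def)
  then obtain e where e: "e > 0" "\<And>N. \<exists>n\<ge>N. e \<le> v (s n)"
    using sK V.nonneg by (auto simp: LIMSEQ_iff not_less)
  obtain N where N: "\<And>m n. m \<ge> N \<Longrightarrow> n \<ge> N \<Longrightarrow> v (s m - s n) < e / 2" using cauchyD[OF s(1), of "e / 2"] e by auto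
  obtain m where m: "m \<ge> N" "e \<le> v (s m)" using e(2) by blast
  have low: "e / 2 \<le> v (s n)" if "n \<ge> N" for n
    using V.diff_ge[OF sK sK, of m "n"] V.diff_ge[OF sK is_subfield_diff[OF K sK sK], of m m n] N[OF m(1) that] m by simp
  have nz: "s n \<noteq> 0" if "n \<ge> N" for n using low[OF that] e V.zero by auto
  have "\<exists>M. \<forall>m\<ge>M. \<forall>n\<ge>M. v (inverse (s m) - inverse (s n)) < d" if d: "d > 0" for d
  proof -
    have "d * (e / 2 * (e / 2)) > 0" using d e by simp
    then obtain M where M: "\<And>m n. m \<ge> M \<Longrightarrow> n \<ge> M \<Longrightarrow> v (s m - s n) < d * (e / 2 * (e / 2))"
      using cauchyD[OF s(1)] by blast
    have "v (inverse (s m) - inverse (s n)) < d" if mn: "m \<ge> max M N" "n \<ge> max M N" for m n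
    proof -
      have nz': "s m \<noteq> 0" "s n \<noteq> 0" using nz mn by auto
      then have "inverse (s m) - inverse (s n) = (s n - s m) / (s m * s n)" by (simp add: field_simps)
      then have "v (inverse (s m) - inverse (s n)) = v (s n - s m) / (v (s m) * v (s n))"
        using sK by (simp add: V.divide V.mult is_subfield_diff[OF K] is_subfieldD(4)[OF K])
      also have "\<dots> \<le> v (s n - s m) / (e / 2 * (e / 2))"
        using low[of m] low[of n] mn e V.nonneg[OF is_subfield_diff[OF K sK sK]]
        by (intro divide_left_mono mult_mono mult_pos_pos) auto
      also have "\<dots> < d" using M[of n m] mn e by (simp add: pos_divide_less_eq)
      finally show ?thesis .
    qed
    then show ?thesis by blast
  qed
  then show "(\<lambda>n. inverse (s n)) \<in> cauchy_seqs F v"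
    using is_subfieldD(6)[OF F(1)] cauchy_in[OF s(1)] by (auto simp: cauchy_seqs_def)
  have "(\<lambda>n. v (s n * inverse (s n) - 1)) \<longlonglongrightarrow> 0"
    by (rule tendsto_eventually) (use nz V.zero in \<open>auto simp: eventually_sequentially intro!: exI[of _ N]\<close>)
  then show "(\<lambda>n. s n * inverse (s n) - 1) \<in> CI"
    using sK by (auto simp: null_seqs_def intro!: is_subfield_diff[OF K] is_subfieldD(2,4,6)[OF K])
qed

lemma cring_QC: "cring QC"
  unfolding completion_def by (rule CI.quotient_is_cring[OF cring_CR])

lemma field_QC: "Ring.field QC"
proof (rule cring.cring_fieldI2[OF cring_QC])
  have "(\<lambda>n. 1 :: qbar) \<notin> CI" using V.one by (simp add: null_seqs_def LIMSEQ_const_iff)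
  then show "\<zero>\<^bsub>QC\<^esub> \<noteq> \<one>\<^bsub>QC\<^esub>"
    using cls_eq_zero[of "\<lambda>n. 1"] cauchy_const[of 1 K] is_subfieldD(2)[OF K] by (metis cls_one)
  fix x assume "x \<in> carrier QC" "x \<noteq> \<zero>\<^bsub>QC\<^esub>"
  then obtain s where s: "s \<in> cauchy_seqs K v" "x = cls s" "s \<notin> CI" using cls_eq_zero by (auto simp: carrier_QC)
  note inv = cauchy_inverse[OF K order_refl s(1,3)]
  have "x \<otimes>\<^bsub>QC\<^esub> cls (\<lambda>n. inverse (s n)) = \<one>\<^bsub>QC\<^esub>"
    using cls_eq[of "\<lambda>n. s n * inverse (s n)" "\<lambda>n. 1"] inv s cauchy_mult[OF K order_refl s(1) inv(1)]
      cauchy_const[of 1 K] is_subfieldD(2)[OF K] by (simp add: cls_mult cls_one)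
  then show "\<exists>b\<in>carrier QC. x \<otimes>\<^bsub>QC\<^esub> b = \<one>\<^bsub>QC\<^esub>" using inv by (auto simp: carrier_QC)
qed

sublocale QC: Ring.field QC
  by (rule field_QC)

lemma is_subfield_Rats: "is_subfield (\<rat> :: qbar set)"
  by (auto simp: is_subfield_def)

abbreviation "QP \<equiv> rat_completion_in K v"

lemma QP_eq: "QP = cls ` cauchy_seqs \<rat> v"
  by (simp add: rat_completion_in_def cls_def[abs_def])

lemma subfield_QP: "subfield QP QC"
proof (rule QC.subfieldI')
  note R = is_subfield_Rats rats_subset
  have um: "\<ominus>\<^bsub>QC\<^esub> cls s = cls (\<lambda>n. - s n)" if "s \<in> cauchy_seqs K v" for s
  proof (rule QC.minus_equality)
    have m: "(\<lambda>n. - s n) \<in> cauchy_seqs K v" by (rule cauchy_uminus[OF order_refl K that])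
    show "cls (\<lambda>n. - s n) \<oplus>\<^bsub>QC\<^esub> cls s = \<zero>\<^bsub>QC\<^esub>" using cls_add[OF m that] by (simp add: cls_zero)
  qed (use that cauchy_uminus[OF order_refl K] in \<open>auto simp: carrier_QC\<close>)
  show "subring QP QC"
  proof (rule QC.subringI)
    show "QP \<subseteq> carrier QC" using cauchy_mono[OF rats_subset] by (auto simp: QP_eq carrier_QC)
    show "\<one>\<^bsub>QC\<^esub> \<in> QP" using cauchy_const[of 1 \<rat>] by (auto simp: QP_eq cls_one)
    show "\<ominus>\<^bsub>QC\<^esub> h \<in> QP" if "h \<in> QP" for h
      using that um cauchy_mono[OF rats_subset] cauchy_uminus[OF R(2,1)] by (auto simp: QP_eq)
    show "x \<otimes>\<^bsub>QC\<^esub> y \<in> QP" "x \<oplus>\<^bsub>QC\<^esub> y \<in> QP" if "x \<in> QP" "y \<in> QP" for x y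
      using that cauchy_mono[OF rats_subset] cauchy_mult[OF R] cauchy_add[OF R]
      by (auto simp: QP_eq cls_mult cls_add)
  qed
  fix k assume "k \<in> QP - {\<zero>\<^bsub>QC\<^esub>}"
  then obtain s where s: "s \<in> cauchy_seqs \<rat> v" "k = cls s" "s \<notin> CI"
    using cls_eq_zero cauchy_mono[OF rats_subset] by (auto simp: QP_eq)
  note inv = cauchy_inverse[OF R s(1,3)]
  have sK: "s \<in> cauchy_seqs K v" "(\<lambda>n. inverse (s n)) \<in> cauchy_seqs K v"
    using cauchy_mono[OF rats_subset] s inv by auto
  have "k \<otimes>\<^bsub>QC\<^esub> cls (\<lambda>n. inverse (s n)) = \<one>\<^bsub>QC\<^esub>"
    using cls_eq[of "\<lambda>n. s n * inverse (s n)" "\<lambda>n. 1"] inv s sK cauchy_mult[OF K order_refl sK]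
      cauchy_const[of 1 K] is_subfieldD(2)[OF K] by (simp add: cls_mult cls_one)
  then have "m_inv QC k = cls (\<lambda>n. inverse (s n))"
    using sK s by (intro QC.comm_inv_char) (auto simp: carrier_QC)
  then show "m_inv QC k \<in> QP" using inv by (auto simp: QP_eq)
qed

lemma cauchy_comb:
  assumes "set bs \<subseteq> K" "\<And>b. b \<in> set bs \<Longrightarrow> C b \<in> cauchy_seqs \<rat> v"
  shows "(\<lambda>n. \<Sum>b\<leftarrow>bs. C b n * b) \<in> cauchy_seqs K v"
  using assms
proof (induction bs)
  case (Cons b bs)
  have "(\<lambda>n. C b n * b) \<in> cauchy_seqs K v"
    using Cons.prems cauchy_mono[OF rats_subset] by (intro cauchy_mult[OF K order_refl] cauchy_const) auto
  then show ?case using Cons by (simp add: cauchy_add[OF K order_refl])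
qed (simp add: cauchy_const is_subfieldD[OF K])

lemma combine_cls:
  assumes "set bs \<subseteq> K" "\<And>b. b \<in> set bs \<Longrightarrow> C b \<in> cauchy_seqs \<rat> v"
  shows "QC.combine (map (\<lambda>b. cls (C b)) bs) (map (\<lambda>b. cls (\<lambda>_. b)) bs) = cls (\<lambda>n. \<Sum>b\<leftarrow>bs. C b n * b)"
  using assms
proof (induction bs)
  case (Cons b bs)
  have 1: "C b \<in> cauchy_seqs K v" "(\<lambda>_. b) \<in> cauchy_seqs K v"
    using Cons.prems cauchy_mono[OF rats_subset] by (auto intro: cauchy_const)
  have 2: "(\<lambda>n. C b n * b) \<in> cauchy_seqs K v" by (rule cauchy_mult[OF K order_refl 1])
  have 3: "(\<lambda>n. \<Sum>b\<leftarrow>bs. C b n * b) \<in> cauchy_seqs K v" using Cons.prems by (intro cauchy_comb) auto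
  show ?case using Cons by (simp add: cls_mult[OF 1] cls_add[OF 2 3])
qed (simp add: cls_zero)

text \<open>The constant sequences from \<open>B\<close> form a basis of the completion. Strong
  independence passes convergence to 0, or the Cauchy property, from a combination to each
  coefficient. Density approximates the n-th term of a Cauchy sequence by a rational combination
  with error below 1/(n+1).\<close>

lemma local_degree_eq_card:
  assumes B: "B \<subseteq> K" "strongly_independent a v B" "dense_span K v B"
  shows "local_degree K v = card B"
proof -
  obtain e where e: "e > 0" "\<And>c b. b \<in> B \<Longrightarrow> e * a (c b) \<le> v (\<Sum>b\<in>B. of_rat (c b) * b)" and finB: "finite B"
    using B(2) unfolding strongly_independent_def by blast
  obtain bs where bs: "set bs = B" "distinct bs" using finite_distinct_list[OF finB] by blast
  let ?Us = "map (\<lambda>b. cls (\<lambda>_. b)) bs"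
  have sum_bs: "(\<Sum>b\<leftarrow>bs. f b) = (\<Sum>b\<in>B. f b)" for f :: "qbar \<Rightarrow> qbar"
    using bs by (simp add: sum_list_distinct_conv_sum_set)
  have Us: "set ?Us \<subseteq> carrier QC" using bs B(1) cauchy_const by (auto simp: carrier_QC)
  have coeffs: "\<exists>C. (\<forall>b\<in>B. C b \<in> cauchy_seqs \<rat> v) \<and> Ks = map (\<lambda>b. cls (C b)) bs"
    if Ks: "set Ks \<subseteq> QP" "length Ks = length bs" for Ks
  proof -
    define f where "f k = (SOME s. s \<in> cauchy_seqs \<rat> v \<and> k = cls s)" for k
    have f: "f k \<in> cauchy_seqs \<rat> v" "k = cls (f k)" if "k \<in> QP" for k
      using someI_ex[of "\<lambda>s. s \<in> cauchy_seqs \<rat> v \<and> k = cls s"] that by (auto simp: f_def QP_eq)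
    define C where "C b = f (the (map_of (zip bs Ks) b))" for b
    have C: "C (bs ! i) = f (Ks ! i)" if "i < length bs" for i
      using that bs Ks by (simp add: C_def map_of_zip_nth)
    have "Ks = map (\<lambda>b. cls (C b)) bs"
    proof (rule nth_equalityI)
      fix i assume "i < length Ks"
      then show "Ks ! i = map (\<lambda>b. cls (C b)) bs ! i"
        using C[of i] f(2)[of "Ks ! i"] Ks by (auto simp: subset_iff)
    qed (use Ks in simp)
    moreover have "C b \<in> cauchy_seqs \<rat> v" if bB: "b \<in> B" for b
    proof -
      obtain i where "i < length bs" "b = bs ! i" using bB bs by (auto simp: in_set_conv_nth)
      then show ?thesis using C[of i] f(1)[of "Ks ! i"] Ks by (auto simp: subset_iff)
    qed
    ultimately show ?thesis by blast
  qed
  have ratseq: "\<exists>q. \<forall>b\<in>B. \<forall>n. C b n = of_rat (q n b)" if C: "\<And>b. b \<in> B \<Longrightarrow> C b \<in> cauchy_seqs \<rat> v" for C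
  proof -
    have "\<forall>n b. \<exists>q. b \<in> B \<longrightarrow> C b n = of_rat q" using cauchy_in[OF C] by (metis Rats_cases)
    then show ?thesis by metis
  qed
  have "QC.independent QP ?Us"
  proof (rule QC.trivial_combine_imp_independent[OF subfield_QP Us])
    fix Ks assume Ks: "set Ks \<subseteq> QP" "QC.combine Ks ?Us = \<zero>\<^bsub>QC\<^esub>"
    have "set Ks \<subseteq> carrier QC" using Ks(1) QC.subring_props(1)[OF subfield_QP] by blast
    \<comment> \<open>\<open>combine\<close> accepts lists of different lengths, so the scalars are
      first brought to the length of the basis.\<close>
    from QC.combine_normalize[OF this Us Ks(2)] obtain Ks' where Ks': "set (take (length ?Us) Ks) \<subseteq> set Ks'"
      "set Ks' \<subseteq> set (take (length ?Us) Ks) \<union> {\<zero>\<^bsub>QC\<^esub>}" "length Ks' = length ?Us" "QC.combine Ks' ?Us = \<zero>\<^bsub>QC\<^esub>" by blast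
    have "\<zero>\<^bsub>QC\<^esub> \<in> QP" using QC.subring_props(2)[OF subfield_QP] .
    then have "set Ks' \<subseteq> QP" using Ks' Ks(1) set_take_subset[of "length ?Us" Ks] by blast
    then have "\<exists>C. (\<forall>b\<in>B. C b \<in> cauchy_seqs \<rat> v) \<and> Ks' = map (\<lambda>b. cls (C b)) bs"
      using Ks'(3) by (intro coeffs) simp_all
    then obtain C where C: "\<And>b. b \<in> B \<Longrightarrow> C b \<in> cauchy_seqs \<rat> v" "Ks' = map (\<lambda>b. cls (C b)) bs"
      by blast
    have comb: "(\<lambda>n. \<Sum>b\<leftarrow>bs. C b n * b) \<in> cauchy_seqs K v" using B bs C by (intro cauchy_comb) auto
    have "cls (\<lambda>n. \<Sum>b\<leftarrow>bs. C b n * b) = \<zero>\<^bsub>QC\<^esub>"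
      using Ks'(4) combine_cls[of bs C] C B(1) bs by simp
    then have "(\<lambda>n. \<Sum>b\<leftarrow>bs. C b n * b) \<in> CI" using cls_eq_zero[OF comb] by simp
    then have lim: "(\<lambda>n. v (\<Sum>b\<in>B. C b n * b)) \<longlonglongrightarrow> 0" by (simp add: null_seqs_def sum_bs)
    obtain q where q: "\<And>b n. b \<in> B \<Longrightarrow> C b n = of_rat (q n b)" using ratseq[of C] C by blast
    have "C b \<in> CI" if b: "b \<in> B" for b
    proof (rule null_le)
      show "C b n \<in> K" for n using cauchy_in[OF C(1)[OF b]] rats_subset by blast
      show "v (C b n) \<le> v (\<Sum>b\<in>B. C b n * b) / e" for n
      proof -
        have "(\<Sum>b\<in>B. C b n * b) = (\<Sum>b\<in>B. of_rat (q n b) * b)" using q by (intro sum.cong) auto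
        then show ?thesis using e(2)[OF b, of "q n"] e(1) q[OF b]
          by (simp add: places_overD(3)[OF vP] pos_le_divide_eq mult.commute)
      qed
      show "(\<lambda>n. v (\<Sum>b\<in>B. C b n * b) / e) \<longlonglongrightarrow> 0"
        using tendsto_divide[OF lim tendsto_const, of e] e(1) by simp
    qed
    then have "cls (C b) = \<zero>\<^bsub>QC\<^esub>" if "b \<in> B" for b
      using cls_eq_zero[OF cauchy_mono[OF rats_subset C(1)[OF that]]] that by simp
    then have "set Ks' \<subseteq> {\<zero>\<^bsub>QC\<^esub>}" using C(2) bs by auto
    then show "set (take (length ?Us) Ks) \<subseteq> {\<zero>\<^bsub>QC\<^esub>}" using Ks'(1) by blast
  qed
  then have "QC.dimension (length ?Us) QP (QC.Span QP ?Us)" by (rule QC.dimension_independent)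
  moreover have "QC.Span QP ?Us = carrier QC"
  proof
    show "QC.Span QP ?Us \<subseteq> carrier QC"
      using QC.Span_in_carrier[OF _ Us] QC.subring_props(1)[OF subfield_QP] by blast
    show "carrier QC \<subseteq> QC.Span QP ?Us"
    proof
      fix x assume "x \<in> carrier QC"
      then obtain s where s: "s \<in> cauchy_seqs K v" "x = cls s" by (auto simp: carrier_QC)
      have "\<exists>c. v (s n - (\<Sum>b\<in>B. of_rat (c b) * b)) < inverse (real (Suc n))" for n
        using B(3) cauchy_in[OF s(1), of n] unfolding dense_span_def by (simp del: of_nat_Suc)
      then obtain c where c: "\<And>n. v (s n - (\<Sum>b\<in>B. of_rat (c n b) * b)) < inverse (real (Suc n))" by metis
      define t where "t n = (\<Sum>b\<in>B. of_rat (c n b) * b)" for n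
      have tK: "t n \<in> K" for n using comb_in[OF B(1)] by (simp add: t_def)
      have st: "(\<lambda>n. s n - t n) \<in> CI"
        by (rule null_le[OF _ _ LIMSEQ_inverse_real_of_nat])
          (use c tK cauchy_in[OF s(1)] in \<open>auto simp: t_def intro: is_subfield_diff[OF K] less_imp_le\<close>)
      have tC: "t \<in> cauchy_seqs K v"
        using cauchy_add[OF K order_refl s(1) cauchy_uminus[OF order_refl K null_cauchy[OF st]]] by simp
      have cb: "(\<lambda>n. of_rat (c n b)) \<in> cauchy_seqs \<rat> v" if b: "b \<in> B" for b
      proof -
        have "\<exists>M. \<forall>m\<ge>M. \<forall>n\<ge>M. v (of_rat (c m b) - of_rat (c n b)) < d" if d: "d > 0" for d
        proof -
          obtain M where M: "\<And>m n. m \<ge> M \<Longrightarrow> n \<ge> M \<Longrightarrow> v (t m - t n) < e * d" using cauchyD[OF tC, of "e * d"] e(1) d by auto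
          have "v (of_rat (c m b) - of_rat (c n b)) < d" if "m \<ge> M" "n \<ge> M" for m n
          proof -
            have "t m - t n = (\<Sum>b\<in>B. of_rat (c m b - c n b) * b)"
              by (simp add: t_def of_rat_diff left_diff_distrib sum_subtractf)
            then have "e * a (c m b - c n b) \<le> v (t m - t n)" using e(2)[OF b, of "\<lambda>b. c m b - c n b"] by simp
            also have "\<dots> < e * d" by (rule M[OF that])
            finally have "a (c m b - c n b) < d" using e by simp
            then show ?thesis using places_overD(3)[OF vP, of "c m b - c n b"] by (simp add: of_rat_diff)
          qed
          then show ?thesis by blast
        qed
        then show ?thesis by (auto simp: cauchy_seqs_def)
      qed
      have "x = cls (\<lambda>n. \<Sum>b\<leftarrow>bs. of_rat (c n b) * b)"
        using cls_eq[OF s(1) tC] st s(2) by (simp add: sum_bs t_def[abs_def])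
      also have "\<dots> = QC.combine (map (\<lambda>b. cls (\<lambda>n. of_rat (c n b))) bs) ?Us"
        using combine_cls[of bs "\<lambda>b n. of_rat (c n b)"] bs B(1) cb by simp
      also have "\<dots> \<in> QC.Span QP ?Us"
      proof -
        have "set (map (\<lambda>b. cls (\<lambda>n. of_rat (c n b))) bs) \<subseteq> QP" using cb bs by (auto simp: QP_eq)
        then show ?thesis unfolding QC.Span_eq_combine_set[OF subfield_QP Us] by blast
      qed
      finally show "x \<in> QC.Span QP ?Us" .
    qed
  qed
  ultimately have "QC.dimension (length ?Us) QP (carrier QC)" by simp
  from QC.dimI[OF subfield_QP this] show ?thesis
    using bs distinct_card[of bs] by (simp add: local_degree_def over_def)
qed

end

theorem (in places_above) sum_local_degree:
  assumes M: "number_field M" "\<And>\<sigma>. \<sigma> \<in> Emb K \<Longrightarrow> \<sigma> ` K \<subseteq> M" and w: "w \<in> places_over a M"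
  shows "(\<Sum>v\<in>places_over a K. real (local_degree K v) * f v) = (\<Sum>\<sigma>\<in>Emb K. f (restrict (w \<circ> \<sigma>) K))"
proof -
  have fin: "finite (places_over a K)" using local_degree_count(1)[OF M w] .
  have "(\<Sum>\<sigma>\<in>Emb K. f (restrict (w \<circ> \<sigma>) K)) =
      (\<Sum>v\<in>places_over a K. \<Sum>\<sigma> | \<sigma> \<in> Emb K \<and> restrict (w \<circ> \<sigma>) K = v. f (restrict (w \<circ> \<sigma>) K))"
    using fin finite_Emb[OF nf] place_comp_Emb[OF K number_fieldD[OF M(1)] w _ M(2)]
    by (subst sum.group) auto
  also have "\<dots> = (\<Sum>v\<in>places_over a K. real (local_degree K v) * f v)"
  proof (rule sum.cong)
    fix v assume v: "v \<in> places_over a K"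
    interpret place_completion K a v using v by unfold_locales
    obtain B where B: "B \<subseteq> K" "strongly_independent a v B" "dense_span K v B"
      using ex_strongly_independent_dense[OF v] by blast
    have "local_degree K v = card {\<sigma> \<in> Emb K. restrict (w \<circ> \<sigma>) K = v}"
      using local_degree_eq_card[OF B] local_degree_count(2)[OF M w v B] by simp
    moreover have "(\<Sum>\<sigma> | \<sigma> \<in> Emb K \<and> restrict (w \<circ> \<sigma>) K = v. f (restrict (w \<circ> \<sigma>) K)) =
        (\<Sum>\<sigma> | \<sigma> \<in> Emb K \<and> restrict (w \<circ> \<sigma>) K = v. f v)" by (rule sum.cong) auto
    ultimately show "(\<Sum>\<sigma> | \<sigma> \<in> Emb K \<and> restrict (w \<circ> \<sigma>) K = v. f (restrict (w \<circ> \<sigma>) K)) = real (local_degree K v) * f v"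
      by simp
  qed simp
  finally show ?thesis ..
qed

section \<open>The places of a number field\<close>

lemma padic_abs_fraction:
  assumes p: "Factorial_Ring.prime p" and ab: "a \<noteq> 0" "b \<noteq> 0"
  shows "padic_abs p (of_int a / of_int b) =
    real p powi (int (multiplicity (int p) b) - int (multiplicity (int p) a))"
proof -
  let ?q = "of_int a / of_int b :: rat"
  obtain n d where nd: "quotient_of ?q = (n, d)" by (cases "quotient_of ?q")
  have d: "d \<noteq> 0" using quotient_of_denom_pos[OF nd] by simp
  have q: "?q = of_int n / of_int d" using quotient_of_div[OF nd] .
  then have n: "n \<noteq> 0" using ab by auto
  have "(of_int (a * d) :: rat) = of_int (n * b)" using q ab d by (simp add: field_simps)
  then have "a * d = n * b" by (simp only: of_int_eq_iff)
  then have "multiplicity (int p) (a * d) = multiplicity (int p) (n * b)" by simp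
  then have "multiplicity (int p) a + multiplicity (int p) d = multiplicity (int p) n + multiplicity (int p) b"
    using p ab d n by (simp add: prime_elem_multiplicity_mult_distrib)
  then have "int (multiplicity (int p) d) - int (multiplicity (int p) n) =
     int (multiplicity (int p) b) - int (multiplicity (int p) a)" by linarith
  then show ?thesis using ab nd by (simp add: padic_abs_def)
qed

lemma rat_fraction: "\<exists>a b. b \<noteq> 0 \<and> (q :: rat) = of_int a / of_int b \<and> (q \<noteq> 0 \<longrightarrow> a \<noteq> 0)"
proof -
  obtain n d where nd: "quotient_of q = (n, d)" by (cases "quotient_of q")
  then have "d \<noteq> 0" "q = of_int n / of_int d" using quotient_of_denom_pos[OF nd] quotient_of_div[OF nd] by auto
  then show ?thesis by (intro exI[of _ n] exI[of _ d]) auto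
qed

lemma padic_abs_mult:
  assumes p: "Factorial_Ring.prime p" shows "padic_abs p (q * r) = padic_abs p q * padic_abs p r"
proof (cases "q = 0 \<or> r = 0")
  case False
  obtain a b where ab: "b \<noteq> 0" "q = of_int a / of_int b" "a \<noteq> 0" using rat_fraction[of q] False by blast
  obtain c d where cd: "d \<noteq> 0" "r = of_int c / of_int d" "c \<noteq> 0" using rat_fraction[of r] False by blast
  have "q * r = of_int (a * c) / of_int (b * d)" using ab cd by simp
  then have "padic_abs p (q * r) = real p powi (int (multiplicity (int p) (b * d)) - int (multiplicity (int p) (a * c)))"
    using ab cd padic_abs_fraction[OF p, of "a * c" "b * d"] by simp
  also have "int (multiplicity (int p) (b * d)) - int (multiplicity (int p) (a * c)) =
     (int (multiplicity (int p) b) - int (multiplicity (int p) a)) + (int (multiplicity (int p) d) - int (multiplicity (int p) c))"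
    using p ab cd by (simp add: prime_elem_multiplicity_mult_distrib)
  also have "real p powi \<dots> = padic_abs p q * padic_abs p r"
    using padic_abs_fraction[OF p, of a b] padic_abs_fraction[OF p, of c d] ab cd prime_gt_0_nat[OF p]
    by (simp add: power_int_add)
  finally show ?thesis .
qed (auto simp: padic_abs_def)

lemma padic_abs_nonneg: "0 \<le> padic_abs p q"
  by (simp add: padic_abs_def)

lemma padic_abs_eq_0: "Factorial_Ring.prime p \<Longrightarrow> padic_abs p q = 0 \<longleftrightarrow> q = 0"
  using prime_gt_0_nat[of p] by (simp add: padic_abs_def)

lemma padic_abs_add:
  assumes p: "Factorial_Ring.prime p" shows "padic_abs p (q + r) \<le> max (padic_abs p q) (padic_abs p r)"
proof (cases "q = 0 \<or> r = 0 \<or> q + r = 0")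
  case False
  obtain a b where ab: "b \<noteq> 0" "q = of_int a / of_int b" "a \<noteq> 0" using rat_fraction[of q] False by blast
  obtain c d where cd: "d \<noteq> 0" "r = of_int c / of_int d" "c \<noteq> 0" using rat_fraction[of r] False by blast
  let ?m = "multiplicity (int p)"
  have p1: "1 < real p" using prime_gt_1_nat[OF p] by simp
  have q: "q = of_int (a * d) / of_int (b * d)" and r: "r = of_int (c * b) / of_int (b * d)"
    using ab cd by auto
  have qr: "q + r = of_int (a * d + c * b) / of_int (b * d)" unfolding q r by (simp add: add_divide_distrib)
  then have nz: "a * d + c * b \<noteq> 0" using False by (metis div_0 of_int_0)
  have bd: "b * d \<noteq> 0" "a * d \<noteq> 0" "c * b \<noteq> 0" using ab cd by auto
  have k: "min (?m (a * d)) (?m (c * b)) \<le> ?m (a * d + c * b)"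
  proof (rule multiplicity_geI[OF nz])
    show "\<not> is_unit (int p)" using p1 by simp
    show "int p ^ min (?m (a * d)) (?m (c * b)) dvd a * d + c * b"
      by (rule dvd_add) (rule multiplicity_dvd', simp)+
  qed
  have mono: "real p powi (int (?m (b * d)) - int j) \<le> real p powi (int (?m (b * d)) - int i)" if "i \<le> j" for i j
    using p1 that by (intro power_int_increasing) auto
  have "padic_abs p (q + r) = real p powi (int (?m (b * d)) - int (?m (a * d + c * b)))"
    unfolding qr by (rule padic_abs_fraction[OF p nz bd(1)])
  also have "\<dots> \<le> real p powi (int (?m (b * d)) - int (min (?m (a * d)) (?m (c * b))))"
    by (rule mono[OF k])
  also have "\<dots> \<le> max (real p powi (int (?m (b * d)) - int (?m (a * d)))) (real p powi (int (?m (b * d)) - int (?m (c * b))))"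
    by (simp add: min_def)
  also have "\<dots> = max (padic_abs p q) (padic_abs p r)"
    unfolding q r by (simp only: padic_abs_fraction[OF p bd(2,1)] padic_abs_fraction[OF p bd(3,1)])
  finally show ?thesis .
next
  case True
  then show ?thesis
    using padic_abs_nonneg[of p q] padic_abs_nonneg[of p r] by (auto simp: padic_abs_def[of p 0])
qed

lemma padic_abs_of_int_le: "Factorial_Ring.prime p \<Longrightarrow> padic_abs p (of_int n) \<le> 1"
proof (cases "n = 0")
  case False
  assume p: "Factorial_Ring.prime p"
  have "real p powi (- int (multiplicity (int p) n)) \<le> real p powi 0"
    using prime_gt_1_nat[OF p] by (intro power_int_increasing) auto
  then show ?thesis using padic_abs_fraction[OF p False, of 1] by simp
qed (simp add: padic_abs_def)

text \<open>The absolute values of the rationals, indexed by \<open>0\<close> (the usual one) and the primes.\<close>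

definition rabs :: "nat \<Rightarrow> rat \<Rightarrow> real" where
  "rabs p q = (if p = 0 then \<bar>of_rat q\<bar> else padic_abs p q)"

definition rplaces :: "nat set" where
  "rplaces = insert 0 {p. Factorial_Ring.prime p}"

lemma rat_abs_rabs: "p \<in> rplaces \<Longrightarrow> rat_abs (rabs p)"
  unfolding rplaces_def
proof (elim insertE)
  assume "p = 0"
  moreover have "\<bar>real_of_rat (q + r)\<bar> \<le> \<bar>real_of_rat q\<bar> + \<bar>real_of_rat r\<bar>" for q r
    unfolding of_rat_add by (rule abs_triangle_ineq)
  ultimately show ?thesis by (simp add: rat_abs_def rabs_def of_rat_mult abs_mult del: abs_of_rat)
next
  assume "p \<in> {p. Factorial_Ring.prime p}"
  then have p: "Factorial_Ring.prime p" by simp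
  have "padic_abs p (q + r) \<le> padic_abs p q + padic_abs p r" for q r
    using padic_abs_add[OF p, of q r] padic_abs_nonneg[of p q] padic_abs_nonneg[of p r] by linarith
  then show ?thesis
    using p prime_gt_0_nat[OF p]
    by (auto simp: rat_abs_def rabs_def padic_abs_nonneg padic_abs_eq_0 padic_abs_mult)
qed

lemma rabs_nontrivial: "p \<in> rplaces \<Longrightarrow> \<exists>q. 0 < rabs p q \<and> rabs p q < 1"
  unfolding rplaces_def
proof (elim insertE)
  assume "p = 0"
  then show ?thesis by (intro exI[of _ "1 / 2"]) (simp add: rabs_def of_rat_divide)
next
  assume "p \<in> {p. Factorial_Ring.prime p}"
  then have p: "Factorial_Ring.prime p" by simp
  have "padic_abs p (of_nat p) = 1 / real p"
    using padic_abs_fraction[OF p, of "int p" 1] prime_gt_0_nat[OF p] p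
    by (simp add: power_int_minus_divide)
  then show ?thesis using prime_gt_1_nat[OF p] by (intro exI[of _ "of_nat p"]) (simp add: rabs_def)
qed

lemma places_above_rabs: "number_field K \<Longrightarrow> p \<in> rplaces \<Longrightarrow> places_above K (rabs p)"
  using rat_abs_rabs rabs_nontrivial by unfold_locales

lemma places_eq: "places K = (\<Union>p\<in>rplaces. places_over (rabs p) K)"
proof -
  have "rabs p = padic_abs p" if "Factorial_Ring.prime p" for p
    using prime_gt_0_nat[OF that] by (auto simp: rabs_def)
  then show ?thesis by (auto simp: places_def places_over_def rplaces_def rabs_def)
qed

text \<open>Among the indices, only the prime \<open>p\<close> itself gives an absolute value below
  1 at \<open>p\<close>.\<close>

lemma rabs_inj: "p \<in> rplaces \<Longrightarrow> p' \<in> rplaces \<Longrightarrow> rabs p = rabs p' \<Longrightarrow> p = p'"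
proof -
  have *: "p = p'" if p: "Factorial_Ring.prime p" and p': "p' \<in> rplaces" and eq: "rabs p = rabs p'" for p p'
  proof (rule ccontr)
    assume ne: "p \<noteq> p'"
    have "rabs p (of_nat p) = 1 / real p"
      using padic_abs_fraction[OF p, of "int p" 1] prime_gt_0_nat[OF p] p
      by (simp add: rabs_def power_int_minus_divide)
    then have lt: "rabs p (of_nat p) < 1" using prime_gt_1_nat[OF p] by simp
    have "rabs p' (of_nat p) \<ge> 1"
    proof (cases "p' = 0")
      case False
      then have p'p: "Factorial_Ring.prime p'" using p' by (auto simp: rplaces_def)
      then have "\<not> int p' dvd int p" using p ne primes_dvd_imp_eq[OF p'p p] by auto
      then have "multiplicity (int p') (int p) = 0" by (rule not_dvd_imp_multiplicity_0)
      then show ?thesis using padic_abs_fraction[OF p'p, of "int p" 1] prime_gt_0_nat[OF p] False by (simp add: rabs_def)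
    qed (use prime_gt_0_nat[OF p] in \<open>simp add: rabs_def\<close>)
    with lt eq show False by simp
  qed
  show "p \<in> rplaces \<Longrightarrow> p' \<in> rplaces \<Longrightarrow> rabs p = rabs p' \<Longrightarrow> p = p'"
    using *[of p p'] *[of p' p] by (auto simp: rplaces_def)
qed

lemma places_over_disjoint:
  "p \<in> rplaces \<Longrightarrow> p' \<in> rplaces \<Longrightarrow> p \<noteq> p' \<Longrightarrow> places_over (rabs p) K \<inter> places_over (rabs p') K = {}"
proof -
  assume p: "p \<in> rplaces" "p' \<in> rplaces" "p \<noteq> p'"
  have "rabs p = rabs p'" if w: "w \<in> places_over (rabs p) K" "w \<in> places_over (rabs p') K" for w
    using places_overD(3)[OF w(1)] places_overD(3)[OF w(2)] by (intro ext) simp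
  then show ?thesis using rabs_inj[OF p(1,2)] p(3) by blast
qed

lemma finite_places_over:
  assumes K: "number_field K" and p: "p \<in> rplaces" shows "finite (places_over (rabs p) K)"
proof -
  obtain M where M: "number_field M" "\<And>\<sigma>. \<sigma> \<in> Emb K \<Longrightarrow> \<sigma> ` K \<subseteq> M" using ex_normal[OF K] by blast
  obtain w where w: "w \<in> places_over (rabs p) M" using ex_place[OF M(1) rat_abs_rabs[OF p]] by blast
  show ?thesis using places_above.local_degree_count(1)[OF places_above_rabs[OF K p] M w] .
qed

text \<open>If x/y = 1 + e with e > 0, the square of Bernoulli's inequality makes (1+e)^(2n) grow at
  least quadratically, faster than 2n + 1. The factor n + 1 in the hypothesis is the number of terms
  of a binomial expansion.\<close>

lemma real_le_of_power_le:
  fixes x y :: real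
  assumes "0 \<le> x" "0 \<le> y" "\<And>n. x ^ n \<le> (real n + 1) * y ^ n" shows "x \<le> y"
proof (rule ccontr)
  assume "\<not> x \<le> y"
  show False
  proof (cases "y = 0")
    case True
    then show False using assms(3)[of 1] \<open>\<not> x \<le> y\<close> by simp
  next
    case False
    then have y: "0 < y" using assms by simp
    define e where "e = x / y - 1"
    have e: "e > 0" using \<open>\<not> x \<le> y\<close> y by (simp add: e_def)
    \<comment> \<open>With this choice (n e)^2 exceeds 3n, hence 2n + 1.\<close>
    obtain n :: nat where n: "3 / e\<^sup>2 < real n" using reals_Archimedean2 by blast
    have n1: "n \<ge> 1" using n e by (cases n) (auto simp: divide_less_0_iff)
    have "(1 + e) ^ (2 * n) \<le> 2 * real n + 1"
      using assms(3)[of "2 * n"] y by (simp add: e_def power_divide pos_divide_le_eq)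
    moreover have "(1 + real n * e)\<^sup>2 \<le> (1 + e) ^ (2 * n)"
    proof -
      have "1 + real n * e \<le> (1 + e) ^ n" using e by (intro Bernoulli_inequality) simp
      then have "(1 + real n * e)\<^sup>2 \<le> ((1 + e) ^ n)\<^sup>2" using e by (intro power_mono) auto
      then show ?thesis by (simp add: power_mult[symmetric] mult.commute)
    qed
    moreover have "3 * real n \<le> (real n * e)\<^sup>2"
    proof -
      have "3 < real n * e\<^sup>2" using n e by (simp add: pos_divide_less_eq)
      then have "real n * 3 \<le> real n * (real n * e\<^sup>2)" by (intro mult_left_mono) auto
      then show ?thesis by (simp add: power2_eq_square mult_ac)
    qed
    moreover have "(real n * e)\<^sup>2 < (1 + real n * e)\<^sup>2" using e by (intro power_strict_mono) auto
    ultimately show False using n1 by linarith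
  qed
qed

section \<open>Places above primes\<close>

context abs_value_on
begin

text \<open>Expand (x + y)^n: binomial coefficients have size at most 1, so the n-th power is at
  most n + 1 times that of the maximum, and \<open>real_le_of_power_le\<close> removes the
  factor.\<close>

lemma ultrametric:
  assumes nat: "\<And>n. v (of_nat n) \<le> 1" and xy: "x \<in> K" "y \<in> K"
  shows "v (x + y) \<le> max (v x) (v y)"
proof (rule real_le_of_power_le)
  have xyK: "x + y \<in> K" using xy by (rule is_subfieldD(3)[OF K])
  show "0 \<le> v (x + y)" "0 \<le> max (v x) (v y)" using nonneg xy xyK by (auto simp: le_max_iff_disj)
  fix n
  have "v (x + y) ^ n = v ((x + y) ^ n)" using power[OF xyK] by simp
  also have "\<dots> = v (\<Sum>k\<le>n. of_nat (n choose k) * (x ^ k * y ^ (n - k)))" by (simp add: binomial_ring mult.assoc)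
  also have "\<dots> \<le> (\<Sum>k\<le>n. v (of_nat (n choose k) * (x ^ k * y ^ (n - k))))"
    using xy by (intro sum_le is_subfieldD(4)[OF K] is_subfield_of_nat[OF K] is_subfield_power[OF K])
  also have "\<dots> \<le> (\<Sum>k\<le>n. max (v x) (v y) ^ n)"
  proof (rule sum_mono)
    fix k assume k: "k \<in> {..n}"
    have "v (of_nat (n choose k) * (x ^ k * y ^ (n - k))) = v (of_nat (n choose k)) * (v x ^ k * v y ^ (n - k))"
      using xy by (simp add: mult power is_subfieldD(4)[OF K] is_subfield_of_nat[OF K] is_subfield_power[OF K])
    also have "\<dots> \<le> 1 * (max (v x) (v y) ^ k * max (v x) (v y) ^ (n - k))"
      using nonneg xy nat by (intro mult_mono power_mono mult_nonneg_nonneg) (auto simp: le_max_iff_disj)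
    also have "\<dots> = max (v x) (v y) ^ n" using k by (simp add: power_add[symmetric])
    finally show "v (of_nat (n choose k) * (x ^ k * y ^ (n - k))) \<le> max (v x) (v y) ^ n" .
  qed
  finally show "v (x + y) ^ n \<le> (real n + 1) * max (v x) (v y) ^ n" by (simp add: algebra_simps)
qed

lemma ultrametric_sum:
  assumes nat: "\<And>n. v (of_nat n) \<le> 1" and C: "0 \<le> C" and f: "\<And>i. i \<in> I \<Longrightarrow> f i \<in> K \<and> v (f i) \<le> C"
  shows "v (sum f I) \<le> C"
  using f
proof (induction I rule: infinite_finite_induct)
  case (insert i I)
  have "v (f i + sum f I) \<le> max (v (f i)) (v (sum f I))"
    using insert.prems by (intro ultrametric nat is_subfield_sum[OF K]) auto
  also have "\<dots> \<le> C" using insert by auto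
  finally show ?case using insert by simp
qed (use C zero in auto)

text \<open>If v(x) > 1, the leading term of the minimal equation would be strictly larger than all
  the others.\<close>

lemma le_one_of_integral:
  assumes nat: "\<And>n. v (of_nat n) \<le> 1" and x: "x \<in> K"
    and co: "\<And>i. v (of_rat (Polynomial.coeff (minp x) i)) \<le> 1"
  shows "v x \<le> 1"
proof (rule ccontr)
  assume "\<not> v x \<le> 1"
  define d where "d = Polynomial.degree (minp x)"
  have d: "d > 0" using degree_minp_pos by (simp add: d_def)
  have "0 = (\<Sum>i\<le>d. of_rat (Polynomial.coeff (minp x) i) * x ^ i)"
    using minp_root[of x] by (simp add: rpoly_altdef d_def)
  also have "\<dots> = x ^ d + (\<Sum>i<d. of_rat (Polynomial.coeff (minp x) i) * x ^ i)"
    using minp_monic[of x] by (simp add: lessThan_Suc_atMost[symmetric] d_def)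
  finally have xd: "x ^ d = - (\<Sum>i<d. of_rat (Polynomial.coeff (minp x) i) * x ^ i)" by (simp add: add_eq_0_iff)
  have "v (\<Sum>i<d. of_rat (Polynomial.coeff (minp x) i) * x ^ i) \<le> v x ^ (d - 1)"
  proof (rule ultrametric_sum[OF nat])
    show "0 \<le> v x ^ (d - 1)" using \<open>\<not> v x \<le> 1\<close> by simp
    fix i assume i: "i \<in> {..<d}"
    have "v (of_rat (Polynomial.coeff (minp x) i) * x ^ i) \<le> 1 * v x ^ (d - 1)"
      using x i co \<open>\<not> v x \<le> 1\<close>
      by (simp only: mult power is_subfield_of_rat[OF K] is_subfield_power[OF K]) (intro mult_mono power_increasing, auto)
    then show "of_rat (Polynomial.coeff (minp x) i) * x ^ i \<in> K \<and> v (of_rat (Polynomial.coeff (minp x) i) * x ^ i) \<le> v x ^ (d - 1)"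
      using x by (simp add: is_subfieldD(4)[OF K] is_subfield_of_rat[OF K] is_subfield_power[OF K])
  qed
  then have "v (x ^ d) \<le> v x ^ (d - 1)"
    using x xd minus[of "\<Sum>i<d. of_rat (Polynomial.coeff (minp x) i) * x ^ i"]
    by (simp add: is_subfield_sum[OF K] is_subfieldD(4)[OF K] is_subfield_of_rat[OF K] is_subfield_power[OF K])
  then have "v x ^ d \<le> v x ^ (d - 1)" using power[OF x] by simp
  moreover have "v x ^ (d - 1) < v x ^ d" using \<open>\<not> v x \<le> 1\<close> d by (intro power_strict_increasing) auto
  ultimately show False by simp
qed

end

lemma place_of_nat_le:
  assumes p: "Factorial_Ring.prime p" and v: "v \<in> places_over (rabs p) K" shows "v (of_nat n) \<le> 1"
proof -
  have "v (of_nat n) = padic_abs p (of_int (int n))"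
    using places_overD(3)[OF v, of "of_nat n"] prime_gt_0_nat[OF p] by (simp add: rabs_def)
  then show ?thesis using padic_abs_of_int_le[OF p, of "int n"] by simp
qed

text \<open>Such a place is archimedean or lies above a prime that divides a denominator of
  \<open>minp x\<close>; above each of these finitely many rational places there are only finitely
  many.\<close>

lemma finite_places_gt_one:
  assumes K: "number_field K" and x: "x \<in> K"
  shows "finite {v \<in> places K. 1 < v x}"
proof -
  let ?c = "\<lambda>i. Polynomial.coeff (minp x) i"
  define D where "D = (\<Prod>i\<le>Polynomial.degree (minp x). snd (quotient_of (?c i)))"
  have D: "D \<noteq> 0"
    unfolding D_def using quotient_of_denom_pos' by (simp add: less_imp_neq[THEN not_sym])
  define T where "T = insert 0 {p. Factorial_Ring.prime p \<and> int p dvd D}"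
  have "finite {p. p dvd nat \<bar>D\<bar>}" using D by (intro finite_divisors_nat) auto
  then have "finite {p. Factorial_Ring.prime p \<and> int p dvd D}"
    by (rule finite_subset[rotated]) (auto simp: nat_dvd_iff int_dvd_int_iff[symmetric])
  then have T: "finite T" by (simp add: T_def)
  have "{v \<in> places K. 1 < v x} \<subseteq> (\<Union>p\<in>T \<inter> rplaces. places_over (rabs p) K)"
  proof
    fix v assume "v \<in> {v \<in> places K. 1 < v x}"
    then obtain p where p: "p \<in> rplaces" "v \<in> places_over (rabs p) K" "1 < v x" by (auto simp: places_eq)
    have "p \<in> T"
    proof (rule ccontr)
      assume "p \<notin> T"
      then have pp: "Factorial_Ring.prime p" and nd: "\<not> int p dvd D" using p by (auto simp: T_def rplaces_def)
      interpret abs_value_on K v using number_fieldD[OF K] places_overD(2)[OF p(2)] by unfold_locales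
      have "v x \<le> 1"
      proof (rule le_one_of_integral[OF place_of_nat_le[OF pp p(2)] x])
        fix i
        show "v (of_rat (?c i)) \<le> 1"
        proof (cases "?c i = 0")
          case False
          then have i: "i \<le> Polynomial.degree (minp x)" by (rule le_degree)
          obtain a b where ab: "quotient_of (?c i) = (a, b)" by (cases "quotient_of (?c i)")
          then have "b dvd D" unfolding D_def using i dvd_prodI[of "{..Polynomial.degree (minp x)}" i "\<lambda>i. snd (quotient_of (?c i))"] by simp
          then have "\<not> int p dvd b" using nd dvd_trans by blast
          then have "multiplicity (int p) b = 0" by (rule not_dvd_imp_multiplicity_0)
          then have "padic_abs p (?c i) = real p powi (- int (multiplicity (int p) a))"
            using False ab by (simp add: padic_abs_def)
          also have "\<dots> \<le> real p powi 0" using prime_gt_1_nat[OF pp] by (intro power_int_increasing) auto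
          finally show ?thesis using places_overD(3)[OF p(2)] prime_gt_0_nat[OF pp] by (simp add: rabs_def)
        qed (simp add: zero)
      qed
      with p(3) show False by simp
    qed
    with p show "v \<in> (\<Union>p\<in>T \<inter> rplaces. places_over (rabs p) K)" by blast
  qed
  then show ?thesis
    by (rule finite_subset) (use T finite_places_over[OF K] in auto)
qed

lemma places_abs_value: "number_field K \<Longrightarrow> v \<in> places K \<Longrightarrow> abs_value_on K v"
  using number_fieldD by unfold_locales (auto simp: places_def)

lemma finite_places_ne_one:
  assumes K: "number_field K" and x: "x \<in> K" "x \<noteq> 0"
  shows "finite {v \<in> places K. v x \<noteq> 1}"
proof (rule finite_subset)
  show "{v \<in> places K. v x \<noteq> 1} \<subseteq> {v \<in> places K. 1 < v x} \<union> {v \<in> places K. 1 < v (inverse x)}"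
  proof
    fix v assume vp: "v \<in> {v \<in> places K. v x \<noteq> 1}"
    interpret abs_value_on K v using places_abs_value[OF K] vp by blast
    show "v \<in> {v \<in> places K. 1 < v x} \<union> {v \<in> places K. 1 < v (inverse x)}"
      using vp inverse[OF x(1)] pos[OF x] by (auto simp: one_less_inverse_iff)
  qed
  show "finite ({v \<in> places K. 1 < v x} \<union> {v \<in> places K. 1 < v (inverse x)})"
    using finite_places_gt_one[OF K] x is_subfieldD(6)[OF number_fieldD[OF K]] by auto
qed

section \<open>The product formula over the rationals\<close>

lemma prod_prime_powers:
  assumes n: "n \<noteq> 0" and S: "finite S" "S \<subseteq> {p. Factorial_Ring.prime p}" "\<And>p. Factorial_Ring.prime p \<Longrightarrow> int p dvd n \<Longrightarrow> p \<in> S"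
  shows "(\<Prod>p\<in>S. real p ^ multiplicity (int p) n) = real_of_int \<bar>n\<bar>"
proof -
  have pf: "prime_factors n = int ` {p \<in> S. int p dvd n}"
  proof
    show "prime_factors n \<subseteq> int ` {p \<in> S. int p dvd n}"
    proof
      fix q assume "q \<in> prime_factors n"
      then have q: "Factorial_Ring.prime q" "q dvd n" using n by (auto simp: in_prime_factors_iff)
      then have "q = int (nat q)" using prime_ge_0_int by simp
      moreover have "Factorial_Ring.prime (nat q)" using iffD1[OF prime_int_nat_transfer q(1)] by blast
      ultimately show "q \<in> int ` {p \<in> S. int p dvd n}" using q S(3) by (metis (mono_tags, lifting) image_eqI mem_Collect_eq)
    qed
    show "int ` {p \<in> S. int p dvd n} \<subseteq> prime_factors n" using S(2) n by (auto simp: in_prime_factors_iff)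
  qed
  have "(\<Prod>p\<in>S. real p ^ multiplicity (int p) n) = (\<Prod>p | p \<in> S \<and> int p dvd n. real p ^ multiplicity (int p) n)"
    using S(1) by (intro prod.mono_neutral_right) (auto simp: not_dvd_imp_multiplicity_0)
  also have "\<dots> = real_of_int (\<Prod>q\<in>prime_factors n. q ^ multiplicity q n)"
    unfolding pf by (subst prod.reindex) (auto simp: inj_on_def)
  also have "(\<Prod>q\<in>prime_factors n. q ^ multiplicity q n) = \<bar>n\<bar>"
    using prod_prime_factors[OF n] by simp
  finally show ?thesis .
qed

text \<open>Quantifying over all larger finite sets allows the index set to be enlarged later by the
  support of another function.\<close>

lemma rational_product_formula:
  assumes q: "q \<noteq> 0"
  shows "\<exists>T. finite T \<and> T \<subseteq> rplaces \<and> (\<forall>T'. finite T' \<longrightarrow> T \<subseteq> T' \<longrightarrow> T' \<subseteq> rplaces \<longrightarrow> (\<Sum>p\<in>T'. ln (rabs p q)) = 0)"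
proof -
  obtain a b where ab: "b \<noteq> 0" "q = of_int a / of_int b" "a \<noteq> 0" using rat_fraction[of q] q by blast
  let ?T = "insert 0 {p. Factorial_Ring.prime p \<and> int p dvd a * b}"
  have "finite {p. p dvd nat \<bar>a * b\<bar>}" using ab by (intro finite_divisors_nat) auto
  then have "finite {p. Factorial_Ring.prime p \<and> int p dvd a * b}"
    by (rule finite_subset[rotated]) (auto simp: nat_dvd_iff int_dvd_int_iff[symmetric])
  moreover have "(\<Sum>p\<in>T'. ln (rabs p q)) = 0" if T': "finite T'" "?T \<subseteq> T'" "T' \<subseteq> rplaces" for T'
  proof -
    let ?S = "T' - {0}"
    have S: "finite ?S" "?S \<subseteq> {p. Factorial_Ring.prime p}" using T' by (auto simp: rplaces_def)
    have mem: "p \<in> ?S" if "Factorial_Ring.prime p" "int p dvd a \<or> int p dvd b" for p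
      using that T'(2) prime_gt_0_nat[OF that(1)] by auto
    have "(\<Sum>p\<in>?S. ln (rabs p q)) = (\<Sum>p\<in>?S. ln (real p ^ multiplicity (int p) b) - ln (real p ^ multiplicity (int p) a))"
    proof (rule sum.cong)
      fix p assume "p \<in> ?S"
      then have p: "Factorial_Ring.prime p" using S by auto
      then have "rabs p q = real p powi (int (multiplicity (int p) b) - int (multiplicity (int p) a))"
        using padic_abs_fraction[OF p ab(3,1)] ab(2) prime_gt_0_nat[OF p] by (simp add: rabs_def)
      also have "\<dots> = real p ^ multiplicity (int p) b / real p ^ multiplicity (int p) a"
        using prime_gt_0_nat[OF p] by (simp add: power_int_diff)
      finally show "ln (rabs p q) = ln (real p ^ multiplicity (int p) b) - ln (real p ^ multiplicity (int p) a)"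
        using prime_gt_0_nat[OF p] by (simp add: ln_div)
    qed simp
    also have "\<dots> = ln (\<Prod>p\<in>?S. real p ^ multiplicity (int p) b) - ln (\<Prod>p\<in>?S. real p ^ multiplicity (int p) a)"
      using S prime_gt_0_nat by (subst (1 2) ln_prod) (auto simp: sum_subtractf subset_iff)
    also have "\<dots> = ln (real_of_int \<bar>b\<bar>) - ln (real_of_int \<bar>a\<bar>)"
      using prod_prime_powers[OF ab(1) S] prod_prime_powers[OF ab(3) S] mem by simp
    also have "\<dots> = - ln (rabs 0 q)"
      using ab by (simp add: rabs_def of_rat_divide abs_divide ln_div)
    finally have "(\<Sum>p\<in>?S. ln (rabs p q)) = - ln (rabs 0 q)" .
    then show ?thesis using T' by (subst sum.remove[of _ 0]) auto
  qed
  ultimately show ?thesis by (intro exI[of _ ?T]) (auto simp: rplaces_def)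
qed

section \<open>Sums over all places\<close>

definition gsum :: "qbar set \<Rightarrow> ((qbar \<Rightarrow> real) \<Rightarrow> real) \<Rightarrow> real" where
  "gsum K g = (\<Sum>\<^sub>\<infinity>v\<in>places K. real (local_degree K v) * g v)"

definition fin_supp :: "qbar set \<Rightarrow> ((qbar \<Rightarrow> real) \<Rightarrow> real) \<Rightarrow> bool" where
  "fin_supp K g \<longleftrightarrow> finite {v \<in> places K. g v \<noteq> 0}"

lemma gsum_eq_sum:
  assumes "finite S" "{v \<in> places K. g v \<noteq> 0} \<subseteq> S" "S \<subseteq> places K"
  shows "gsum K g = (\<Sum>v\<in>S. real (local_degree K v) * g v)"
proof -
  have "gsum K g = (\<Sum>\<^sub>\<infinity>v\<in>S. real (local_degree K v) * g v)"
    unfolding gsum_def by (rule infsum_cong_neutral) (use assms in auto)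
  then show ?thesis using assms by simp
qed

lemma gsum_eq_sum_primes:
  assumes K: "number_field K" and T: "finite T" "T \<subseteq> rplaces"
    and supp: "{v \<in> places K. g v \<noteq> 0} \<subseteq> (\<Union>p\<in>T. places_over (rabs p) K)"
  shows "gsum K g = (\<Sum>p\<in>T. \<Sum>v\<in>places_over (rabs p) K. real (local_degree K v) * g v)"
proof -
  have fin: "finite (places_over (rabs p) K)" if "p \<in> T" for p using finite_places_over[OF K] T that by blast
  have "gsum K g = (\<Sum>v\<in>(\<Union>p\<in>T. places_over (rabs p) K). real (local_degree K v) * g v)"
    by (rule gsum_eq_sum) (use supp T fin places_eq in auto)
  also have "\<dots> = (\<Sum>p\<in>T. \<Sum>v\<in>places_over (rabs p) K. real (local_degree K v) * g v)"
    using T fin places_over_disjoint by (intro sum.UNION_disjoint) (auto, blast)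
  finally show ?thesis .
qed

lemma ex_supp_primes:
  assumes "fin_supp K g"
  shows "\<exists>T. finite T \<and> T \<subseteq> rplaces \<and> {v \<in> places K. g v \<noteq> 0} \<subseteq> (\<Union>p\<in>T. places_over (rabs p) K)"
proof -
  define f where "f v = (SOME p. p \<in> rplaces \<and> v \<in> places_over (rabs p) K)" for v
  have f: "f v \<in> rplaces \<and> v \<in> places_over (rabs (f v)) K" if "v \<in> places K" for v
    unfolding f_def by (rule someI_ex) (use that in \<open>auto simp: places_eq\<close>)
  have "finite (f ` {v \<in> places K. g v \<noteq> 0})" using assms by (simp add: fin_supp_def)
  moreover have "f ` {v \<in> places K. g v \<noteq> 0} \<subseteq> rplaces" using f by blast
  moreover have "{v \<in> places K. g v \<noteq> 0} \<subseteq> (\<Union>p\<in>f ` {v \<in> places K. g v \<noteq> 0}. places_over (rabs p) K)"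
    using f by blast
  ultimately show ?thesis by blast
qed

lemma fin_supp_add: "fin_supp K f \<Longrightarrow> fin_supp K g \<Longrightarrow> fin_supp K (\<lambda>v. f v + g v)"
  unfolding fin_supp_def by (rule finite_subset[of _ "{v \<in> places K. f v \<noteq> 0} \<union> {v \<in> places K. g v \<noteq> 0}"]) auto

lemma fin_supp_scale: "fin_supp K f \<Longrightarrow> fin_supp K (\<lambda>v. c * f v)"
  unfolding fin_supp_def by (rule finite_subset[of _ "{v \<in> places K. f v \<noteq> 0}"]) auto

lemma fin_supp_sum: "(\<And>i. i \<in> I \<Longrightarrow> fin_supp K (f i)) \<Longrightarrow> fin_supp K (\<lambda>v. \<Sum>i\<in>I. f i v)"
proof (induction I rule: infinite_finite_induct)
  case (insert i I)
  then show ?case using fin_supp_add[of K "f i" "\<lambda>v. \<Sum>i\<in>I. f i v"] by simp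
next
  case (infinite I)
  then show ?case by (simp add: fin_supp_def)
next
  case empty
  then show ?case by (simp add: fin_supp_def)
qed

lemma gsum_add:
  assumes "fin_supp K f" "fin_supp K g" shows "gsum K (\<lambda>v. f v + g v) = gsum K f + gsum K g"
proof -
  let ?S = "{v \<in> places K. f v \<noteq> 0} \<union> {v \<in> places K. g v \<noteq> 0}"
  have "finite ?S" using assms by (simp add: fin_supp_def)
  then have "gsum K f = (\<Sum>v\<in>?S. real (local_degree K v) * f v)" "gsum K g = (\<Sum>v\<in>?S. real (local_degree K v) * g v)"
    "gsum K (\<lambda>v. f v + g v) = (\<Sum>v\<in>?S. real (local_degree K v) * (f v + g v))"
    by (auto intro!: gsum_eq_sum)
  then show ?thesis by (simp add: distrib_left sum.distrib)
qed

lemma gsum_scale: assumes "fin_supp K f" shows "gsum K (\<lambda>v. c * f v) = c * gsum K f"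
proof -
  let ?S = "{v \<in> places K. f v \<noteq> 0}"
  have "finite ?S" using assms by (simp add: fin_supp_def)
  then show ?thesis
    using gsum_eq_sum[of ?S K f] gsum_eq_sum[of ?S K "\<lambda>v. c * f v"]
    by (auto simp: sum_distrib_left mult.left_commute)
qed

lemma gsum_mono:
  assumes "fin_supp K f" "fin_supp K g" "\<And>v. v \<in> places K \<Longrightarrow> f v \<le> g v" shows "gsum K f \<le> gsum K g"
proof -
  let ?S = "{v \<in> places K. f v \<noteq> 0} \<union> {v \<in> places K. g v \<noteq> 0}"
  have "finite ?S" using assms by (simp add: fin_supp_def)
  then have "gsum K f = (\<Sum>v\<in>?S. real (local_degree K v) * f v)" "gsum K g = (\<Sum>v\<in>?S. real (local_degree K v) * g v)"
    by (auto intro!: gsum_eq_sum)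
  then show ?thesis using assms(3) by (auto intro!: sum_mono mult_left_mono)
qed

lemma gsum_cong: "(\<And>v. v \<in> places K \<Longrightarrow> f v = g v) \<Longrightarrow> gsum K f = gsum K g"
  unfolding gsum_def by (intro infsum_cong) auto

lemma restrict_place:
  assumes "is_subfield K" "K \<subseteq> L" "w \<in> places_over a L" shows "restrict w K \<in> places_over a K"
  using assms is_subfieldD[OF assms(1)] is_subfield_of_rat[OF assms(1)]
  by (auto simp: places_over_def is_abs_value_def subset_iff)

lemma dim_pos: "number_field K \<Longrightarrow> 0 < QV.dim K"
  using number_field_primitive[of K] dim_qadj degree_minp_pos by metis

text \<open>Above each rational place both sums become sums over embeddings with values in one
  common field, and every embedding of \<open>K\<close> has [L:K] extensions to \<open>L\<close>.
  After division by the degrees this factor disappears.\<close>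

lemma gsum_extend:
  assumes K: "number_field K" and L: "number_field L" and KL: "K \<subseteq> L" and f: "fin_supp K f"
  shows "fin_supp L (\<lambda>w. f (restrict w K))"
    and "gsum L (\<lambda>w. f (restrict w K)) / QV.dim L = gsum K f / QV.dim K"
proof -
  let ?g = "\<lambda>w. f (restrict w K)"
  have K': "is_subfield K" by (rule number_fieldD[OF K])
  obtain T where T: "finite T" "T \<subseteq> rplaces" "{v \<in> places K. f v \<noteq> 0} \<subseteq> (\<Union>p\<in>T. places_over (rabs p) K)"
    using ex_supp_primes[OF f] by blast
  have supp: "{w \<in> places L. ?g w \<noteq> 0} \<subseteq> (\<Union>p\<in>T. places_over (rabs p) L)"
  proof
    fix w assume "w \<in> {w \<in> places L. ?g w \<noteq> 0}"
    then obtain p where p: "p \<in> rplaces" "w \<in> places_over (rabs p) L" "?g w \<noteq> 0" by (auto simp: places_eq)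
    then have r: "restrict w K \<in> places_over (rabs p) K" using restrict_place[OF K' KL] by blast
    then obtain p' where p': "p' \<in> T" "restrict w K \<in> places_over (rabs p') K" using T(3) p places_eq by blast
    then have "p = p'" using places_over_disjoint[OF p(1), of p' K] T(2) r by blast
    with p p' show "w \<in> (\<Union>p\<in>T. places_over (rabs p) L)" by blast
  qed
  show fin: "fin_supp L ?g" unfolding fin_supp_def
    by (rule finite_subset[OF supp]) (use T finite_places_over[OF L] in auto)
  obtain k where k: "QV.dim L = QV.dim K * k" "\<And>\<sigma>. \<sigma> \<in> Emb K \<Longrightarrow> card {\<tau> \<in> Emb L. restrict \<tau> K = \<sigma>} = k"
    using Emb_fibre[OF K L KL] by blast
  have k0: "k > 0" using k(1) dim_pos[OF L] by (cases k) auto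
  obtain M where M: "number_field M" "\<And>\<sigma>. \<sigma> \<in> Emb L \<Longrightarrow> \<sigma> ` L \<subseteq> M" using ex_normal[OF L] by blast
  \<comment> \<open>Embeddings of \<open>K\<close> extend to \<open>L\<close>, so the field
    \<open>M\<close> chosen for \<open>L\<close> also contains the images of
    \<open>K\<close>.\<close>
  have MK: "\<sigma> ` K \<subseteq> M" if "\<sigma> \<in> Emb K" for \<sigma>
  proof -
    have "{\<tau> \<in> Emb L. restrict \<tau> K = \<sigma>} \<noteq> {}" using k(2)[OF that] k0 by (metis card.empty less_irrefl)
    then obtain \<tau> where "\<tau> \<in> Emb L" "restrict \<tau> K = \<sigma>" by blast
    then have \<tau>: "\<tau> ` L \<subseteq> M" "\<And>x. x \<in> K \<Longrightarrow> \<sigma> x = \<tau> x" using M(2)[of \<tau>] by auto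
    show ?thesis
    proof (rule image_subsetI)
      fix x assume x: "x \<in> K"
      then have "\<tau> x \<in> M" using KL \<tau>(1) by blast
      then show "\<sigma> x \<in> M" by (simp only: \<tau>(2)[OF x])
    qed
  qed
  have local: "(\<Sum>w\<in>places_over (rabs p) L. real (local_degree L w) * ?g w) =
      real k * (\<Sum>v\<in>places_over (rabs p) K. real (local_degree K v) * f v)" if p: "p \<in> T" for p
  proof -
    have pr: "p \<in> rplaces" using p T by blast
    obtain W where W: "W \<in> places_over (rabs p) M" using ex_place[OF M(1) rat_abs_rabs[OF pr]] by blast
    have "(\<Sum>w\<in>places_over (rabs p) L. real (local_degree L w) * ?g w) =
        (\<Sum>\<tau>\<in>Emb L. f (restrict (restrict (W \<circ> \<tau>) L) K))"
      by (rule places_above.sum_local_degree[OF places_above_rabs[OF L pr] M W])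
    also have "\<dots> = (\<Sum>\<tau>\<in>Emb L. f (restrict (W \<circ> restrict \<tau> K) K))"
      using KL by (intro sum.cong arg_cong[of _ _ f]) (auto simp: restrict_def fun_eq_iff)
    also have "\<dots> = (\<Sum>\<sigma>\<in>Emb K. \<Sum>\<tau> | \<tau> \<in> Emb L \<and> restrict \<tau> K = \<sigma>. f (restrict (W \<circ> restrict \<tau> K) K))"
      using restrict_Emb[OF K' KL] finite_Emb[OF K] finite_Emb[OF L] by (subst sum.group) auto
    also have "\<dots> = (\<Sum>\<sigma>\<in>Emb K. real k * f (restrict (W \<circ> \<sigma>) K))"
    proof (rule sum.cong)
      fix \<sigma> assume s: "\<sigma> \<in> Emb K"
      have "(\<Sum>\<tau> | \<tau> \<in> Emb L \<and> restrict \<tau> K = \<sigma>. f (restrict (W \<circ> restrict \<tau> K) K)) =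
         (\<Sum>\<tau> | \<tau> \<in> Emb L \<and> restrict \<tau> K = \<sigma>. f (restrict (W \<circ> \<sigma>) K))" by (rule sum.cong) auto
      then show "(\<Sum>\<tau> | \<tau> \<in> Emb L \<and> restrict \<tau> K = \<sigma>. f (restrict (W \<circ> restrict \<tau> K) K)) =
         real k * f (restrict (W \<circ> \<sigma>) K)" using k(2)[OF s] by simp
    qed simp
    also have "\<dots> = real k * (\<Sum>v\<in>places_over (rabs p) K. real (local_degree K v) * f v)"
      using places_above.sum_local_degree[OF places_above_rabs[OF K pr] M(1) MK W, of f]
      by (simp add: sum_distrib_left)
    finally show ?thesis .
  qed
  have "gsum L ?g = (\<Sum>p\<in>T. \<Sum>w\<in>places_over (rabs p) L. real (local_degree L w) * ?g w)"
    by (rule gsum_eq_sum_primes[OF L T(1,2) supp])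
  also have "\<dots> = real k * (\<Sum>p\<in>T. \<Sum>v\<in>places_over (rabs p) K. real (local_degree K v) * f v)"
    using local by (simp add: sum_distrib_left)
  also have "\<dots> = real k * gsum K f" using gsum_eq_sum_primes[OF K T] by simp
  finally have "gsum L ?g = real k * gsum K f" .
  moreover have "real (QV.dim L) = real k * real (QV.dim K)" unfolding k(1) of_nat_mult by (rule mult.commute)
  ultimately show "gsum L ?g / QV.dim L = gsum K f / QV.dim K"
    using k0 mult_divide_mult_cancel_left[of "real k" "gsum K f" "real (QV.dim K)"] by (simp only: of_nat_eq_0_iff)
qed

text \<open>Above a rational place the local sum is the logarithm of the size of the product of all
  \<sigma>(c). That product is rational, which reduces the claim to the product formula over the
  rationals.\<close>

lemma product_formula:
  assumes K: "number_field K" and c: "c \<in> K" "c \<noteq> 0"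
  shows "fin_supp K (\<lambda>v. ln (v c))" "gsum K (\<lambda>v. ln (v c)) = 0"
proof -
  have K': "is_subfield K" by (rule number_fieldD[OF K])
  show fs: "fin_supp K (\<lambda>v. ln (v c))"
    unfolding fin_supp_def by (rule finite_subset[OF _ finite_places_ne_one[OF K c]]) auto
  obtain T where T: "finite T" "T \<subseteq> rplaces" "{v \<in> places K. ln (v c) \<noteq> 0} \<subseteq> (\<Union>p\<in>T. places_over (rabs p) K)"
    using ex_supp_primes[OF fs] by blast
  obtain q where q: "(\<Prod>\<sigma>\<in>Emb K. \<sigma> c) = of_rat q" using prod_Emb_rat[OF K c(1)] by blast
  have ne: "\<sigma> c \<noteq> 0" if "\<sigma> \<in> Emb K" for \<sigma>
  proof -
    interpret embedding K \<sigma> using K' that by unfold_locales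
    show ?thesis using nonzero[OF c] .
  qed
  then have "(\<Prod>\<sigma>\<in>Emb K. \<sigma> c) \<noteq> 0"
    using prod_zero_iff[OF finite_Emb[OF K], of "\<lambda>\<sigma>. \<sigma> c"] by blast
  then have "q \<noteq> 0" unfolding q by simp
  from rational_product_formula[OF this] obtain T1 where T1: "finite T1" "T1 \<subseteq> rplaces"
    and T1': "\<forall>T'. finite T' \<longrightarrow> T1 \<subseteq> T' \<longrightarrow> T' \<subseteq> rplaces \<longrightarrow> (\<Sum>p\<in>T'. ln (rabs p q)) = 0"
    by (elim exE conjE) (rule that, assumption+)
  obtain M where M: "number_field M" "\<And>\<sigma>. \<sigma> \<in> Emb K \<Longrightarrow> \<sigma> ` K \<subseteq> M" using ex_normal[OF K] by blast
  have local: "(\<Sum>v\<in>places_over (rabs p) K. real (local_degree K v) * ln (v c)) = ln (rabs p q)" if p: "p \<in> rplaces" for p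
  proof -
    obtain W where W: "W \<in> places_over (rabs p) M" using ex_place[OF M(1) rat_abs_rabs[OF p]] by blast
    interpret W: abs_value_on M W using number_fieldD[OF M(1)] places_overD(2)[OF W] by unfold_locales
    have sM: "\<sigma> c \<in> M" if "\<sigma> \<in> Emb K" for \<sigma> using M(2)[OF that] c by blast
    have "(\<Sum>v\<in>places_over (rabs p) K. real (local_degree K v) * ln (v c)) = (\<Sum>\<sigma>\<in>Emb K. ln (W (\<sigma> c)))"
      using places_above.sum_local_degree[OF places_above_rabs[OF K p] M W, of "\<lambda>v. ln (v c)"] c by simp
    also have "\<dots> = ln (\<Prod>\<sigma>\<in>Emb K. W (\<sigma> c))"
      by (rule ln_prod[symmetric]) (rule finite_Emb[OF K], rule not_sym[OF less_imp_neq[OF W.pos[OF sM ne]]])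
    also have "(\<Prod>\<sigma>\<in>Emb K. W (\<sigma> c)) = W (\<Prod>\<sigma>\<in>Emb K. \<sigma> c)" by (rule W.prod[symmetric]) (rule sM)
    also have "\<dots> = rabs p q" using q places_overD(3)[OF W] by simp
    finally show ?thesis .
  qed
  have "gsum K (\<lambda>v. ln (v c)) = (\<Sum>p\<in>T \<union> T1. \<Sum>v\<in>places_over (rabs p) K. real (local_degree K v) * ln (v c))"
    by (rule gsum_eq_sum_primes[OF K]) (use T T1 in auto)
  also have "\<dots> = (\<Sum>p\<in>T \<union> T1. ln (rabs p q))" using local T T1 by (intro sum.cong) auto
  also have "\<dots> = 0" using T T1 by (intro T1'[rule_format]) auto
  finally show "gsum K (\<lambda>v. ln (v c)) = 0" .
qed

section \<open>The Weil height\<close>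

definition vmax :: "(qbar \<Rightarrow> real) \<Rightarrow> qbar ^ 'n::finite \<Rightarrow> real" where
  "vmax v x = Max (range (\<lambda>i. v (x $ i)))"

lemma vmax_ge: "v (x $ i) \<le> vmax v x"
  unfolding vmax_def by (intro Max_ge) auto

lemma vmax_le: "(\<And>i. v (x $ i) \<le> C) \<Longrightarrow> vmax v x \<le> C"
  unfolding vmax_def by (intro Max.boundedI) auto

lemma vmax_attained: "\<exists>i. vmax v x = v (x $ i)"
proof -
  have "vmax v x \<in> range (\<lambda>i. v (x $ i))" unfolding vmax_def by (intro Max_in) auto
  then obtain i where "vmax v x = v (x $ i)" by (rule rangeE)
  then show ?thesis by (rule exI)
qed

lemma vmax_pos:
  fixes x :: "qbar ^ 'n::finite"
  assumes "abs_value_on K v" "\<And>i. x $ i \<in> K" "x \<noteq> 0" shows "0 < vmax v x"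
proof -
  obtain i where "x $ i \<noteq> 0" using assms(3) by (auto simp: vec_eq_iff)
  then have "0 < v (x $ i)" using abs_value_on.pos[OF assms(1)] assms(2) by blast
  then show ?thesis using vmax_ge[of v x i] by simp
qed

lemma fin_supp_vmax:
  fixes x :: "qbar ^ 'n::finite"
  assumes K: "number_field K" and x: "\<And>i. x $ i \<in> K" "x \<noteq> 0"
  shows "fin_supp K (\<lambda>v. ln (vmax v x))"
  unfolding fin_supp_def
proof (rule finite_subset)
  show "{v \<in> places K. ln (vmax v x) \<noteq> 0} \<subseteq> (\<Union>i\<in>{i. x $ i \<noteq> 0}. {v \<in> places K. v (x $ i) \<noteq> 1})"
  proof
    fix v assume vp: "v \<in> {v \<in> places K. ln (vmax v x) \<noteq> 0}"
    interpret abs_value_on K v using places_abs_value[OF K] vp by blast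
    show "v \<in> (\<Union>i\<in>{i. x $ i \<noteq> 0}. {v \<in> places K. v (x $ i) \<noteq> 1})"
    proof (rule ccontr)
      assume "\<not> ?thesis"
      then have "v (x $ i) = 1" if "x $ i \<noteq> 0" for i using that vp by auto
      moreover obtain i where "vmax v x = v (x $ i)" using vmax_attained by metis
      moreover have "x $ i \<noteq> 0"
        using calculation vmax_pos[OF abs_value_on_axioms x] zero by auto
      ultimately show False using vp by auto
    qed
  qed
  show "finite (\<Union>i\<in>{i. x $ i \<noteq> 0}. {v \<in> places K. v (x $ i) \<noteq> 1})"
    using finite_places_ne_one[OF K x(1)] by auto
qed

lemma height_in_eq: "number_field K \<Longrightarrow> height_in K x = gsum K (\<lambda>v. ln (vmax v x)) / QV.dim K"
  by (simp add: height_in_def gsum_def vmax_def field_degree_eq)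

lemma height_in_extend:
  fixes x :: "qbar ^ 'n::finite"
  assumes K: "number_field K" and L: "number_field L" and KL: "K \<subseteq> L" and x: "\<And>i. x $ i \<in> K" "x \<noteq> 0"
  shows "height_in L x = height_in K x"
proof -
  have "vmax (restrict w K) x = vmax w x" for w using x by (simp add: vmax_def)
  then have eq: "(\<lambda>w. ln (vmax (restrict w K) x)) = (\<lambda>w. ln (vmax w x))" by (intro ext) (simp only:)
  show ?thesis
    using gsum_extend(2)[OF K L KL fin_supp_vmax[OF K x]] unfolding eq height_in_eq[OF K] height_in_eq[OF L] .
qed

lemma height_in_scale:
  fixes x :: "qbar ^ 'n::finite"
  assumes K: "number_field K" and x: "\<And>i. x $ i \<in> K" "x \<noteq> 0" and c: "c \<in> K" "c \<noteq> 0"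
  shows "height_in K (c *s x) = height_in K x"
proof -
  have "ln (vmax v (c *s x)) = ln (v c) + ln (vmax v x)" if vp: "v \<in> places K" for v
  proof -
    interpret abs_value_on K v using places_abs_value[OF K vp] .
    have "vmax v (c *s x) = v c * vmax v x"
    proof (rule antisym)
      show "vmax v (c *s x) \<le> v c * vmax v x"
        using x c nonneg by (intro vmax_le) (auto simp: mult intro!: mult_left_mono vmax_ge)
      obtain i where "vmax v x = v (x $ i)" using vmax_attained by metis
      then show "v c * vmax v x \<le> vmax v (c *s x)" using vmax_ge[of v "c *s x" i] x c by (simp add: mult)
    qed
    then show ?thesis using pos[OF c] vmax_pos[OF abs_value_on_axioms x] by (simp add: ln_mult)
  qed
  then have "gsum K (\<lambda>v. ln (vmax v (c *s x))) = gsum K (\<lambda>v. ln (v c) + ln (vmax v x))"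
    by (rule gsum_cong)
  also have "\<dots> = gsum K (\<lambda>v. ln (vmax v x))"
    using gsum_add[OF product_formula(1)[OF K c] fin_supp_vmax[OF K x]] product_formula(2)[OF K c] by simp
  finally show ?thesis by (simp add: height_in_eq K)
qed

lemma abs_pspace_eq:
  assumes "x \<noteq> 0" "y \<noteq> 0"
  shows "abs_pspace x = abs_pspace y \<longleftrightarrow> (\<exists>c. c \<noteq> 0 \<and> y = c *s x)"
proof -
  have refl: "proj_rel z z" if "z \<noteq> 0" for z :: "qbar ^ 'a"
    using that by (auto simp: proj_rel_def intro!: exI[of _ 1])
  have "proj_rel x y \<longleftrightarrow> abs_pspace x = abs_pspace y"
    using Quotient3_rel[OF Quotient3_pspace, of x y] refl assms by blast
  then show ?thesis using assms by (auto simp: proj_rel_def)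
qed

lemma pspace_cases: "\<exists>x. x \<noteq> 0 \<and> P = abs_pspace x"
proof -
  have "proj_rel (rep_pspace P) (rep_pspace P)" by (rule Quotient3_rep_reflp[OF Quotient3_pspace])
  then show ?thesis using Quotient3_abs_rep[OF Quotient3_pspace, of P] by (metis proj_rel_def)
qed

lemma ex_number_field_vec:
  assumes "number_field K" shows "\<exists>L. number_field L \<and> K \<subseteq> L \<and> (\<forall>i. (x :: qbar ^ 'n::finite) $ i \<in> L)"
  using ex_number_field[of "range (\<lambda>i. x $ i)" K] assms by (auto simp: image_subset_iff)

lemma weil_height_eq:
  fixes x :: "qbar ^ 'n::finite"
  assumes K: "number_field K" and x: "\<And>i. x $ i \<in> K" "x \<noteq> 0"
  shows "weil_height (abs_pspace x) = height_in K x"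
  unfolding weil_height_def
proof (rule the_equality)
  show "\<exists>K' x'. number_field K' \<and> x' \<noteq> 0 \<and> (\<forall>i. x' $ i \<in> K') \<and> abs_pspace x = abs_pspace x' \<and> height_in K x = height_in K' x'"
    using assms by blast
  fix r assume "\<exists>K' x'. number_field K' \<and> x' \<noteq> 0 \<and> (\<forall>i. x' $ i \<in> K') \<and> abs_pspace x = abs_pspace x' \<and> r = height_in K' x'"
  then obtain K' x' where K': "number_field K'" and x': "x' \<noteq> 0" "\<And>i. vec_nth x' i \<in> K'"
    and eq: "abs_pspace x = abs_pspace x'" and r: "r = height_in K' x'" by blast
  obtain c where c: "c \<noteq> 0" "x' = c *s x" using eq abs_pspace_eq[OF x(2) x'(1)] by blast
  obtain y where y: "K' = qadj y" using number_field_primitive[OF K'] by blast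
  obtain L where L: "number_field L" "{y, c} \<subseteq> L" "K \<subseteq> L" using ex_number_field[of "{y, c}" K] K by blast
  have K'L: "K' \<subseteq> L" using qadj_subset[OF number_fieldD[OF L(1)]] L(2) y by blast
  have "height_in K' x' = height_in L x'" by (rule height_in_extend[OF K' L(1) K'L x'(2,1), symmetric])
  also have "\<dots> = height_in L x"
    unfolding c(2) by (rule height_in_scale) (use L x c in auto)
  also have "\<dots> = height_in K x" by (rule height_in_extend[OF K L(1,3) x])
  finally show "r = height_in K x" using r by simp
qed

section \<open>Polynomial maps\<close>

lemma peval_superset:
  "finite S \<Longrightarrow> Poly_Mapping.keys p \<subseteq> S \<Longrightarrow>
    peval p x = (\<Sum>m\<in>S. Poly_Mapping.lookup p m * monom_fun (Poly_Mapping.lookup m) x)"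
  unfolding peval_def monom_fun_def
  by (rule sum.mono_neutral_left) (auto simp: in_keys_iff)

lemma peval_add: "peval (p + q) x = peval p x + peval q x"
proof -
  let ?S = "Poly_Mapping.keys p \<union> Poly_Mapping.keys q"
  have "finite ?S" by simp
  then show ?thesis
    using peval_superset[of ?S p x] peval_superset[of ?S q x] peval_superset[of ?S "p + q" x] Poly_Mapping.keys_add[of p q]
    by (simp add: lookup_add distrib_right sum.distrib)
qed

lemma peval_single: "peval (Poly_Mapping.single m c) x = c * monom_fun (Poly_Mapping.lookup m) x"
  by (subst peval_superset[of "{m}"]) auto

lemma peval_0 [simp]: "peval 0 x = 0"
  by (simp add: peval_def)

lemma peval_1 [simp]: "peval 1 x = 1"
  using peval_single[of 0 1 x] by (simp add: monom_fun_def)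

lemma peval_sum: "peval (sum f I) x = (\<Sum>i\<in>I. peval (f i) x)"
  by (induction I rule: infinite_finite_induct) (simp_all add: peval_add)

lemma poly_mapping_sum_single:
  "p = (\<Sum>m\<in>Poly_Mapping.keys p. Poly_Mapping.single m (Poly_Mapping.lookup p m))"
  by (rule poly_mapping_eqI) (simp add: lookup_sum lookup_single when_def in_keys_iff)

lemma lookup_add_fun: "Poly_Mapping.lookup (m + l) = (\<lambda>i. Poly_Mapping.lookup m i + Poly_Mapping.lookup l i)"
  by (rule ext) (rule lookup_add)

lemma peval_mult: "peval (p * q) x = peval p x * peval q x"
proof -
  have single: "peval (Poly_Mapping.single m a * Poly_Mapping.single l b) x =
      peval (Poly_Mapping.single m a) x * peval (Poly_Mapping.single l b) x" for m l a b
    by (simp add: mult_single peval_single lookup_add_fun monom_fun_add)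
  let ?f = "\<lambda>p m. Poly_Mapping.single m (Poly_Mapping.lookup p m)"
  have "peval (p * q) x = peval ((\<Sum>m\<in>Poly_Mapping.keys p. ?f p m) * (\<Sum>l\<in>Poly_Mapping.keys q. ?f q l)) x"
    using poly_mapping_sum_single[of p] poly_mapping_sum_single[of q] by simp
  also have "\<dots> = peval (\<Sum>m\<in>Poly_Mapping.keys p. ?f p m) x * peval (\<Sum>l\<in>Poly_Mapping.keys q. ?f q l) x"
    unfolding sum_product peval_sum by (simp add: single)
  also have "\<dots> = peval p x * peval q x"
    using poly_mapping_sum_single[of p] poly_mapping_sum_single[of q] by simp
  finally show ?thesis .
qed

lemma peval_power: "peval (p ^ n) x = peval p x ^ n"
  by (induction n) (simp_all add: peval_mult)

lemma peval_prod: "peval (prod f I) x = (\<Prod>i\<in>I. peval (f i) x)"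
  by (induction I rule: infinite_finite_induct) (simp_all add: peval_mult)

lemma homogeneous_iff: "homogeneous d p \<longleftrightarrow> (\<forall>m\<in>Poly_Mapping.keys p. mdeg (Poly_Mapping.lookup m) = d)"
  by (simp add: homogeneous_def mdeg_def)

lemma homogeneous_0: "homogeneous d 0"
  by (simp add: homogeneous_iff)

lemma homogeneous_add: "homogeneous d p \<Longrightarrow> homogeneous d q \<Longrightarrow> homogeneous d (p + q)"
  using Poly_Mapping.keys_add[of p q] by (auto simp: homogeneous_iff)

lemma homogeneous_sum: "(\<And>i. i \<in> I \<Longrightarrow> homogeneous d (f i)) \<Longrightarrow> homogeneous d (sum f I)"
  by (induction I rule: infinite_finite_induct) (auto simp: homogeneous_0 homogeneous_add)

lemma homogeneous_mult: "homogeneous d p \<Longrightarrow> homogeneous e q \<Longrightarrow> homogeneous (d + e) (p * q)"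
  using keys_mult[of p q] by (fastforce simp: homogeneous_iff lookup_add_fun mdeg_add)

lemma homogeneous_const: "homogeneous 0 (Poly_Mapping.single 0 c)"
  by (auto simp: homogeneous_iff mdeg_def)

lemma homogeneous_1: "homogeneous 0 1"
  using homogeneous_const[of 1] by simp

lemma homogeneous_power: "homogeneous d p \<Longrightarrow> homogeneous (n * d) (p ^ n)"
  by (induction n) (auto simp: homogeneous_1 homogeneous_mult)

lemma homogeneous_prod: "(\<And>i. i \<in> I \<Longrightarrow> homogeneous (d i) (f i)) \<Longrightarrow> homogeneous (sum d I) (prod f I)"
  by (induction I rule: infinite_finite_induct) (auto simp: homogeneous_1 homogeneous_mult)

lemma peval_hom_fun: assumes "homogeneous d p" shows "peval p \<in> hom_fun d"
proof -
  have "(\<lambda>x. \<Sum>m\<in>Poly_Mapping.keys p. Poly_Mapping.lookup p m * monom_fun (Poly_Mapping.lookup m) x) \<in> hom_fun d"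
  proof (intro hom_fun_sum hom_fun_scale)
    fix m assume "m \<in> Poly_Mapping.keys p"
    then have "mdeg (Poly_Mapping.lookup m) = d" using assms by (simp add: homogeneous_iff)
    then show "monom_fun (Poly_Mapping.lookup m) \<in> hom_fun d" using hom_fun_monom by blast
  qed
  moreover have "(\<lambda>x. \<Sum>m\<in>Poly_Mapping.keys p. Poly_Mapping.lookup p m * monom_fun (Poly_Mapping.lookup m) x) = peval p"
    by (rule ext) (rule peval_superset[symmetric], auto)
  ultimately show ?thesis by simp
qed

definition psubst :: "'n::finite qpoly \<Rightarrow> ('n \<Rightarrow> 'n qpoly) \<Rightarrow> 'n qpoly" where
  "psubst p F = (\<Sum>m\<in>Poly_Mapping.keys p. Poly_Mapping.single 0 (Poly_Mapping.lookup p m) *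
     (\<Prod>i\<in>UNIV. F i ^ Poly_Mapping.lookup m i))"

lemma peval_psubst: "peval (psubst p F) x = peval p (\<chi> i. peval (F i) x)"
  by (simp add: psubst_def peval_sum peval_mult peval_prod peval_power peval_single monom_fun_def peval_def[of p])

lemma homogeneous_psubst:
  assumes p: "homogeneous d p" and F: "\<And>i. homogeneous e (F i)"
  shows "homogeneous (d * e) (psubst p F)"
  unfolding psubst_def
proof (rule homogeneous_sum)
  fix m assume m: "m \<in> Poly_Mapping.keys p"
  have "homogeneous (\<Sum>i\<in>UNIV. Poly_Mapping.lookup m i * e) (\<Prod>i\<in>UNIV. F i ^ Poly_Mapping.lookup m i)"
    by (intro homogeneous_prod homogeneous_power F)
  moreover have "(\<Sum>i\<in>UNIV. Poly_Mapping.lookup m i * e) = d * e"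
    using p m by (simp add: homogeneous_def sum_distrib_right[symmetric])
  ultimately have "homogeneous (d * e) (\<Prod>i\<in>UNIV. F i ^ Poly_Mapping.lookup m i)" by simp
  from homogeneous_mult[OF homogeneous_const this]
  show "homogeneous (d * e) (Poly_Mapping.single 0 (Poly_Mapping.lookup p m) * (\<Prod>i\<in>UNIV. F i ^ Poly_Mapping.lookup m i))"
    by simp
qed

lemma digits_unique:
  fixes f g :: "nat \<Rightarrow> nat"
  assumes "\<And>i. i < n \<Longrightarrow> f i < B \<and> g i < B" "(\<Sum>i<n. f i * B ^ i) = (\<Sum>i<n. g i * B ^ i)"
  shows "\<forall>i<n. f i = g i"
  using assms
proof (induction n arbitrary: f g)
  case (Suc n)
  have shift: "(\<Sum>i<Suc n. h i * B ^ i) = h 0 + B * (\<Sum>i<n. h (Suc i) * B ^ i)" for h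
    by (simp only: sum.lessThan_Suc_shift) (simp add: sum_distrib_left mult_ac)
  have eq: "f 0 + B * (\<Sum>i<n. f (Suc i) * B ^ i) = g 0 + B * (\<Sum>i<n. g (Suc i) * B ^ i)"
    using Suc.prems(2) by (simp only: shift)
  then have "(f 0 + B * (\<Sum>i<n. f (Suc i) * B ^ i)) mod B = (g 0 + B * (\<Sum>i<n. g (Suc i) * B ^ i)) mod B" by simp
  then have 0: "f 0 = g 0" using Suc.prems(1)[of 0] by simp
  have "B > 0" using Suc.prems(1)[of 0] by simp
  then have "(\<Sum>i<n. f (Suc i) * B ^ i) = (\<Sum>i<n. g (Suc i) * B ^ i)" using eq 0 by simp
  then have "\<forall>i<n. f (Suc i) = g (Suc i)" using Suc.prems(1) by (intro Suc.IH) auto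
  with 0 show ?case by (auto simp: less_Suc_eq_0_disj)
qed simp

text \<open>Kronecker substitution \<open>x\<^sub>i = t ^ (B ^ i)\<close> reduces the vanishing of a polynomial function to one variable.\<close>

lemma peval_zero_imp_zero:
  fixes p :: "'n::finite qpoly"
  assumes "\<And>x. x \<noteq> 0 \<Longrightarrow> peval p x = 0" shows "p = 0"
proof (rule ccontr)
  assume "p \<noteq> 0"
  then obtain m0 where m0: "m0 \<in> Poly_Mapping.keys p" using keys_eq_empty by blast
  obtain idx :: "'n \<Rightarrow> nat" where idx: "bij_betw idx UNIV {..<CARD('n)}"
    using ex_bij_betw_finite_nat[of "UNIV :: 'n set"] by (auto simp: atLeast0LessThan)
  \<comment> \<open>\<open>B\<close> exceeds every exponent in \<open>p\<close>. So \<open>E\<close>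
    reads the exponents of a monomial as digits to base \<open>B\<close> and separates the monomials
    of \<open>p\<close>.\<close>
  define B where "B = Suc (\<Sum>m\<in>Poly_Mapping.keys p. mdeg (Poly_Mapping.lookup m))"
  have B: "Poly_Mapping.lookup m i < B" if "m \<in> Poly_Mapping.keys p" for m i
  proof -
    have "Poly_Mapping.lookup m i \<le> mdeg (Poly_Mapping.lookup m)"
      unfolding mdeg_def by (rule member_le_sum) auto
    also have "\<dots> \<le> (\<Sum>m\<in>Poly_Mapping.keys p. mdeg (Poly_Mapping.lookup m))"
      using that by (intro member_le_sum) auto
    finally show ?thesis by (simp add: B_def)
  qed
  define E where "E m = (\<Sum>i\<in>UNIV. Poly_Mapping.lookup m i * B ^ idx i)" for m :: "'n \<Rightarrow>\<^sub>0 nat"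
  have E: "E m = (\<Sum>k<CARD('n). Poly_Mapping.lookup m (inv_into UNIV idx k) * B ^ k)" for m
    unfolding E_def
    using sum.reindex_bij_betw[OF idx, of "\<lambda>k. Poly_Mapping.lookup m (inv_into UNIV idx k) * B ^ k"] bij_betw_inv_into_left[OF idx]
    by simp
  have inj: "m = m'" if mm: "m \<in> Poly_Mapping.keys p" "m' \<in> Poly_Mapping.keys p" "E m = E m'" for m m'
  proof (rule poly_mapping_eqI)
    fix i
    have "\<forall>k<CARD('n). Poly_Mapping.lookup m (inv_into UNIV idx k) = Poly_Mapping.lookup m' (inv_into UNIV idx k)"
      using mm B E by (intro digits_unique[where B = B]) auto
    moreover have "idx i < CARD('n)" "inv_into UNIV idx (idx i) = i"
      using bij_betwE[OF idx] bij_betw_inv_into_left[OF idx] by auto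
    ultimately show "Poly_Mapping.lookup m i = Poly_Mapping.lookup m' i" by metis
  qed
  define P where "P = (\<Sum>m\<in>Poly_Mapping.keys p. Polynomial.monom (Poly_Mapping.lookup p m) (E m))"
  have "Polynomial.coeff P (E m0) = (\<Sum>m\<in>Poly_Mapping.keys p. if m = m0 then Poly_Mapping.lookup p m else 0)"
    unfolding P_def coeff_sum by (rule sum.cong) (use inj m0 in \<open>auto simp: coeff_monom\<close>)
  also have "\<dots> = Poly_Mapping.lookup p m0" using m0 by simp
  finally have "P \<noteq> 0" using m0 by (auto simp: in_keys_iff)
  have "poly P t = 0" if t: "t \<noteq> 0" for t
  proof -
    let ?x = "(\<chi> i. t ^ (B ^ idx i)) :: qbar ^ 'n"
    have "poly P t = peval p ?x"
      unfolding P_def poly_sum peval_def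
      by (rule sum.cong) (simp_all add: poly_monom E_def power_sum power_mult[symmetric] mult.commute)
    moreover have "?x \<noteq> 0" using t by (simp add: vec_eq_iff)
    ultimately show ?thesis using assms by simp
  qed
  then have "UNIV - {0} \<subseteq> {t. poly P t = 0}" by auto
  then have "finite (UNIV - {0 :: qbar})" using poly_roots_finite[OF \<open>P \<noteq> 0\<close>] finite_subset by blast
  then show False using infinite_UNIV_char_0[where 'a = qbar] by simp
qed

text \<open>A common factor has no zero outside the origin, so its restriction to a line avoiding
  the origin is a polynomial without roots, hence constant. Two independent points lie on such a
  line; two proportional points are joined through a third, for which a second coordinate is needed.
  The factor is therefore a nonzero constant.\<close>

lemma no_common_factor:
  fixes F :: "'n::finite \<Rightarrow> 'n qpoly"
  assumes card: "CARD('n) \<ge> 2" and F: "\<And>x. x \<noteq> 0 \<Longrightarrow> (\<chi> i. peval (F i) x) \<noteq> 0" and G: "\<And>i. G dvd F i"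
  shows "G dvd 1"
proof -
  have nz: "peval G x \<noteq> 0" if "x \<noteq> 0" for x
  proof
    assume "peval G x = 0"
    then have "peval (F i) x = 0" for i using G[of i] by (auto simp: dvd_def peval_mult)
    then show False using F[OF that] by (simp add: vec_eq_iff)
  qed
  have line: "peval G a = peval G b" if ab: "\<And>t. a + t *s (b - a) \<noteq> 0" for a b :: "qbar ^ 'n"
  proof -
    define Q where "Q = (\<Sum>m\<in>Poly_Mapping.keys G. Polynomial.smult (Poly_Mapping.lookup G m)
       (\<Prod>i\<in>UNIV. [:vec_nth a i, vec_nth b i - vec_nth a i:] ^ Poly_Mapping.lookup m i))"
    have Q: "poly Q t = peval G (a + t *s (b - a))" for t
      unfolding Q_def by (simp add: poly_sum poly_prod peval_def mult.commute right_diff_distrib)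
    have "poly Q t \<noteq> 0" for t using nz[OF ab] Q by simp
    then have "Polynomial.degree Q = 0" using alg_closed_imp_poly_has_root[of Q] by blast
    then obtain c where "Q = [:c:]" by (rule degree_eq_zeroE)
    then have "poly Q 0 = poly Q 1" by simp
    then show ?thesis by (simp add: Q)
  qed
  have indep: "peval G a = peval G b" if a: "a \<noteq> 0" and ab: "\<And>t. b \<noteq> t *s a" for a b :: "qbar ^ 'n"
  proof (rule line)
    fix t
    show "a + t *s (b - a) \<noteq> 0"
    proof
      assume 0: "a + t *s (b - a) = 0"
      have "t \<noteq> 0" using 0 a by auto
      have "vec_nth b i = ((t - 1) / t) * vec_nth a i" for i
      proof -
        have "vec_nth a i + t * (vec_nth b i - vec_nth a i) = 0" using 0 by (simp add: vec_eq_iff right_diff_distrib)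
        then show ?thesis using \<open>t \<noteq> 0\<close> by (simp add: field_simps add_eq_0_iff)
      qed
      then have "b = ((t - 1) / t) *s a" by (simp add: vec_eq_iff)
      with ab show False by blast
    qed
  qed
  have "\<exists>i j :: 'n. i \<noteq> j"
  proof (rule ccontr)
    assume "\<not> ?thesis"
    then have "UNIV = {undefined :: 'n}" by auto
    then have "CARD('n) = 1" by (metis card.empty card_insert_disjoint finite.emptyI insert_absorb insert_not_empty One_nat_def)
    then show False using card by simp
  qed
  then obtain i j :: 'n where ij: "i \<noteq> j" by blast
  have const: "peval G a = peval G b" if a: "a \<noteq> 0" and b: "b \<noteq> 0" for a b :: "qbar ^ 'n"
  proof (cases "\<exists>t. b = t *s a")
    case False
    then show ?thesis using indep[OF a, of b] by blast
  next
    case True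
    then obtain t where t: "b = t *s a" by blast
    obtain k where k: "vec_nth a k \<noteq> 0" using a by (auto simp: vec_eq_iff)
    define l where "l = (if k = i then j else i)"
    have lk: "l \<noteq> k" using ij by (auto simp: l_def)
    define c where "c = ((\<chi> n. if n = l then 1 else 0) :: qbar ^ 'n)"
    have "c \<noteq> s *s a" for s
    proof
      assume "c = s *s a"
      then have "vec_nth c k = s * vec_nth a k" "vec_nth c l = s * vec_nth a l" by auto
      then show False using k lk by (auto simp: c_def)
    qed
    moreover have "c \<noteq> s *s b" for s using calculation[of "s * t"] by (simp add: t vector_smult_assoc)
    ultimately have "peval G a = peval G c" "peval G b = peval G c" using indep[OF a, of c] indep[OF b, of c] by auto
    then show ?thesis by simp
  qed
  define k where "k = peval G (1 :: qbar ^ 'n)"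
  have one: "(1 :: qbar ^ 'n) \<noteq> 0" by (simp add: vec_eq_iff)
  have "k \<noteq> 0" using nz[OF one] by (simp add: k_def)
  have "G - Poly_Mapping.single 0 k = 0"
  proof (rule peval_zero_imp_zero)
    fix x :: "qbar ^ 'n" assume x: "x \<noteq> 0"
    have "peval G x = peval (G - Poly_Mapping.single 0 k) x + peval (Poly_Mapping.single 0 k) x"
      by (subst peval_add[symmetric]) simp
    moreover have "peval (Poly_Mapping.single 0 k) x = k" by (simp add: peval_single monom_fun_def)
    ultimately show "peval (G - Poly_Mapping.single 0 k) x = 0" using const[OF x one] by (simp add: k_def)
  qed
  then have "G * Poly_Mapping.single 0 (inverse k) = 1"
    using \<open>k \<noteq> 0\<close> by (simp add: mult_single)
  then show ?thesis by (metis dvd_triv_left)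
qed

text \<open>The substituted tuple has no common zero, so \<open>no_common_factor\<close> shows that
  it is reduced and the degree does not drop.\<close>

lemma defines_endo_comp:
  fixes \<phi> \<psi> :: "'n::finite pspace \<Rightarrow> 'n pspace"
  assumes card: "CARD('n) \<ge> 2" and \<phi>: "defines_endo d F \<phi>" and \<psi>: "defines_endo e G \<psi>"
  shows "defines_endo (d * e) (\<lambda>i. psubst (F i) G) (\<phi> \<circ> \<psi>)"
proof -
  have F: "\<And>i. homogeneous d (F i)" "\<And>x. x \<noteq> 0 \<Longrightarrow> (\<chi> i. peval (F i) x) \<noteq> 0"
    "\<And>x. x \<noteq> 0 \<Longrightarrow> \<phi> (abs_pspace x) = abs_pspace (\<chi> i. peval (F i) x)"
    using \<phi> by (auto simp: defines_endo_def)
  have G: "\<And>i. homogeneous e (G i)" "\<And>x. x \<noteq> 0 \<Longrightarrow> (\<chi> i. peval (G i) x) \<noteq> 0"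
    "\<And>x. x \<noteq> 0 \<Longrightarrow> \<psi> (abs_pspace x) = abs_pspace (\<chi> i. peval (G i) x)"
    using \<psi> by (auto simp: defines_endo_def)
  have nz: "(\<chi> i. peval (psubst (F i) G) x) \<noteq> 0" if "x \<noteq> 0" for x
    using F(2)[OF G(2)[OF that]] by (simp add: peval_psubst)
  have "H dvd 1" if "\<forall>i. H dvd psubst (F i) G" for H
    using no_common_factor[OF card nz] that by blast
  then show ?thesis
    unfolding defines_endo_def using homogeneous_psubst[OF F(1) G(1)] nz F(3)[OF G(2)] G(3)
    by (simp add: peval_psubst)
qed

lemma defines_endo_id:
  assumes card: "CARD('n) \<ge> 2"
  shows "defines_endo 1 (\<lambda>i. Poly_Mapping.single (Poly_Mapping.single i 1) 1) (id :: 'n::finite pspace \<Rightarrow> 'n pspace)"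
proof -
  let ?X = "\<lambda>i :: 'n. Poly_Mapping.single (Poly_Mapping.single i 1) 1 :: 'n qpoly"
  have X: "peval (?X i) x = vec_nth x i" for i x
  proof -
    have "monom_fun (Poly_Mapping.lookup (Poly_Mapping.single i 1)) x = (\<Prod>j\<in>UNIV. if j = i then vec_nth x j else 1)"
      unfolding monom_fun_def by (rule prod.cong) (auto simp: lookup_single when_def)
    then show ?thesis by (simp add: peval_single)
  qed
  have hom: "homogeneous 1 (?X i)" for i
    by (simp add: homogeneous_iff mdeg_def lookup_single when_def)
  have id: "(\<chi> i. peval (?X i) x) = x" for x by (simp only: X vec_lambda_eta)
  have "H dvd 1" if "\<forall>i. H dvd ?X i" for H
    using no_common_factor[OF card, of ?X H] that id by simp
  then show ?thesis unfolding defines_endo_def using hom id by simp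
qed

section \<open>Heights and endomorphisms\<close>

text \<open>This is log^+ of \<open>v x\<close>. Being nonnegative, such terms can be added freely
  when a bound is enlarged.\<close>

definition lp :: "(qbar \<Rightarrow> real) \<Rightarrow> qbar \<Rightarrow> real" where
  "lp v x = max 0 (ln (v x))"

lemma lp_nonneg: "0 \<le> lp v x"
  by (simp add: lp_def)

lemma fin_supp_lp: "number_field K \<Longrightarrow> x \<in> K \<Longrightarrow> fin_supp K (\<lambda>v. lp v x)"
  unfolding fin_supp_def
proof (cases "x = 0")
  case False
  assume "number_field K" "x \<in> K"
  then have "finite {v \<in> places K. v x \<noteq> 1}" using finite_places_ne_one False by blast
  then show "finite {v \<in> places K. lp v x \<noteq> 0}"
    by (rule finite_subset[rotated]) (auto simp: lp_def)
next
  case True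
  assume K: "number_field K"
  have "lp v x = 0" if "v \<in> places K" for v
    using abs_value_on.zero[OF places_abs_value[OF K that]] True by (simp add: lp_def)
  then have "{v \<in> places K. lp v x \<noteq> 0} = {}" by blast
  then show "finite {v \<in> places K. lp v x \<noteq> 0}" by (simp only: finite.emptyI)
qed

lemma le_exp_lp: "abs_value_on K v \<Longrightarrow> x \<in> K \<Longrightarrow> v x \<le> exp (lp v x)"
proof (cases "x = 0")
  case False
  assume "abs_value_on K v" "x \<in> K"
  then have "0 < v x" using abs_value_on.pos False by blast
  then have "v x = exp (ln (v x))" by simp
  also have "\<dots> \<le> exp (lp v x)" by (simp add: lp_def)
  finally show ?thesis .
qed (simp add: abs_value_on.zero)

text \<open>For nonempty \<open>I\<close> the factor is the number of terms at an archimedean place;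
  at the others it is 1, which suffices by the ultrametric inequality. Expressed through
  \<open>lp\<close>, it is one finitely supported function of the place, and the height estimates
  need no case distinction.\<close>

lemma place_sum_le:
  assumes KN: "number_field K" and vK: "v \<in> places K" and f: "\<And>i. i \<in> I \<Longrightarrow> f i \<in> K \<and> v (f i) \<le> C" and C: "0 \<le> C"
  shows "v (sum f I) \<le> exp (lp v (of_nat (card I))) * C"
proof -
  interpret abs_value_on K v by (rule places_abs_value[OF KN vK])
  obtain p where p: "p \<in> rplaces" "v \<in> places_over (rabs p) K" using vK by (auto simp: places_eq)
  show ?thesis
  proof (cases "p = 0")
    case True
    have vn: "v (of_nat n) = real n" for n
      using places_overD(3)[OF p(2), of "of_nat n"] True by (simp add: rabs_def)
    show ?thesis
    proof (cases "card I = 0")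
      case True
      then have "sum f I = 0" by (cases "finite I") auto
      then show ?thesis using C by (simp add: zero)
    next
      case False
      have "v (sum f I) \<le> (\<Sum>i\<in>I. v (f i))" by (rule sum_le) (use f in blast)
      also have "\<dots> \<le> (\<Sum>i\<in>I. C)" by (rule sum_mono) (use f in blast)
      also have "\<dots> = real (card I) * C" by simp
      also have "\<dots> \<le> exp (lp v (of_nat (card I))) * C"
        using le_exp_lp[OF abs_value_on_axioms is_subfield_of_nat[OF K], of "card I"] C
        by (intro mult_right_mono) (simp_all add: vn)
      finally show ?thesis .
    qed
  next
    case False
    then have pp: "Factorial_Ring.prime p" using p(1) by (auto simp: rplaces_def)
    have "v (sum f I) \<le> 1 * C" using ultrametric_sum[OF place_of_nat_le[OF pp p(2)] C, of I f] f by simp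
    also have "\<dots> \<le> exp (lp v (of_nat (card I))) * C" using C by (intro mult_right_mono) (simp_all add: lp_nonneg)
    finally show ?thesis .
  qed
qed

definition hval :: "(('n::finite \<Rightarrow> nat) \<Rightarrow> qbar) \<Rightarrow> nat \<Rightarrow> qbar ^ 'n \<Rightarrow> qbar" where
  "hval c e x = (\<Sum>m | mdeg m = e. c m * monom_fun m x)"

text \<open>The logarithm of a crude local bound: the log^+ of the coefficients are added instead of
  maximised, which makes finiteness of the support immediate.\<close>

definition hsize :: "(qbar \<Rightarrow> real) \<Rightarrow> (('n::finite \<Rightarrow> nat) \<Rightarrow> qbar) \<Rightarrow> nat \<Rightarrow> real" where
  "hsize v c e = lp v (of_nat (card {m :: 'n \<Rightarrow> nat. mdeg m = e})) + (\<Sum>m | mdeg m = e. lp v (c m))"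

lemma hsize_nonneg: "0 \<le> hsize v c e"
  by (simp add: hsize_def lp_nonneg sum_nonneg)

lemma monom_fun_in: "is_subfield K \<Longrightarrow> (\<And>i. vec_nth x i \<in> K) \<Longrightarrow> monom_fun m x \<in> K"
  unfolding monom_fun_def by (intro is_subfield_prod is_subfield_power)

lemma hval_in: "is_subfield K \<Longrightarrow> (\<And>m. mdeg m = e \<Longrightarrow> c m \<in> K) \<Longrightarrow> (\<And>i. vec_nth x i \<in> K) \<Longrightarrow> hval c e x \<in> K"
  unfolding hval_def by (intro is_subfield_sum is_subfieldD(4) monom_fun_in) auto

lemma fin_supp_hsize:
  "number_field K \<Longrightarrow> (\<And>m. mdeg m = e \<Longrightarrow> c m \<in> K) \<Longrightarrow> fin_supp K (\<lambda>v. hsize v c e)"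
  unfolding hsize_def
  by (intro fin_supp_add fin_supp_sum fin_supp_lp) (auto intro: is_subfield_of_nat number_fieldD)

lemma hval_le:
  fixes x :: "qbar ^ 'n::finite"
  assumes KN: "number_field K" and vK: "v \<in> places K" and c: "\<And>m. mdeg m = e \<Longrightarrow> c m \<in> K" and x: "\<And>i. vec_nth x i \<in> K"
  shows "v (hval c e x) \<le> exp (hsize v c e) * vmax v x ^ e"
proof -
  interpret abs_value_on K v by (rule places_abs_value[OF KN vK])
  have X0: "0 \<le> vmax v x"
  proof -
    obtain i where "vmax v x = v (vec_nth x i)" using vmax_attained by metis
    then show ?thesis using nonneg x by simp
  qed
  let ?M = "{m :: 'n \<Rightarrow> nat. mdeg m = e}" and ?L = "\<Sum>m | mdeg m = e. lp v (c m)"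
  have "v (hval c e x) \<le> exp (lp v (of_nat (card ?M))) * (exp ?L * vmax v x ^ e)"
    unfolding hval_def
  proof (rule place_sum_le[OF KN vK])
    show "0 \<le> exp ?L * vmax v x ^ e" using X0 by simp
    fix m :: "'n \<Rightarrow> nat" assume "m \<in> ?M"
    then have m: "mdeg m = e" by simp
    have mK: "monom_fun m x \<in> K" using x by (rule monom_fun_in[OF K])
    have "v (monom_fun m x) = (\<Prod>i\<in>UNIV. v (vec_nth x i) ^ m i)"
      unfolding monom_fun_def using x by (simp add: prod power is_subfield_power[OF K])
    also have "\<dots> \<le> (\<Prod>i\<in>UNIV. vmax v x ^ m i)"
      using x nonneg by (intro prod_mono conjI power_mono vmax_ge zero_le_power) auto
    also have "\<dots> = vmax v x ^ e" unfolding m[symmetric] mdeg_def by (rule power_sum[symmetric])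
    finally have 1: "v (monom_fun m x) \<le> vmax v x ^ e" .
    have "v (c m) \<le> exp (lp v (c m))" by (rule le_exp_lp[OF abs_value_on_axioms c[OF m]])
    also have "\<dots> \<le> exp ?L" unfolding exp_le_cancel_iff by (rule member_le_sum) (use m finite_mdeg lp_nonneg in auto)
    finally have "v (c m) * v (monom_fun m x) \<le> exp ?L * vmax v x ^ e"
      using 1 nonneg[OF mK] by (intro mult_mono) auto
    then show "c m * monom_fun m x \<in> K \<and> v (c m * monom_fun m x) \<le> exp ?L * vmax v x ^ e"
      using c[OF m] mK by (simp add: mult is_subfieldD(4)[OF K])
  qed
  then show ?thesis by (simp add: hsize_def exp_add mult.assoc)
qed

text \<open>All constants live over a field \<open>K0\<close> that depends only on the map. For a
  point \<open>P\<close> the estimate takes place over a larger field \<open>K\<close>, but by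
  \<open>gsum_extend\<close> the normalised sum of the local constants \<open>f\<close> does not
  change, so \<open>C\<close> is independent of \<open>P\<close>.\<close>

theorem height_endo_bound:
  fixes \<phi> :: "'n::finite pspace \<Rightarrow> 'n pspace"
  assumes "defines_endo d F \<phi>"
  shows "\<exists>C. \<forall>P. \<bar>weil_height (\<phi> P) - real d * weil_height P\<bar> \<le> C"
proof -
  have F: "\<And>i. homogeneous d (F i)" "\<And>x. x \<noteq> 0 \<Longrightarrow> (\<chi> i. peval (F i) x) \<noteq> 0"
    "\<And>x. x \<noteq> 0 \<Longrightarrow> \<phi> (abs_pspace x) = abs_pspace (\<chi> i. peval (F i) x)"
    using assms by (auto simp: defines_endo_def)
  have "\<forall>i. \<exists>c. peval (F i) = hval c d"
    using peval_hom_fun[OF F(1)] by (fastforce simp: hom_fun_def hval_def fun_eq_iff)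
  then obtain c where c: "\<And>i. peval (F i) = hval (c i) d" by metis
  have "\<exists>e. \<forall>i. \<exists>G. (\<forall>j. G j \<in> hom_fun e) \<and> (\<forall>x. (vec_nth x i) ^ (d + e) = (\<Sum>j\<in>UNIV. G j x * peval (F j) x))"
  proof (rule projective_nullstellensatz)
    show "\<exists>j. peval (F j) x \<noteq> 0" if "x \<noteq> 0" for x using F(2)[OF that] by (auto simp: vec_eq_iff)
  qed (rule peval_hom_fun[OF F(1)])
  then obtain e where "\<forall>i. \<exists>G. (\<forall>j. G j \<in> hom_fun e) \<and> (\<forall>x. (vec_nth x i) ^ (d + e) = (\<Sum>j\<in>UNIV. G j x * peval (F j) x))"
    by (rule exE)
  from choice[OF this] obtain G where G': "\<forall>i. (\<forall>j. G i j \<in> hom_fun e) \<and> (\<forall>x. (vec_nth x i) ^ (d + e) = (\<Sum>j\<in>UNIV. G i j x * peval (F j) x))"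
    by (rule exE)
  have G: "\<And>i j. G i j \<in> hom_fun e" "\<And>i x. (vec_nth x i) ^ (d + e) = (\<Sum>j\<in>UNIV. G i j x * peval (F j) x)"
    using G'[THEN spec, THEN conjunct1, THEN spec] G'[THEN spec, THEN conjunct2, THEN spec] .
  have "\<forall>i j. \<exists>g. G i j = hval g e" using G(1) by (fastforce simp: hom_fun_def hval_def fun_eq_iff)
  then obtain g where g: "\<And>i j. G i j = hval (g i j) e" by metis
  let ?A = "(\<Union>i. c i ` {m. mdeg m = d}) \<union> (\<Union>i. \<Union>j. g i j ` {m. mdeg m = e})"
  have "finite ?A" using finite_mdeg by auto
  then obtain K0 where K0: "number_field K0" "?A \<subseteq> K0"
    using ex_number_field[OF _ number_field_qadj[of 0]] by metis
  have cK: "c i m \<in> K0" if "mdeg m = d" for i m using K0(2) that by blast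
  have gK: "g i j m \<in> K0" if "mdeg m = e" for i j m using K0(2) that by blast
  \<comment> \<open>The first sum serves the upper bound. The other two terms account for the number
    of terms and the coefficients in the Nullstellensatz identities, hence for the lower
    bound.\<close>
  define f where "f v = (\<Sum>i\<in>UNIV. hsize v (c i) d) + (lp v (of_nat CARD('n)) + (\<Sum>i\<in>UNIV. \<Sum>j\<in>UNIV. hsize v (g i j) e))" for v
  have ff: "fin_supp K0 f"
    unfolding f_def using K0(1) cK gK
    by (intro fin_supp_add fin_supp_sum fin_supp_hsize fin_supp_lp is_subfield_of_nat number_fieldD) auto
  define C where "C = gsum K0 f / QV.dim K0"
  have "\<bar>weil_height (\<phi> P) - real d * weil_height P\<bar> \<le> C" for P
  proof -
    obtain x where x: "x \<noteq> 0" "P = abs_pspace x" using pspace_cases by blast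
    obtain K where K: "number_field K" "K0 \<subseteq> K" "\<And>i. vec_nth x i \<in> K" using ex_number_field_vec[OF K0(1)] by metis
    have K': "is_subfield K" by (rule number_fieldD[OF K(1)])
    define y where "y = (\<chi> i. peval (F i) x)"
    have y0: "y \<noteq> 0" using F(2)[OF x(1)] by (simp add: y_def)
    have yi: "vec_nth y i = hval (c i) d x" for i by (simp add: y_def c)
    have yK: "vec_nth y i \<in> K" for i unfolding yi using cK K by (intro hval_in[OF K']) auto
    have hP: "weil_height P = gsum K (\<lambda>v. ln (vmax v x)) / QV.dim K"
      unfolding x(2) using weil_height_eq[OF K(1,3) x(1)] height_in_eq[OF K(1)] by simp
    have hphi: "weil_height (\<phi> P) = gsum K (\<lambda>v. ln (vmax v y)) / QV.dim K"
      unfolding x(2) F(3)[OF x(1)] y_def[symmetric]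
      using weil_height_eq[OF K(1) yK y0] height_in_eq[OF K(1)] by simp
    have fsx: "fin_supp K (\<lambda>v. ln (vmax v x))" by (rule fin_supp_vmax[OF K(1,3) x(1)])
    have fsy: "fin_supp K (\<lambda>v. ln (vmax v y))" by (rule fin_supp_vmax[OF K(1) yK y0])
    have fK: "f (restrict v K0) = f v" for v
    proof -
      have "lp (restrict v K0) a = lp v a" if "a \<in> K0" for a using that by (simp add: lp_def)
      then have "hsize (restrict v K0) (c i) d = hsize v (c i) d" "hsize (restrict v K0) (g i j) e = hsize v (g i j) e"
        "lp (restrict v K0) (of_nat CARD('n)) = lp v (of_nat CARD('n))" for i j
        using cK gK is_subfield_of_nat[OF number_fieldD[OF K0(1)]] by (auto simp: hsize_def)
      then show ?thesis by (simp add: f_def)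
    qed
    have fsf: "fin_supp K f" and gf: "gsum K f / QV.dim K = C"
      using gsum_extend[OF K0(1) K(1,2) ff] by (simp_all add: fK C_def)
    have bounds: "ln (vmax v y) \<le> f v + real d * ln (vmax v x) \<and> real d * ln (vmax v x) \<le> f v + ln (vmax v y)"
      if v: "v \<in> places K" for v
    proof -
      interpret V: abs_value_on K v by (rule places_abs_value[OF K(1) v])
      have X: "0 < vmax v x" using vmax_pos[OF V.abs_value_on_axioms K(3) x(1)] .
      have Y: "0 < vmax v y" using vmax_pos[OF V.abs_value_on_axioms yK y0] .
      let ?c = "\<Sum>i\<in>UNIV. hsize v (c i) d" and ?g = "\<Sum>i\<in>UNIV. \<Sum>j\<in>UNIV. hsize v (g i j) e"
      have c0: "0 \<le> ?c" by (simp add: sum_nonneg hsize_nonneg)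
      have g0: "0 \<le> ?g" by (simp add: sum_nonneg hsize_nonneg)
      have l0: "0 \<le> lp v (of_nat CARD('n))" by (rule lp_nonneg)
      obtain i where i: "vmax v y = v (vec_nth y i)" using vmax_attained by metis
      have "vmax v y \<le> exp (hsize v (c i) d) * vmax v x ^ d"
        unfolding i yi using K cK by (intro hval_le[OF K(1) v]) auto
      also have "\<dots> \<le> exp ?c * vmax v x ^ d"
        using X by (intro mult_right_mono) (auto intro!: member_le_sum hsize_nonneg)
      finally have "ln (vmax v y) \<le> ln (exp ?c * vmax v x ^ d)" using Y by (simp add: ln_le_cancel_iff[THEN iffD2] X)
      also have "\<dots> = ?c + real d * ln (vmax v x)" using X by (simp add: ln_mult ln_realpow)
      finally have up: "ln (vmax v y) \<le> f v + real d * ln (vmax v x)" using g0 l0 by (simp add: f_def)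
      \<comment> \<open>The identity is used at a coordinate of largest size, so that its left side
        is \<open>vmax v x ^ (d + e)\<close>; the part belonging to \<open>e\<close> then
        cancels.\<close>
      obtain k where k: "vmax v x = v (vec_nth x k)" using vmax_attained by metis
      have "vmax v x ^ (d + e) = v (\<Sum>j\<in>UNIV. G k j x * peval (F j) x)"
        unfolding k using V.power[OF K(3)] G(2) by metis
      also have "\<dots> \<le> exp (lp v (of_nat (card (UNIV :: 'n set)))) * (exp ?g * vmax v x ^ e * vmax v y)"
      proof (rule place_sum_le[OF K(1) v])
        show "0 \<le> exp ?g * vmax v x ^ e * vmax v y" using X Y by simp
        fix j :: 'n
        have GK: "G k j x \<in> K" unfolding g using gK K by (intro hval_in[OF K']) auto
        have FK: "peval (F j) x \<in> K" using yK[of j] by (simp add: y_def)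
        have "v (G k j x) \<le> exp (hsize v (g k j) e) * vmax v x ^ e"
          unfolding g using K gK by (intro hval_le[OF K(1) v]) auto
        also have "hsize v (g k j) e \<le> (\<Sum>j\<in>UNIV. hsize v (g k j) e)"
          by (rule member_le_sum) (auto simp: hsize_nonneg)
        also have "\<dots> \<le> ?g"
          by (rule member_le_sum[where f = "\<lambda>k. \<Sum>j\<in>UNIV. hsize v (g k j) e"]) (auto simp: hsize_nonneg sum_nonneg)
        finally have 1: "v (G k j x) \<le> exp ?g * vmax v x ^ e" using X by (simp add: mult_right_mono)
        have 2: "v (peval (F j) x) \<le> vmax v y" using vmax_ge[of v y j] by (simp add: y_def)
        show "G k j x * peval (F j) x \<in> K \<and> v (G k j x * peval (F j) x) \<le> exp ?g * vmax v x ^ e * vmax v y"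
          using GK FK mult_mono[OF 1 2] X V.nonneg[OF FK] by (simp add: V.mult is_subfieldD(4)[OF K'])
      qed
      finally have "ln (vmax v x ^ (d + e)) \<le> ln (exp (lp v (of_nat CARD('n))) * (exp ?g * vmax v x ^ e * vmax v y))"
        using X Y by (subst ln_le_cancel_iff) auto
      then have "real (d + e) * ln (vmax v x) \<le> lp v (of_nat CARD('n)) + (?g + real e * ln (vmax v x) + ln (vmax v y))"
        using X Y by (simp add: ln_mult ln_realpow)
      then have "real d * ln (vmax v x) \<le> f v + ln (vmax v y)" using c0 by (simp add: f_def algebra_simps)
      with up show ?thesis ..
    qed
    have "gsum K (\<lambda>v. ln (vmax v y)) \<le> gsum K (\<lambda>v. f v + real d * ln (vmax v x))"
      using bounds fsy fsx fsf by (intro gsum_mono fin_supp_add fin_supp_scale) auto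
    also have "\<dots> = gsum K f + real d * gsum K (\<lambda>v. ln (vmax v x))"
      using gsum_add[OF fsf fin_supp_scale[OF fsx]] gsum_scale[OF fsx] by simp
    finally have 1: "gsum K (\<lambda>v. ln (vmax v y)) \<le> gsum K f + real d * gsum K (\<lambda>v. ln (vmax v x))" .
    have "real d * gsum K (\<lambda>v. ln (vmax v x)) = gsum K (\<lambda>v. real d * ln (vmax v x))" using gsum_scale[OF fsx] by simp
    also have "\<dots> \<le> gsum K (\<lambda>v. f v + ln (vmax v y))"
      using bounds fsy fsx fsf by (intro gsum_mono fin_supp_add fin_supp_scale) auto
    also have "\<dots> = gsum K f + gsum K (\<lambda>v. ln (vmax v y))" by (rule gsum_add[OF fsf fsy])
    finally have 2: "real d * gsum K (\<lambda>v. ln (vmax v x)) \<le> gsum K f + gsum K (\<lambda>v. ln (vmax v y))" .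
    have D: "0 < real (QV.dim K)" using dim_pos[OF K(1)] by simp
    have "\<bar>gsum K (\<lambda>v. ln (vmax v y)) - real d * gsum K (\<lambda>v. ln (vmax v x))\<bar> \<le> gsum K f" using 1 2 by linarith
    then have "\<bar>gsum K (\<lambda>v. ln (vmax v y)) - real d * gsum K (\<lambda>v. ln (vmax v x))\<bar> / QV.dim K \<le> gsum K f / QV.dim K"
      using D by (intro divide_right_mono) auto
    moreover have "\<bar>a / QV.dim K - real d * (b / QV.dim K)\<bar> = \<bar>a - real d * b\<bar> / QV.dim K" for a b
      using D by (simp add: diff_divide_distrib[symmetric] abs_divide)
    ultimately show ?thesis unfolding hP hphi gf by (simp only:)
  qed
  then show ?thesis by blast
qed

text \<open>A point with one coordinate 2^k and all others 1 has height at least k ln 2: this comes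
  from the archimedean places, and the coordinate 1 keeps all other contributions
  nonnegative.\<close>

lemma height_unbounded:
  assumes card: "CARD('n::finite) \<ge> 2" shows "\<exists>P :: 'n pspace. B < weil_height P"
proof -
  have "\<exists>i j :: 'n. i \<noteq> j"
  proof (rule ccontr)
    assume "\<not> ?thesis"
    then have "UNIV = {undefined :: 'n}" by auto
    then have "CARD('n) = 1" by (metis card.empty card_insert_disjoint finite.emptyI insert_absorb insert_not_empty One_nat_def)
    then show False using card by simp
  qed
  then obtain i j :: 'n where ij: "i \<noteq> j" by blast
  obtain k :: nat where "B / ln 2 < real k" using reals_Archimedean2 by blast
  then have k: "B < real k * ln 2" by (simp add: pos_divide_less_eq)
  define x where "x = ((\<chi> l. if l = i then 2 ^ k else 1) :: qbar ^ 'n)"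
  define K where "K = qadj 0"
  have K: "number_field K" unfolding K_def by (rule number_field_qadj)
  have K': "is_subfield K" by (rule number_fieldD[OF K])
  have "(2 :: qbar) \<in> K" using is_subfield_of_nat[OF K', of 2] by simp
  then have xK: "vec_nth x l \<in> K" for l by (simp add: x_def is_subfield_power[OF K'] is_subfieldD[OF K'])
  have x0: "x \<noteq> 0" using ij by (auto simp: x_def vec_eq_iff)
  let ?g = "\<lambda>v. ln (vmax v x)"
  have fs: "fin_supp K ?g" by (rule fin_supp_vmax[OF K xK x0])
  have r0: "0 \<in> rplaces" by (simp add: rplaces_def)
  have g0: "0 \<le> ?g v" if "v \<in> places K" for v
  proof -
    interpret abs_value_on K v by (rule places_abs_value[OF K that])
    have "1 \<le> vmax v x" using vmax_ge[of v x j] ij by (simp add: x_def one)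
    then show ?thesis by simp
  qed
  have ginf: "real k * ln 2 \<le> ?g v" if v: "v \<in> places_over (rabs 0) K" for v
  proof -
    have "v (2 ^ k) = 2 ^ k" using places_overD(3)[OF v, of "2 ^ k"] by (simp add: rabs_def of_rat_power)
    then have "2 ^ k \<le> vmax v x" using vmax_ge[of v x i] by (simp add: x_def)
    then have "ln (2 ^ k) \<le> ?g v" by (subst ln_le_cancel_iff) (auto intro: less_le_trans[of _ "2 ^ k"])
    then show ?thesis by (simp add: ln_realpow)
  qed
  obtain M where M: "number_field M" "\<And>\<sigma>. \<sigma> \<in> Emb K \<Longrightarrow> \<sigma> ` K \<subseteq> M" using ex_normal[OF K] by blast
  obtain w where w: "w \<in> places_over (rabs 0) M" using ex_place[OF M(1) rat_abs_rabs[OF r0]] by blast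
  \<comment> \<open>The archimedean local degrees add up to [K:Q], the case of the constant function
    1 in \<open>sum_local_degree\<close>.\<close>
  have "(\<Sum>v\<in>places_over (rabs 0) K. real (local_degree K v) * 1) = real (QV.dim K)"
    using places_above.sum_local_degree[OF places_above_rabs[OF K r0] M w, of "\<lambda>_. 1"] card_Emb[OF K] by simp
  then have "real (QV.dim K) * (real k * ln 2) = (\<Sum>v\<in>places_over (rabs 0) K. real (local_degree K v) * (real k * ln 2))"
    by (simp add: sum_distrib_right[symmetric])
  also have "\<dots> \<le> (\<Sum>v\<in>places_over (rabs 0) K. real (local_degree K v) * ?g v)"
    using ginf by (intro sum_mono mult_left_mono) auto
  also have "\<dots> \<le> (\<Sum>v\<in>places_over (rabs 0) K \<union> {v \<in> places K. ?g v \<noteq> 0}. real (local_degree K v) * ?g v)"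
  proof (rule sum_mono2)
    show "finite (places_over (rabs 0) K \<union> {v \<in> places K. ?g v \<noteq> 0})"
      using finite_places_over[OF K r0] fs by (simp add: fin_supp_def)
    fix v assume "v \<in> places_over (rabs 0) K \<union> {v \<in> places K. ?g v \<noteq> 0} - places_over (rabs 0) K"
    then have "v \<in> places K" by blast
    then show "0 \<le> real (local_degree K v) * ?g v" by (intro mult_nonneg_nonneg g0) simp
  qed simp
  also have "\<dots> = gsum K ?g"
    by (rule gsum_eq_sum[symmetric]) (use finite_places_over[OF K r0] fs r0 places_eq in \<open>auto simp: fin_supp_def\<close>)
  finally have "real k * ln 2 \<le> gsum K ?g / QV.dim K"
    using dim_pos[OF K] by (simp add: pos_le_divide_eq mult.commute)
  then have "B < weil_height (abs_pspace x)"
    using k weil_height_eq[OF K xK x0] height_in_eq[OF K, of x] by simp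
  then show ?thesis by blast
qed

text \<open>Two different degrees would make \<open>weil_height\<close> bounded, by comparison of
  the two estimates of h(\<phi> P).\<close>

lemma endo_degree_unique:
  fixes \<phi> :: "'n::finite pspace \<Rightarrow> 'n pspace"
  assumes card: "CARD('n) \<ge> 2" and F: "defines_endo d F \<phi>" and G: "defines_endo e G \<phi>"
  shows "d = e"
proof (rule ccontr)
  assume ne: "d \<noteq> e"
  obtain C where C: "\<And>P. \<bar>weil_height (\<phi> P) - real d * weil_height P\<bar> \<le> C" using height_endo_bound[OF F] by blast
  obtain C' where C': "\<And>P. \<bar>weil_height (\<phi> P) - real e * weil_height P\<bar> \<le> C'" using height_endo_bound[OF G] by blast
  obtain P :: "'n pspace" where P: "max 0 (C + C') < weil_height P" using height_unbounded[OF card] by blast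
  have "\<bar>(real d - real e) * weil_height P\<bar> \<le> C + C'"
    using C[of P] C'[of P] by (simp add: left_diff_distrib)
  moreover have "1 \<le> \<bar>real d - real e\<bar>" using ne by linarith
  ultimately have "1 * \<bar>weil_height P\<bar> \<le> C + C'"
    unfolding abs_mult by (meson abs_ge_zero mult_right_mono order_trans)
  then show False using P by simp
qed

lemma endo_degree_eq:
  fixes \<phi> :: "'n::finite pspace \<Rightarrow> 'n pspace"
  assumes "CARD('n) \<ge> 2" "defines_endo d F \<phi>" shows "endo_degree \<phi> = d"
  unfolding endo_degree_def using assms endo_degree_unique by (intro the_equality) blast+

lemma ex_defines_endo:
  fixes \<phi> :: "'n::finite pspace \<Rightarrow> 'n pspace"
  assumes "CARD('n) \<ge> 2" "endomorphism \<phi>" shows "\<exists>F. defines_endo (endo_degree \<phi>) F \<phi>"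
  using assms endo_degree_eq by (metis endomorphism_def)

lemma endo_comp:
  fixes \<phi> \<psi> :: "'n::finite pspace \<Rightarrow> 'n pspace"
  assumes card: "CARD('n) \<ge> 2" and "endomorphism \<phi>" "endomorphism \<psi>"
  shows "endomorphism (\<phi> \<circ> \<psi>)" "endo_degree (\<phi> \<circ> \<psi>) = endo_degree \<phi> * endo_degree \<psi>"
proof -
  obtain F G where "defines_endo (endo_degree \<phi>) F \<phi>" "defines_endo (endo_degree \<psi>) G \<psi>"
    using ex_defines_endo[OF card] assms by blast
  from defines_endo_comp[OF card this] show "endomorphism (\<phi> \<circ> \<psi>)" "endo_degree (\<phi> \<circ> \<psi>) = endo_degree \<phi> * endo_degree \<psi>"
    using endo_degree_eq[OF card] by (auto simp: endomorphism_def)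
qed

lemma endo_id:
  assumes card: "CARD('n::finite) \<ge> 2"
  shows "endomorphism (id :: 'n pspace \<Rightarrow> 'n pspace)" "endo_degree (id :: 'n pspace \<Rightarrow> 'n pspace) = 1"
  using defines_endo_id[OF card] endo_degree_eq[OF card] by (auto simp: endomorphism_def)

section \<open>The law of the iterated logarithm\<close>

lemma exp_le_quadratic:
  assumes "e > 0"
  shows "\<exists>r>0. \<forall>y::real. \<bar>y\<bar> \<le> r \<longrightarrow> exp y \<le> 1 + y + (1 + e) * y\<^sup>2 / 2"
proof -
  have "((\<lambda>y::real. (exp y - 1 - y) / y\<^sup>2) \<longlongrightarrow> 1 / 2) (at 0)" by real_asymp
  then have "\<forall>\<^sub>F y in at 0. (exp y - 1 - y) / y\<^sup>2 < (1 + e) / 2"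
    using assms by (intro order_tendstoD(2)) auto
  then obtain d where d: "d > 0" "\<And>y::real. y \<noteq> 0 \<Longrightarrow> \<bar>y\<bar> < d \<Longrightarrow> (exp y - 1 - y) / y\<^sup>2 < (1 + e) / 2"
    unfolding eventually_at dist_real_def by auto
  show ?thesis
  proof (intro exI[of _ "d / 2"] conjI allI impI)
    fix y :: real assume y: "\<bar>y\<bar> \<le> d / 2"
    show "exp y \<le> 1 + y + (1 + e) * y\<^sup>2 / 2"
    proof (cases "y = 0")
      case False
      then have "(exp y - 1 - y) / y\<^sup>2 < (1 + e) / 2" using d y by auto
      then have "exp y - 1 - y < (1 + e) / 2 * y\<^sup>2" using False by (subst (asm) pos_divide_less_eq) auto
      then show ?thesis by simp
    qed simp
  qed (use d in auto)
qed

text \<open>The tail beyond \<open>T\<close> is at least the density at T + 1, taken over an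
  interval of length 1. As b < 1, the exponent on the other side is larger by e T^2 / 2, which for
  large \<open>T\<close> outweighs the linear term from (T + 1)^2 / 2 and the normalising
  constant.\<close>

lemma std_normal_tail:
  assumes b: "0 < b" "b < 1"
  shows "\<exists>T>0. cdf std_normal_distribution T < 1 - exp (- T\<^sup>2 / (2 * b\<^sup>2))"
proof -
  interpret G: real_distribution std_normal_distribution by (rule real_dist_normal_dist)
  define e where "e = 1 / b\<^sup>2 - 1"
  have e: "e > 0" using b by (simp add: e_def power_less_one_iff field_simps)
  have "filterlim (\<lambda>T::real. e * T\<^sup>2 / 2 - T - 1 / 2) at_top at_top" using e by real_asymp
  then have "\<forall>\<^sub>F T in at_top. e * T\<^sup>2 / 2 - T - 1 / 2 > ln (sqrt (2 * pi))"
    by (simp add: filterlim_at_top_dense)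
  then have "\<forall>\<^sub>F T in at_top. T > 0 \<and> e * T\<^sup>2 / 2 - T - 1 / 2 > ln (sqrt (2 * pi))"
    using eventually_gt_at_top[of 0] by eventually_elim simp
  then obtain T where T: "T > 0" "e * T\<^sup>2 / 2 - T - 1 / 2 > ln (sqrt (2 * pi))"
    using eventually_happens'[of at_top] trivial_limit_at_top_linorder by blast
  let ?D = "std_normal_density (T + 1)"
  have "T\<^sup>2 / (2 * b\<^sup>2) = T\<^sup>2 / 2 + e * T\<^sup>2 / 2" using b by (simp add: e_def field_simps)
  moreover have "(T + 1)\<^sup>2 / 2 = T\<^sup>2 / 2 + T + 1 / 2" unfolding power2_sum by (simp add: add_divide_distrib)
  ultimately have "- (T\<^sup>2 / (2 * b\<^sup>2)) < - ln (sqrt (2 * pi)) - (T + 1)\<^sup>2 / 2" using T(2) by linarith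
  then have "- T\<^sup>2 / (2 * b\<^sup>2) < - ln (sqrt (2 * pi)) - (T + 1)\<^sup>2 / 2" by simp
  then have "exp (- T\<^sup>2 / (2 * b\<^sup>2)) < exp (- ln (sqrt (2 * pi)) - (T + 1)\<^sup>2 / 2)" by simp
  also have "\<dots> = ?D" by (simp add: std_normal_density_def exp_diff exp_minus inverse_eq_divide)
  finally have lt: "exp (- T\<^sup>2 / (2 * b\<^sup>2)) < ?D" .
  have "ennreal ?D = (\<integral>\<^sup>+ x. ennreal ?D * indicator {T<..T+1} x \<partial>lborel)"
    by (simp add: nn_integral_cmult)
  also have "\<dots> \<le> (\<integral>\<^sup>+ x. ennreal (std_normal_density x) * indicator {T<..T+1} x \<partial>lborel)"
  proof (intro nn_integral_mono)
    fix x :: real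
    have "?D \<le> std_normal_density x" if "T < x" "x \<le> T + 1"
      using that T(1) by (auto simp: std_normal_density_def intro!: divide_right_mono power_mono)
    then show "ennreal ?D * indicator {T<..T+1} x \<le> ennreal (std_normal_density x) * indicator {T<..T+1} x"
      by (auto simp: indicator_def intro!: ennreal_leI)
  qed
  also have "\<dots> = emeasure std_normal_distribution {T<..T+1}"
    by (subst emeasure_density) auto
  finally have "ennreal ?D \<le> ennreal (measure std_normal_distribution {T<..T+1})"
    by (simp add: G.emeasure_eq_measure)
  then have "?D \<le> measure std_normal_distribution {T<..T+1}" by simp
  also have "\<dots> \<le> measure std_normal_distribution (space std_normal_distribution - {..T})"
    by (intro G.finite_measure_mono) auto
  also have "\<dots> = 1 - cdf std_normal_distribution T"
    unfolding cdf_def by (rule G.prob_compl) simp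
  finally show ?thesis using lt T(1) by (intro exI[of _ T]) auto
qed

text \<open>By independence and 1 - p \<le> exp(-p), the probability that none of the events from
  \<open>K\<close> up to n - 1 occurs is at most the exponential of minus the sum of their
  probabilities, and these sums are unbounded.\<close>

lemma (in prob_space) borel_cantelli_indep:
  fixes Y :: "nat \<Rightarrow> 'a \<Rightarrow> real"
  assumes ind: "indep_vars (\<lambda>_. borel) Y UNIV"
    and ns: "\<not> summable (\<lambda>k. prob {x \<in> space M. y k \<le> Y k x})"
  shows "AE x in M. \<exists>\<^sub>F k in sequentially. y k \<le> Y k x"
proof -
  have [measurable]: "Y k \<in> borel_measurable M" for k using ind by (auto simp: indep_vars_def)
  let ?p = "\<lambda>k. prob {x \<in> space M. y k \<le> Y k x}"
  have "AE x in M. \<exists>k\<ge>K. y k \<le> Y k x" for K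
  proof -
    let ?N = "{x \<in> space M. \<forall>k\<ge>K. Y k x < y k}"
    have N: "?N \<in> events" by measurable
    have "prob ?N \<le> 0"
    proof (rule ccontr)
      assume "\<not> prob ?N \<le> 0"
      then have d: "prob ?N > 0" by simp
      have "\<exists>n. (\<Sum>k<n. ?p k) > real K - ln (prob ?N)"
      proof (rule ccontr)
        assume "\<not> (\<exists>n. (\<Sum>k<n. ?p k) > real K - ln (prob ?N))"
        then have "\<And>n. (\<Sum>k<n. ?p k) \<le> real K - ln (prob ?N)" by (auto simp: not_less)
        then have "summable ?p" by (intro summableI_nonneg_bounded[of ?p]) auto
        with ns show False by blast
      qed
      then obtain n0 where n0: "(\<Sum>k<n0. ?p k) > real K - ln (prob ?N)" by blast
      define n where "n = max n0 (Suc K)"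
      have "(\<Sum>k<n0. ?p k) \<le> (\<Sum>k<n. ?p k)" by (rule sum_mono2) (auto simp: n_def)
      also have "\<dots> = (\<Sum>k<K. ?p k) + (\<Sum>k\<in>{K..<n}. ?p k)"
        by (subst sum.union_disjoint[symmetric]) (auto simp: n_def intro!: sum.cong)
      also have "(\<Sum>k<K. ?p k) \<le> (\<Sum>k<K. 1)" by (rule sum_mono) simp
      finally have sum: "(\<Sum>k\<in>{K..<n}. ?p k) > - ln (prob ?N)" using n0 by simp
      have "prob ?N \<le> prob (\<Inter>k\<in>{K..<n}. Y k -` {..<y k} \<inter> space M)"
        by (intro finite_measure_mono sets.finite_INT) (auto simp: n_def measurable_sets)
      also have "\<dots> = (\<Prod>k\<in>{K..<n}. prob (Y k -` {..<y k} \<inter> space M))"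
        by (rule indep_varsD[OF ind]) (auto simp: n_def)
      also have "\<dots> \<le> (\<Prod>k\<in>{K..<n}. exp (- ?p k))"
      proof (intro prod_mono conjI)
        fix k
        have "Y k -` {..<y k} \<inter> space M = space M - {x \<in> space M. y k \<le> Y k x}" by auto
        then have "prob (Y k -` {..<y k} \<inter> space M) = 1 - ?p k" by (simp only:) (rule prob_compl, measurable)
        then show "prob (Y k -` {..<y k} \<inter> space M) \<le> exp (- ?p k)" using exp_ge_add_one_self[of "- ?p k"] by simp
      qed simp
      also have "\<dots> = exp (- (\<Sum>k\<in>{K..<n}. ?p k))" by (simp add: exp_sum[symmetric] sum_negf)
      also have "\<dots> < exp (ln (prob ?N))" using sum by simp
      finally show False using d by simp
    qed
    then have "prob ?N = 0" using measure_nonneg[of M ?N] by linarith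
    then have "AE x in M. x \<notin> ?N" using N by (intro AE_not_in) (simp add: null_sets_def emeasure_eq_measure)
    then show ?thesis by (rule AE_mp) (auto simp: not_le[symmetric])
  qed
  then have "AE x in M. \<forall>K. \<exists>k\<ge>K. y k \<le> Y k x" by (simp add: AE_all_countable)
  then show ?thesis by (simp add: frequently_sequentially)
qed

section \<open>Sums of bounded independent variables\<close>

definition psum :: "('a \<Rightarrow> real) \<Rightarrow> (nat \<Rightarrow> 'a) \<Rightarrow> nat \<Rightarrow> real" where
  "psum f \<gamma> n = (\<Sum>i<n. f (\<gamma> i))"

abbreviation lil_scale :: "nat \<Rightarrow> real" where
  "lil_scale n \<equiv> sqrt (2 * real n * ln (ln (real n)))"

text \<open>From 3 on the iterated logarithm is nonnegative, because e \<le> 3.\<close>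

lemma lil_scale_mono:
  assumes "3 \<le> m" "m \<le> n" shows "lil_scale m \<le> lil_scale n"
proof -
  have "(exp 1 :: real) \<le> 3" by (rule exp_le)
  then have e: "exp 1 \<le> real m" using assms by linarith
  then have "1 \<le> ln (real m)" using assms by (subst ln_ge_iff) auto
  moreover have "ln (real m) \<le> ln (real n)" using assms by simp
  ultimately have "0 \<le> ln (ln (real m))" "ln (ln (real m)) \<le> ln (ln (real n))" by auto
  then show ?thesis using assms by (intro real_sqrt_le_mono mult_mono) auto
qed

text \<open>The locale fixes the law of one step; the random sequence is the coordinate process on
  the product \<open>Q\<close>.\<close>

locale bounded_iid = prob_space M for M :: "'a measure" +
  fixes f :: "'a \<Rightarrow> real" and c \<sigma> :: real
  assumes meas [measurable]: "f \<in> borel_measurable M"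
    and bound: "\<And>x. x \<in> space M \<Longrightarrow> \<bar>f x\<bar> \<le> c"
    and mean: "expectation f = 0"
    and var: "expectation (\<lambda>x. (f x)\<^sup>2) = \<sigma>\<^sup>2"
    and sigma_pos: "0 < \<sigma>"
begin

abbreviation Q :: "(nat \<Rightarrow> 'a) measure" where "Q \<equiv> Pi\<^sub>M UNIV (\<lambda>_. M)"

sublocale Q: prob_space "Pi\<^sub>M (UNIV :: nat set) (\<lambda>_. M)"
  by (rule prob_space_PiM) unfold_locales

lemma psum_measurable [measurable]: "(\<lambda>\<gamma>. psum f \<gamma> n) \<in> borel_measurable Q"
  unfolding psum_def by measurable

lemma integrable_f: "integrable M f"
  by (rule integrable_const_bound[of _ c]) (auto simp: bound)

lemma integrable_f2: "integrable M (\<lambda>x. (f x)\<^sup>2)"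
proof (rule integrable_const_bound[of _ "c\<^sup>2"])
  show "AE x in M. norm ((f x)\<^sup>2) \<le> c\<^sup>2" using power_mono[OF bound, of _ 2] by auto
qed measurable

lemma integrable_exp_f: "integrable M (\<lambda>x. exp (t * f x))"
proof (rule integrable_const_bound[of _ "exp (\<bar>t\<bar> * c)"])
  have "t * f x \<le> \<bar>t\<bar> * c" if "x \<in> space M" for x
    using mult_left_mono[OF bound[OF that], of "\<bar>t\<bar>"] abs_ge_self[of "t * f x"] by (simp add: abs_mult)
  then show "AE x in M. norm (exp (t * f x)) \<le> exp (\<bar>t\<bar> * c)" by auto
qed measurable

lemma mgf_ge_one: "1 \<le> expectation (\<lambda>x. exp (t * f x))"
proof -
  have "expectation (\<lambda>x. 1 + t * f x) \<le> expectation (\<lambda>x. exp (t * f x))"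
    using integrable_f integrable_exp_f exp_ge_add_one_self by (intro integral_mono) auto
  then show ?thesis using integrable_f mean prob_space by simp
qed

text \<open>Second order expansion inside the expectation: the mean 0 removes the linear term, and
  boundedness of \<open>f\<close> makes one range of \<open>t\<close> work at all points.\<close>

lemma mgf_le:
  assumes "e > 0"
  shows "\<exists>t0>0. \<forall>t. 0 \<le> t \<longrightarrow> t \<le> t0 \<longrightarrow> expectation (\<lambda>x. exp (t * f x)) \<le> exp ((1 + e) * t\<^sup>2 * \<sigma>\<^sup>2 / 2)"
proof -
  obtain r where r: "r > 0" "\<And>y::real. \<bar>y\<bar> \<le> r \<Longrightarrow> exp y \<le> 1 + y + (1 + e) * y\<^sup>2 / 2"
    using exp_le_quadratic[OF assms] by blast
  define t0 where "t0 = r / (\<bar>c\<bar> + 1)"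
  have "expectation (\<lambda>x. exp (t * f x)) \<le> exp ((1 + e) * t\<^sup>2 * \<sigma>\<^sup>2 / 2)" if t: "0 \<le> t" "t \<le> t0" for t
  proof -
    have "\<bar>t * f x\<bar> \<le> r" if "x \<in> space M" for x
    proof -
      have "t * \<bar>f x\<bar> \<le> t0 * (\<bar>c\<bar> + 1)" using t bound[OF that] by (intro mult_mono) auto
      then show ?thesis using t by (simp add: t0_def abs_mult)
    qed
    then have le: "exp (t * f x) \<le> 1 + t * f x + (1 + e) * t\<^sup>2 / 2 * (f x)\<^sup>2" if "x \<in> space M" for x
      using r(2)[of "t * f x"] that by (simp add: power_mult_distrib mult_ac)
    have "expectation (\<lambda>x. exp (t * f x)) \<le> expectation (\<lambda>x. 1 + t * f x + (1 + e) * t\<^sup>2 / 2 * (f x)\<^sup>2)"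
      using integrable_f integrable_f2 integrable_exp_f le by (intro integral_mono) auto
    also have "\<dots> = 1 + (1 + e) * t\<^sup>2 / 2 * \<sigma>\<^sup>2"
      using integrable_f integrable_f2 mean var prob_space by simp
    also have "\<dots> \<le> exp ((1 + e) * t\<^sup>2 * \<sigma>\<^sup>2 / 2)" using exp_ge_add_one_self[of "(1 + e) * t\<^sup>2 * \<sigma>\<^sup>2 / 2"] by simp
    finally show ?thesis .
  qed
  moreover have "t0 > 0" using r(1) by (simp add: t0_def)
  ultimately show ?thesis by blast
qed

text \<open>The infinite product is the image of the product of its first factor with itself under
  prepending, which permits induction on the number of steps.\<close>

lemma emeasure_first_step:
  assumes A: "A \<in> sets Q"
  shows "emeasure Q A = (\<integral>\<^sup>+ x. emeasure Q {\<omega> \<in> space Q. case_nat x \<omega> \<in> A} \<partial>M)"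
proof -
  interpret seq: sequence_space M by unfold_locales
  let ?h = "\<lambda>(s, \<omega>). case_nat s \<omega>"
  have h: "?h \<in> measurable (M \<Otimes>\<^sub>M Q) Q" by measurable
  have "emeasure Q A = emeasure (distr (M \<Otimes>\<^sub>M Q) Q ?h) A" by (simp only: seq.PiM_iter)
  also have "\<dots> = emeasure (M \<Otimes>\<^sub>M Q) (?h -` A \<inter> space (M \<Otimes>\<^sub>M Q))" by (rule emeasure_distr[OF h A])
  also have "\<dots> = (\<integral>\<^sup>+ x. emeasure Q (Pair x -` (?h -` A \<inter> space (M \<Otimes>\<^sub>M Q))) \<partial>M)"
    by (rule Q.emeasure_pair_measure_alt) (rule measurable_sets[OF h A])
  also have "\<dots> = (\<integral>\<^sup>+ x. emeasure Q {\<omega> \<in> space Q. case_nat x \<omega> \<in> A} \<partial>M)"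
    by (intro nn_integral_cong arg_cong[of _ _ "emeasure Q"]) (auto simp: space_pair_measure)
  finally show ?thesis .
qed

text \<open>
  An exponential form of Doob's maximal inequality. The induction conditions on the first step
  instead of stopping at the first passage.
\<close>

lemma emeasure_maximal:
  assumes t: "0 \<le> t"
  shows "emeasure Q {\<gamma> \<in> space Q. \<exists>k\<le>n. l \<le> psum f \<gamma> k} \<le>
    ennreal (exp (- t * l) * expectation (\<lambda>x. exp (t * f x)) ^ n)"
proof (induction n arbitrary: l)
  case 0
  show ?case
  proof (cases "l \<le> 0")
    case True
    then have "(1 :: real) \<le> exp (- t * l)" using t by (simp add: mult_nonneg_nonpos)
    then have "ennreal 1 \<le> ennreal (exp (- t * l))" by (intro ennreal_leI)
    then show ?thesis using order.trans[OF Q.emeasure_le_1] by simp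
  qed (simp add: psum_def)
next
  case (Suc n)
  let ?m = "expectation (\<lambda>x. exp (t * f x))"
  have m: "1 \<le> ?m" by (rule mgf_ge_one)
  let ?A = "{\<gamma> \<in> space Q. \<exists>k\<le>Suc n. l \<le> psum f \<gamma> k}"
  show ?case
  proof (cases "l \<le> 0")
    case True
    then have "(1 :: real) * 1 \<le> exp (- t * l) * ?m ^ Suc n"
      using t m by (intro mult_mono one_le_power) (auto simp: mult_nonneg_nonpos)
    then have "ennreal 1 \<le> ennreal (exp (- t * l) * ?m ^ Suc n)" by (intro ennreal_leI) simp
    then show ?thesis using order.trans[OF Q.emeasure_le_1] by simp
  next
    case False
    have "emeasure Q ?A = (\<integral>\<^sup>+ x. emeasure Q {\<omega> \<in> space Q. case_nat x \<omega> \<in> ?A} \<partial>M)"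
      by (rule emeasure_first_step) measurable
    also have "\<dots> \<le> (\<integral>\<^sup>+ x. ennreal (exp (- t * l) * ?m ^ n * exp (t * f x)) \<partial>M)"
    proof (rule nn_integral_mono)
      fix x assume "x \<in> space M"
      have "emeasure Q {\<omega> \<in> space Q. case_nat x \<omega> \<in> ?A} \<le> emeasure Q {\<omega> \<in> space Q. \<exists>k\<le>n. l - f x \<le> psum f \<omega> k}"
      proof (rule emeasure_mono)
        show "{\<omega> \<in> space Q. case_nat x \<omega> \<in> ?A} \<subseteq> {\<omega> \<in> space Q. \<exists>k\<le>n. l - f x \<le> psum f \<omega> k}"
        proof safe
          fix \<omega> k assume k: "k \<le> Suc n" "l \<le> psum f (case_nat x \<omega>) k"
          \<comment> \<open>Here \<open>l\<close> is positive, so the level is not reached at time 0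
            and at least one step has been made.\<close>
          then obtain j where j: "k = Suc j" using False by (cases k) (auto simp: psum_def)
          have "psum f (case_nat x \<omega>) (Suc j) = f x + psum f \<omega> j"
            unfolding psum_def by (subst sum.lessThan_Suc_shift) simp
          then show "\<exists>k\<le>n. l - f x \<le> psum f \<omega> k" using k j by (intro exI[of _ j]) auto
        qed
      qed measurable
      also have "\<dots> \<le> ennreal (exp (- t * (l - f x)) * ?m ^ n)" by (rule Suc.IH)
      also have "exp (- t * (l - f x)) * ?m ^ n = exp (- t * l) * ?m ^ n * exp (t * f x)"
        by (simp add: exp_add[symmetric] algebra_simps)
      finally show "emeasure Q {\<omega> \<in> space Q. case_nat x \<omega> \<in> ?A} \<le> ennreal (exp (- t * l) * ?m ^ n * exp (t * f x))" .
    qed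
    also have "\<dots> = ennreal (expectation (\<lambda>x. exp (- t * l) * ?m ^ n * exp (t * f x)))"
      using integrable_exp_f m by (intro nn_integral_eq_integral) auto
    also have "expectation (\<lambda>x. exp (- t * l) * ?m ^ n * exp (t * f x)) = exp (- t * l) * ?m ^ Suc n"
      by simp
    finally show ?thesis .
  qed
qed

lemma prob_maximal:
  assumes "0 \<le> t"
  shows "Q.prob {\<gamma> \<in> space Q. \<exists>k\<le>n. l \<le> psum f \<gamma> k} \<le> exp (- t * l) * expectation (\<lambda>x. exp (t * f x)) ^ n"
proof -
  have "0 \<le> exp (- t * l) * expectation (\<lambda>x. exp (t * f x)) ^ n"
    using mgf_ge_one[of t] by (intro mult_nonneg_nonneg zero_le_power) auto
  then show ?thesis using emeasure_maximal[OF assms, of n l] by (simp add: Q.emeasure_eq_measure)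
qed

text \<open>The maximal inequality is applied on the ranges \<theta>^k \<le> n < \<theta>^(k+1),
  followed by the first Borel-Cantelli lemma. The slack a = \<theta>^2 pays once for the length of
  the range and once for the error in the moment generating function; the bound that remains is a
  multiple of k^(-a).\<close>

lemma AE_eventually_le:
  assumes a: "1 < a"
  shows "AE \<gamma> in Q. \<forall>\<^sub>F n in sequentially. psum f \<gamma> n \<le> a * \<sigma> * lil_scale n"
proof -
  define \<theta> where "\<theta> = sqrt a"
  have \<theta>: "1 < \<theta>" "\<theta>\<^sup>2 = a" using a by (auto simp: \<theta>_def)
  then have ln\<theta>: "0 < ln \<theta>" by simp
  obtain t0 where t0: "t0 > 0" "\<And>t. 0 \<le> t \<Longrightarrow> t \<le> t0 \<Longrightarrow>
      expectation (\<lambda>x. exp (t * f x)) \<le> exp (\<theta> * t\<^sup>2 * \<sigma>\<^sup>2 / 2)"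
    using mgf_le[of "\<theta> - 1"] \<theta> by auto
  define L where "L k = ln (real k * ln \<theta>)" for k
  define lam where "lam k = a * \<sigma> * sqrt (2 * \<theta> ^ k * L k)" for k
  \<comment> \<open>The minimiser of \<open>- t * lam k + \<theta> ^ (k + 2) * t\<^sup>2 *
    \<sigma>\<^sup>2 / 2\<close> as a function of \<open>t\<close>; the minimum is
    \<open>- a * L k\<close>.\<close>
  define tt where "tt k = lam k / (\<sigma>\<^sup>2 * \<theta> ^ (k + 2))" for k
  define N where "N k = nat \<lfloor>\<theta> ^ (k + 1)\<rfloor>" for k
  define A where "A k = {\<gamma> \<in> space Q. \<exists>j\<le>N k. lam k \<le> psum f \<gamma> j}" for k
  have N: "real (N k) \<le> \<theta> ^ (k + 1)" for k using \<theta> unfolding N_def by simp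
  have A[measurable]: "A k \<in> sets Q" for k unfolding A_def by measurable
  have "filterlim (\<lambda>k::nat. real k * ln \<theta>) at_top at_top" using ln\<theta> by real_asymp
  then have evL: "\<forall>\<^sub>F k in sequentially. 1 \<le> real k * ln \<theta>" by (simp add: filterlim_at_top)
  have "((\<lambda>k::nat. sqrt (2 * (\<theta> ^ k) * ln (real k * ln \<theta>)) / \<theta> ^ (k + 2)) \<longlongrightarrow> 0) at_top"
    using ln\<theta> \<theta>(1) by real_asymp
  then have "((\<lambda>k. a * \<sigma> / \<sigma>\<^sup>2 * (sqrt (2 * (\<theta> ^ k) * ln (real k * ln \<theta>)) / \<theta> ^ (k + 2))) \<longlongrightarrow> a * \<sigma> / \<sigma>\<^sup>2 * 0) at_top"
    by (intro tendsto_mult tendsto_const)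
  then have "(tt \<longlongrightarrow> 0) at_top" unfolding tt_def lam_def L_def by (simp add: mult_ac)
  then have evt: "\<forall>\<^sub>F k in sequentially. tt k < t0" using t0(1) by (rule order_tendstoD)
  have "\<forall>\<^sub>F k in sequentially. norm (Q.prob (A k)) \<le> ln \<theta> powr (- a) * real k powr (- a)"
    using evL evt
  proof eventually_elim
    case (elim k)
    have L: "0 \<le> L k" unfolding L_def using elim(1) by simp
    have lam: "0 \<le> lam k" "(lam k)\<^sup>2 = a\<^sup>2 * \<sigma>\<^sup>2 * (2 * \<theta> ^ k * L k)"
      unfolding lam_def using a sigma_pos \<theta> L by (auto simp: power_mult_distrib)
    have t: "0 \<le> tt k" "tt k \<le> t0" using lam \<theta> elim by (auto simp: tt_def)
    have "Q.prob (A k) \<le> exp (- tt k * lam k) * expectation (\<lambda>x. exp (tt k * f x)) ^ N k"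
      unfolding A_def by (rule prob_maximal[OF t(1)])
    also have "\<dots> \<le> exp (- tt k * lam k) * exp (\<theta> * (tt k)\<^sup>2 * \<sigma>\<^sup>2 / 2) ^ N k"
      using t0(2)[OF t] mgf_ge_one[of "tt k"] by (intro mult_left_mono power_mono) auto
    also have "\<dots> = exp (- tt k * lam k + real (N k) * (\<theta> * (tt k)\<^sup>2 * \<sigma>\<^sup>2 / 2))"
      by (simp only: exp_add exp_of_nat_mult)
    also have "\<dots> \<le> exp (- tt k * lam k + \<theta> ^ (k + 1) * (\<theta> * (tt k)\<^sup>2 * \<sigma>\<^sup>2 / 2))"
      using N[of k] \<theta> by (simp only: exp_le_cancel_iff) (intro add_left_mono mult_right_mono, auto)
    also have "- tt k * lam k + \<theta> ^ (k + 1) * (\<theta> * (tt k)\<^sup>2 * \<sigma>\<^sup>2 / 2) = - (lam k)\<^sup>2 / (2 * (\<sigma>\<^sup>2 * \<theta> ^ (k + 2)))"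
      using \<theta>(1) sigma_pos by (simp add: tt_def field_simps power2_eq_square)
    also have "\<dots> = - a * L k"
      unfolding lam(2) using \<theta>(1) sigma_pos by (simp add: \<theta>(2)[symmetric] field_simps power2_eq_square)
    also have "exp (- a * L k) = (real k * ln \<theta>) powr (- a)"
      using elim(1) ln\<theta> by (cases "k = 0") (auto simp: L_def powr_def)
    also have "\<dots> = ln \<theta> powr (- a) * real k powr (- a)" using ln\<theta> by (simp add: powr_mult)
    finally show ?case by simp
  qed
  moreover have "summable (\<lambda>k. ln \<theta> powr (- a) * real k powr (- a))"
    using a by (intro summable_mult) (simp add: summable_real_powr_iff)
  ultimately have "summable (\<lambda>k. Q.prob (A k))" by (rule summable_comparison_test_ev)
  then have "AE \<gamma> in Q. \<forall>\<^sub>F k in sequentially. \<gamma> \<in> space Q - A k"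
    by (intro borel_cantelli_AE1) (auto simp: Q.emeasure_eq_measure)
  then show ?thesis
  proof (rule AE_mp, intro AE_I2 impI)
    fix \<gamma> assume "\<forall>\<^sub>F k in sequentially. \<gamma> \<in> space Q - A k"
    then have "\<forall>\<^sub>F k in sequentially. \<gamma> \<in> space Q - A k \<and> 1 \<le> real k * ln \<theta>" using evL by eventually_elim simp
    then obtain K where K: "\<And>k. k \<ge> K \<Longrightarrow> \<gamma> \<in> space Q - A k \<and> 1 \<le> real k * ln \<theta>"
      by (auto simp: eventually_sequentially)
    have "\<forall>\<^sub>F n::nat in sequentially. \<theta> ^ (K + 1) \<le> real n"
      using filterlim_real_sequentially by (simp add: filterlim_at_top)
    then show "\<forall>\<^sub>F n in sequentially. psum f \<gamma> n \<le> a * \<sigma> * lil_scale n"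
    proof eventually_elim
      case (elim n)
      have n1: "1 \<le> real n" using elim one_le_power[of \<theta> "K + 1"] \<theta>(1) by linarith
      \<comment> \<open>Locates \<open>n\<close> in its geometric range: with
        \<open>m = Suc k\<close>, it lies between \<theta>^k and \<theta>^(k+1).\<close>
      define m where "m = (LEAST m. real n < \<theta> ^ m)"
      have m: "real n < \<theta> ^ m" unfolding m_def using real_arch_pow[OF \<theta>(1), of "real n"] by (auto intro: LeastI_ex)
      then have "m \<noteq> 0" using n1 by (cases m) auto
      then obtain k where k: "m = Suc k" by (cases m) auto
      have lo: "\<theta> ^ k \<le> real n" using not_less_Least[of k "\<lambda>m. real n < \<theta> ^ m"] k unfolding m_def by auto
      have "\<theta> ^ (K + 1) < \<theta> ^ m" using elim m by linarith
      then have "K + 1 < m" by (rule power_less_imp_less_exp[OF \<theta>(1)])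
      then have "k \<ge> K" using k by simp
      then have kk: "\<gamma> \<in> space Q - A k" "1 \<le> real k * ln \<theta>" using K by auto
      have "n \<le> N k" unfolding N_def using m k by (simp add: le_nat_floor)
      then have "\<not> lam k \<le> psum f \<gamma> n" using kk(1) unfolding A_def by blast
      then have "psum f \<gamma> n < lam k" by simp
      also have "lam k \<le> a * \<sigma> * lil_scale n"
      proof -
        have "real k * ln \<theta> = ln (\<theta> ^ k)" using \<theta> by (simp add: ln_realpow)
        also have "\<dots> \<le> ln (real n)" using lo \<theta> n1 by simp
        finally have "L k \<le> ln (ln (real n))" unfolding L_def using kk(2) by simp
        moreover have "0 \<le> L k" unfolding L_def using kk(2) by simp
        ultimately have "2 * \<theta> ^ k * L k \<le> 2 * real n * ln (ln (real n))" using lo \<theta> by (intro mult_mono) auto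
        then show ?thesis unfolding lam_def using a sigma_pos by (intro mult_left_mono real_sqrt_le_mono) auto
      qed
      finally show ?case by simp
    qed
  qed
qed

section \<open>Independent blocks and the lower half of the law\<close>

lemma indep_coordinates: "Q.indep_vars (\<lambda>_. M) (\<lambda>i \<gamma>. \<gamma> i) (UNIV :: nat set)"
proof -
  have "distr Q M (\<lambda>\<gamma>. \<gamma> i) = M" for i :: nat
    by (rule distr_PiM_component) (auto intro: prob_space_axioms)
  then show ?thesis
    by (subst Q.indep_vars_iff_distr_eq_PiM) (auto simp: restrict_UNIV distr_id)
qed

lemma indep_blocks:
  assumes "disjoint_family_on K J"
  shows "Q.indep_vars (\<lambda>_. borel) (\<lambda>j \<gamma>. \<Sum>i\<in>K j. f (\<gamma> i)) J"
proof -
  have "Q.indep_vars (\<lambda>j. PiM (K j) (\<lambda>_. M)) (\<lambda>j \<gamma>. restrict (\<lambda>i. \<gamma> i) (K j)) J"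
    by (rule Q.indep_vars_restrict[OF indep_coordinates _ assms]) auto
  then have "Q.indep_vars (\<lambda>_. borel) (\<lambda>j \<gamma>. (\<lambda>x. \<Sum>i\<in>K j. f (x i)) (restrict (\<lambda>i. \<gamma> i) (K j))) J"
    by (rule Q.indep_vars_compose2) measurable
  then show ?thesis by (simp cong: sum.cong)
qed

text \<open>The product measure is invariant under the shift of the coordinates by
  \<open>a\<close>.\<close>

lemma prob_block:
  "Q.prob {\<gamma> \<in> space Q. x \<le> (\<Sum>i\<in>{a..<a + n}. f (\<gamma> i))} = Q.prob {\<gamma> \<in> space Q. x \<le> psum f \<gamma> n}"
proof -
  let ?h = "\<lambda>(\<omega> :: nat \<Rightarrow> 'a) i. \<omega> (a + i)"
  have h: "?h \<in> measurable Q Q" by (rule measurable_PiM_single') (auto simp: space_PiM)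
  have d: "distr Q Q ?h = Q"
    using distr_PiM_reindex[of UNIV "\<lambda>_. M" "\<lambda>i. a + i" UNIV] prob_space_axioms by (simp add: restrict_UNIV)
  have "Q.prob {\<gamma> \<in> space Q. x \<le> psum f \<gamma> n} = measure (distr Q Q ?h) {\<gamma> \<in> space Q. x \<le> psum f \<gamma> n}" by (simp only: d)
  also have "\<dots> = Q.prob (?h -` {\<gamma> \<in> space Q. x \<le> psum f \<gamma> n} \<inter> space Q)"
    by (rule measure_distr[OF h]) measurable
  also have "?h -` {\<gamma> \<in> space Q. x \<le> psum f \<gamma> n} \<inter> space Q = {\<gamma> \<in> space Q. x \<le> psum f (?h \<gamma>) n}"
    using measurable_space[OF h] by auto
  also have "\<dots> = {\<gamma> \<in> space Q. x \<le> (\<Sum>i\<in>{a..<a + n}. f (\<gamma> i))}"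
    using sum.shift_bounds_nat_ivl[of "\<lambda>i. f (_ i)" 0 a n] by (simp add: psum_def lessThan_atLeast0 add.commute)
  finally show ?thesis by simp
qed

text \<open>It suffices that each of \<open>r\<close> consecutive independent blocks of length
  \<open>p\<close> contributes at least \<open>x\<close>.\<close>

lemma prob_blocks_ge:
  "Q.prob {\<gamma> \<in> space Q. x \<le> psum f \<gamma> p} ^ r \<le> Q.prob {\<gamma> \<in> space Q. real r * x \<le> psum f \<gamma> (p * r)}"
proof (cases "r = 0")
  case True
  then show ?thesis by (simp add: psum_def Q.prob_space)
next
  case False
  define K where "K j = {j * p..<j * p + p}" for j
  define Y where "Y j \<gamma> = (\<Sum>i\<in>K j. f (\<gamma> i))" for j and \<gamma> :: "nat \<Rightarrow> 'a"
  have "K i \<inter> K j = {}" if "i < j" for i j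
  proof -
    have "i * p + p \<le> j * p" using mult_le_mono1[of "Suc i" j p] that by simp
    then show ?thesis unfolding K_def by auto
  qed
  then have "disjoint_family_on K {..<r}"
    by (auto simp: disjoint_family_on_def) (metis disjoint_iff nat_neq_iff)
  then have ind: "Q.indep_vars (\<lambda>_. borel) Y {..<r}" unfolding Y_def[abs_def] by (rule indep_blocks)
  have [measurable]: "Y j \<in> borel_measurable Q" for j unfolding Y_def[abs_def] by measurable
  have eq: "Y j -` {x..} \<inter> space Q = {\<gamma> \<in> space Q. x \<le> Y j \<gamma>}" for j by auto
  have "Q.prob {\<gamma> \<in> space Q. x \<le> psum f \<gamma> p} ^ r = (\<Prod>j<r. Q.prob (Y j -` {x..} \<inter> space Q))"
    unfolding eq unfolding Y_def K_def prob_block by simp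
  also have "\<dots> = Q.prob (\<Inter>j\<in>{..<r}. Y j -` {x..} \<inter> space Q)"
    using False by (intro Q.indep_varsD[OF ind, symmetric]) auto
  also have "\<dots> \<le> Q.prob {\<gamma> \<in> space Q. real r * x \<le> psum f \<gamma> (p * r)}"
  proof (rule Q.finite_measure_mono)
    show "(\<Inter>j\<in>{..<r}. Y j -` {x..} \<inter> space Q) \<subseteq> {\<gamma> \<in> space Q. real r * x \<le> psum f \<gamma> (p * r)}"
    proof
      fix \<gamma> assume \<gamma>: "\<gamma> \<in> (\<Inter>j\<in>{..<r}. Y j -` {x..} \<inter> space Q)"
      have "\<forall>j\<in>{..<r}. \<gamma> \<in> Y j -` {x..} \<inter> space Q" using \<gamma> unfolding INT_iff .
      then have Y: "\<And>j. j < r \<Longrightarrow> x \<le> Y j \<gamma>" and "\<gamma> \<in> space Q" using False by auto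
      have "(\<Sum>j<r. x) \<le> (\<Sum>j<r. Y j \<gamma>)" using Y by (intro sum_mono) auto
      also have "\<dots> = psum f \<gamma> (r * p)" unfolding Y_def K_def psum_def by (rule sum.nat_group)
      finally show "\<gamma> \<in> {\<gamma> \<in> space Q. real r * x \<le> psum f \<gamma> (p * r)}" using \<open>\<gamma> \<in> space Q\<close> by (simp add: mult.commute)
    qed
  qed measurable
  finally show ?thesis .
qed

text \<open>At the point \<open>T\<close> of \<open>std_normal_tail\<close> the Gaussian tail is
  strictly larger than the bound, so the central limit theorem transfers the inequality to all long
  sums.\<close>

lemma clt_lower:
  assumes b: "0 < b" "b < 1"
  shows "\<exists>T>0. \<forall>\<^sub>F p in sequentially. exp (- T\<^sup>2 / (2 * b\<^sup>2)) \<le> Q.prob {\<gamma> \<in> space Q. T * \<sigma> * sqrt (real p) \<le> psum f \<gamma> p}"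
proof -
  obtain T where T: "T > 0" "cdf std_normal_distribution T < 1 - exp (- T\<^sup>2 / (2 * b\<^sup>2))"
    using std_normal_tail[OF b] by blast
  interpret G: real_distribution std_normal_distribution by (rule real_dist_normal_dist)
  have dM: "distr Q M (\<lambda>\<gamma>. \<gamma> i) = M" for i :: nat
    by (rule distr_PiM_component) (auto intro: prob_space_axioms)
  have Qint: "Q.expectation (\<lambda>\<gamma>. g (\<gamma> i)) = expectation g" if "g \<in> borel_measurable M" for g :: "'a \<Rightarrow> real" and i :: nat
    using integral_distr[of "\<lambda>\<gamma>. \<gamma> i" Q M g] that by (simp add: dM)
  have ind: "Q.indep_vars (\<lambda>_. borel) (\<lambda>i \<gamma>. f (\<gamma> i)) (UNIV :: nat set)"
    by (rule Q.indep_vars_compose2[OF indep_coordinates]) measurable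
  have mean0: "Q.expectation (\<lambda>\<gamma>. f (\<gamma> i)) = 0" for i using Qint[OF meas] mean by simp
  have "weak_conv_m (\<lambda>n. distr Q borel (\<lambda>\<gamma>. (\<Sum>i<n. f (\<gamma> i)) / sqrt (real n * \<sigma>\<^sup>2))) std_normal_distribution"
  proof (rule Q.central_limit_theorem_zero_mean[OF ind mean0 sigma_pos])
    have "\<bar>f (\<gamma> n)\<bar> \<le> c" if "\<gamma> \<in> space Q" for \<gamma> n using that bound by (auto simp: space_PiM)
    then have "norm ((f (\<gamma> n))\<^sup>2) \<le> c\<^sup>2" if "\<gamma> \<in> space Q" for \<gamma> n using power_mono[of "\<bar>f (\<gamma> n)\<bar>" c 2] that by auto
    then show "integrable Q (\<lambda>\<gamma>. (f (\<gamma> n))\<^sup>2)" for n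
      by (intro Q.integrable_const_bound[of _ "c\<^sup>2"]) auto
    show "Q.variance (\<lambda>\<gamma>. f (\<gamma> n)) = \<sigma>\<^sup>2" for n using Qint[of "\<lambda>x. (f x)\<^sup>2" n] var by (simp add: mean0)
    show "distr Q borel (\<lambda>\<gamma>. f (\<gamma> n)) = distr M borel f" for n
      using distr_distr[of f M borel "\<lambda>\<gamma>. \<gamma> n" Q] by (simp add: dM comp_def)
  qed
  moreover have "isCont (cdf std_normal_distribution) T"
    unfolding G.isCont_cdf by (simp add: measure_def emeasure_density)
  ultimately have "(\<lambda>n. cdf (distr Q borel (\<lambda>\<gamma>. (\<Sum>i<n. f (\<gamma> i)) / sqrt (real n * \<sigma>\<^sup>2))) T) \<longlonglongrightarrow> cdf std_normal_distribution T"
    unfolding weak_conv_m_def weak_conv_def by blast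
  then have "\<forall>\<^sub>F n in sequentially. cdf (distr Q borel (\<lambda>\<gamma>. (\<Sum>i<n. f (\<gamma> i)) / sqrt (real n * \<sigma>\<^sup>2))) T < 1 - exp (- T\<^sup>2 / (2 * b\<^sup>2))"
    using T(2) by (rule order_tendstoD)
  then have "\<forall>\<^sub>F p in sequentially. exp (- T\<^sup>2 / (2 * b\<^sup>2)) \<le> Q.prob {\<gamma> \<in> space Q. T * \<sigma> * sqrt (real p) \<le> psum f \<gamma> p}"
    using eventually_gt_at_top[of 0]
  proof eventually_elim
    case (elim p)
    let ?Z = "\<lambda>\<gamma>. (\<Sum>i<p. f (\<gamma> i)) / sqrt (real p * \<sigma>\<^sup>2)"
    have [measurable]: "?Z \<in> borel_measurable Q" by measurable
    have "cdf (distr Q borel ?Z) T = Q.prob {\<gamma> \<in> space Q. ?Z \<gamma> \<le> T}"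
      unfolding cdf_def by (subst measure_distr) (auto intro!: arg_cong[of _ _ "measure Q"])
    moreover have "Q.prob (space Q - {\<gamma> \<in> space Q. ?Z \<gamma> \<le> T}) = 1 - Q.prob {\<gamma> \<in> space Q. ?Z \<gamma> \<le> T}"
      by (rule Q.prob_compl) measurable
    moreover have "Q.prob (space Q - {\<gamma> \<in> space Q. ?Z \<gamma> \<le> T}) \<le> Q.prob {\<gamma> \<in> space Q. T * \<sigma> * sqrt (real p) \<le> psum f \<gamma> p}"
    proof (rule Q.finite_measure_mono)
      have "T * \<sigma> * sqrt (real p) \<le> psum f \<gamma> p" if "\<not> ?Z \<gamma> \<le> T" for \<gamma>
      proof -
        have "T < psum f \<gamma> p / (\<sigma> * sqrt (real p))"
          using that sigma_pos by (simp add: psum_def real_sqrt_mult mult.commute)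
        then show ?thesis using sigma_pos elim(2) by (simp add: less_divide_eq mult_ac less_imp_le)
      qed
      then show "space Q - {\<gamma> \<in> space Q. ?Z \<gamma> \<le> T} \<subseteq> {\<gamma> \<in> space Q. T * \<sigma> * sqrt (real p) \<le> psum f \<gamma> p}" by blast
    qed measurable
    ultimately show ?case using elim(1) by linarith
  qed
  with T(1) show ?thesis by blast
qed

text \<open>
  The times \<open>s k = q ^ k\<close> grow so fast that the increment up to \<open>e k \<le> q ^ (k + 1)\<close> dominates the
  past. This increment is a sum of \<open>r k \<sim> ln k\<close> blocks of length \<open>p k\<close>, and the central limit
  theorem, applied to each block separately, is sharp enough on the exponential scale.
\<close>

lemma AE_frequently_ge:
  assumes neg: "AE \<gamma> in Q. \<forall>\<^sub>F n in sequentially. - psum f \<gamma> n \<le> 2 * \<sigma> * lil_scale n"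
    and b': "0 < b'" "b' < 1"
  shows "AE \<gamma> in Q. \<exists>\<^sub>F n in sequentially. b' * \<sigma> * lil_scale n \<le> psum f \<gamma> n"
proof -
  \<comment> \<open>A constant strictly between \<open>b'\<close> and 1 leaves room for the losses
    caused by a finite \<open>q\<close>.\<close>
  define b where "b = (1 + b') / 2"
  have b: "0 < b" "b < 1" "b' < b" using b' by (auto simp: b_def)
  \<comment> \<open>Of the time q^(k+1), at least the fraction 1 - 2/q is covered by the blocks: one
    share of q^k is the past, another is lost by rounding. The term 2 / sqrt q bounds the negative
    influence of the past, by \<open>neg\<close> at time q^k.\<close>
  have "((\<lambda>q::nat. b * sqrt (1 - 2 / real q) - 2 / sqrt (real q)) \<longlongrightarrow> b) at_top" by real_asymp
  then have "\<forall>\<^sub>F q in sequentially. b' < b * sqrt (1 - 2 / real q) - 2 / sqrt (real q)"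
    using b(3) by (rule order_tendstoD)
  then have "\<forall>\<^sub>F q in sequentially. b' < b * sqrt (1 - 2 / real q) - 2 / sqrt (real q) \<and> 3 \<le> q"
    using eventually_ge_at_top[of 3] by eventually_elim simp
  then obtain q where q: "b' < b * sqrt (1 - 2 / real q) - 2 / sqrt (real q)" "3 \<le> q"
    by (auto simp: eventually_sequentially)
  obtain T where T: "T > 0" "\<forall>\<^sub>F p in sequentially. exp (- T\<^sup>2 / (2 * b\<^sup>2)) \<le> Q.prob {\<gamma> \<in> space Q. T * \<sigma> * sqrt (real p) \<le> psum f \<gamma> p}"
    using clt_lower[OF b(1,2)] by blast
  then obtain p0 where p0: "\<And>p. p \<ge> p0 \<Longrightarrow> exp (- T\<^sup>2 / (2 * b\<^sup>2)) \<le> Q.prob {\<gamma> \<in> space Q. T * \<sigma> * sqrt (real p) \<le> psum f \<gamma> p}"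
    by (auto simp: eventually_sequentially)
  \<comment> \<open>Raising the block probability of \<open>clt_lower\<close> to the power C ln k
    gives exactly 1/k, which is not summable. The same \<open>C\<close> makes the level
    \<open>x k\<close> comparable with b \<sigma> sqrt(2 q^(k+1) ln k), up to the factor from the
    covered fraction.\<close>
  define C where "C = 2 * b\<^sup>2 / T\<^sup>2"
  have C: "C > 0" using b T by (simp add: C_def)
  define r where "r k = nat \<lceil>C * ln (real k)\<rceil>" for k
  define p where "p k = (q ^ k * (q - 1)) div r k" for k
  define e where "e k = q ^ k + p k * r k" for k
  define x where "x k = real (r k) * (T * \<sigma> * sqrt (real (p k)))" for k
  define Y where "Y k \<gamma> = (\<Sum>i\<in>{q ^ k..<e k}. f (\<gamma> i))" for k and \<gamma> :: "nat \<Rightarrow> 'a"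
  let ?Q = "ln (real q)"
  have Q1: "?Q > 1"
    using q(2) exp_less_cancel_iff[of 1 "ln (real q)"] e_less_272 by simp
  have r: "C * ln (real k) \<le> real (r k)" "real (r k) \<le> C * ln (real k) + 1" if "k \<ge> 1" for k
    using that C by (auto simp: r_def of_nat_nat zero_le_ceiling intro!: less_imp_le)
  have pr: "p k * r k \<le> q ^ k * (q - 1)" for k unfolding p_def by (rule div_times_less_eq_dividend)
  then have e_le: "e k \<le> q ^ Suc k" for k
  proof -
    have "q ^ k + q ^ k * (q - 1) = q ^ Suc k" using q(2) by (cases q) auto
    then show ?thesis unfolding e_def using pr[of k] by linarith
  qed
  \<comment> \<open>Since \<open>r k\<close> grows only logarithmically, the blocks eventually have
    length at least \<open>p0\<close>, and rounding loses at most q^k.\<close>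
  have "((\<lambda>k::nat. (real p0 + 1) * (C * ln (real k) + 1) / 3 ^ k) \<longlongrightarrow> 0) at_top" using C by real_asymp
  then have "\<forall>\<^sub>F k in sequentially. (real p0 + 1) * (C * ln (real k) + 1) / 3 ^ k < 1"
    by (rule order_tendstoD) simp
  then have ev1: "\<forall>\<^sub>F k in sequentially. (real p0 + 1) * real (r k) \<le> real q ^ k"
    using eventually_ge_at_top[of 1]
  proof eventually_elim
    case (elim k)
    have "(real p0 + 1) * real (r k) \<le> (real p0 + 1) * (C * ln (real k) + 1)" using r(2)[OF elim(2)] by (intro mult_left_mono) auto
    also have "\<dots> \<le> 3 ^ k" using elim(1) by (simp add: divide_less_eq)
    also have "\<dots> \<le> real q ^ k" using q(2) by (intro power_mono) auto
    finally show ?case .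
  qed
  \<comment> \<open>The final comparison, divided by \<sigma> sqrt(2 q^(k+1)). The three square
    roots of logarithms are asymptotically equal, so it reduces to the choice of
    \<open>q\<close>.\<close>
  have ev2: "\<forall>\<^sub>F k in sequentially. b' * sqrt (ln (real (Suc k) * ?Q)) \<le>
      b * sqrt (1 - 2 / real q) * sqrt (ln (real k)) - 2 / sqrt (real q) * sqrt (ln (real k * ?Q))"
  proof -
    let ?D = "b * sqrt (1 - 2 / real q)" and ?E = "2 / sqrt (real q)"
    have Q0: "?Q > 0" using Q1 by simp
    have "((\<lambda>k::nat. sqrt (ln (real k * ?Q)) / sqrt (ln (real k))) \<longlongrightarrow> 1) at_top"
      "((\<lambda>k::nat. sqrt (ln (real (Suc k) * ?Q)) / sqrt (ln (real k))) \<longlongrightarrow> 1) at_top"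
      using Q0 by real_asymp+
    then have "((\<lambda>k::nat. ?D - ?E * (sqrt (ln (real k * ?Q)) / sqrt (ln (real k)))
        - b' * (sqrt (ln (real (Suc k) * ?Q)) / sqrt (ln (real k)))) \<longlongrightarrow> ?D - ?E * 1 - b' * 1) at_top"
      by (intro tendsto_intros)
    then have "\<forall>\<^sub>F k in sequentially. 0 < ?D - ?E * (sqrt (ln (real k * ?Q)) / sqrt (ln (real k)))
        - b' * (sqrt (ln (real (Suc k) * ?Q)) / sqrt (ln (real k)))"
      using q(1) by (intro order_tendstoD(1)) auto
    then show ?thesis using eventually_ge_at_top[of 2]
    proof eventually_elim
      case (elim k)
      have "sqrt (ln (real k)) > 0" using elim(2) by simp
      then have "0 < (?D - ?E * (sqrt (ln (real k * ?Q)) / sqrt (ln (real k)))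
        - b' * (sqrt (ln (real (Suc k) * ?Q)) / sqrt (ln (real k)))) * sqrt (ln (real k))" using elim(1) by simp
      then show ?case using \<open>sqrt (ln (real k)) > 0\<close> by (simp add: field_simps)
    qed
  qed
  have q_mono: "q ^ Suc i \<le> q ^ j" if "i < j" for i j using q(2) that by (intro power_increasing) auto
  have "{q ^ i..<e i} \<inter> {q ^ j..<e j} = {}" if "i < j" for i j
    using q_mono[OF that] e_le[of i] by auto
  then have "disjoint_family_on (\<lambda>k. {q ^ k..<e k}) UNIV"
    by (auto simp: disjoint_family_on_def) (metis disjoint_iff nat_neq_iff)
  then have ind: "Q.indep_vars (\<lambda>_. borel) Y UNIV" unfolding Y_def[abs_def] by (rule indep_blocks)
  have prob: "\<forall>\<^sub>F k in sequentially. exp (- T\<^sup>2 / (2 * b\<^sup>2)) * inverse (real k) \<le> Q.prob {\<gamma> \<in> space Q. x k \<le> Y k \<gamma>}"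
    using ev1 eventually_ge_at_top[of 2]
  proof eventually_elim
    case (elim k)
    have k: "k \<ge> 1" using elim(2) by simp
    have lnk: "0 < ln (real k)" using elim(2) by simp
    then have rpos: "r k > 0" using r(1)[OF k] C by (metis less_le_trans mult_pos_pos of_nat_0_less_iff)
    have "p0 * r k \<le> q ^ k * (q - 1)"
    proof -
      have "real (p0 * r k) \<le> (real p0 + 1) * real (r k)" by (simp add: algebra_simps)
      also have "\<dots> \<le> real (q ^ k)" using elim(1) by simp
      finally have "p0 * r k \<le> q ^ k" by (simp only: of_nat_le_iff)
      also have "\<dots> \<le> q ^ k * (q - 1)" using q(2) by simp
      finally show ?thesis .
    qed
    then have pk: "p k \<ge> p0" unfolding p_def using rpos by (simp add: less_eq_div_iff_mult_less_eq)
    have "exp (- T\<^sup>2 / (2 * b\<^sup>2)) * inverse (real k) = exp (- T\<^sup>2 / (2 * b\<^sup>2) * (C * ln (real k) + 1))"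
    proof -
      have "- T\<^sup>2 / (2 * b\<^sup>2) * (C * ln (real k) + 1) = - ln (real k) + - T\<^sup>2 / (2 * b\<^sup>2)"
        using T(1) b by (simp add: C_def field_simps)
      then show ?thesis using k by (simp only: exp_add) (simp add: exp_minus)
    qed
    also have "\<dots> \<le> exp (- T\<^sup>2 / (2 * b\<^sup>2) * real (r k))"
      using r(2)[OF k] b by (simp only: exp_le_cancel_iff) (intro mult_left_mono_neg, auto)
    also have "\<dots> = exp (- T\<^sup>2 / (2 * b\<^sup>2)) ^ r k" by (subst mult.commute) (rule exp_of_nat_mult)
    also have "\<dots> \<le> Q.prob {\<gamma> \<in> space Q. T * \<sigma> * sqrt (real (p k)) \<le> psum f \<gamma> (p k)} ^ r k"
      using p0[OF pk] by (intro power_mono) auto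
    also have "\<dots> \<le> Q.prob {\<gamma> \<in> space Q. x k \<le> psum f \<gamma> (p k * r k)}" unfolding x_def by (rule prob_blocks_ge)
    also have "\<dots> = Q.prob {\<gamma> \<in> space Q. x k \<le> Y k \<gamma>}" unfolding Y_def e_def by (rule prob_block[symmetric])
    finally show ?case .
  qed
  have "\<not> summable (\<lambda>k. Q.prob {\<gamma> \<in> space Q. x k \<le> Y k \<gamma>})"
  proof
    assume "summable (\<lambda>k. Q.prob {\<gamma> \<in> space Q. x k \<le> Y k \<gamma>})"
    then have "summable (\<lambda>k. exp (- T\<^sup>2 / (2 * b\<^sup>2)) * inverse (real k))"
      by (rule summable_comparison_test_ev[rotated]) (use prob in \<open>simp add: abs_mult\<close>)
    then have "summable (\<lambda>k. inverse (real k))" by (rule summable_mult_D) simp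
    then show False using not_summable_harmonic by blast
  qed
  then have "AE \<gamma> in Q. \<exists>\<^sub>F k in sequentially. x k \<le> Y k \<gamma>" by (rule Q.borel_cantelli_indep[OF ind])
  with neg show ?thesis
  proof eventually_elim
    case (elim \<gamma>)
    have lim: "filterlim (\<lambda>k. q ^ k) sequentially sequentially"
      using q(2) by (intro filterlim_subseq strict_monoI power_strict_increasing) auto
    have eq: "\<forall>\<^sub>F k in sequentially. - psum f \<gamma> (q ^ k) \<le> 2 * \<sigma> * lil_scale (q ^ k)"
      using elim(1) lim by (rule eventually_compose_filterlim)
    have ineq: "\<forall>\<^sub>F k in sequentially. x k \<le> Y k \<gamma> \<longrightarrow> b' * \<sigma> * lil_scale (e k) \<le> psum f \<gamma> (e k)"
      using eq ev1 ev2 eventually_ge_at_top[of 2]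
    proof eventually_elim
      case (elim k)
      have k: "k \<ge> 1" using elim(4) by simp
      let ?R = "sqrt (2 * real q ^ Suc k)"
      have lnk: "0 < ln (real k)" using elim(4) by simp
      then have rpos: "0 < r k" using r(1)[OF k] C by (metis less_le_trans mult_pos_pos of_nat_0_less_iff)
      have "real (q ^ k * (q - 1)) - real (r k) \<le> real (p k * r k)"
      proof -
        have "q ^ k * (q - 1) = p k * r k + (q ^ k * (q - 1)) mod r k" unfolding p_def by (rule div_mult_mod_eq[symmetric])
        moreover have "(q ^ k * (q - 1)) mod r k < r k" using rpos by simp
        ultimately have "q ^ k * (q - 1) \<le> p k * r k + r k" by linarith
        then show ?thesis by (metis diff_le_eq of_nat_add of_nat_le_iff)
      qed
      moreover have "real (r k) \<le> real q ^ k"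
      proof -
        have "real (r k) \<le> (real p0 + 1) * real (r k)" by (simp add: distrib_right)
        then show ?thesis using elim(2) by (rule order_trans)
      qed
      moreover have "real (q ^ k * (q - 1)) = real q ^ k * (real q - 1)" using q(2) by (simp add: of_nat_diff)
      ultimately have "real q ^ k * (real q - 1) - real q ^ k \<le> real (p k * r k)" by linarith
      then have prk: "real q ^ Suc k * (1 - 2 / real q) \<le> real (p k * r k)" using q(2) by (simp add: field_simps)
      have "b * sqrt (1 - 2 / real q) * sqrt (ln (real k)) * ?R = T * (sqrt (C * ln (real k)) * sqrt (real q ^ Suc k * (1 - 2 / real q)))"
        using T(1) b by (simp add: C_def real_sqrt_mult real_sqrt_divide)
      also have "\<dots> \<le> T * (sqrt (real (r k)) * sqrt (real (p k * r k)))"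
        using r(1)[OF k] prk C lnk T(1) q(2) by (intro mult_left_mono mult_mono real_sqrt_le_mono) auto
      also have "sqrt (real (r k)) * sqrt (real (p k * r k)) = real (r k) * sqrt (real (p k))"
        by (simp add: real_sqrt_mult)
      finally have xk: "\<sigma> * (b * sqrt (1 - 2 / real q) * sqrt (ln (real k)) * ?R) \<le> x k"
        unfolding x_def using mult_left_mono[of _ "T * (real (r k) * sqrt (real (p k)))" \<sigma>] sigma_pos by (simp add: mult_ac)
      have s_ge: "3 \<le> q ^ k" using q(2) k self_le_power[of q k] by linarith
      have "lil_scale (e k) \<le> lil_scale (q ^ Suc k)"
        using s_ge e_le by (intro lil_scale_mono) (auto simp: e_def)
      also have "\<dots> = ?R * sqrt (ln (real (Suc k) * ?Q))"
        using q(2) by (simp add: real_sqrt_mult ln_mult ln_realpow algebra_simps)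
      finally have g1: "b' * \<sigma> * lil_scale (e k) \<le> b' * \<sigma> * (?R * sqrt (ln (real (Suc k) * ?Q)))"
        using b' sigma_pos by (intro mult_left_mono) auto
      have g2: "lil_scale (q ^ k) = ?R * (1 / sqrt (real q) * sqrt (ln (real k * ?Q)))"
        using q(2) by (simp add: real_sqrt_mult ln_realpow)
      show ?case
      proof
        assume Y: "x k \<le> Y k \<gamma>"
        have "psum f \<gamma> (e k) = psum f \<gamma> (q ^ k) + Y k \<gamma>"
          unfolding psum_def Y_def lessThan_atLeast0 by (rule sum.atLeastLessThan_concat[symmetric]) (auto simp: e_def)
        moreover have "\<sigma> * ?R * (b' * sqrt (ln (real (Suc k) * ?Q))) \<le>
            \<sigma> * ?R * (b * sqrt (1 - 2 / real q) * sqrt (ln (real k)) - 2 / sqrt (real q) * sqrt (ln (real k * ?Q)))"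
          using elim(3) sigma_pos by (intro mult_left_mono) auto
        moreover have "\<sigma> * ?R * (b * sqrt (1 - 2 / real q) * sqrt (ln (real k)) - 2 / sqrt (real q) * sqrt (ln (real k * ?Q)))
            = \<sigma> * (b * sqrt (1 - 2 / real q) * sqrt (ln (real k)) * ?R) - 2 * \<sigma> * lil_scale (q ^ k)"
          unfolding g2 by (simp add: algebra_simps)
        moreover have "b' * \<sigma> * (?R * sqrt (ln (real (Suc k) * ?Q))) = \<sigma> * ?R * (b' * sqrt (ln (real (Suc k) * ?Q)))"
          by (simp only: mult_ac)
        ultimately show "b' * \<sigma> * lil_scale (e k) \<le> psum f \<gamma> (e k)"
          using Y elim(1) g1 xk by linarith
      qed
    qed
    have "\<exists>\<^sub>F k in sequentially. b' * \<sigma> * lil_scale (e k) \<le> psum f \<gamma> (e k)"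
      using frequently_rev_mp[OF elim(2) ineq] .
    moreover have "filterlim e sequentially sequentially"
      by (rule filterlim_at_top_mono[OF lim]) (auto simp: e_def)
    ultimately show ?case
      unfolding frequently_def using eventually_compose_filterlim by blast
  qed
qed

lemma neg_iid: "bounded_iid M (\<lambda>x. - f x) c \<sigma>"
  using bound mean var sigma_pos by unfold_locales auto

lemma psum_uminus: "psum (\<lambda>x. - f x) \<gamma> n = - psum f \<gamma> n"
  by (simp add: psum_def sum_negf)

lemma AE_eventually_ge: "AE \<gamma> in Q. \<forall>\<^sub>F n in sequentially. - psum f \<gamma> n \<le> 2 * \<sigma> * lil_scale n"
  using bounded_iid.AE_eventually_le[OF neg_iid, of 2] by (simp add: psum_uminus)

text \<open>A consequence of the upper half for \<open>f\<close> and for its negative, because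
  \<open>lil_scale n\<close> is o(n).\<close>

lemma strong_law: "AE \<gamma> in Q. (\<lambda>n. psum f \<gamma> n / real n) \<longlonglongrightarrow> 0"
proof -
  have "AE \<gamma> in Q. \<forall>\<^sub>F n in sequentially. psum f \<gamma> n \<le> 2 * \<sigma> * lil_scale n" by (rule AE_eventually_le) simp
  then show ?thesis using AE_eventually_ge
  proof eventually_elim
    case (elim \<gamma>)
    have "(\<lambda>n. lil_scale n / real n) \<longlonglongrightarrow> 0" by real_asymp
    then have "(\<lambda>n. 2 * \<sigma> * (lil_scale n / real n)) \<longlonglongrightarrow> 0" by (rule tendsto_mult_right_zero)
    moreover have "\<forall>\<^sub>F n in sequentially. norm (psum f \<gamma> n / real n) \<le> 2 * \<sigma> * (lil_scale n / real n)"
      using elim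
    proof eventually_elim
      case (elim n)
      then have "\<bar>psum f \<gamma> n\<bar> \<le> 2 * \<sigma> * lil_scale n" by linarith
      then have "\<bar>psum f \<gamma> n\<bar> / real n \<le> 2 * \<sigma> * lil_scale n / real n" by (rule divide_right_mono) simp
      then show ?case by (simp add: abs_divide)
    qed
    ultimately show ?case by (rule Lim_null_comparison[rotated])
  qed
qed

text \<open>Countably many constants approach 1 from either side, so that their exceptional sets
  form one null set.\<close>

theorem law_of_iterated_logarithm:
  "AE \<gamma> in Q. limsup (\<lambda>n. ereal (psum f \<gamma> n / (\<sigma> * lil_scale n))) = 1"
proof -
  have "AE \<gamma> in Q. \<forall>j. \<exists>\<^sub>F n in sequentially. (1 - 1 / real (j + 2)) * \<sigma> * lil_scale n \<le> psum f \<gamma> n"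
    unfolding AE_all_countable by (intro allI AE_frequently_ge[OF AE_eventually_ge]) auto
  moreover have "AE \<gamma> in Q. \<forall>j. \<forall>\<^sub>F n in sequentially. psum f \<gamma> n \<le> (1 + 1 / real (j + 1)) * \<sigma> * lil_scale n"
    unfolding AE_all_countable by (intro allI AE_eventually_le) auto
  ultimately show ?thesis
  proof eventually_elim
    case (elim \<gamma>)
    have "filterlim (\<lambda>n::nat. ln (ln (real n))) at_top at_top" by real_asymp
    then have "\<forall>\<^sub>F n::nat in sequentially. 0 < ln (ln (real n))" by (simp add: filterlim_at_top_dense)
    then have pos: "\<forall>\<^sub>F n in sequentially. 0 < \<sigma> * lil_scale n"
      using eventually_gt_at_top[of 0] by eventually_elim (use sigma_pos in auto)
    let ?L = "limsup (\<lambda>n. ereal (psum f \<gamma> n / (\<sigma> * lil_scale n)))"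
    have up: "?L \<le> ereal (1 + 1 / real (j + 1))" for j
    proof (rule Limsup_bounded)
      have "\<forall>\<^sub>F n in sequentially. psum f \<gamma> n \<le> (1 + 1 / real (j + 1)) * \<sigma> * lil_scale n" using elim(2) by blast
      then show "\<forall>\<^sub>F n in sequentially. ereal (psum f \<gamma> n / (\<sigma> * lil_scale n)) \<le> ereal (1 + 1 / real (j + 1))"
        using pos by eventually_elim (simp add: divide_le_eq mult_ac)
    qed
    have lo: "ereal (1 - 1 / real (j + 2)) \<le> ?L" for j
    proof (rule ccontr)
      assume "\<not> ereal (1 - 1 / real (j + 2)) \<le> ?L"
      then have "?L < ereal (1 - 1 / real (j + 2))" by simp
      then have "\<forall>\<^sub>F n in sequentially. ereal (psum f \<gamma> n / (\<sigma> * lil_scale n)) < ereal (1 - 1 / real (j + 2))"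
        by (rule Limsup_lessD)
      then have "\<forall>\<^sub>F n in sequentially. \<not> (1 - 1 / real (j + 2)) * \<sigma> * lil_scale n \<le> psum f \<gamma> n"
        using pos by eventually_elim (simp add: divide_less_eq mult_ac)
      moreover have "\<exists>\<^sub>F n in sequentially. (1 - 1 / real (j + 2)) * \<sigma> * lil_scale n \<le> psum f \<gamma> n" using elim(1) by blast
      ultimately show False by (simp add: frequently_def)
    qed
    have l1: "(\<lambda>j::nat. ereal (1 + 1 / real (j + 1))) \<longlonglongrightarrow> ereal 1" "(\<lambda>j::nat. ereal (1 - 1 / real (j + 2))) \<longlonglongrightarrow> ereal 1"
      unfolding lim_ereal by real_asymp+
    have "?L \<le> ereal 1" by (rule LIMSEQ_le_const[OF l1(1)]) (use up in blast)
    moreover have "ereal 1 \<le> ?L" by (rule LIMSEQ_le_const2[OF l1(2)]) (use lo in blast)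
    ultimately show ?case by (simp add: one_ereal_def)
  qed
qed

end

section \<open>Random compositions\<close>

text \<open>The error term C (D - 1) is shaped to survive the induction: C + d C (D - 1) \<le> C (d
  D - 1) holds because d \<ge> 2.\<close>

lemma left_comp_bound:
  fixes h :: "'a \<Rightarrow> real"
  assumes h: "\<And>i P. \<bar>h (\<gamma> i P) - d i * h P\<bar> \<le> C" and d: "\<And>i. 2 \<le> d i"
  shows "\<bar>h (left_comp \<gamma> n P) - (\<Prod>i<n. d i) * h P\<bar> \<le> C * ((\<Prod>i<n. d i) - 1)"
proof (induction n)
  case (Suc n)
  let ?D = "\<Prod>i<n. d i" and ?L = "left_comp \<gamma> n P"
  have C: "0 \<le> C" using order_trans[OF abs_ge_zero h[of 0 P]] .
  have "\<bar>d n * h ?L - d n * (?D * h P)\<bar> = d n * \<bar>h ?L - ?D * h P\<bar>"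
    using d[of n] by (simp add: abs_mult right_diff_distrib[symmetric])
  also have "\<dots> \<le> d n * (C * (?D - 1))" using Suc d[of n] by (intro mult_left_mono) auto
  finally have "\<bar>h (\<gamma> n ?L) - d n * (?D * h P)\<bar> \<le> C + d n * (C * (?D - 1))" using h[of n ?L] by linarith
  also have "\<dots> = C * (?D * d n - 1) - C * (d n - 2)" by (simp add: algebra_simps)
  also have "\<dots> \<le> C * (?D * d n - 1)" using C d[of n] by simp
  finally show ?case by (simp add: mult_ac)
qed simp

text \<open>The new map acts first, so the induction runs over all starting points and the error of
  that map is multiplied by \<open>D\<close>: C (D - 1) + D C \<le> C (D d - 1), again by d \<ge>
  2.\<close>

lemma right_comp_bound:
  fixes h :: "'a \<Rightarrow> real"
  assumes h: "\<And>i P. \<bar>h (\<gamma> i P) - d i * h P\<bar> \<le> C" and d: "\<And>i. 2 \<le> d i"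
  shows "\<bar>h (right_comp \<gamma> n P) - (\<Prod>i<n. d i) * h P\<bar> \<le> C * ((\<Prod>i<n. d i) - 1)"
proof (induction n arbitrary: P)
  case (Suc n)
  let ?D = "\<Prod>i<n. d i" and ?P = "\<gamma> n P"
  have C: "0 \<le> C" using order_trans[OF abs_ge_zero h[of 0 P]] .
  have D: "0 \<le> ?D" by (intro prod_nonneg) (meson d order_trans zero_le_numeral)
  have "\<bar>?D * h ?P - ?D * (d n * h P)\<bar> = ?D * \<bar>h ?P - d n * h P\<bar>"
    using D by (simp add: abs_mult right_diff_distrib[symmetric])
  also have "\<dots> \<le> ?D * C" using D h by (intro mult_left_mono) auto
  finally have "\<bar>h (right_comp \<gamma> n ?P) - ?D * (d n * h P)\<bar> \<le> C * (?D - 1) + ?D * C" using Suc[of ?P] by linarith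
  also have "\<dots> = C * (?D * d n - 1) - C * (?D * (d n - 2))" by (simp add: algebra_simps)
  also have "\<dots> \<le> C * (?D * d n - 1)" using C D d[of n] by simp
  finally show ?case by (simp add: mult_ac)
qed simp

text \<open>The value \<open>x\<close> lies between D (t - C) and D (t + C), which confines its
  logarithm near ln D uniformly in \<open>D\<close>.\<close>

lemma ln_bounded_ratio:
  fixes x D t C :: real
  assumes x: "\<bar>x - D * t\<bar> \<le> C * (D - 1)" and D: "1 \<le> D" and t: "C < t" and C: "0 \<le> C"
  shows "0 < x" "\<bar>ln x - ln D\<bar> \<le> \<bar>ln (t - C)\<bar> + \<bar>ln (t + C)\<bar>"
proof -
  have "D * (t - C) \<le> D * t - C * (D - 1)" "D * t + C * (D - 1) \<le> D * (t + C)"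
    using C by (simp_all add: algebra_simps)
  then have lo: "D * (t - C) \<le> x" and hi: "x \<le> D * (t + C)" using x by linarith+
  have "0 < D * (t - C)" using D t by simp
  with lo show x0: "0 < x" by linarith
  have "ln (D * (t - C)) \<le> ln x" using lo x0 \<open>0 < D * (t - C)\<close> by simp
  moreover have "ln (D * (t - C)) = ln D + ln (t - C)" using D t by (simp add: ln_mult)
  moreover have "ln x \<le> ln (D * (t + C))" using hi x0 by simp
  moreover have "ln (D * (t + C)) = ln D + ln (t + C)" using D t C by (simp add: ln_mult)
  ultimately show "\<bar>ln x - ln D\<bar> \<le> \<bar>ln (t - C)\<bar> + \<bar>ln (t + C)\<bar>" by linarith
qed

lemma root_tendsto_exp:
  fixes x s :: "nat \<Rightarrow> real"
  assumes pos: "\<And>n. 0 < x n" and bd: "\<And>n. \<bar>ln (x n) - (s n + real n * \<mu>)\<bar> \<le> K" and s: "(\<lambda>n. s n / real n) \<longlonglongrightarrow> 0"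
  shows "(\<lambda>n. root n (x n)) \<longlonglongrightarrow> exp \<mu>"
proof -
  let ?e = "\<lambda>n. (ln (x n) - (s n + real n * \<mu>)) / real n"
  have "(\<lambda>n. K / real n) \<longlonglongrightarrow> 0" by (rule lim_const_over_n)
  then have "?e \<longlonglongrightarrow> 0"
  proof (rule Lim_null_comparison[rotated], intro always_eventually allI)
    show "norm (?e n) \<le> K / real n" for n using bd[of n] by (simp add: abs_divide divide_right_mono)
  qed
  then have "(\<lambda>n. exp (?e n + s n / real n + \<mu>)) \<longlonglongrightarrow> exp (0 + 0 + \<mu>)" using s by (intro tendsto_intros)
  moreover have "\<forall>\<^sub>F n in sequentially. exp (?e n + s n / real n + \<mu>) = root n (x n)"
    using eventually_gt_at_top[of 0]
  proof eventually_elim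
    case (elim n)
    then have "?e n + s n / real n + \<mu> = ln (x n) / real n" by (simp add: field_simps)
    then show ?case using elim pos[of n] by (simp add: root_powr_inverse powr_def)
  qed
  ultimately show ?thesis by (simp add: Lim_transform_eventually)
qed

lemma limsup_perturb:
  fixes u r g :: "nat \<Rightarrow> real"
  assumes lim: "limsup (\<lambda>n. ereal (u n / g n)) = 1" and g: "filterlim g at_top sequentially"
    and r: "\<And>n. \<bar>r n\<bar> \<le> K"
  shows "limsup (\<lambda>n. ereal ((u n + r n) / g n)) = 1"
proof -
  have "((\<lambda>n. K / g n) \<longlongrightarrow> 0) sequentially"
    by (rule tendsto_divide_0[OF tendsto_const filterlim_at_top_imp_at_infinity[OF g]])
  moreover have "\<forall>\<^sub>F n in sequentially. 0 < g n" using g by (simp add: filterlim_at_top_dense)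
  then have "\<forall>\<^sub>F n in sequentially. norm (r n / g n) \<le> K / g n"
    by eventually_elim (use r in \<open>simp add: abs_divide divide_right_mono\<close>)
  ultimately have "((\<lambda>n. r n / g n) \<longlongrightarrow> 0) sequentially" by (rule Lim_null_comparison[rotated])
  then have "((\<lambda>n. ereal (r n / g n)) \<longlongrightarrow> ereal 0) sequentially" by simp
  then have "limsup (\<lambda>n. ereal (r n / g n) + ereal (u n / g n)) = ereal 0 + limsup (\<lambda>n. ereal (u n / g n))"
    by (rule ereal_limsup_lim_add) simp
  then show ?thesis using lim by (simp add: add_divide_distrib add.commute)
qed

lemma finite_discrete_integral:
  fixes g :: "'a \<Rightarrow> real"
  assumes fin: "finite S" and pr: "prob_space \<nu>" and sp: "space \<nu> = S" and se: "sets \<nu> = Pow S"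
  shows "integral\<^sup>L \<nu> g = (\<Sum>x\<in>S. g x * measure \<nu> {x})"
proof -
  interpret prob_space \<nu> by fact
  have "integral\<^sup>L \<nu> g = (\<integral>y. (\<Sum>x\<in>S. g x * indicator {x} y) \<partial>\<nu>)"
    using fin sp by (intro Bochner_Integration.integral_cong) (auto simp: indicator_def if_distrib cong: if_cong)
  also have "\<dots> = (\<Sum>x\<in>S. \<integral>y. g x * indicator {x} y \<partial>\<nu>)"
    using se by (intro Bochner_Integration.integral_sum integrable_mult_right integrable_real_indicator) (auto simp: emeasure_eq_measure)
  also have "\<dots> = (\<Sum>x\<in>S. g x * measure \<nu> {x})" using sp by (intro sum.cong) (auto simp: Int_absorb2)
  finally show ?thesis .
qed

lemma endo_degree_compositions:
  fixes \<gamma> :: "nat \<Rightarrow> 'n::finite pspace \<Rightarrow> 'n pspace"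
  assumes card: "CARD('n) \<ge> 2" and \<gamma>: "\<And>i. endomorphism (\<gamma> i)"
  shows "endo_degree (left_comp \<gamma> n) = (\<Prod>i<n. endo_degree (\<gamma> i))"
    and "endo_degree (right_comp \<gamma> n) = (\<Prod>i<n. endo_degree (\<gamma> i))"
proof -
  have "endomorphism (left_comp \<gamma> n) \<and> endo_degree (left_comp \<gamma> n) = (\<Prod>i<n. endo_degree (\<gamma> i))"
  proof (induction n)
    case 0
    show ?case by (simp only: left_comp.simps endo_id[OF card] lessThan_0 prod.empty simp_thms)
  next
    case (Suc n)
    then show ?case by (simp only: left_comp.simps endo_comp[OF card \<gamma>] prod.lessThan_Suc mult.commute simp_thms)
  qed
  moreover have "endomorphism (right_comp \<gamma> n) \<and> endo_degree (right_comp \<gamma> n) = (\<Prod>i<n. endo_degree (\<gamma> i))"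
  proof (induction n)
    case 0
    show ?case by (simp only: right_comp.simps endo_id[OF card] lessThan_0 prod.empty simp_thms)
  next
    case (Suc n)
    then show ?case by (simp only: right_comp.simps endo_comp[OF card _ \<gamma>] prod.lessThan_Suc simp_thms)
  qed
  ultimately show "endo_degree (left_comp \<gamma> n) = (\<Prod>i<n. endo_degree (\<gamma> i))"
    "endo_degree (right_comp \<gamma> n) = (\<Prod>i<n. endo_degree (\<gamma> i))" by blast+
qed

theorem theorem1p2:
  fixes N :: nat
    and S :: "('n::finite pspace \<Rightarrow> 'n pspace) set"
    and \<nu> :: "('n pspace \<Rightarrow> 'n pspace) measure"
  assumes "N \<ge> 1" and "CARD('n) = N + 1"
    and "finite S"
    and "\<And>\<phi>. \<phi> \<in> S \<Longrightarrow> endomorphism \<phi> \<and> endo_degree \<phi> \<ge> 2"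
    and "prob_space \<nu>" and "space \<nu> = S" and "sets \<nu> = Pow S"
    and "\<And>\<phi>. \<phi> \<in> S \<Longrightarrow> measure \<nu> {\<phi>} > 0"
  shows "\<exists>B :: real.
    dynamical_degree \<nu> = (\<Prod>\<phi>\<in>S. real (endo_degree \<phi>) powr measure \<nu> {\<phi>}) \<and>
    (AE \<gamma> in seq_measure \<nu>. \<forall>P. weil_height P > B \<longrightarrow>
       (\<lambda>n. root n (weil_height (left_comp \<gamma> n P))) \<longlonglongrightarrow> dynamical_degree \<nu> \<and>
       (\<lambda>n. root n (weil_height (right_comp \<gamma> n P))) \<longlonglongrightarrow> dynamical_degree \<nu>) \<and>
    (log_degree_variance \<nu> \<noteq> 0 \<longrightarrow>
      (AE \<gamma> in seq_measure \<nu>. \<forall>P. weil_height P > B \<longrightarrow>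
        (\<forall>iter \<in> {left_comp, right_comp}.
          limsup (\<lambda>n. ereal (ln (weil_height (iter \<gamma> n P) / dynamical_degree \<nu> ^ n) /
            (sqrt (log_degree_variance \<nu>) * sqrt (2 * real n * ln (ln (real n)))))) = 1 \<and>
          limsup (\<lambda>n. ereal (ln (dynamical_degree \<nu> ^ n / weil_height (iter \<gamma> n P)) /
            (sqrt (log_degree_variance \<nu>) * sqrt (2 * real n * ln (ln (real n)))))) = 1)))"
proof -
  interpret nu: prob_space \<nu> by fact
  interpret Q: prob_space "seq_measure \<nu>"
    unfolding seq_measure_def by (rule prob_space_PiM) unfold_locales
  note fin = assms(3) and sp = assms(6)
  let ?d = "\<lambda>\<phi> :: 'n pspace \<Rightarrow> 'n pspace. real (endo_degree \<phi>)"
  have card: "CARD('n) \<ge> 2" using assms(1,2) by simp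
  have endo: "endomorphism \<phi>" and deg: "2 \<le> ?d \<phi>" if "\<phi> \<in> S" for \<phi> using assms(4)[OF that] by auto
  note int = finite_discrete_integral[OF fin assms(5-7)]
  \<comment> \<open>The expectation of the logarithm of the degree, so exp(\<mu>) is the asserted
    dynamical degree; \<open>f\<close> below is the centred logarithm.\<close>
  define \<mu> where "\<mu> = (\<Sum>\<phi>\<in>S. ln (?d \<phi>) * measure \<nu> {\<phi>})"
  define f where "f \<phi> = ln (?d \<phi>) - \<mu>" for \<phi>
  let ?V = "log_degree_variance \<nu>"
  have V: "nu.expectation (\<lambda>\<phi>. (f \<phi>)\<^sup>2) = ?V"
    unfolding log_degree_variance_def f_def \<mu>_def int[of "\<lambda>\<phi>. ln (?d \<phi>)"] ..
  have mass: "(\<Sum>\<phi>\<in>S. measure \<nu> {\<phi>}) = 1" using int[of "\<lambda>_. 1"] nu.prob_space by simp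
  have Ef: "nu.expectation f = 0"
    unfolding int[of f] f_def by (simp add: left_diff_distrib sum_subtractf sum_distrib_left[symmetric] mass \<mu>_def)
  have V0: "0 \<le> ?V" unfolding V[symmetric] by (rule integral_nonneg_AE) simp
  have inS: "\<gamma> i \<in> S" if "\<gamma> \<in> space (seq_measure \<nu>)" for \<gamma> i
    using that by (auto simp: seq_measure_def space_PiM sp)
  have iid: "bounded_iid \<nu> f (\<Sum>\<phi>\<in>S. \<bar>f \<phi>\<bar>) (sqrt ?V)" if "?V \<noteq> 0"
  proof unfold_locales
    show "f \<in> borel_measurable \<nu>" using assms(6,7) by (auto simp: measurable_def)
    show "\<bar>f \<phi>\<bar> \<le> (\<Sum>\<phi>\<in>S. \<bar>f \<phi>\<bar>)" if "\<phi> \<in> space \<nu>" for \<phi>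
      using that fin sp by (intro member_le_sum) auto
    show "nu.expectation (\<lambda>\<phi>. (f \<phi>)\<^sup>2) = (sqrt ?V)\<^sup>2" using V V0 by simp
    show "0 < sqrt ?V" using that V0 by simp
  qed (rule Ef)
  have slln: "AE \<gamma> in seq_measure \<nu>. (\<lambda>n. psum f \<gamma> n / real n) \<longlonglongrightarrow> 0"
  proof (cases "?V = 0")
    \<comment> \<open>\<open>bounded_iid\<close> requires a positive standard deviation. With
      variance 0, \<open>f\<close> vanishes on all of \<open>S\<close> because every element has
      positive mass, and the sums are identically 0.\<close>
    case True
    then have "(\<Sum>\<phi>\<in>S. (f \<phi>)\<^sup>2 * measure \<nu> {\<phi>}) = 0" using V int[of "\<lambda>\<phi>. (f \<phi>)\<^sup>2"] by simp
    then have "(f \<phi>)\<^sup>2 * measure \<nu> {\<phi>} = 0" if "\<phi> \<in> S" for \<phi>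
      using sum_nonneg_eq_0_iff[OF fin, of "\<lambda>\<phi>. (f \<phi>)\<^sup>2 * measure \<nu> {\<phi>}"] that by simp
    then have "f \<phi> = 0" if "\<phi> \<in> S" for \<phi> using assms(8)[OF that] that by fastforce
    then have "psum f \<gamma> n = 0" if "\<gamma> \<in> space (seq_measure \<nu>)" for \<gamma> n using inS[OF that] by (simp add: psum_def)
    then show ?thesis by (intro AE_I2) simp
  next
    case False
    show ?thesis unfolding seq_measure_def by (rule bounded_iid.strong_law[OF iid[OF False]])
  qed
  define D where "D \<gamma> n = (\<Prod>i<n. ?d (\<gamma> i))" for \<gamma> and n :: nat
  have D1: "1 \<le> D \<gamma> n" and lnD: "ln (D \<gamma> n) = psum f \<gamma> n + real n * \<mu>"
    if "\<gamma> \<in> space (seq_measure \<nu>)" for \<gamma> n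
  proof -
    have d: "2 \<le> ?d (\<gamma> i)" for i by (rule deg[OF inS[OF that]])
    have d1: "1 \<le> ?d (\<gamma> i)" for i using d[of i] by linarith
    show "1 \<le> D \<gamma> n" unfolding D_def by (rule prod_ge_1) (rule d1)
    have "?d (\<gamma> i) \<noteq> 0" for i using d[of i] by linarith
    then have "ln (D \<gamma> n) = (\<Sum>i<n. ln (?d (\<gamma> i)))" unfolding D_def by (intro ln_prod) auto
    also have "\<dots> = psum f \<gamma> n + real n * \<mu>" by (simp add: psum_def f_def sum_subtractf)
    finally show "ln (D \<gamma> n) = psum f \<gamma> n + real n * \<mu>" .
  qed
  have "AE \<gamma> in seq_measure \<nu>. (\<lambda>n. root n (D \<gamma> n)) \<longlonglongrightarrow> exp \<mu>"
    using slln AE_space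
  proof eventually_elim
    case (elim \<gamma>)
    have "0 < D \<gamma> n" for n using D1[OF elim(2), of n] by linarith
    then show ?case by (rule root_tendsto_exp[where K = 0, OF _ _ elim(1)]) (simp add: lnD[OF elim(2)])
  qed
  then have dd: "AE \<gamma> in seq_measure \<nu>. (\<lambda>n. root n (real (endo_degree (left_comp \<gamma> n)))) \<longlonglongrightarrow> exp \<mu> \<and>
      (\<lambda>n. root n (real (endo_degree (right_comp \<gamma> n)))) \<longlonglongrightarrow> exp \<mu>"
    using AE_space
  proof eventually_elim
    case (elim \<gamma>)
    have "endomorphism (\<gamma> i)" for i by (rule endo[OF inS[OF elim(2)]])
    from endo_degree_compositions[where \<gamma> = \<gamma>, OF card this] show ?case using elim(1) by (simp add: D_def)
  qed
  have dyn: "dynamical_degree \<nu> = exp \<mu>"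
    unfolding dynamical_degree_def
  proof (rule the_equality)
    show "AE \<gamma> in seq_measure \<nu>. (\<lambda>n. root n (real (endo_degree (left_comp \<gamma> n)))) \<longlonglongrightarrow> exp \<mu> \<and>
      (\<lambda>n. root n (real (endo_degree (right_comp \<gamma> n)))) \<longlonglongrightarrow> exp \<mu>" by (rule dd)
    fix \<delta> assume "AE \<gamma> in seq_measure \<nu>. (\<lambda>n. root n (real (endo_degree (left_comp \<gamma> n)))) \<longlonglongrightarrow> \<delta> \<and>
      (\<lambda>n. root n (real (endo_degree (right_comp \<gamma> n)))) \<longlonglongrightarrow> \<delta>"
    with dd have "AE \<gamma> in seq_measure \<nu>. \<delta> = exp \<mu>"
      by eventually_elim (blast intro: LIMSEQ_unique)
    \<comment> \<open>An almost sure statement that does not mention \<gamma> holds outright,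
      because \<open>seq_measure \<nu>\<close> is a probability measure.\<close>
    then show "\<delta> = exp \<mu>" by simp
  qed
  have prod: "exp \<mu> = (\<Prod>\<phi>\<in>S. ?d \<phi> powr measure \<nu> {\<phi>})"
  proof -
    have "exp \<mu> = (\<Prod>\<phi>\<in>S. exp (ln (?d \<phi>) * measure \<nu> {\<phi>}))" unfolding \<mu>_def by (rule exp_sum[OF fin])
    also have "\<dots> = (\<Prod>\<phi>\<in>S. ?d \<phi> powr measure \<nu> {\<phi>})"
      using deg by (intro prod.cong) (fastforce simp: powr_def mult.commute)+
    finally show ?thesis .
  qed
  have "\<forall>\<phi>\<in>S. \<exists>C. \<forall>P. \<bar>weil_height (\<phi> P) - ?d \<phi> * weil_height P\<bar> \<le> C"
    using ex_defines_endo[OF card] endo height_endo_bound by blast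
  from bchoice[OF this] obtain c where c: "\<forall>\<phi>\<in>S. \<forall>P. \<bar>weil_height (\<phi> P) - ?d \<phi> * weil_height P\<bar> \<le> c \<phi>"
    by (rule exE)
  \<comment> \<open>One height constant for all maps in \<open>S\<close>; it is also the witness for
    \<open>B\<close>.\<close>
  define C where "C = (\<Sum>\<phi>\<in>S. \<bar>c \<phi>\<bar>)"
  have C0: "0 \<le> C" by (simp add: C_def sum_nonneg)
  have C: "\<bar>weil_height (\<phi> P) - ?d \<phi> * weil_height P\<bar> \<le> C" if "\<phi> \<in> S" for \<phi> P
  proof -
    have "\<bar>weil_height (\<phi> P) - ?d \<phi> * weil_height P\<bar> \<le> c \<phi>" using c that by blast
    also have "\<dots> \<le> \<bar>c \<phi>\<bar>" by simp
    also have "\<dots> \<le> C" unfolding C_def using that fin by (intro member_le_sum) auto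
    finally show ?thesis .
  qed
  \<comment> \<open>These bounds hold for every sequence, point and \<open>n\<close>. Null sets
    arise only from limit theorems about \<open>psum f \<gamma>\<close>, which does not involve
    \<open>P\<close>; hence the conclusions hold simultaneously for all points.\<close>
  have growth: "0 < weil_height (iter \<gamma> n P)"
    "\<bar>ln (weil_height (iter \<gamma> n P)) - (psum f \<gamma> n + real n * \<mu>)\<bar> \<le> \<bar>ln (weil_height P - C)\<bar> + \<bar>ln (weil_height P + C)\<bar>"
    if \<gamma>: "\<gamma> \<in> space (seq_measure \<nu>)" and P: "C < weil_height P" and iter: "iter \<in> {left_comp, right_comp}"
    for \<gamma> P n and iter :: "(nat \<Rightarrow> 'n pspace \<Rightarrow> 'n pspace) \<Rightarrow> nat \<Rightarrow> 'n pspace \<Rightarrow> 'n pspace"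
  proof -
    have "\<bar>weil_height (iter \<gamma> n P) - D \<gamma> n * weil_height P\<bar> \<le> C * (D \<gamma> n - 1)"
      using iter left_comp_bound[of weil_height \<gamma> "\<lambda>i. ?d (\<gamma> i)", OF C[OF inS[OF \<gamma>]] deg[OF inS[OF \<gamma>]]]
        right_comp_bound[of weil_height \<gamma> "\<lambda>i. ?d (\<gamma> i)", OF C[OF inS[OF \<gamma>]] deg[OF inS[OF \<gamma>]]]
      unfolding D_def by blast
    from ln_bounded_ratio[OF this D1[OF \<gamma>] P C0] show "0 < weil_height (iter \<gamma> n P)"
      "\<bar>ln (weil_height (iter \<gamma> n P)) - (psum f \<gamma> n + real n * \<mu>)\<bar> \<le> \<bar>ln (weil_height P - C)\<bar> + \<bar>ln (weil_height P + C)\<bar>"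
      unfolding lnD[OF \<gamma>] .
  qed
  have part2: "AE \<gamma> in seq_measure \<nu>. \<forall>P. weil_height P > C \<longrightarrow>
       (\<lambda>n. root n (weil_height (left_comp \<gamma> n P))) \<longlonglongrightarrow> dynamical_degree \<nu> \<and>
       (\<lambda>n. root n (weil_height (right_comp \<gamma> n P))) \<longlonglongrightarrow> dynamical_degree \<nu>"
    using slln AE_space
  proof eventually_elim
    case (elim \<gamma>)
    have "(\<lambda>n. root n (weil_height (iter \<gamma> n P))) \<longlonglongrightarrow> exp \<mu>"
      if "C < weil_height P" "iter \<in> {left_comp, right_comp}" for P iter
      using growth[OF elim(2) that] elim(1) by (rule root_tendsto_exp)
    then show ?case unfolding dyn by blast
  qed
  have part3: "AE \<gamma> in seq_measure \<nu>. \<forall>P. weil_height P > C \<longrightarrow>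
        (\<forall>iter \<in> {left_comp, right_comp}.
          limsup (\<lambda>n. ereal (ln (weil_height (iter \<gamma> n P) / dynamical_degree \<nu> ^ n) /
            (sqrt ?V * sqrt (2 * real n * ln (ln (real n)))))) = 1 \<and>
          limsup (\<lambda>n. ereal (ln (dynamical_degree \<nu> ^ n / weil_height (iter \<gamma> n P)) /
            (sqrt ?V * sqrt (2 * real n * ln (ln (real n)))))) = 1)" if V1: "?V \<noteq> 0"
  proof -
    interpret B: bounded_iid \<nu> f "\<Sum>\<phi>\<in>S. \<bar>f \<phi>\<bar>" "sqrt ?V" by (rule iid[OF V1])
    let ?g = "\<lambda>n. sqrt ?V * lil_scale n"
    have "filterlim (\<lambda>n. lil_scale n) at_top at_top" by real_asymp
    then have g: "filterlim ?g at_top sequentially"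
      by (rule filterlim_tendsto_pos_mult_at_top[OF tendsto_const B.sigma_pos])
    have "AE \<gamma> in seq_measure \<nu>. limsup (\<lambda>n. ereal (psum f \<gamma> n / ?g n)) = 1"
      unfolding seq_measure_def by (rule B.law_of_iterated_logarithm)
    moreover have "AE \<gamma> in seq_measure \<nu>. limsup (\<lambda>n. ereal (- psum f \<gamma> n / ?g n)) = 1"
      using bounded_iid.law_of_iterated_logarithm[OF B.neg_iid] unfolding seq_measure_def B.psum_uminus .
    ultimately show ?thesis using AE_space
    proof eventually_elim
      case (elim \<gamma>)
      have "limsup (\<lambda>n. ereal (ln (weil_height (iter \<gamma> n P) / dynamical_degree \<nu> ^ n) / ?g n)) = 1 \<and>
          limsup (\<lambda>n. ereal (ln (dynamical_degree \<nu> ^ n / weil_height (iter \<gamma> n P)) / ?g n)) = 1"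
        if P: "C < weil_height P" and iter: "iter \<in> {left_comp, right_comp}" for P iter
      proof -
        note gr = growth[OF elim(3) P iter]
        define r where "r n = ln (weil_height (iter \<gamma> n P)) - (psum f \<gamma> n + real n * \<mu>)" for n
        let ?K = "\<bar>ln (weil_height P - C)\<bar> + \<bar>ln (weil_height P + C)\<bar>"
        have r: "\<bar>r n\<bar> \<le> ?K" "\<bar>- r n\<bar> \<le> ?K" for n using gr(2)[of n] by (simp_all add: r_def)
        have pos: "0 < dynamical_degree \<nu> ^ n" "ln (dynamical_degree \<nu> ^ n) = real n * \<mu>" for n
          unfolding dyn by (simp_all add: ln_realpow)
        have e1: "ln (weil_height (iter \<gamma> n P) / dynamical_degree \<nu> ^ n) = psum f \<gamma> n + r n" for n
          unfolding ln_divide_pos[OF gr(1) pos(1)] pos(2) by (simp add: r_def)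
        have e2: "ln (dynamical_degree \<nu> ^ n / weil_height (iter \<gamma> n P)) = - psum f \<gamma> n + - r n" for n
          unfolding ln_divide_pos[OF pos(1) gr(1)] pos(2) by (simp add: r_def)
        show ?thesis
          unfolding e1 e2 using limsup_perturb[OF elim(1) g r(1)] limsup_perturb[OF elim(2) g r(2)] by (rule conjI)
      qed
      then show ?case by blast
    qed
  qed
  show ?thesis
    by (intro exI[of _ C] conjI impI part2 part3) (use dyn prod in simp)
qed

end
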